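(* Let $\theta\in(0,\pi/2)$, let $$\Sigma:=\{(x,\cot(\theta)|x|)\in\mathbb{R}^2: x\in\mathbb{R}\}$$ be the broken line, and let $\alpha>0$ and $\beta=4/\alpha$ be constants. Then $$\lambda_n(-\Delta_{\delta',\beta})<\lambda_n(-\Delta_{\delta,\alpha})$$ holds for all $n\in\mathbb{N}$ such that $\lambda_n(-\Delta_{\delta,\alpha})<-\alpha^2/4$.
   Context: The broken line $\Sigma$ splits $\mathbb{R}^2$ into $\Omega_1=\{(x,y)\in\mathbb{R}^2: y>\cot(\theta)|x|\}$ and $\Omega_2=\{(x,y)\in\mathbb{R}^2: y<\cot(\theta)|x|\}$. Notation: $(\cdot,\cdot)_\Omega$ and $(\cdot,\cdot)_\Sigma$ are the inner products of $L^2(\Omega)$ (also of $L^2(\Omega,\mathbb{C}^2)$) and $L^2(\Sigma)$ (arc length measure). $u|_\Sigma\in L^2(\Sigma)$ is the trace of an $H^1$ function. For $u\in L^2(\mathbb{R}^2)$ write $u=u_1\oplus u_2$ with $u_j=u|_{\Omega_j}$. $H^1(\mathbb{R}^2\setminus\Sigma)=H^1(\Omega_1)\oplus H^1(\Omega_2)$. Operators: $-\Delta_{\delta,\alpha}$ is the self-adjoint operator in $L^2(\mathbb{R}^2)$ associated with the densely defined, symmetric, lower semibounded, closed form $$\mathfrak{a}_{\delta,\alpha}[u,v]=(\nabla u,\nabla v)_{\mathbb{R}^2}-(\alpha u|_\Sigma,v|_\Sigma)_\Sigma,\quad \operatorname{dom}\mathfrak{a}_{\delta,\alpha}=H^1(\mathbb{R}^2),$$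 and $-\Delta_{\delta',\beta}$ is the self-adjoint operator in $L^2(\mathbb{R}^2)$ associated with the densely defined, symmetric, lower semibounded, closed form $$\mathfrak{a}_{\delta',\beta}[u,v]=(\nabla u_1,\nabla v_1)_{\Omega_1}+(\nabla u_2,\nabla v_2)_{\Omega_2}-\Big(\tfrac1\beta(u_1|_\Sigma-u_2|_\Sigma),v_1|_\Sigma-v_2|_\Sigma\Big)_\Sigma,\quad \operatorname{dom}\mathfrak{a}_{\delta',\beta}=H^1(\mathbb{R}^2\setminus\Sigma).$$ Eigenvalues: for $A=-\Delta_{\delta,\alpha}$ or $A=-\Delta_{\delta',\beta}$, $\lambda_1(A)\le\lambda_2(A)\le\dots<\inf\sigma_{\rm ess}(A)$ are the eigenvalues of $A$ below the bottom of the essential spectrum $\sigma_{\rm ess}(A)$, counted with multiplicities. It is known that $\sigma_{\rm ess}(-\Delta_{\delta,\alpha})=[-\alpha^2/4,+\infty)=[-4/\beta^2,+\infty)=\sigma_{\rm ess}(-\Delta_{\delta',\beta})$, and that $\lambda_n(-\Delta_{\delta',\beta})$ exists whenever $\lambda_n(-\Delta_{\delta,\alpha})<-\alpha^2/4$ exists. *)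

theory Defs
  imports "HOL-Analysis.Analysis" "HOL-Library.Extended_Nat"
begin

section \<open>Square-integrable functions\<close>

text \<open>
  Elements of \<open>L\<^sup>2(M)\<close> are represented by measurable functions; functions that agree almost
  everywhere represent the same element. All notions below are insensitive to the choice of
  representative.
\<close>

definition L2 :: "'a measure \<Rightarrow> ('a \<Rightarrow> complex) set" where
  "L2 M = {f \<in> borel_measurable M. integrable M (\<lambda>x. (cmod (f x))\<^sup>2)}"

definition L2_inner :: "'a measure \<Rightarrow> ('a \<Rightarrow> complex) \<Rightarrow> ('a \<Rightarrow> complex) \<Rightarrow> complex" where
  "L2_inner M f g = (\<integral>x. f x * cnj (g x) \<partial>M)"

definition L2_norm :: "'a measure \<Rightarrow> ('a \<Rightarrow> complex) \<Rightarrow> real" where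
  "L2_norm M f = sqrt (\<integral>x. (cmod (f x))\<^sup>2 \<partial>M)"

text \<open>A function on the whole space is regarded as a function on \<open>\<Omega>\<close> by using this measure.\<close>

abbreviation leb_on :: "'a::euclidean_space set \<Rightarrow> 'a measure" where
  "leb_on \<Omega> \<equiv> restrict_space lborel \<Omega>"


section \<open>Unbounded operators, spectrum, eigenvalues below the essential spectrum\<close>

text \<open>An operator in \<open>L\<^sup>2(M)\<close> is represented by its graph.\<close>

type_synonym 'a L2_op = "(('a \<Rightarrow> complex) \<times> ('a \<Rightarrow> complex)) set"

text \<open>
  The operator associated with a sesquilinear form \<open>a\<close> (linear in the first argument) with
  domain \<open>D\<close>, as in the first representation theorem.
\<close>

definition form_operator ::
  "'a measure \<Rightarrow> ('a \<Rightarrow> complex) set \<Rightarrow> (('a \<Rightarrow> complex) \<Rightarrow> ('a \<Rightarrow> complex) \<Rightarrow> complex) \<Rightarrow> 'a L2_op" where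
  "form_operator M D a = {(u, f). u \<in> D \<and> f \<in> L2 M \<and> (\<forall>v\<in>D. a u v = L2_inner M f v)}"

definition resolvent_set :: "'a measure \<Rightarrow> 'a L2_op \<Rightarrow> complex set" where
  "resolvent_set M A = {z.
     (\<forall>f\<in>L2 M. \<exists>u. (u, \<lambda>x. f x + z * u x) \<in> A) \<and>
     (\<exists>C. \<forall>(u, f)\<in>A. L2_norm M u \<le> C * L2_norm M (\<lambda>x. f x - z * u x))}"

definition op_spectrum :: "'a measure \<Rightarrow> 'a L2_op \<Rightarrow> complex set" where
  "op_spectrum M A = - resolvent_set M A"

definition eigenspace :: "'a L2_op \<Rightarrow> complex \<Rightarrow> ('a \<Rightarrow> complex) set" where
  "eigenspace A z = {u. (u, \<lambda>x. z * u x) \<in> A}"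

definition AE_independent :: "'a measure \<Rightarrow> nat \<Rightarrow> (nat \<Rightarrow> 'a \<Rightarrow> complex) \<Rightarrow> bool" where
  "AE_independent M k u \<longleftrightarrow>
     (\<forall>c. (AE x in M. (\<Sum>i<k. c i * u i x) = 0) \<longrightarrow> (\<forall>i<k. c i = 0))"

text \<open>The dimension of the eigenspace as a subspace of \<open>L\<^sup>2(M)\<close>, possibly \<open>\<infinity>\<close>.\<close>

definition op_multiplicity :: "'a measure \<Rightarrow> 'a L2_op \<Rightarrow> complex \<Rightarrow> enat" where
  "op_multiplicity M A z =
     (SUP k \<in> {k. \<exists>u. (\<forall>i<k. u i \<in> eigenspace A z) \<and> AE_independent M k u}. enat k)"

definition op_eigenvalue :: "'a measure \<Rightarrow> 'a L2_op \<Rightarrow> complex \<Rightarrow> bool" where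
  "op_eigenvalue M A z \<longleftrightarrow> (\<exists>u \<in> eigenspace A z. \<not> (AE x in M. u x = 0))"

definition discrete_spectrum :: "'a measure \<Rightarrow> 'a L2_op \<Rightarrow> complex set" where
  "discrete_spectrum M A = {z \<in> op_spectrum M A.
     op_eigenvalue M A z \<and> op_multiplicity M A z < \<infinity> \<and> \<not> z islimpt op_spectrum M A}"

definition essential_spectrum :: "'a measure \<Rightarrow> 'a L2_op \<Rightarrow> complex set" where
  "essential_spectrum M A = op_spectrum M A - discrete_spectrum M A"

text \<open>The value is \<open>\<infinity>\<close> if the essential spectrum is empty.\<close>

definition inf_essential_spectrum :: "'a measure \<Rightarrow> 'a L2_op \<Rightarrow> ereal" where
  "inf_essential_spectrum M A = (INF z \<in> essential_spectrum M A. ereal (Re z))"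

text \<open>
  \<open>nth_eigenvalue M A n l\<close> means that \<open>\<lambda>\<^sub>n(A)\<close> exists and equals \<open>l\<close>: in the nondecreasing
  enumeration (starting with index 1, multiplicities counted) of the eigenvalues of \<open>A\<close> below
  the essential spectrum, \<open>l\<close> is the \<open>n\<close>-th one.
\<close>

definition nth_eigenvalue :: "'a measure \<Rightarrow> 'a L2_op \<Rightarrow> nat \<Rightarrow> real \<Rightarrow> bool" where
  "nth_eigenvalue M A n l \<longleftrightarrow>
     op_eigenvalue M A (of_real l) \<and> ereal l < inf_essential_spectrum M A \<and>
     finite {m::real. op_eigenvalue M A (of_real m) \<and> m \<le> l} \<and>
     (\<Sum>m | op_eigenvalue M A (of_real m) \<and> m < l. op_multiplicity M A (of_real m)) < enat n \<and>
     enat n \<le> (\<Sum>m | op_eigenvalue M A (of_real m) \<and> m \<le> l. op_multiplicity M A (of_real m))"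

lemma nth_eigenvalue_unique:
  assumes "nth_eigenvalue M A n l" and "nth_eigenvalue M A n l'"
  shows "l = l'"
proof -
  have no_less: False if "nth_eigenvalue M A n a" "nth_eigenvalue M A n b" "a < b" for a b
  proof -
    let ?E = "\<lambda>m. op_eigenvalue M A (of_real m)" and ?\<mu> = "\<lambda>m::real. op_multiplicity M A (of_real m)"
    have "finite {m. ?E m \<and> m \<le> b}"
      using that(2) by (simp add: nth_eigenvalue_def)
    then have "finite {m. ?E m \<and> m < b}"
      by (rule rev_finite_subset) auto
    then have "(\<Sum>m | ?E m \<and> m \<le> a. ?\<mu> m) \<le> (\<Sum>m | ?E m \<and> m < b. ?\<mu> m)"
      using that(3) by (intro sum_mono2) auto
    moreover have "enat n \<le> (\<Sum>m | ?E m \<and> m \<le> a. ?\<mu> m)"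
      using that(1) by (simp add: nth_eigenvalue_def)
    moreover have "(\<Sum>m | ?E m \<and> m < b. ?\<mu> m) < enat n"
      using that(2) by (simp add: nth_eigenvalue_def)
    ultimately show False
      by (meson leD order.trans)
  qed
  show ?thesis
    using no_less[of l l'] no_less[of l' l] assms by (cases l l' rule: linorder_cases) auto
qed


section \<open>Sobolev spaces of order one\<close>

primrec Ck :: "nat \<Rightarrow> ('a::euclidean_space \<Rightarrow> complex) \<Rightarrow> bool" where
  "Ck 0 f \<longleftrightarrow> continuous_on UNIV f"
| "Ck (Suc k) f \<longleftrightarrow> (\<forall>x. f differentiable (at x)) \<and>
     (\<forall>e\<in>Basis. Ck k (\<lambda>x. frechet_derivative f (at x) e))"

text \<open>\<open>C\<^sub>c\<^sup>\<infinity>(\<Omega>)\<close>, its elements being extended by zero.\<close>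

definition Cc_infty :: "'a::euclidean_space set \<Rightarrow> ('a \<Rightarrow> complex) set" where
  "Cc_infty \<Omega> = {\<phi>. (\<forall>k. Ck k \<phi>) \<and>
     compact (closure {x. \<phi> x \<noteq> 0}) \<and> closure {x. \<phi> x \<noteq> 0} \<subseteq> \<Omega>}"

definition has_weak_deriv ::
  "'a::euclidean_space set \<Rightarrow> 'a \<Rightarrow> ('a \<Rightarrow> complex) \<Rightarrow> ('a \<Rightarrow> complex) \<Rightarrow> bool" where
  "has_weak_deriv \<Omega> e u g \<longleftrightarrow> g \<in> L2 (leb_on \<Omega>) \<and>
     (\<forall>\<phi>\<in>Cc_infty \<Omega>. (\<integral>x. u x * frechet_derivative \<phi> (at x) e \<partial>leb_on \<Omega>)
                      = - (\<integral>x. g x * \<phi> x \<partial>leb_on \<Omega>))"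

definition H1 :: "'a::euclidean_space set \<Rightarrow> ('a \<Rightarrow> complex) set" where
  "H1 \<Omega> = {u \<in> L2 (leb_on \<Omega>). \<forall>e\<in>Basis. \<exists>g. has_weak_deriv \<Omega> e u g}"

definition weak_deriv :: "'a::euclidean_space set \<Rightarrow> 'a \<Rightarrow> ('a \<Rightarrow> complex) \<Rightarrow> 'a \<Rightarrow> complex" where
  "weak_deriv \<Omega> e u = (SOME g. has_weak_deriv \<Omega> e u g)"

definition grad_inner ::
  "'a::euclidean_space set \<Rightarrow> ('a \<Rightarrow> complex) \<Rightarrow> ('a \<Rightarrow> complex) \<Rightarrow> complex" where
  "grad_inner \<Omega> u v = (\<Sum>e\<in>Basis. L2_inner (leb_on \<Omega>) (weak_deriv \<Omega> e u) (weak_deriv \<Omega> e v))"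

definition H1_norm :: "'a::euclidean_space set \<Rightarrow> ('a \<Rightarrow> complex) \<Rightarrow> real" where
  "H1_norm \<Omega> u =
     sqrt ((L2_norm (leb_on \<Omega>) u)\<^sup>2 + (\<Sum>e\<in>Basis. (L2_norm (leb_on \<Omega>) (weak_deriv \<Omega> e u))\<^sup>2))"

text \<open>
  The trace with respect to a measure \<open>S\<close> carried by a curve in the closure of \<open>\<Omega>\<close>: the
  continuous extension of the restriction map \<open>\<phi> \<mapsto> \<phi>|\<^sub>\<Sigma>\<close> from (restrictions to \<open>\<Omega>\<close> of)
  functions in \<open>C\<^sub>c\<^sup>\<infinity>\<close> of the whole space, which are dense in \<open>H\<^sup>1(\<Omega>)\<close> for the domains used
  below, to \<open>H\<^sup>1(\<Omega>)\<close>.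
\<close>

definition is_trace ::
  "'a::euclidean_space measure \<Rightarrow> 'a set \<Rightarrow> ('a \<Rightarrow> complex) \<Rightarrow> ('a \<Rightarrow> complex) \<Rightarrow> bool" where
  "is_trace S \<Omega> u g \<longleftrightarrow> g \<in> L2 S \<and>
     (\<exists>\<phi>. (\<forall>k::nat. \<phi> k \<in> Cc_infty UNIV) \<and>
          (\<lambda>k. H1_norm \<Omega> (\<lambda>x. \<phi> k x - u x)) \<longlonglongrightarrow> 0 \<and>
          (\<lambda>k. L2_norm S (\<lambda>x. \<phi> k x - g x)) \<longlonglongrightarrow> 0)"

definition sobolev_trace :: "'a::euclidean_space measure \<Rightarrow> 'a set \<Rightarrow> ('a \<Rightarrow> complex) \<Rightarrow> 'a \<Rightarrow> complex" where
  "sobolev_trace S \<Omega> u = (SOME g. is_trace S \<Omega> u g)"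


section \<open>The broken line and the two Schroedinger operators\<close>

definition broken_line :: "real \<Rightarrow> (real \<times> real) set" where
  "broken_line \<theta> = {(x, cot \<theta> * \<bar>x\<bar>) | x. True}"

definition Omega1 :: "real \<Rightarrow> (real \<times> real) set" where
  "Omega1 \<theta> = {(x, y). y > cot \<theta> * \<bar>x\<bar>}"

definition Omega2 :: "real \<Rightarrow> (real \<times> real) set" where
  "Omega2 \<theta> = {(x, y). y < cot \<theta> * \<bar>x\<bar>}"

definition arc_param :: "real \<Rightarrow> real \<Rightarrow> real \<times> real" where
  "arc_param \<theta> s = (s * sin \<theta>, \<bar>s\<bar> * cos \<theta>)"

lemma bij_betw_arc_param:
  assumes "0 < \<theta>" "\<theta> < pi / 2"
  shows "bij_betw (arc_param \<theta>) UNIV (broken_line \<theta>)"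
proof -
  have s: "sin \<theta> > 0"
    using assms by (simp add: sin_gt_zero)
  have "inj (arc_param \<theta>)"
    using s by (auto simp: inj_def arc_param_def)
  moreover have "range (arc_param \<theta>) = broken_line \<theta>"
  proof (intro equalityI subsetI)
    fix p assume "p \<in> range (arc_param \<theta>)"
    then show "p \<in> broken_line \<theta>"
      using s by (auto simp: arc_param_def broken_line_def cot_def abs_mult)
  next
    fix p assume "p \<in> broken_line \<theta>"
    then obtain x where "p = (x, cot \<theta> * \<bar>x\<bar>)"
      by (auto simp: broken_line_def)
    then have "p = arc_param \<theta> (x / sin \<theta>)"
      using s by (simp add: arc_param_def cot_def)
    then show "p \<in> range (arc_param \<theta>)"
      by simp
  qed
  ultimately show ?thesis
    by (simp add: bij_betw_def)
qed

lemma arc_param_unit_speed: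
  assumes "s * t \<ge> 0"
  shows "dist (arc_param \<theta> s) (arc_param \<theta> t) = \<bar>s - t\<bar>"
proof -
  have "(\<bar>s\<bar> - \<bar>t\<bar>)\<^sup>2 = (s - t)\<^sup>2"
    using assms by (simp add: power2_diff abs_mult[symmetric] mult.assoc)
  then have "(s * sin \<theta> - t * sin \<theta>)\<^sup>2 + (\<bar>s\<bar> * cos \<theta> - \<bar>t\<bar> * cos \<theta>)\<^sup>2
      = (s - t)\<^sup>2 * ((sin \<theta>)\<^sup>2 + (cos \<theta>)\<^sup>2)"
    by (simp only: left_diff_distrib[symmetric] power_mult_distrib distrib_left)
  then show ?thesis
    by (simp add: arc_param_def dist_Pair_Pair dist_real_def)
qed

text \<open>
  The arc length measure of the broken line, as a Borel measure on the plane: the image of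
  the Lebesgue measure under the parametrization by arc length.
\<close>

definition arc_measure :: "real \<Rightarrow> (real \<times> real) measure" where
  "arc_measure \<theta> = distr lborel borel (arc_param \<theta>)"

definition delta_form ::
  "real \<Rightarrow> real \<Rightarrow> (real \<times> real \<Rightarrow> complex) \<Rightarrow> (real \<times> real \<Rightarrow> complex) \<Rightarrow> complex" where
  "delta_form \<theta> \<alpha> u v =
     (let S = arc_measure \<theta> in
      grad_inner UNIV u v
      - L2_inner S (\<lambda>x. of_real \<alpha> * sobolev_trace S UNIV u x) (sobolev_trace S UNIV v))"

definition delta_operator :: "real \<Rightarrow> real \<Rightarrow> (real \<times> real) L2_op" where
  "delta_operator \<theta> \<alpha> = form_operator lborel (H1 UNIV) (delta_form \<theta> \<alpha>)"

text \<open>\<open>H\<^sup>1(\<real>\<^sup>2 \<setminus> \<Sigma>) = H\<^sup>1(\<Omega>\<^sub>1) \<oplus> H\<^sup>1(\<Omega>\<^sub>2)\<close>\<close>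

definition H1_broken :: "real \<Rightarrow> (real \<times> real \<Rightarrow> complex) set" where
  "H1_broken \<theta> = {u \<in> L2 lborel. u \<in> H1 (Omega1 \<theta>) \<and> u \<in> H1 (Omega2 \<theta>)}"

definition trace_jump :: "real \<Rightarrow> (real \<times> real \<Rightarrow> complex) \<Rightarrow> real \<times> real \<Rightarrow> complex" where
  "trace_jump \<theta> u x =
     sobolev_trace (arc_measure \<theta>) (Omega1 \<theta>) u x - sobolev_trace (arc_measure \<theta>) (Omega2 \<theta>) u x"

definition delta'_form ::
  "real \<Rightarrow> real \<Rightarrow> (real \<times> real \<Rightarrow> complex) \<Rightarrow> (real \<times> real \<Rightarrow> complex) \<Rightarrow> complex" where
  "delta'_form \<theta> \<beta> u v =
     grad_inner (Omega1 \<theta>) u v + grad_inner (Omega2 \<theta>) u v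
     - L2_inner (arc_measure \<theta>) (\<lambda>x. of_real (1 / \<beta>) * trace_jump \<theta> u x) (trace_jump \<theta> v)"

definition delta'_operator :: "real \<Rightarrow> real \<Rightarrow> (real \<times> real) L2_op" where
  "delta'_operator \<theta> \<beta> = form_operator lborel (H1_broken \<theta>) (delta'_form \<theta> \<beta>)"

end

theory Submission
  imports Defs "HOL-Library.Function_Algebras"
begin

text \<open>
  Let \<open>\<gamma> = \<alpha> / 2 = 2 / \<beta>\<close>, let \<open>a\<close> and \<open>a'\<close> be the forms of the \<open>\<delta>\<close>- and the \<open>\<delta>'\<close>-operator, and let
  \<open>reflect u\<close> be \<open>u\<close> on \<open>\<Omega>\<^sub>1\<close> and \<open>- u\<close> on \<open>\<Omega>\<^sub>2\<close>. This isometry of \<open>L\<^sup>2\<close> maps \<open>H\<^sup>1(\<real>\<^sup>2)\<close> into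
  \<open>H\<^sup>1(\<real>\<^sup>2 \<setminus> \<Sigma>)\<close>, it preserves the gradient term, and the jump of \<open>reflect u\<close> is twice the trace of
  \<open>u\<close>. As \<open>4 / \<beta> = \<alpha>\<close>, it carries \<open>a\<close> into \<open>a'\<close> (\<open>delta'_form_reflect\<close>). The eigenfunctions of \<open>a\<close>
  for eigenvalues up to \<open>l = \<lambda>\<^sub>n\<close> thus give an at least \<open>n\<close>-dimensional space on which the Rayleigh
  quotient of \<open>a'\<close> is at most \<open>l\<close> (\<open>nth_eigenvalue_trial_space\<close>), and the min-max principle already
  yields \<open>\<le>\<close>.

  The inequality is strict because this space contains no eigenfunction of \<open>a'\<close> for \<open>l\<close>
  (\<open>reflect_not_eigenvector\<close>). Testing the eigenvalue equation of \<open>x = reflect u\<close> with the restriction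
  of \<open>x\<close> to \<open>\<Omega>\<^sub>2\<close> shows that the Robin form \<open>\<parallel>\<nabla>x\<parallel>\<^sup>2 - \<gamma> \<parallel>x\<parallel>\<^sub>\<Sigma>\<^sup>2\<close> on \<open>\<Omega>\<^sub>2\<close> equals \<open>l \<parallel>x\<parallel>\<^sup>2\<close>. But
  \<open>\<Omega>\<^sub>2\<close> is the nonconvex side: the normals of the two rays sweep disjoint half-strips of infinite
  length, and the one-dimensional inequality on each normal gives the lower bound \<open>- \<gamma>\<^sup>2 > l\<close>
  (\<open>Robin_Omega2\<close>). So \<open>x\<close> and its trace vanish on \<open>\<Omega>\<^sub>2\<close>, and \<open>a[u] \<ge> 0\<close>, which is absurd.

  Min-max and the discreteness of the spectrum of \<open>a'\<close> below \<open>- \<gamma>\<^sup>2\<close> come from one property of \<open>a'\<close>: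
  for each \<open>\<epsilon> > 0\<close> the bound \<open>a'[u] \<ge> - (\<gamma>\<^sup>2 + \<epsilon>) \<parallel>u\<parallel>\<^sup>2\<close> holds up to a penalty in finitely many
  linear functionals of \<open>u\<close> (\<open>finite_codim_bound\<close>). It replaces every compactness argument. For the
  broken line it follows from the Robin inequality on \<open>\<Omega>\<^sub>2\<close>, from the same argument along the normals
  on \<open>\<Omega>\<^sub>1\<close> away from the corner, and near the corner from a trace estimate on finitely many small
  cells, whose mean values are the functionals (\<open>Robin_Omega1\<close>).

  All inequalities are proved for test functions. They extend to \<open>H\<^sup>1\<close> since test functions are dense
  (\<open>smooth_approximation\<close>); the traces are the corresponding limits.
\<close>

section \<open>Hermitian forms and the Riesz representation theorem\<close>

lemma homogeneous_system:
  fixes L :: "nat => 'i => complex"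
  assumes "finite I" and "m < card I"
  shows "\<exists>c. (\<exists>i\<in>I. c i \<noteq> 0) \<and> (\<forall>j<m. (\<Sum>i\<in>I. c i * L j i) = 0)"
  using assms
proof (induction m arbitrary: I L)
  case 0
  then obtain i where "i \<in> I" by fastforce
  then show ?case by (intro exI[of _ "%_. 1"]) auto
next
  case (Suc m)
  show ?case
  proof (cases "\<forall>i\<in>I. L m i = 0")
    case True
    obtain c where "\<exists>i\<in>I. c i \<noteq> 0" "\<forall>j<m. (\<Sum>i\<in>I. c i * L j i) = 0"
      using Suc.IH[of I L] Suc.prems by auto
    with True show ?thesis
      by (intro exI[of _ c]) (auto simp: less_Suc_eq)
  next
    case False
    then obtain p where p: "p \<in> I" "L m p \<noteq> 0" by blast
    define J where "J = I - {p}"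
    have J: "finite J" "m < card J" "I = insert p J" "p \<notin> J"
      using Suc.prems p by (auto simp: J_def)
    define L' where "L' j i = L j i - L j p * L m i / L m p" for j i
    obtain c where c: "\<exists>i\<in>J. c i \<noteq> 0" "\<And>j. j < m ==> (\<Sum>i\<in>J. c i * L' j i) = 0"
      using Suc.IH[of J L'] J by auto
    define d where "d = c(p := - (\<Sum>i\<in>J. c i * L m i) / L m p)"
    have dJ: "d i = c i" if "i \<in> J" for i using that J by (auto simp: d_def)
    have sum: "(\<Sum>i\<in>I. d i * L j i) = (\<Sum>i\<in>J. c i * L' j i)" for j
    proof -
      have "(\<Sum>i\<in>I. d i * L j i) = d p * L j p + (\<Sum>i\<in>J. c i * L j i)"
        using J dJ by simp
      moreover have "(\<Sum>i\<in>J. c i * L' j i) = (\<Sum>i\<in>J. c i * L j i) - (\<Sum>i\<in>J. c i * L m i) * L j p / L m p"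
        by (simp add: L'_def right_diff_distrib sum_subtractf sum_distrib_left sum_distrib_right
            sum_divide_distrib mult_ac)
      ultimately show ?thesis by (simp add: d_def)
    qed
    have "(\<Sum>i\<in>J. c i * L' m i) = 0" using p by (simp add: L'_def)
    then have "\<forall>j<Suc m. (\<Sum>i\<in>I. d i * L j i) = 0"
      using c(2) sum by (auto simp: less_Suc_eq)
    moreover have "\<exists>i\<in>I. d i \<noteq> 0" using c(1) dJ J by auto
    ultimately show ?thesis by blast
  qed
qed

lemma sum_cnj_mult_self: "(\<Sum>i\<in>I. c i * cnj (c i)) = of_real (\<Sum>i\<in>I. (cmod (c i))\<^sup>2)"
  by (simp add: complex_norm_square[symmetric])

locale hermitian_form = vector_space sc
  for sc :: "complex => 'v::ab_group_add => 'v" (infixr "\<star>" 75) +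
  fixes V :: "'v set" and q :: "'v => 'v => complex"
  assumes V: "subspace V"
    and q_add_left: "\<And>u v w. u \<in> V ==> v \<in> V ==> w \<in> V ==> q (u + v) w = q u w + q v w"
    and q_scale_left: "\<And>c u w. u \<in> V ==> w \<in> V ==> q (c \<star> u) w = c * q u w"
    and q_cnj: "\<And>u v. u \<in> V ==> v \<in> V ==> cnj (q u v) = q v u"
begin

lemma V_closed [simp, intro]:
  "0 \<in> V" "u \<in> V ==> v \<in> V ==> u + v \<in> V" "u \<in> V ==> v \<in> V ==> u - v \<in> V" "u \<in> V ==> c \<star> u \<in> V"
  "(\<And>i. i \<in> I ==> f i \<in> V) ==> sum f I \<in> V"
  using V by (auto intro: subspace_0 subspace_add subspace_diff subspace_scale subspace_sum)

lemma q_zero_left [simp]: "w \<in> V ==> q 0 w = 0"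
  using q_scale_left[of 0 w 0] by simp

lemma q_add_right: "u \<in> V ==> v \<in> V ==> w \<in> V ==> q w (u + v) = q w u + q w v"
  by (metis V_closed(2) complex_cnj_add q_add_left q_cnj)

lemma q_scale_right: "u \<in> V ==> w \<in> V ==> q w (c \<star> u) = cnj c * q w u"
  by (metis V_closed(4) complex_cnj_mult q_scale_left q_cnj)

lemma q_diff_left: "u \<in> V ==> v \<in> V ==> w \<in> V ==> q (u - v) w = q u w - q v w"
  using q_add_left[of "u - v" v w] by simp

lemma q_diff_right: "u \<in> V ==> v \<in> V ==> w \<in> V ==> q w (u - v) = q w u - q w v"
  using q_add_right[of "u - v" v w] by simp

lemma q_zero_right [simp]: "w \<in> V ==> q w 0 = 0"
  using q_scale_right[of 0 w 0] by simp

lemma q_sum_left: "(\<And>i. i \<in> I ==> f i \<in> V) ==> w \<in> V ==> q (sum f I) w = (\<Sum>i\<in>I. q (f i) w)"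
  by (induction I rule: infinite_finite_induct) (auto simp: q_add_left)

lemma q_sum_right: "(\<And>i. i \<in> I ==> f i \<in> V) ==> w \<in> V ==> q w (sum f I) = (\<Sum>i\<in>I. q w (f i))"
  by (induction I rule: infinite_finite_induct) (auto simp: q_add_right)

lemma q_self: "u \<in> V ==> q u u = of_real (Re (q u u))"
  using q_cnj[of u u] by (simp add: complex_eq_iff)

lemma Re_q_add: "u \<in> V ==> v \<in> V ==> Re (q (u + v) (u + v)) = Re (q u u) + 2 * Re (q u v) + Re (q v v)"
  using q_cnj[of u v] by (simp add: q_add_left q_add_right complex_eq_iff)

lemma Re_q_diff: "u \<in> V ==> v \<in> V ==> Re (q (u - v) (u - v)) = Re (q u u) - 2 * Re (q u v) + Re (q v v)"
  using q_cnj[of u v] by (simp add: q_diff_left q_diff_right complex_eq_iff)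

lemma Re_q_scale: "u \<in> V ==> Re (q (c \<star> u) (c \<star> u)) = (cmod c)\<^sup>2 * Re (q u u)"
proof -
  assume u: "u \<in> V"
  have "q (c \<star> u) (c \<star> u) = (c * cnj c) * q u u"
    using u by (simp add: q_scale_left q_scale_right)
  also have "c * cnj c = of_real ((cmod c)\<^sup>2)" by (rule complex_norm_square[symmetric])
  finally show ?thesis by simp
qed

lemma q_orthogonal_combination:
  assumes "finite I" "\<And>i. i \<in> I ==> e i \<in> V" "\<And>i j. i \<in> I ==> j \<in> I ==> q (e i) (e j) = (if i = j then d i else 0)"
  shows "q (\<Sum>i\<in>I. c i \<star> e i) (\<Sum>i\<in>I. c i \<star> e i) = (\<Sum>i\<in>I. of_real ((cmod (c i))\<^sup>2) * d i)"
proof -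
  have "q (\<Sum>i\<in>I. c i \<star> e i) (\<Sum>i\<in>I. c i \<star> e i) = (\<Sum>i\<in>I. \<Sum>j\<in>I. c i * (cnj (c j) * q (e i) (e j)))"
    using assms(2) by (subst q_sum_left) (auto simp: q_sum_right q_scale_left q_scale_right
        sum_distrib_left intro!: sum.cong)
  also have "\<dots> = (\<Sum>i\<in>I. \<Sum>j\<in>I. if i = j then c i * cnj (c i) * d i else 0)"
    using assms(3) by (intro sum.cong refl) auto
  also have "\<dots> = (\<Sum>i\<in>I. of_real ((cmod (c i))\<^sup>2) * d i)"
    using assms(1) by (simp add: complex_norm_square del: of_real_power)
  finally show ?thesis .
qed

end

locale semi_inner_product = hermitian_form sc V q
  for sc :: "complex => 'v::ab_group_add => 'v" (infixr "\<star>" 75) and V :: "'v set" and q :: "'v => 'v => complex" +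
  assumes q_nonneg: "\<And>u. u \<in> V ==> 0 <= Re (q u u)"
begin

definition N :: "'v => real" where "N u = sqrt (Re (q u u))"

lemma N_nonneg [simp]: "u \<in> V ==> 0 <= N u"
  by (simp add: N_def q_nonneg)

lemma N_sq: "u \<in> V ==> (N u)\<^sup>2 = Re (q u u)"
  by (simp add: N_def q_nonneg)

lemma Cauchy_Schwarz_sq:
  assumes "u \<in> V" "v \<in> V"
  shows "(cmod (q u v))\<^sup>2 <= Re (q u u) * Re (q v v)"
proof -
  define B where "B = (cmod (q u v))\<^sup>2"
  have ineq: "0 <= Re (q u u) - 2 * s * B + s\<^sup>2 * B * Re (q v v)" for s :: real
  proof -
    let ?c = "of_real s * q u v"
    have "0 <= Re (q (u - ?c \<star> v) (u - ?c \<star> v))" using assms by (intro q_nonneg) auto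
    also have "\<dots> = Re (q u u) - 2 * Re (cnj ?c * q u v) + (cmod ?c)\<^sup>2 * Re (q v v)"
      using assms by (simp only: V_closed Re_q_diff Re_q_scale) (simp add: q_scale_right)
    also have "cnj ?c * q u v = of_real (s * B)"
      by (simp add: B_def complex_norm_square mult_ac del: of_real_power)
    also have "(cmod ?c)\<^sup>2 = s\<^sup>2 * B" by (simp add: B_def norm_mult power_mult_distrib)
    finally show ?thesis by simp
  qed
  have "B \<ge> 0" by (simp add: B_def)
  have "B <= Re (q u u) * Re (q v v)"
  proof (cases "Re (q v v) = 0")
    case True
    have "B = 0"
    proof (rule ccontr)
      assume "B \<noteq> 0"
      then show False using ineq[of "(Re (q u u) + 1) / B"] True q_nonneg[OF assms(1)] by simp
    qed
    then show ?thesis using True by simp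
  next
    case False
    then have "Re (q v v) > 0" using q_nonneg[OF assms(2)] by simp
    with ineq[of "1 / Re (q v v)"] show ?thesis
      by (simp add: field_simps power2_eq_square)
  qed
  then show ?thesis by (simp add: B_def)
qed

lemma Cauchy_Schwarz: "u \<in> V ==> v \<in> V ==> cmod (q u v) <= N u * N v"
  using Cauchy_Schwarz_sq[of u v] unfolding N_def
  by (metis norm_ge_zero real_le_rsqrt real_sqrt_mult)

lemma N_triangle: "u \<in> V ==> v \<in> V ==> N (u + v) <= N u + N v"
proof -
  assume u: "u \<in> V" "v \<in> V"
  have "(N (u + v))\<^sup>2 = (N u)\<^sup>2 + 2 * Re (q u v) + (N v)\<^sup>2"
    using u by (simp add: N_sq Re_q_add)
  also have "Re (q u v) <= N u * N v"
    using Cauchy_Schwarz[OF u] complex_Re_le_cmod order_trans by blast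
  finally have "(N (u + v))\<^sup>2 <= (N u + N v)\<^sup>2" by (simp add: power2_sum)
  then show ?thesis using u by (simp add: power2_le_iff_abs_le)
qed

lemma N_minus: "u \<in> V ==> v \<in> V ==> N (u - v) = N (v - u)"
  using q_cnj[of u v] by (simp add: N_def Re_q_diff complex_eq_iff)

lemma N_diff: "u \<in> V ==> v \<in> V ==> \<bar>N u - N v\<bar> <= N (u - v)"
  using N_triangle[of "u - v" v] N_triangle[of "v - u" u] N_minus[of u v] by auto

lemma N_tendsto:
  assumes "\<And>k::nat. w k \<in> V" "x \<in> V" "(%k. N (w k - x)) \<longlonglongrightarrow> 0"
  shows "(%k. N (w k)) \<longlonglongrightarrow> N x"
proof (rule LIM_zero_cancel, rule tendsto_0_le[OF assms(3), of _ 1])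
  show "\<forall>\<^sub>F k in sequentially. norm (N (w k) - N x) <= norm (N (w k - x)) * 1"
    using assms N_diff by (intro always_eventually) auto
qed

lemma q_tendsto:
  assumes "\<And>k::nat. w k \<in> V" "x \<in> V" "(%k. N (w k - x)) \<longlonglongrightarrow> 0" "v \<in> V"
  shows "(%k. q (w k) v) \<longlonglongrightarrow> q x v"
proof (rule LIM_zero_cancel, rule tendsto_0_le[OF assms(3), of _ "N v"])
  show "\<forall>\<^sub>F k in sequentially. norm (q (w k) v - q x v) <= norm (N (w k - x)) * N v"
  proof (intro always_eventually allI)
    fix k
    show "norm (q (w k) v - q x v) <= norm (N (w k - x)) * N v"
      using Cauchy_Schwarz[of "w k - x" v] assms by (simp add: q_diff_left)
  qed
qed

lemma Re_q_tendsto: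
  assumes "\<And>k::nat. w k \<in> V" "x \<in> V" "(%k. N (w k - x)) \<longlonglongrightarrow> 0"
  shows "(%k. Re (q (w k) (w k))) \<longlonglongrightarrow> Re (q x x)"
  using tendsto_power[OF N_tendsto[OF assms], of 2] assms by (simp add: N_sq)

definition complete_form :: bool where
  "complete_form \<longleftrightarrow> (\<forall>w::nat => 'v. (\<forall>k. w k \<in> V) \<longrightarrow> (\<forall>e>0. \<exists>K. \<forall>j\<ge>K. \<forall>k\<ge>K. N (w j - w k) < e)
      \<longrightarrow> (\<exists>x\<in>V. (%k. N (w k - x)) \<longlonglongrightarrow> 0))"

lemma minimizing_gap:
  assumes "u \<in> V" "v \<in> V"
  shows "Re (q (u - v) (u - v)) = 2 * Re (q u u) + 2 * Re (q v v) - 4 * Re (q ((1/2) \<star> (u + v)) ((1/2) \<star> (u + v)))"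
  using assms by (simp only: V_closed Re_q_scale Re_q_add Re_q_diff) (simp add: power2_eq_square field_simps)

text \<open>
  The representing vector is the limit of a minimizing sequence of \<open>q v v - 2 Re (l v)\<close>, which is a
  Cauchy sequence by the parallelogram law. Vectors of norm zero are not divided out, so the
  solution is unique only up to such vectors.
\<close>

theorem Riesz:
  assumes complete: complete_form
    and l_add: "\<And>u v. u \<in> V ==> v \<in> V ==> l (u + v) = l u + l v"
    and l_scale: "\<And>c u. u \<in> V ==> l (c \<star> u) = cnj c * l u"
    and l_bound: "\<And>u. u \<in> V ==> cmod (l u) <= C * N u"
  shows "\<exists>u\<in>V. \<forall>v\<in>V. q u v = l v"
proof -
  define J where "J u = Re (q u u) - 2 * Re (l u)" for u
  define m where "m = Inf (J ` V)"
  have lower: "- C\<^sup>2 <= J u" if "u \<in> V" for u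
  proof -
    have "Re (l u) <= C * N u"
      using l_bound[OF that] complex_Re_le_cmod order_trans by blast
    moreover have "0 <= (N u - C)\<^sup>2" by simp
    ultimately show ?thesis using N_sq[OF that] by (simp add: J_def power2_diff mult_ac)
  qed
  have bdd: "bdd_below (J ` V)"
    using lower by (auto simp: bdd_below_def)
  have m_le: "m <= J u" if "u \<in> V" for u
    unfolding m_def using bdd that by (simp add: cInf_lower)
  have "\<exists>u\<in>V. J u < m + e" if "e > 0" for e
    using cInf_lessD[of "J ` V" "m + e"] that V_closed(1) unfolding m_def by force
  then have "\<forall>k::nat. \<exists>u\<in>V. J u < m + inverse (real (Suc k))" by simp
  then obtain w where w: "\<And>k. w k \<in> V" "\<And>k. J (w k) < m + inverse (real (Suc k))"
    by metis
  have gap: "Re (q (w j - w k) (w j - w k)) <= 2 * inverse (real (Suc j)) + 2 * inverse (real (Suc k))" for j k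
  proof -
    let ?h = "(1/2) \<star> (w j + w k)"
    have "Re (l ?h) = (Re (l (w j)) + Re (l (w k))) / 2"
      using w by (simp add: l_scale l_add)
    moreover have "m <= J ?h" using w by (intro m_le) auto
    ultimately show ?thesis
      using w(2)[of j] w(2)[of k] minimizing_gap[OF w(1)[of j] w(1)[of k]] by (simp add: J_def)
  qed
  have "\<exists>K. \<forall>j\<ge>K. \<forall>k\<ge>K. N (w j - w k) < e" if "e > 0" for e
  proof -
    obtain K where K: "inverse (real (Suc K)) < e\<^sup>2 / 4"
      using reals_Archimedean[of "e\<^sup>2 / 4"] \<open>e > 0\<close> by auto
    have "N (w j - w k) < e" if "j \<ge> K" "k \<ge> K" for j k
    proof -
      have "inverse (real (Suc j)) <= inverse (real (Suc K))" "inverse (real (Suc k)) <= inverse (real (Suc K))"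
        using that by (auto intro!: le_imp_inverse_le)
      then have "Re (q (w j - w k) (w j - w k)) < e\<^sup>2" using gap[of j k] K by linarith
      then show ?thesis using \<open>e > 0\<close> by (simp add: N_def real_less_lsqrt)
    qed
    then show ?thesis by blast
  qed
  then obtain u where u: "u \<in> V" "(%k. N (w k - u)) \<longlonglongrightarrow> 0"
    using complete w(1) unfolding complete_form_def by blast
  have l_diff: "l (x - y) = l x - l y" if "x \<in> V" "y \<in> V" for x y
    using l_add[of "x - y" y] that by simp
  have "(%k. l (w k)) \<longlonglongrightarrow> l u"
  proof (rule LIM_zero_cancel, rule tendsto_0_le[OF u(2), of _ C])
    show "\<forall>\<^sub>F k in sequentially. norm (l (w k) - l u) <= norm (N (w k - u)) * C"
      using l_bound[of "w k - u" for k] w(1) u(1) l_diff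
      by (intro always_eventually) (auto simp: mult.commute[of C])
  qed
  then have "(%k. J (w k)) \<longlonglongrightarrow> J u"
    unfolding J_def by (intro tendsto_diff[OF Re_q_tendsto[OF w(1) u]] tendsto_mult tendsto_const tendsto_Re)
  moreover have "(%k. m + inverse (real (Suc k))) \<longlonglongrightarrow> m + 0"
    by (intro tendsto_intros LIMSEQ_inverse_real_of_nat)
  ultimately have "J u <= m"
    using w(2) by (intro LIMSEQ_le) (auto intro: less_imp_le)
  have "q u v = l v" if v: "v \<in> V" for v
  proof -
    define d where "d = q u v - l v"
    define t where "t = 1 / (Re (q v v) + 1)"
    have t: "t > 0" "t * Re (q v v) < 1" using q_nonneg[OF v] by (auto simp: t_def)
    define c where "c = - of_real t * d"
    have "J u <= J (u + c \<star> v)"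
      using m_le[of "u + c \<star> v"] \<open>J u <= m\<close> u(1) v by auto
    also have "J (u + c \<star> v) = J u + 2 * Re (cnj c * d) + (cmod c)\<^sup>2 * Re (q v v)"
      unfolding J_def using u(1) v
      by (simp only: V_closed Re_q_add Re_q_scale l_add) (simp add: l_scale q_scale_right d_def algebra_simps)
    also have "cnj c * d = - of_real (t * (cmod d)\<^sup>2)"
      by (simp add: c_def complex_norm_square mult_ac del: of_real_power)
    also have "(cmod c)\<^sup>2 = t * (t * (cmod d)\<^sup>2)"
      by (simp add: c_def norm_mult power_mult_distrib power2_eq_square)
    finally have "t * (cmod d)\<^sup>2 * (2 - t * Re (q v v)) <= 0"
      by (simp add: algebra_simps)
    then have "t * (cmod d)\<^sup>2 <= 0" using t by (simp add: mult_le_0_iff)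
    then have "(cmod d)\<^sup>2 <= 0" using t by (simp add: mult_le_0_iff)
    then show ?thesis by (simp add: d_def)
  qed
  with u(1) show ?thesis by blast
qed

end

section \<open>Closed forms and their minimizers\<close>

text \<open>
  The assumption \<open>finite_codim_bound\<close> stands for \<open>inf \<sigma>\<^sub>e\<^sub>s\<^sub>s \<ge> b\<close>: below \<open>b\<close> the form can be negative
  only in finitely many directions, up to an arbitrarily small loss. The inner product \<open>ip\<close> may be
  degenerate, so that functions need not be identified when they agree almost everywhere.
\<close>

locale closed_form =
  ip: semi_inner_product sc H ip + a: hermitian_form sc D a
  for sc :: "complex => 'v::ab_group_add => 'v" (infixr "\<star>" 75) and H ip D a +
  fixes b :: real
  assumes D_H: "D \<subseteq> H"
    and closed: "\<And>w::nat => 'v. (\<And>k. w k \<in> D) ==>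
        (\<And>e. e > 0 ==> \<exists>K. \<forall>j\<ge>K. \<forall>k\<ge>K. Re (ip (w j - w k) (w j - w k)) < e \<and> \<bar>Re (a (w j - w k) (w j - w k))\<bar> < e)
        ==> \<exists>x\<in>D. (%k. Re (ip (w k - x) (w k - x))) \<longlonglongrightarrow> 0 \<and> (%k. Re (a (w k - x) (w k - x))) \<longlonglongrightarrow> 0"
    and finite_codim_bound: "\<And>e. e > 0 ==> \<exists>(p::nat) g C. (\<forall>i<p. g i \<in> H) \<and> C \<ge> 0 \<and>
        (\<forall>u\<in>D. (b - e) * Re (ip u u) <= Re (a u u) + C * (\<Sum>i<p. (cmod (ip u (g i)))\<^sup>2))"
begin

lemma DH [simp, intro]: "u \<in> D ==> u \<in> H" using D_H by blast

lemma semibounded: "\<exists>B\<ge>0. \<forall>u\<in>D. - B * Re (ip u u) <= Re (a u u)"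
proof -
  obtain p g C where g: "\<forall>i<p::nat. g i \<in> H" "C \<ge> 0"
    and F: "\<And>u. u \<in> D ==> (b - 1) * Re (ip u u) <= Re (a u u) + C * (\<Sum>i<p. (cmod (ip u (g i)))\<^sup>2)"
    using finite_codim_bound[of 1] by auto
  define G where "G = (\<Sum>i<p. Re (ip (g i) (g i)))"
  have G: "G \<ge> 0" unfolding G_def using g ip.q_nonneg by (intro sum_nonneg) auto
  have "- (\<bar>b - 1\<bar> + C * G) * Re (ip u u) <= Re (a u u)" if u: "u \<in> D" for u
  proof -
    have "(\<Sum>i<p. (cmod (ip u (g i)))\<^sup>2) <= (\<Sum>i<p. Re (ip u u) * Re (ip (g i) (g i)))"
      using g u by (intro sum_mono ip.Cauchy_Schwarz_sq) auto
    also have "\<dots> = Re (ip u u) * G" by (simp add: G_def sum_distrib_left)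
    finally have "C * (\<Sum>i<p. (cmod (ip u (g i)))\<^sup>2) <= C * (Re (ip u u) * G)"
      using g by (intro mult_left_mono)
    moreover have "- \<bar>b - 1\<bar> * Re (ip u u) <= (b - 1) * Re (ip u u)"
      using u ip.q_nonneg by (intro mult_right_mono) auto
    ultimately show ?thesis using F[OF u] by (simp add: algebra_simps)
  qed
  then show ?thesis using g G by (intro exI[of _ "\<bar>b - 1\<bar> + C * G"]) auto
qed

definition shifted :: "real => 'v => 'v => complex" where
  "shifted t u v = a u v - of_real t * ip u v"

lemma hermitian_shifted: "hermitian_form sc D (shifted t)"
proof unfold_locales
  show "ip.subspace D" by (rule a.V)
qed (auto simp: shifted_def a.q_add_left ip.q_add_left a.q_scale_left ip.q_scale_left algebra_simps a.q_cnj ip.q_cnj)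

lemma Re_shifted: "Re (shifted t u u) = Re (a u u) - t * Re (ip u u)"
  by (simp add: shifted_def)

text \<open>
  Along a normalized minimizing sequence the finitely many functionals of \<open>finite_codim_bound\<close> are
  bounded, hence convergent after passing to a subsequence. For differences of members of that
  sequence the penalty then tends to zero; as \<open>\<mu> < b\<close>, the parallelogram law forces the sequence to
  be Cauchy, and its limit is a minimizer.
\<close>

theorem minimum_attained:
  assumes mu: "\<mu> < b" and lower: "\<And>u. u \<in> D ==> \<mu> * Re (ip u u) <= Re (a u u)"
    and inf: "\<And>e. e > 0 ==> \<exists>u\<in>D. Re (ip u u) > 0 \<and> Re (a u u) < (\<mu> + e) * Re (ip u u)"
  shows "\<exists>w\<in>D. Re (ip w w) = 1 \<and> (\<forall>v\<in>D. a w v = of_real \<mu> * ip w v)"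
proof -
  interpret s: hermitian_form sc D "shifted \<mu>" by (rule hermitian_shifted)
  interpret s: semi_inner_product sc D "shifted \<mu>"
    using lower by unfold_locales (simp add: Re_shifted)
  have "\<exists>u\<in>D. Re (ip u u) = 1 \<and> Re (shifted \<mu> u u) < e" if e: "e > 0" for e
  proof -
    obtain u where u: "u \<in> D" "Re (ip u u) > 0" "Re (a u u) < (\<mu> + e) * Re (ip u u)"
      using inf[OF e] by blast
    let ?c = "of_real (1 / sqrt (Re (ip u u))) :: complex"
    have c: "(cmod ?c)\<^sup>2 = 1 / Re (ip u u)" using u by (simp add: power_divide norm_divide)
    have "Re (ip (?c \<star> u) (?c \<star> u)) = 1"
      using u c by (simp only: ip.Re_q_scale[OF DH[OF u(1)]]) simp
    moreover have "Re (shifted \<mu> (?c \<star> u) (?c \<star> u)) < e"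
      using u c by (simp only: s.Re_q_scale[OF u(1)]) (simp add: Re_shifted divide_simps algebra_simps)
    ultimately show ?thesis using u(1) by blast
  qed
  then have "\<forall>k::nat. \<exists>u\<in>D. Re (ip u u) = 1 \<and> Re (shifted \<mu> u u) < inverse (real (Suc k))" by simp
  then obtain w0 where w0: "\<And>k. w0 k \<in> D" "\<And>k. Re (ip (w0 k) (w0 k)) = 1"
      "\<And>k. Re (shifted \<mu> (w0 k) (w0 k)) < inverse (real (Suc k))"
    by metis
  define \<epsilon> where "\<epsilon> = (b - \<mu>) / 2"
  have eps: "\<epsilon> > 0" using mu by (simp add: \<epsilon>_def)
  obtain p g C where g: "\<And>i. i < p ==> g i \<in> H" "C \<ge> 0"
    and F: "\<And>u. u \<in> D ==> (b - \<epsilon>) * Re (ip u u) <= Re (a u u) + C * (\<Sum>i<p::nat. (cmod (ip u (g i)))\<^sup>2)"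
    using finite_codim_bound[OF eps] by blast
  have "\<exists>r::nat => nat. strict_mono r \<and> (\<forall>i<p'. convergent (%k. ip (w0 (r k)) (g i)))" if "p' <= p" for p'
    using that
  proof (induction p')
    case 0 then show ?case by (intro exI[of _ id]) (simp add: strict_mono_def)
  next
    case (Suc p')
    then obtain r where r: "strict_mono (r::nat=>nat)" "\<forall>i<p'. convergent (%k. ip (w0 (r k)) (g i))" by auto
    have bd: "cmod (ip (w0 (r k)) (g p')) <= ip.N (g p')" for k
      using ip.Cauchy_Schwarz[of "w0 (r k)" "g p'"] g(1)[of p'] Suc.prems w0 by (simp add: ip.N_def)
    have "bounded (range (%k. ip (w0 (r k)) (g p')))"
      using bd by (auto simp: bounded_iff)
    then obtain l r' where r': "strict_mono (r'::nat=>nat)" "((%k. ip (w0 (r k)) (g p')) \<circ> r') \<longlonglongrightarrow> l"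
      using bounded_imp_convergent_subsequence by blast
    have "convergent (%k. ip (w0 (r (r' k))) (g i))" if "i < Suc p'" for i
    proof (cases "i = p'")
      case True then show ?thesis using r'(2) by (auto simp: convergent_def o_def)
    next
      case False
      then have "convergent ((%k. ip (w0 (r k)) (g i)) \<circ> r')"
        using r(2) that r'(1) by (intro convergent_subseq_convergent) auto
      then show ?thesis by (simp add: o_def)
    qed
    then show ?case using r r' by (intro exI[of _ "r \<circ> r'"]) (auto simp: strict_mono_def)
  qed
  then obtain r where r: "strict_mono (r::nat=>nat)" "\<And>i. i < p ==> convergent (%k. ip (w0 (r k)) (g i))" by blast
  define w where "w k = w0 (r k)" for k
  have w: "w k \<in> D" "Re (ip (w k) (w k)) = 1" for k by (auto simp: w_def w0)
  have w_small: "Re (shifted \<mu> (w k) (w k)) < inverse (real (Suc k))" for k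
  proof -
    have "k <= r k" using r(1) by (rule seq_suble)
    then have "inverse (real (Suc (r k))) <= inverse (real (Suc k))" by (intro le_imp_inverse_le) auto
    then show ?thesis using w0(3)[of "r k"] unfolding w_def by linarith
  qed
  have s_diff: "Re (shifted \<mu> (w j - w k) (w j - w k)) <= 2 * inverse (real (Suc j)) + 2 * inverse (real (Suc k))" for j k
  proof -
    have "0 <= Re (shifted \<mu> ((1/2) \<star> (w j + w k)) ((1/2) \<star> (w j + w k)))"
      using w by (intro s.q_nonneg a.V_closed)
    then show ?thesis
      using s.minimizing_gap[OF w(1)[of j] w(1)[of k]] w_small[of j] w_small[of k] by linarith
  qed
  have ip_diff: "\<epsilon> * Re (ip (w j - w k) (w j - w k))
      <= 2 * inverse (real (Suc j)) + 2 * inverse (real (Suc k)) + C * (\<Sum>i<p. (cmod (ip (w j) (g i) - ip (w k) (g i)))\<^sup>2)" for j k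
  proof -
    have "(\<Sum>i<p. (cmod (ip (w j - w k) (g i)))\<^sup>2) = (\<Sum>i<p. (cmod (ip (w j) (g i) - ip (w k) (g i)))\<^sup>2)"
      using g w by (intro sum.cong) (auto simp: ip.q_diff_left)
    then have "(b - \<epsilon>) * Re (ip (w j - w k) (w j - w k)) <= Re (a (w j - w k) (w j - w k)) +
        C * (\<Sum>i<p. (cmod (ip (w j) (g i) - ip (w k) (g i)))\<^sup>2)"
      using F[of "w j - w k"] w by auto
    moreover have "(b - \<epsilon>) = \<epsilon> + \<mu>" by (simp add: \<epsilon>_def field_simps)
    ultimately show ?thesis using s_diff[of j k] by (simp add: Re_shifted algebra_simps)
  qed
  have small: "\<exists>K. \<forall>j\<ge>K. \<forall>k\<ge>K. 2 * inverse (real (Suc j)) + 2 * inverse (real (Suc k)) +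
      C * (\<Sum>i<p. (cmod (ip (w j) (g i) - ip (w k) (g i)))\<^sup>2) < e" if "e > 0" for e
  proof -
    obtain l where l: "\<And>i. i < p ==> (%k. ip (w k) (g i)) \<longlonglongrightarrow> l i"
      using r(2) unfolding convergent_def w_def by metis
    define h where "h k = (\<Sum>i<p. (cmod (ip (w k) (g i) - l i))\<^sup>2)" for k
    have "h \<longlonglongrightarrow> (\<Sum>i<p. (cmod (l i - l i))\<^sup>2)"
      unfolding h_def using l by (intro tendsto_intros) auto
    then have "(%k. 2 * inverse (real (Suc k)) + 2 * C * h k) \<longlonglongrightarrow> 2 * 0 + 2 * C * 0"
      by (intro tendsto_intros LIMSEQ_inverse_real_of_nat) simp
    then have "\<forall>\<^sub>F k in sequentially. 2 * inverse (real (Suc k)) + 2 * C * h k < e / 2"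
      using \<open>e > 0\<close> by (intro order_tendstoD(2)) auto
    then obtain K where K: "\<And>k. k \<ge> K ==> 2 * inverse (real (Suc k)) + 2 * C * h k < e / 2"
      by (auto simp: eventually_sequentially)
    have tri: "(cmod (x - y))\<^sup>2 <= 2 * (cmod (x - z))\<^sup>2 + 2 * (cmod (y - z))\<^sup>2" for x y z :: complex
    proof -
      have "(cmod (x - y))\<^sup>2 <= (cmod (x - z) + cmod (y - z))\<^sup>2"
        using norm_triangle_ineq4[of "x - z" "y - z"] by (intro power_mono) auto
      also have "\<dots> <= 2 * (cmod (x - z))\<^sup>2 + 2 * (cmod (y - z))\<^sup>2"
        using sum_squares_ge_zero[of "cmod (x - z) - cmod (y - z)" 0] by (simp add: power2_eq_square algebra_simps)
      finally show ?thesis .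
    qed
    have "2 * inverse (real (Suc j)) + 2 * inverse (real (Suc k)) +
      C * (\<Sum>i<p. (cmod (ip (w j) (g i) - ip (w k) (g i)))\<^sup>2) < e" if "j \<ge> K" "k \<ge> K" for j k
    proof -
      have "(\<Sum>i<p. (cmod (ip (w j) (g i) - ip (w k) (g i)))\<^sup>2) <= (\<Sum>i<p. 2 * (cmod (ip (w j) (g i) - l i))\<^sup>2 + 2 * (cmod (ip (w k) (g i) - l i))\<^sup>2)"
        by (intro sum_mono tri)
      also have "\<dots> = 2 * h j + 2 * h k" by (simp add: h_def sum.distrib sum_distrib_left)
      finally have "C * (\<Sum>i<p. (cmod (ip (w j) (g i) - ip (w k) (g i)))\<^sup>2) <= C * (2 * h j + 2 * h k)"
        using g(2) by (intro mult_left_mono)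
      also have "\<dots> = 2 * C * h j + 2 * C * h k" by (simp add: algebra_simps)
      finally show ?thesis using K[OF that(1)] K[OF that(2)] by linarith
    qed
    then show ?thesis by blast
  qed
  have "\<exists>K. \<forall>j\<ge>K. \<forall>k\<ge>K. Re (ip (w j - w k) (w j - w k)) < e \<and> \<bar>Re (a (w j - w k) (w j - w k))\<bar> < e" if e: "e > 0" for e
  proof -
    define e' where "e' = min (\<epsilon> * e / (2 * (1 + \<bar>\<mu>\<bar>))) (e / 2)"
    have e'1: "e' > 0" using e eps by (simp add: e'_def)
    have e': "e' > 0" "e' <= \<epsilon> * e / (2 * (1 + \<bar>\<mu>\<bar>))" "e' <= e / 2"
      by (rule e'1) (unfold e'_def, rule min.cobounded1, rule min.cobounded2)
    obtain K where K: "\<And>j k. j \<ge> K ==> k \<ge> K ==> 2 * inverse (real (Suc j)) + 2 * inverse (real (Suc k)) +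
      C * (\<Sum>i<p. (cmod (ip (w j) (g i) - ip (w k) (g i)))\<^sup>2) < e'" using small[OF e'(1)] by blast
    have "Re (ip (w j - w k) (w j - w k)) < e \<and> \<bar>Re (a (w j - w k) (w j - w k))\<bar> < e" if jk: "j \<ge> K" "k \<ge> K" for j k
    proof -
      let ?I = "Re (ip (w j - w k) (w j - w k))" and ?S = "Re (shifted \<mu> (w j - w k) (w j - w k))"
      have I0: "?I \<ge> 0" using w by (intro ip.q_nonneg ip.V_closed DH)
      have S0: "?S \<ge> 0" using w by (intro s.q_nonneg a.V_closed)
      have pos: "C * (\<Sum>i<p. (cmod (ip (w j) (g i) - ip (w k) (g i)))\<^sup>2) \<ge> 0"
        using g(2) by (intro mult_nonneg_nonneg sum_nonneg) auto
      have S: "?S < e / 2" using K[OF jk] pos s_diff[of j k] e'(3) by linarith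
      have "\<epsilon> * ?I < \<epsilon> * (e / (2 * (1 + \<bar>\<mu>\<bar>)))" using K[OF jk] ip_diff[of j k] e'(2) by simp
      then have I: "?I < e / (2 * (1 + \<bar>\<mu>\<bar>))" using eps by (simp only: mult_less_cancel_left_pos)
      then have I2: "(1 + \<bar>\<mu>\<bar>) * ?I < e / 2" by (simp only: pos_less_divide_eq) (simp add: field_simps add_pos_nonneg)
      have "\<bar>\<mu> * ?I\<bar> = \<bar>\<mu>\<bar> * ?I" using I0 by (simp only: abs_mult abs_of_nonneg)
      moreover have "0 <= \<bar>\<mu>\<bar> * ?I" using I0 by (intro mult_nonneg_nonneg) auto
      moreover have "Re (a (w j - w k) (w j - w k)) = ?S + \<mu> * ?I" by (simp only: Re_shifted)
      moreover have "(1 + \<bar>\<mu>\<bar>) * ?I = ?I + \<bar>\<mu>\<bar> * ?I" by (simp only: distrib_right mult_1)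
      ultimately show ?thesis using S S0 I2 I0 e by linarith
    qed
    then show ?thesis by blast
  qed
  from closed[OF w(1) this] obtain x where x: "x \<in> D"
    "(%k. Re (ip (w k - x) (w k - x))) \<longlonglongrightarrow> 0" "(%k. Re (a (w k - x) (w k - x))) \<longlonglongrightarrow> 0"
    by blast
  have "(%k. ip.N (w k - x)) \<longlonglongrightarrow> 0" using tendsto_real_sqrt[OF x(2)] by (simp add: ip.N_def)
  then have "(%k. Re (ip (w k) (w k))) \<longlonglongrightarrow> Re (ip x x)"
    using w x(1) by (intro ip.Re_q_tendsto) auto
  then have x1: "Re (ip x x) = 1" using w by (simp add: LIMSEQ_const_iff)
  have "(%k. Re (shifted \<mu> (w k - x) (w k - x))) \<longlonglongrightarrow> 0 - \<mu> * 0"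
    unfolding Re_shifted by (intro tendsto_intros x)
  then have "(%k. s.N (w k - x)) \<longlonglongrightarrow> 0"
    using tendsto_real_sqrt[of "%k. Re (shifted \<mu> (w k - x) (w k - x))" 0] by (simp add: s.N_def)
  then have "(%k. Re (shifted \<mu> (w k) (w k))) \<longlonglongrightarrow> Re (shifted \<mu> x x)"
    using w x(1) by (intro s.Re_q_tendsto) auto
  then have "Re (shifted \<mu> x x) <= 0"
    using w_small by (intro LIMSEQ_le[OF _ LIMSEQ_inverse_real_of_nat]) (auto intro: less_imp_le)
  then have "Re (shifted \<mu> x x) = 0" using s.q_nonneg[OF x(1)] by simp
  then have "a x v = of_real \<mu> * ip x v" if "v \<in> D" for v
    using s.Cauchy_Schwarz_sq[OF x(1) that] by (simp add: shifted_def)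
  then show ?thesis using x1 x(1) by blast
qed

end

section \<open>Eigenvalues below the threshold\<close>

context closed_form begin

definition eigenvector :: "complex => 'v => bool" where
  "eigenvector z u \<longleftrightarrow> u \<in> D \<and> (\<forall>v\<in>D. a u v = z * ip u v)"

lemma eigenvector_real:
  assumes "eigenvector z u" "ip u u \<noteq> 0"
  shows "z = of_real (Re z)"
proof -
  have u: "u \<in> D" "a u u = z * ip u u" using assms by (auto simp: eigenvector_def)
  have "of_real (Re (a u u)) = z * of_real (Re (ip u u))"
    using u a.q_self[OF u(1)] ip.q_self[OF DH[OF u(1)]] by simp
  moreover have "Re (ip u u) \<noteq> 0" using assms(2) ip.q_self[OF DH[OF u(1)]] by auto
  ultimately have "z = of_real (Re (a u u) / Re (ip u u))" by (simp add: field_simps)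
  then show ?thesis by (metis Re_complex_of_real)
qed

lemma eigenvectors_orthogonal:
  assumes "eigenvector (of_real l) u" "eigenvector (of_real m) v" "l \<noteq> m"
  shows "ip u v = 0"
proof -
  have D: "u \<in> D" "v \<in> D" using assms by (auto simp: eigenvector_def)
  have "of_real l * ip u v = a u v" using assms D by (auto simp: eigenvector_def)
  also have "\<dots> = cnj (a v u)" using a.q_cnj[OF D(2,1)] by simp
  also have "\<dots> = of_real m * ip u v"
    using assms D ip.q_cnj[of v u] by (auto simp: eigenvector_def)
  finally show ?thesis using assms(3) by simp
qed

lemma eigenvector_combination:
  assumes "\<And>i. i \<in> I ==> eigenvector z (u i)"
  shows "eigenvector z (\<Sum>i\<in>I. c i \<star> u i)"
  using assms unfolding eigenvector_def
  by (auto simp: a.q_sum_left ip.q_sum_left a.q_scale_left ip.q_scale_left sum_distrib_left mult.left_commute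
      intro!: sum.cong)

text \<open>
  A space of larger dimension than the number of functionals contains a nonzero vector on which all
  of them vanish, by \<open>homogeneous_system\<close>; there the Rayleigh quotient would exceed \<open>c\<close>.
\<close>

lemma dimension_bound:
  assumes "c < b"
  obtains p :: nat where "\<And>(I::'i set) u. finite I ==> (\<And>i. i \<in> I ==> u i \<in> D) ==>
     (\<And>k x. x = (\<Sum>i\<in>I. k i \<star> u i) ==> \<exists>i\<in>I. k i \<noteq> 0 ==> Re (ip x x) > 0 \<and> Re (a x x) <= c * Re (ip x x))
     ==> card I <= p"
proof -
  define \<epsilon> where "\<epsilon> = (b - c) / 2"
  have eps: "\<epsilon> > 0" using assms by (simp add: \<epsilon>_def)
  obtain p g C where g: "\<And>i. i < p ==> g i \<in> H" "C \<ge> 0"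
    and F: "\<And>u. u \<in> D ==> (b - \<epsilon>) * Re (ip u u) <= Re (a u u) + C * (\<Sum>i<p::nat. (cmod (ip u (g i)))\<^sup>2)"
    using finite_codim_bound[OF eps] by blast
  have "card I <= p" if I: "finite I" "\<And>i. i \<in> I ==> u i \<in> D"
     "\<And>k x. x = (\<Sum>i\<in>I. k i \<star> u i) ==> \<exists>i\<in>I. k i \<noteq> 0 ==> Re (ip x x) > 0 \<and> Re (a x x) <= c * Re (ip x x)"
    for I :: "'i set" and u
  proof (rule ccontr)
    assume "\<not> card I <= p"
    then obtain k where k: "\<exists>i\<in>I. k i \<noteq> 0" "\<And>j. j < p ==> (\<Sum>i\<in>I. k i * ip (u i) (g j)) = 0"
      using homogeneous_system[OF I(1), of p "%j i. ip (u i) (g j)"] by auto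
    define x where "x = (\<Sum>i\<in>I. k i \<star> u i)"
    have x: "x \<in> D" using I(2) by (auto simp: x_def)
    have "ip x (g j) = 0" if "j < p" for j
      using k(2)[OF that] I(2) g(1)[OF that] by (simp add: x_def ip.q_sum_left ip.q_scale_left)
    then have "(b - \<epsilon>) * Re (ip x x) <= Re (a x x)" using F[OF x] by simp
    moreover have "Re (ip x x) > 0" "Re (a x x) <= c * Re (ip x x)" using I(3)[OF x_def k(1)] by auto
    moreover have "c * Re (ip x x) < (b - \<epsilon>) * Re (ip x x)"
      using \<open>Re (ip x x) > 0\<close> assms by (intro mult_strict_right_mono) (auto simp: \<epsilon>_def field_simps)
    ultimately show False by linarith
  qed
  then show thesis by (rule that)
qed

definition eigensystem :: "'i set => ('i => 'v) => ('i => real) => bool" where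
  "eigensystem I e m \<longleftrightarrow> finite I \<and> (\<forall>i\<in>I. eigenvector (of_real (m i)) (e i)) \<and>
     (\<forall>i\<in>I. \<forall>j\<in>I. ip (e i) (e j) = (if i = j then 1 else 0))"

lemma eigensystemD:
  assumes "eigensystem I e m"
  shows "finite I" "\<And>i. i \<in> I ==> e i \<in> D" "\<And>i v. i \<in> I ==> v \<in> D ==> a (e i) v = of_real (m i) * ip (e i) v"
    "\<And>i j. i \<in> I ==> j \<in> I ==> ip (e i) (e j) = (if i = j then 1 else 0)"
    "\<And>i v. i \<in> I ==> v \<in> D ==> a v (e i) = of_real (m i) * ip v (e i)"
proof -
  show D: "e i \<in> D" and *: "v \<in> D ==> a (e i) v = of_real (m i) * ip (e i) v" if "i \<in> I" for i v
    using assms that by (auto simp: eigensystem_def eigenvector_def)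
  show "a v (e i) = of_real (m i) * ip v (e i)" if "i \<in> I" "v \<in> D" for i v
    using *[OF that] a.q_cnj[OF D[OF that(1)] that(2)] ip.q_cnj[of "e i" v] D[OF that(1)] that(2)
    by (metis DH complex_cnj_complex_of_real complex_cnj_mult)
qed (use assms in \<open>auto simp: eigensystem_def\<close>)

lemma eigensystem_combination:
  assumes "eigensystem I e m" "\<And>i. i \<in> I ==> m i <= c" "\<exists>i\<in>I. k i \<noteq> 0" "x = (\<Sum>i\<in>I. k i \<star> e i)"
  shows "Re (ip x x) > 0 \<and> Re (a x x) <= c * Re (ip x x)"
proof -
  note e = eigensystemD[OF assms(1)]
  have ip: "ip x x = of_real (\<Sum>i\<in>I. (cmod (k i))\<^sup>2)"
    unfolding assms(4) by (subst ip.q_orthogonal_combination[where d = "%_. 1"]) (use e in auto)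
  have "a (e i) (e j) = (if i = j then of_real (m i) else 0)" if "i \<in> I" "j \<in> I" for i j
    using e that by simp
  then have a: "a x x = of_real (\<Sum>i\<in>I. (cmod (k i))\<^sup>2 * m i)"
    unfolding assms(4) by (subst a.q_orthogonal_combination[where d = "%i. of_real (m i)"]) (use e in auto)
  have "(\<Sum>i\<in>I. (cmod (k i))\<^sup>2 * m i) <= (\<Sum>i\<in>I. (cmod (k i))\<^sup>2 * c)"
    using assms(2) by (intro sum_mono mult_left_mono) auto
  then have "Re (a x x) <= c * Re (ip x x)" unfolding ip a by (simp add: sum_distrib_left mult.commute)
  moreover have "(\<Sum>i\<in>I. (cmod (k i))\<^sup>2) > 0"
    using assms(3) e(1) by (metis (no_types, lifting) norm_eq_zero sum_pos2 zero_le_power2 zero_less_power2)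
  ultimately show ?thesis by (simp add: ip)
qed

text \<open>
  Shifting finitely many eigenvectors upwards by \<open>K\<close> removes their eigenvalues from the part of the
  spectrum under consideration and leaves the hypotheses of the locale intact, so that results on
  minimizers apply again.
\<close>

definition penalized :: "real => 'i set => ('i => 'v) => 'v => 'v => complex" where
  "penalized K I e u v = a u v + of_real K * (\<Sum>i\<in>I. ip u (e i) * ip (e i) v)"

lemma penalized_self:
  assumes "eigensystem I e m" "u \<in> D"
  shows "Re (penalized K I e u u) = Re (a u u) + K * (\<Sum>i\<in>I. (cmod (ip u (e i)))\<^sup>2)"
proof -
  have "(\<Sum>i\<in>I. ip u (e i) * ip (e i) u) = (\<Sum>i\<in>I. ip u (e i) * cnj (ip u (e i)))"
    using eigensystemD(2)[OF assms(1)] assms(2) by (intro sum.cong) (auto simp: ip.q_cnj)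
  then show ?thesis unfolding penalized_def sum_cnj_mult_self by simp
qed

lemma coefficient_bound:
  assumes "eigensystem I e m" "u \<in> H"
  shows "(\<Sum>i\<in>I. (cmod (ip u (e i)))\<^sup>2) <= real (card I) * Re (ip u u)"
proof -
  have "(cmod (ip u (e i)))\<^sup>2 <= Re (ip u u)" if "i \<in> I" for i
    using ip.Cauchy_Schwarz_sq[of u "e i"] eigensystemD(2,4)[OF assms(1)] that assms(2) by simp
  then have "(\<Sum>i\<in>I. (cmod (ip u (e i)))\<^sup>2) <= (\<Sum>i\<in>I. Re (ip u u))" by (intro sum_mono)
  then show ?thesis by simp
qed

lemma closed_form_penalized:
  assumes e: "eigensystem I e m" and K: "K \<ge> 0"
  shows "closed_form sc H ip D (penalized K I e) b"
proof -
  note eD = eigensystemD[OF e]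
  interpret h: hermitian_form sc D "penalized K I e"
  proof unfold_locales
    show "ip.subspace D" by (rule a.V)
    fix u v assume uv: "u \<in> D" "v \<in> D"
    have "cnj (\<Sum>i\<in>I. ip u (e i) * ip (e i) v) = (\<Sum>i\<in>I. ip v (e i) * ip (e i) u)"
      unfolding cnj_sum complex_cnj_mult using uv eD(2)
      by (intro sum.cong) (auto simp: ip.q_cnj mult.commute)
    then show "cnj (penalized K I e u v) = penalized K I e v u"
      using uv by (simp add: penalized_def a.q_cnj)
  qed (use eD in \<open>auto simp: penalized_def a.q_add_left ip.q_add_left a.q_scale_left ip.q_scale_left
      algebra_simps sum.distrib sum_distrib_left\<close>)
  define K' where "K' = K * real (card I)"
  have K': "K' \<ge> 0" using K by (simp add: K'_def)
  have pen: "Re (a u u) <= Re (penalized K I e u u)"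
     "Re (penalized K I e u u) <= Re (a u u) + K' * Re (ip u u)" if "u \<in> D" for u
  proof -
    have "0 <= K * (\<Sum>i\<in>I. (cmod (ip u (e i)))\<^sup>2)" using K by (intro mult_nonneg_nonneg sum_nonneg) auto
    moreover have "K * (\<Sum>i\<in>I. (cmod (ip u (e i)))\<^sup>2) <= K * (real (card I) * Re (ip u u))"
      using K that coefficient_bound[OF e, of u] by (intro mult_left_mono) auto
    ultimately show "Re (a u u) <= Re (penalized K I e u u)"
     "Re (penalized K I e u u) <= Re (a u u) + K' * Re (ip u u)"
      using penalized_self[OF e that, of K] by (auto simp: K'_def)
  qed
  show ?thesis
  proof unfold_locales
    show "D \<subseteq> H" by (rule D_H)
  next
    fix w :: "nat => 'v"
    assume w: "\<And>k. w k \<in> D" and cau: "\<And>\<epsilon>. \<epsilon> > 0 ==> \<exists>J. \<forall>j\<ge>J. \<forall>k\<ge>J. Re (ip (w j - w k) (w j - w k)) < \<epsilon> \<and>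
        \<bar>Re (penalized K I e (w j - w k) (w j - w k))\<bar> < \<epsilon>"
    have "\<exists>J. \<forall>j\<ge>J. \<forall>k\<ge>J. Re (ip (w j - w k) (w j - w k)) < \<epsilon> \<and>
        \<bar>Re (a (w j - w k) (w j - w k))\<bar> < \<epsilon>" if eps: "\<epsilon> > 0" for \<epsilon>
    proof -
      have pos: "\<epsilon> / (1 + K') > 0" using eps K' by simp
      obtain J where J: "\<And>j k. j \<ge> J ==> k \<ge> J ==> Re (ip (w j - w k) (w j - w k)) < \<epsilon> / (1 + K') \<and>
        \<bar>Re (penalized K I e (w j - w k) (w j - w k))\<bar> < \<epsilon> / (1 + K')" using cau[OF pos] by blast
      have "Re (ip (w j - w k) (w j - w k)) < \<epsilon> \<and> \<bar>Re (a (w j - w k) (w j - w k))\<bar> < \<epsilon>"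
        if jk: "j \<ge> J" "k \<ge> J" for j k
      proof -
        define d where "d = w j - w k"
        have d: "d \<in> D" using w by (simp add: d_def)
        have I0: "Re (ip d d) \<ge> 0" using d by (intro ip.q_nonneg) auto
        have lt: "Re (ip d d) < \<epsilon> / (1 + K')" "\<bar>Re (penalized K I e d d)\<bar> < \<epsilon> / (1 + K')"
          using J[OF jk] by (auto simp: d_def)
        have "K' * Re (ip d d) <= K' * (\<epsilon> / (1 + K'))" using lt K' by (intro mult_left_mono) auto
        moreover have "\<epsilon> / (1 + K') + K' * (\<epsilon> / (1 + K')) = \<epsilon>"
          using K' by (simp add: field_simps add_nonneg_eq_0_iff)
        moreover have "0 <= K' * (\<epsilon> / (1 + K'))" using pos K' by (intro mult_nonneg_nonneg) auto
        ultimately show ?thesis using lt pen[OF d] I0 unfolding d_def[symmetric] by linarith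
      qed
      then show ?thesis by blast
    qed
    from closed[OF w this] obtain x where x: "x \<in> D"
      "(%k. Re (ip (w k - x) (w k - x))) \<longlonglongrightarrow> 0" "(%k. Re (a (w k - x) (w k - x))) \<longlonglongrightarrow> 0" by blast
    have "(%k. Re (penalized K I e (w k - x) (w k - x))) \<longlonglongrightarrow> 0"
    proof (rule tendsto_sandwich[OF _ _ x(3)])
      show "(%k. Re (a (w k - x) (w k - x)) + K' * Re (ip (w k - x) (w k - x))) \<longlonglongrightarrow> 0"
        using tendsto_add[OF x(3) tendsto_mult_left[OF x(2), of K']] by simp
    qed (use pen w x in auto)
    then show "\<exists>x\<in>D. (%k. Re (ip (w k - x) (w k - x))) \<longlonglongrightarrow> 0 \<and>
        (%k. Re (penalized K I e (w k - x) (w k - x))) \<longlonglongrightarrow> 0"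
      using x by blast
  next
    fix \<epsilon> :: real assume "\<epsilon> > 0"
    then obtain p g C where "\<forall>i<p::nat. g i \<in> H" "C \<ge> 0" and
      F: "\<forall>u\<in>D. (b - \<epsilon>) * Re (ip u u) <= Re (a u u) + C * (\<Sum>i<p. (cmod (ip u (g i)))\<^sup>2)"
      using finite_codim_bound by blast
    moreover have "(b - \<epsilon>) * Re (ip u u) <= Re (penalized K I e u u) + C * (\<Sum>i<p. (cmod (ip u (g i)))\<^sup>2)"
      if "u \<in> D" for u
      using F that pen(1)[OF that] by fastforce
    ultimately show "\<exists>p g C. (\<forall>i<p::nat. g i \<in> H) \<and> 0 <= C \<and>
      (\<forall>u\<in>D. (b - \<epsilon>) * Re (ip u u) <= Re (penalized K I e u u) + C * (\<Sum>i<p. (cmod (ip u (g i)))\<^sup>2))"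
      by blast
  qed
qed

definition maximal_below :: "real => 'i set => ('i => 'v) => ('i => real) => bool" where
  "maximal_below c I e m \<longleftrightarrow> eigensystem I e m \<and> (\<forall>i\<in>I. m i < c) \<and>
     (\<forall>u l. eigenvector (of_real l) u \<and> l < c \<and> (\<forall>i\<in>I. ip u (e i) = 0) \<longrightarrow> Re (ip u u) \<noteq> 1)"

text \<open>
  Otherwise the penalized form would have an infimum below \<open>c\<close>. It would be attained, and the minimizer
  would be an eigenvector orthogonal to all \<open>e i\<close>, which contradicts maximality.
\<close>

lemma penalized_lower_bound:
  assumes e: "maximal_below c I e m" and c: "c <= b" and K: "K \<ge> 0" "\<And>i. i \<in> I ==> c <= m i + K" and u: "u \<in> D"
  shows "c * Re (ip u u) <= Re (penalized K I e u u)"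
proof (rule ccontr)
  assume less: "\<not> c * Re (ip u u) <= Re (penalized K I e u u)"
  have es: "eigensystem I e m" using e by (simp add: maximal_below_def)
  note eD = eigensystemD[OF es]
  interpret E: closed_form sc H ip D "penalized K I e" b by (rule closed_form_penalized[OF es K(1)])
  obtain B where B: "\<And>v. v \<in> D ==> - B * Re (ip v v) <= Re (penalized K I e v v)"
    using E.semibounded by blast
  define X where "X = {Re (penalized K I e v v) / Re (ip v v) | v. v \<in> D \<and> Re (ip v v) > 0}"
  define \<mu> where "\<mu> = Inf X"
  have "bdd_below X"
    using B unfolding X_def bdd_below_def by (intro exI[of _ "-B"]) (auto simp: field_simps)
  have "Re (ip u u) \<noteq> 0" using less B[OF u] by auto
  then have pos: "Re (ip u u) > 0" using ip.q_nonneg[OF DH[OF u]] by simp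
  then have uX: "Re (penalized K I e u u) / Re (ip u u) \<in> X" using u by (auto simp: X_def)
  have "\<mu> <= Re (penalized K I e u u) / Re (ip u u)"
    unfolding \<mu>_def using uX \<open>bdd_below X\<close> by (rule cInf_lower)
  also have "\<dots> < c" using less pos by (simp add: field_simps)
  finally have mu: "\<mu> < c" .
  have "\<exists>w\<in>D. Re (ip w w) = 1 \<and> (\<forall>v\<in>D. penalized K I e w v = of_real \<mu> * ip w v)"
  proof (rule E.minimum_attained)
    show "\<mu> < b" using mu c by simp
    fix v assume v: "v \<in> D"
    show "\<mu> * Re (ip v v) <= Re (penalized K I e v v)"
    proof (cases "Re (ip v v) = 0")
      case True then show ?thesis using B[OF v] by simp
    next
      case False
      then have p: "Re (ip v v) > 0" using ip.q_nonneg[OF DH[OF v]] by simp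
      then have "\<mu> <= Re (penalized K I e v v) / Re (ip v v)"
        unfolding \<mu>_def using \<open>bdd_below X\<close> v by (intro cInf_lower) (auto simp: X_def)
      then show ?thesis using p by (simp add: field_simps)
    qed
  next
    fix r :: real assume "r > 0"
    then obtain y where "y \<in> X" "y < \<mu> + r" using cInf_lessD[of X "\<mu> + r"] uX by (auto simp: \<mu>_def)
    then show "\<exists>u\<in>D. 0 < Re (ip u u) \<and> Re (penalized K I e u u) < (\<mu> + r) * Re (ip u u)"
      by (auto simp: X_def field_simps)
  qed
  then obtain w where w: "w \<in> D" "Re (ip w w) = 1" "\<And>v. v \<in> D ==> penalized K I e w v = of_real \<mu> * ip w v"
    by blast
  have orth: "ip w (e i) = 0" if i: "i \<in> I" for i
  proof -
    have "(\<Sum>j\<in>I. ip w (e j) * ip (e j) (e i)) = (\<Sum>j\<in>I. if j = i then ip w (e i) else 0)"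
      using eD(4) i by (intro sum.cong) auto
    also have "\<dots> = ip w (e i)" using eD(1) i by simp
    finally have "of_real \<mu> * ip w (e i) = of_real (m i + K) * ip w (e i)"
      using w(3)[OF eD(2)[OF i]] eD(5)[OF i w(1)] by (simp add: penalized_def algebra_simps)
    moreover have "\<mu> \<noteq> m i + K" using mu K(2)[OF i] by simp
    ultimately show ?thesis by (metis mult_right_cancel of_real_eq_iff)
  qed
  then have "eigenvector (of_real \<mu>) w"
    using w by (simp add: eigenvector_def penalized_def)
  then show False using e orth w(2) mu unfolding maximal_below_def by blast
qed

lemma eigensystem_bounded:
  assumes "c < b"
  obtains p where "\<And>(I::nat set) e m. eigensystem I e m ==> (\<And>i. i \<in> I ==> m i <= c) ==> card I <= p"
proof -
  obtain p :: nat where p: "\<And>(I::nat set) u. finite I ==> (\<And>i. i \<in> I ==> u i \<in> D) ==>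
     (\<And>k x. x = (\<Sum>i\<in>I. k i \<star> u i) ==> \<exists>i\<in>I. k i \<noteq> 0 ==> Re (ip x x) > 0 \<and> Re (a x x) <= c * Re (ip x x))
     ==> card I <= p"
    using dimension_bound[OF assms, where 'i = nat] by blast
  show thesis
  proof (rule that)
    fix I :: "nat set" and e m assume e: "eigensystem I e m" and m: "\<And>i. i \<in> I ==> m i <= c"
    show "card I <= p"
      by (rule p[OF eigensystemD(1)[OF e]], erule eigensystemD(2)[OF e], rule eigensystem_combination[OF e m])
  qed
qed

lemma maximal_below_exists:
  assumes "c < b"
  obtains n e m where "maximal_below c {..<n::nat} e m"
proof -
  obtain p where p: "\<And>(I::nat set) e m. eigensystem I e m ==> (\<And>i. i \<in> I ==> m i <= c) ==> card I <= p"
    using eigensystem_bounded[OF assms] by blast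
  define P where "P n \<longleftrightarrow> (\<exists>e m. eigensystem {..<n::nat} e m \<and> (\<forall>i<n. m i < c))" for n
  have "P 0" by (simp add: P_def eigensystem_def)
  moreover have le: "n <= p" if "P n" for n
  proof -
    from that obtain e m where "eigensystem {..<n} e m" "\<forall>i<n. m i < c" by (auto simp: P_def)
    then show ?thesis using p[of "{..<n}" e m] by (auto intro: less_imp_le)
  qed
  ultimately obtain n where n: "P n" "\<And>k. P k ==> k <= n"
    using GreatestI_nat[of P 0 p] Greatest_le_nat[of P _ p] by metis
  then obtain e m where em: "eigensystem {..<n} e m" "\<forall>i<n. m i < c" by (auto simp: P_def)
  have "maximal_below c {..<n} e m"
    unfolding maximal_below_def
  proof (intro conjI allI impI)
    fix u l assume u: "eigenvector (of_real l) u \<and> l < c \<and> (\<forall>i\<in>{..<n}. ip u (e i) = 0)"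
    show "Re (ip u u) \<noteq> 1"
    proof
      assume one: "Re (ip u u) = 1"
      have uD: "u \<in> D" using u by (simp add: eigenvector_def)
      have "ip u u = 1" using one ip.q_self[OF DH[OF uD]] by simp
      moreover have "ip (e i) u = 0" if "i < n" for i
        using u that ip.q_cnj[of u "e i"] eigensystemD(2)[OF em(1), of i] uD by auto
      ultimately have "eigensystem {..<Suc n} (e(n := u)) (m(n := l))"
        using em u by (auto simp: eigensystem_def less_Suc_eq lessThan_Suc)
      then have "P (Suc n)" unfolding P_def
        using em u by (intro exI[of _ "e(n := u)"] exI[of _ "m(n := l)"]) (auto simp: less_Suc_eq)
      then show False using n(2) by fastforce
    qed
  qed (use em in auto)
  then show thesis by (rule that)
qed

text \<open>
  Write \<open>T\<close> for the operator of \<open>a - t ip\<close>, which is invertible by the Riesz theorem. Now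
  \<open>(T + \<i> s) T\<^sup>-\<^sup>1 (T - \<i> s) = T + s\<^sup>2 T\<^sup>-\<^sup>1\<close> is again symmetric and coercive, so that a second
  application of the theorem inverts \<open>T - \<i> s\<close>.
\<close>

lemma coercive_solvable:
  assumes c0: "c0 > 0" and coercive: "\<And>u. u \<in> D ==> c0 * Re (ip u u) <= Re (a u u) - t * Re (ip u u)" and f: "f \<in> H"
  shows "\<exists>u\<in>D. \<forall>v\<in>D. a u v - Complex t s * ip u v = ip f v"
proof -
  interpret q: hermitian_form sc D "shifted t" by (rule hermitian_shifted)
  have cq: "c0 * Re (ip u u) <= Re (shifted t u u)" if "u \<in> D" for u
    using coercive[OF that] by (simp add: Re_shifted)
  interpret q: semi_inner_product sc D "shifted t"
  proof unfold_locales
    fix u assume u: "u \<in> D"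
    have "0 <= c0 * Re (ip u u)" using c0 ip.q_nonneg[OF DH[OF u]] by simp
    then show "0 <= Re (shifted t u u)" using cq[OF u] by simp
  qed
  have Nip: "sqrt c0 * ip.N u <= q.N u" if "u \<in> D" for u
    using cq[OF that] unfolding ip.N_def q.N_def real_sqrt_mult[symmetric] by simp
  have qcomplete: q.complete_form
    unfolding q.complete_form_def
  proof (intro allI impI)
    fix w :: "nat => 'v" assume "\<forall>k. w k \<in> D" "\<forall>e>0. \<exists>K. \<forall>j\<ge>K. \<forall>k\<ge>K. q.N (w j - w k) < e"
    then have w: "\<And>k. w k \<in> D" and cau: "\<And>e. e > 0 ==> \<exists>K. \<forall>j\<ge>K. \<forall>k\<ge>K. q.N (w j - w k) < e" by auto
    have "\<exists>K. \<forall>j\<ge>K. \<forall>k\<ge>K. Re (ip (w j - w k) (w j - w k)) < e \<and> \<bar>Re (a (w j - w k) (w j - w k))\<bar> < e"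
      if e: "e > 0" for e
    proof -
      define r where "r = e / (1 + (1 + \<bar>t\<bar>) / c0)"
      have r: "r > 0" using e c0 by (simp add: r_def add_pos_nonneg)
      obtain K where K: "\<And>j k. j \<ge> K ==> k \<ge> K ==> q.N (w j - w k) < sqrt r"
        using cau[of "sqrt r"] r by auto
      have "Re (ip (w j - w k) (w j - w k)) < e \<and> \<bar>Re (a (w j - w k) (w j - w k))\<bar> < e" if jk: "j \<ge> K" "k \<ge> K" for j k
      proof -
        define d where "d = w j - w k"
        have d: "d \<in> D" using w by (simp add: d_def)
        have I0: "Re (ip d d) \<ge> 0" using d by (intro ip.q_nonneg) auto
        have S: "Re (shifted t d d) < r" using K[OF jk] by (simp add: d_def q.N_def)
        have I: "Re (ip d d) < r / c0" using cq[OF d] S c0 by (simp add: field_simps)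
        have "\<bar>t * Re (ip d d)\<bar> = \<bar>t\<bar> * Re (ip d d)" using I0 by (simp add: abs_mult)
        also have "\<dots> <= \<bar>t\<bar> * (r / c0)" using I by (intro mult_left_mono) auto
        finally have T: "\<bar>t * Re (ip d d)\<bar> <= \<bar>t\<bar> * (r / c0)" .
        have req: "r + r / c0 + \<bar>t\<bar> * (r / c0) = e"
        proof -
          have "r + r / c0 + \<bar>t\<bar> * (r / c0) = r * (1 + (1 + \<bar>t\<bar>) / c0)" using c0 by (simp add: field_simps)
          also have "\<dots> = e" using c0 by (simp add: r_def add_pos_nonneg add_nonneg_eq_0_iff)
          finally show ?thesis .
        qed
        have "0 <= Re (shifted t d d)" using d by (rule q.q_nonneg)
        moreover have "Re (a d d) = Re (shifted t d d) + t * Re (ip d d)" by (simp add: Re_shifted)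
        moreover have "0 < r / c0" "0 <= \<bar>t\<bar> * (r / c0)" using r c0 by auto
        ultimately have "Re (ip d d) < e \<and> \<bar>Re (a d d)\<bar> < e" using I S T req r by linarith
        then show ?thesis by (simp add: d_def)
      qed
      then show ?thesis by blast
    qed
    from closed[OF w this] obtain x where x: "x \<in> D"
      "(%k. Re (ip (w k - x) (w k - x))) \<longlonglongrightarrow> 0" "(%k. Re (a (w k - x) (w k - x))) \<longlonglongrightarrow> 0" by blast
    have "(%k. Re (shifted t (w k - x) (w k - x))) \<longlonglongrightarrow> 0 - t * 0"
      unfolding Re_shifted by (intro tendsto_intros x)
    then have "(%k. q.N (w k - x)) \<longlonglongrightarrow> 0"
      using tendsto_real_sqrt[of "%k. Re (shifted t (w k - x) (w k - x))" 0] by (simp add: q.N_def)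
    then show "\<exists>x\<in>D. (%k. q.N (w k - x)) \<longlonglongrightarrow> 0" using x by blast
  qed
  have ip_bound: "cmod (ip h v) <= (ip.N h / sqrt c0) * q.N v" if "h \<in> H" "v \<in> D" for h v
  proof -
    have "cmod (ip h v) <= ip.N h * ip.N v" using that by (intro ip.Cauchy_Schwarz) auto
    also have "ip.N v <= q.N v / sqrt c0" using Nip[OF that(2)] c0 by (simp add: field_simps)
    finally show ?thesis using that by (simp add: mult_left_mono)
  qed
  have "\<exists>u\<in>D. \<forall>v\<in>D. shifted t u v = ip h v" if h: "h \<in> H" for h
    using h by (intro q.Riesz[OF qcomplete, where C = "ip.N h / sqrt c0"] ip_bound)
      (auto simp: ip.q_add_right ip.q_scale_right)
  then obtain R where R: "\<And>h. h \<in> H ==> R h \<in> D" "\<And>h v. h \<in> H ==> v \<in> D ==> shifted t (R h) v = ip h v"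
    by metis
  define q2 where "q2 u v = shifted t u v + of_real (s\<^sup>2) * ip u (R v)" for u v
  have ipR: "ip u (R v) = ip (R u) v" if "u \<in> D" "v \<in> D" for u v
  proof -
    have "ip u (R v) = shifted t (R u) (R v)" using that R by simp
    also have "\<dots> = cnj (shifted t (R v) (R u))" using that R(1) by (simp add: q.q_cnj)
    also have "\<dots> = ip (R u) v" using that R by (simp add: ip.q_cnj)
    finally show ?thesis .
  qed
  interpret q2: hermitian_form sc D q2
  proof unfold_locales
    show "ip.subspace D" by (rule a.V)
    show "cnj (q2 u v) = q2 v u" if "u \<in> D" "v \<in> D" for u v
      using that ipR[of v u] R by (simp add: q2_def q.q_cnj ip.q_cnj)
  qed (use R in \<open>auto simp: q2_def q.q_add_left ip.q_add_left q.q_scale_left ip.q_scale_left algebra_simps\<close>)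
  have q2q: "Re (shifted t u u) <= Re (q2 u u)" if "u \<in> D" for u
  proof -
    have "0 <= Re (shifted t (R u) (R u))" using that R by (intro q.q_nonneg) auto
    then show ?thesis using that R by (simp add: q2_def)
  qed
  interpret q2: semi_inner_product sc D q2
    using q2q q.q_nonneg order_trans by unfold_locales blast
  have NR: "q.N (R u) <= q.N u / c0" if u: "u \<in> D" for u
  proof -
    have "(q.N (R u))\<^sup>2 = Re (ip u (R u))" using u R by (simp add: q.N_sq)
    also have "\<dots> <= cmod (ip u (R u))" by (rule complex_Re_le_cmod)
    also have "\<dots> <= (ip.N u / sqrt c0) * q.N (R u)" using u R by (intro ip_bound) auto
    also have "\<dots> <= ((q.N u / sqrt c0) / sqrt c0) * q.N (R u)"
      using Nip[OF u] c0 u R by (intro mult_right_mono divide_right_mono) (auto simp: field_simps)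
    also have "(q.N u / sqrt c0) / sqrt c0 = q.N u / c0" using c0 by simp
    finally have le: "q.N (R u) * q.N (R u) <= (q.N u / c0) * q.N (R u)" by (simp only: power2_eq_square)
    show ?thesis
    proof (cases "q.N (R u) = 0")
      case True then show ?thesis using u c0 by simp
    next
      case False
      have "R u \<in> D" using R(1) DH[OF u] by blast
      then have "q.N (R u) > 0" using q.N_nonneg[of "R u"] False by linarith
      then show ?thesis using le by (simp only: mult_le_cancel_right_pos)
    qed
  qed
  have q2N: "q2.N u <= sqrt (1 + s\<^sup>2 / c0\<^sup>2) * q.N u" if u: "u \<in> D" for u
  proof -
    have "Re (q2 u u) = (q.N u)\<^sup>2 + s\<^sup>2 * (q.N (R u))\<^sup>2"
      using u R by (simp add: q2_def q.N_sq)
    also have "\<dots> <= (q.N u)\<^sup>2 + s\<^sup>2 * (q.N u / c0)\<^sup>2"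
      using NR[OF u] u R by (intro add_left_mono mult_left_mono power_mono) auto
    also have "\<dots> = (1 + s\<^sup>2 / c0\<^sup>2) * (q.N u)\<^sup>2" by (simp add: power_divide algebra_simps)
    finally have "q2.N u <= sqrt ((1 + s\<^sup>2 / c0\<^sup>2) * (q.N u)\<^sup>2)" unfolding q2.N_def by (rule real_sqrt_le_mono)
    then show ?thesis using u by (simp add: real_sqrt_mult)
  qed
  have Nq2: "q.N u <= q2.N u" if "u \<in> D" for u using q2q[OF that] by (simp add: q.N_def q2.N_def)
  have "q2.complete_form"
    unfolding q2.complete_form_def
  proof (intro allI impI)
    fix w :: "nat => 'v" assume *: "\<forall>k. w k \<in> D" "\<forall>e>0. \<exists>K. \<forall>j\<ge>K. \<forall>k\<ge>K. q2.N (w j - w k) < e"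
    then have w: "\<And>k. w k \<in> D" by auto
    have "\<forall>e>0. \<exists>K. \<forall>j\<ge>K. \<forall>k\<ge>K. q.N (w j - w k) < e"
      using * Nq2[of "w j - w k" for j k] by (meson a.V_closed(3) le_less_trans)
    then obtain x where x: "x \<in> D" "(%k. q.N (w k - x)) \<longlonglongrightarrow> 0"
      using qcomplete w unfolding q.complete_form_def by blast
    have "(%k. q2.N (w k - x)) \<longlonglongrightarrow> 0"
    proof (rule tendsto_0_le[OF x(2), of _ "sqrt (1 + s\<^sup>2 / c0\<^sup>2)"])
      show "\<forall>\<^sub>F k in sequentially. norm (q2.N (w k - x)) <= norm (q.N (w k - x)) * sqrt (1 + s\<^sup>2 / c0\<^sup>2)"
        using q2N[of "w k - x" for k] w x(1) by (intro always_eventually) (auto simp: mult.commute)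
    qed
    then show "\<exists>x\<in>D. (%k. q2.N (w k - x)) \<longlonglongrightarrow> 0" using x by blast
  qed
  then have "\<exists>u\<in>D. \<forall>v\<in>D. q2 u v = ip f v"
  proof (rule q2.Riesz[where C = "ip.N f / sqrt c0"])
    fix v assume v: "v \<in> D"
    have "(ip.N f / sqrt c0) * q.N v <= (ip.N f / sqrt c0) * q2.N v"
      using Nq2[OF v] f c0 by (intro mult_left_mono) auto
    then show "cmod (ip f v) <= (ip.N f / sqrt c0) * q2.N v" using ip_bound[OF f v] by linarith
  qed (use f in \<open>auto simp: ip.q_add_right ip.q_scale_right\<close>)
  then obtain w where w: "w \<in> D" "\<And>v. v \<in> D ==> q2 w v = ip f v" by blast
  let ?u = "w + (\<i> * of_real s) \<star> R w"
  have "a ?u v - Complex t s * ip ?u v = ip f v" if v: "v \<in> D" for v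
  proof -
    have "a ?u v - Complex t s * ip ?u v = shifted t ?u v - \<i> * of_real s * ip ?u v"
      by (simp add: shifted_def Complex_eq algebra_simps)
    also have "\<dots> = shifted t w v + \<i> * of_real s * ip w v - \<i> * of_real s * (ip w v + \<i> * of_real s * ip (R w) v)"
      using w v R by (simp add: q.q_add_left q.q_scale_left ip.q_add_left ip.q_scale_left)
    also have "\<dots> = shifted t w v + of_real (s\<^sup>2) * ip (R w) v"
      by (simp add: algebra_simps power2_eq_square)
    also have "\<dots> = ip f v" using w(2)[OF v] ipR[OF w(1) v] by (simp add: q2_def)
    finally show ?thesis .
  qed
  moreover have "?u \<in> D" using w R by auto
  ultimately show ?thesis by blast
qed

end

context closed_form begin

text \<open>
  After penalizing all eigenvectors below some \<open>c\<close> between \<open>Re z\<close> and \<open>b\<close>, the form is coercive at \<open>z\<close>;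
  the penalty is then undone, eigenvector by eigenvector, since \<open>z\<close> is not among the eigenvalues.
\<close>

lemma resolvent_below:
  assumes z: "Re z < b" and no_ev: "\<And>u. eigenvector z u ==> ip u u = 0"
  shows "\<forall>f\<in>H. \<exists>u\<in>D. \<forall>v\<in>D. a u v - z * ip u v = ip f v"
    and "\<exists>C. \<forall>u\<in>D. \<forall>h\<in>H. (\<forall>v\<in>D. a u v - z * ip u v = ip h v) \<longrightarrow> ip.N u <= C * ip.N h"
proof -
  define c where "c = (Re z + b) / 2"
  have c: "Re z < c" "c < b" using z by (auto simp: c_def)
  obtain n e m where max: "maximal_below c {..<n::nat} e m" using maximal_below_exists[OF c(2)] by blast
  let ?I = "{..<n}"
  have es: "eigensystem ?I e m" using max by (simp add: maximal_below_def)
  note eD = eigensystemD[OF es]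
  define K where "K = (\<Sum>i\<in>?I. \<bar>c - m i\<bar>)"
  have K: "K \<ge> 0" "\<And>i. i \<in> ?I ==> c <= m i + K"
  proof -
    show "K \<ge> 0" by (simp add: K_def sum_nonneg)
    fix i assume "i \<in> ?I"
    then have "\<bar>c - m i\<bar> <= K" unfolding K_def by (intro member_le_sum) auto
    then show "c <= m i + K" by linarith
  qed
  have low: "c * Re (ip u u) <= Re (penalized K ?I e u u)" if "u \<in> D" for u
    using penalized_lower_bound[OF max _ K that] c by simp
  interpret E: closed_form sc H ip D "penalized K ?I e" b by (rule closed_form_penalized[OF es K(1)])
  have ne: "of_real (m i) - z \<noteq> 0" if i: "i \<in> ?I" for i
  proof
    assume "of_real (m i) - z = 0"
    then have "eigenvector z (e i)" using es i by (auto simp: eigensystem_def)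
    then have "ip (e i) (e i) = 0" by (rule no_ev)
    then show False using eD(4)[OF i i] by simp
  qed
  show "\<forall>f\<in>H. \<exists>u\<in>D. \<forall>v\<in>D. a u v - z * ip u v = ip f v"
  proof
    fix f assume f: "f \<in> H"
    have "\<exists>u\<in>D. \<forall>v\<in>D. penalized K ?I e u v - Complex (Re z) (Im z) * ip u v = ip f v"
    proof (rule E.coercive_solvable[where ?c0.0 = "c - Re z"])
      show "(c - Re z) * Re (ip u u) <= Re (penalized K ?I e u u) - Re z * Re (ip u u)" if "u \<in> D" for u
        using low[OF that] by (simp add: algebra_simps)
    qed (use c f in auto)
    then obtain u where u: "u \<in> D" "\<And>v. v \<in> D ==> penalized K ?I e u v - z * ip u v = ip f v"
      by auto
    define d where "d i = of_real K * ip u (e i) / (of_real (m i) - z)" for i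
    let ?w = "\<Sum>i\<in>?I. d i \<star> e i"
    have wD: "?w \<in> D" using eD(2) by auto
    have "a (u + ?w) v - z * ip (u + ?w) v = ip f v" if v: "v \<in> D" for v
    proof -
      have "a ?w v - z * ip ?w v = (\<Sum>i\<in>?I. d i * (of_real (m i) - z) * ip (e i) v)"
      proof -
        have "a ?w v = (\<Sum>i\<in>?I. d i * (of_real (m i) * ip (e i) v))"
          using eD v by (subst a.q_sum_left) (auto simp: a.q_scale_left intro!: sum.cong)
        moreover have "ip ?w v = (\<Sum>i\<in>?I. d i * ip (e i) v)"
          using eD v by (subst ip.q_sum_left) (auto simp: ip.q_scale_left intro!: sum.cong)
        ultimately show ?thesis by (simp add: sum_distrib_left sum_subtractf[symmetric] algebra_simps)
      qed
      also have "\<dots> = (\<Sum>i\<in>?I. of_real K * (ip u (e i) * ip (e i) v))"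
        using ne by (intro sum.cong) (auto simp: d_def)
      also have "\<dots> = penalized K ?I e u v - a u v" by (simp add: penalized_def sum_distrib_left)
      finally have "a ?w v - z * ip ?w v = penalized K ?I e u v - a u v" .
      then show ?thesis using u(2)[OF v] u(1) v wD by (simp add: a.q_add_left ip.q_add_left algebra_simps)
    qed
    then show "\<exists>u\<in>D. \<forall>v\<in>D. a u v - z * ip u v = ip f v" using u(1) wD by blast
  qed
  define P where "P = (\<Sum>i\<in>?I. 1 / (cmod (of_real (m i) - z))\<^sup>2)"
  have P0: "P \<ge> 0" by (simp add: P_def sum_nonneg)
  define C where "C = 1 / (c - Re z) + sqrt (K * P / (c - Re z))"
  have "ip.N u <= (1 / (c - Re z) + sqrt (K * P / (c - Re z))) * ip.N h"
    if u: "u \<in> D" and h: "h \<in> H" and eq: "\<And>v. v \<in> D ==> a u v - z * ip u v = ip h v" for u h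
  proof -
    define x where "x = ip.N u"
    define y where "y = ip.N h"
    define g where "g = c - Re z"
    have g: "g > 0" using c by (simp add: g_def)
    have x0: "x \<ge> 0" "y \<ge> 0" using u h by (auto simp: x_def y_def)
    have coef: "(cmod (ip u (e i)))\<^sup>2 <= y\<^sup>2 * (1 / (cmod (of_real (m i) - z))\<^sup>2)" if i: "i \<in> ?I" for i
    proof -
      have "(of_real (m i) - z) * ip u (e i) = ip h (e i)"
        using eq[OF eD(2)[OF i]] eD(5)[OF i u] by (simp add: algebra_simps)
      then have "(cmod (of_real (m i) - z))\<^sup>2 * (cmod (ip u (e i)))\<^sup>2 = (cmod (ip h (e i)))\<^sup>2"
        by (metis norm_mult power_mult_distrib)
      also have "\<dots> <= y\<^sup>2"
        using ip.Cauchy_Schwarz_sq[of h "e i"] eD(2,4) i h by (simp add: y_def ip.N_sq)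
      finally show ?thesis using ne[OF i] by (simp add: field_simps)
    qed
    have "(\<Sum>i\<in>?I. (cmod (ip u (e i)))\<^sup>2) <= (\<Sum>i\<in>?I. y\<^sup>2 * (1 / (cmod (of_real (m i) - z))\<^sup>2))"
      by (intro sum_mono coef)
    also have "\<dots> = y\<^sup>2 * P" by (simp add: P_def sum_distrib_left)
    finally have "K * (\<Sum>i\<in>?I. (cmod (ip u (e i)))\<^sup>2) <= K * (y\<^sup>2 * P)" using K by (intro mult_left_mono)
    moreover have "Re (a u u) = Re z * Re (ip u u) + Re (ip h u)"
    proof -
      have "Re (z * ip u u) = Re z * Re (ip u u)"
        using ip.q_self[OF DH[OF u]] by (metis Im_complex_of_real diff_zero mult_zero_right times_complex.sel(1))
      then show ?thesis using eq[OF u] by (metis add.commute diff_eq_eq plus_complex.sel(1))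
    qed
    moreover have "Re (ip h u) <= y * x"
      using ip.Cauchy_Schwarz[OF h DH[OF u]] complex_Re_le_cmod[of "ip h u"] by (simp add: x_def y_def)
    moreover have "Re (ip u u) = x\<^sup>2" using u by (simp add: x_def ip.N_sq)
    ultimately have main: "g * x\<^sup>2 <= y * x + K * (y\<^sup>2 * P)"
      using low[OF u] penalized_self[OF es u, of K] by (simp add: g_def algebra_simps)
    have "x <= y / g + sqrt (K * P / g) * y"
    proof (rule ccontr)
      assume "\<not> x <= y / g + sqrt (K * P / g) * y"
      then have *: "y / g + sqrt (K * P / g) * y < x" by simp
      define r where "r = sqrt (K * P / g) * y"
      have r0: "r \<ge> 0" using K P0 g x0 by (simp add: r_def)
      have xy: "x > y / g" "x > r" "x - y / g > r" using * x0 g r0 by (auto simp: r_def[symmetric] intro: order_le_less_trans[rotated] add_nonneg_pos)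
      have "r * r = K * P / g * y\<^sup>2"
        using K P0 g by (simp add: r_def power2_eq_square real_sqrt_mult_self algebra_simps)
      moreover have "r * r < (x - y / g) * x"
        using xy r0 by (intro mult_strict_mono) auto
      ultimately have "K * P / g * y\<^sup>2 < (x - y / g) * x" by simp
      then have "g * (K * P / g * y\<^sup>2) < g * ((x - y / g) * x)" using g by (rule mult_strict_left_mono)
      then have "K * (y\<^sup>2 * P) < g * x\<^sup>2 - y * x" using g by (simp add: algebra_simps power2_eq_square)
      then show False using main by simp
    qed
    then show ?thesis by (simp add: x_def y_def g_def algebra_simps)
  qed
  then show "\<exists>C. \<forall>u\<in>D. \<forall>h\<in>H. (\<forall>v\<in>D. a u v - z * ip u v = ip h v) \<longrightarrow> ip.N u <= C * ip.N h"
    by blast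
qed

text \<open>
  If a maximal system of eigenvectors below \<open>l\<close> had fewer than \<open>card I\<close> members, some nonzero trial
  vector would be orthogonal to it. By \<open>penalized_lower_bound\<close> that vector would minimize the
  Rayleigh quotient on the orthogonal complement and hence be an eigenvector for \<open>l\<close>.
\<close>

lemma min_max_strict:
  assumes l: "l < b" and I: "finite I" "\<And>i. i \<in> I ==> u i \<in> D"
    and trial: "\<And>k x. x = (\<Sum>i\<in>I. k i \<star> u i) ==> \<exists>i\<in>I. k i \<noteq> 0 ==>
       Re (ip x x) > 0 \<and> Re (a x x) <= l * Re (ip x x) \<and> \<not> eigenvector (of_real l) x"
  obtains n e m where "eigensystem {..<n::nat} e m" "\<And>i. i < n ==> m i < l" "card I <= n"
proof -
  obtain n e m where max: "maximal_below l {..<n::nat} e m" using maximal_below_exists[OF l] by blast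
  let ?I = "{..<n}"
  have es: "eigensystem ?I e m" using max by (simp add: maximal_below_def)
  note eD = eigensystemD[OF es]
  define K where "K = (\<Sum>i\<in>?I. \<bar>l - m i\<bar>)"
  have K: "K \<ge> 0" "\<And>i. i \<in> ?I ==> l <= m i + K"
  proof -
    show "K \<ge> 0" by (simp add: K_def sum_nonneg)
    fix i assume "i \<in> ?I"
    then have "\<bar>l - m i\<bar> <= K" unfolding K_def by (intro member_le_sum) auto
    then show "l <= m i + K" by linarith
  qed
  have low: "l * Re (ip u u) <= Re (penalized K ?I e u u)" if "u \<in> D" for u
    using penalized_lower_bound[OF max _ K that] l by simp
  interpret E: closed_form sc H ip D "penalized K ?I e" b by (rule closed_form_penalized[OF es K(1)])
  have "card I <= n"
  proof (rule ccontr)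
    assume "\<not> card I <= n"
    then obtain k where k: "\<exists>i\<in>I. k i \<noteq> 0" "\<And>j. j < n ==> (\<Sum>i\<in>I. k i * ip (u i) (e j)) = 0"
      using homogeneous_system[OF I(1), of n "%j i. ip (u i) (e j)"] by auto
    define x where "x = (\<Sum>i\<in>I. k i \<star> u i)"
    have x: "x \<in> D" using I(2) by (auto simp: x_def)
    have orth: "ip x (e j) = 0" if "j \<in> ?I" for j
      using k(2)[of j] that I(2) eD(2)[OF that] unfolding x_def
      by (subst ip.q_sum_left) (auto simp: ip.q_scale_left)
    note tr = trial[OF x_def k(1)]
    have pen: "penalized K ?I e x v = a x v" for v using orth by (simp add: penalized_def)
    interpret s: hermitian_form sc D "E.shifted l" by (rule E.hermitian_shifted)
    interpret s: semi_inner_product sc D "E.shifted l"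
      using low by unfold_locales (simp add: E.Re_shifted)
    have "Re (E.shifted l x x) = 0"
      using s.q_nonneg[OF x] tr by (simp add: E.Re_shifted pen)
    then have "E.shifted l x v = 0" if "v \<in> D" for v
      using s.Cauchy_Schwarz_sq[OF x that] by simp
    then have "eigenvector (of_real l) x"
      using x by (simp add: eigenvector_def E.shifted_def pen)
    then show False using tr by blast
  qed
  then show thesis using that[OF es] max by (auto simp: maximal_below_def)
qed

end

section \<open>Square-integrable functions\<close>

definition fscale :: "complex => ('a => complex) => 'a => complex" where
  "fscale c f = (%x. c * f x)"

lemma fscale_apply [simp]: "fscale c f x = c * f x"
  by (simp add: fscale_def)

interpretation fun_space: vector_space fscale
  by unfold_locales (auto simp: fun_eq_iff algebra_simps)

lemma cmod_add_sq_le: "(cmod (x + y))\<^sup>2 <= 2 * (cmod x)\<^sup>2 + 2 * (cmod y)\<^sup>2"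
proof -
  have "(cmod (x + y))\<^sup>2 <= (cmod x + cmod y)\<^sup>2" by (intro power_mono norm_triangle_ineq) auto
  also have "\<dots> <= 2 * (cmod x)\<^sup>2 + 2 * (cmod y)\<^sup>2"
    using sum_squares_ge_zero[of "cmod x - cmod y" 0] by (simp add: power2_eq_square algebra_simps)
  finally show ?thesis .
qed

lemma L2_measurable [measurable_dest]: "f \<in> L2 M ==> f \<in> borel_measurable M"
  by (simp add: L2_def)

lemma L2_integrable: "f \<in> L2 M ==> integrable M (%x. (cmod (f x))\<^sup>2)"
  by (simp add: L2_def)

abbreviation norm_on :: "'a::euclidean_space set => ('a => complex) => real" where
  "norm_on W \<equiv> L2_norm (leb_on W)"

lemma L2_iff_nn: "f \<in> L2 M \<longleftrightarrow> f \<in> borel_measurable M \<and> (\<integral>\<^sup>+x. ennreal ((cmod (f x))\<^sup>2) \<partial>M) < \<infinity>"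
  by (auto simp: L2_def integrable_iff_bounded)

lemma L2_norm_sq: "(L2_norm M f)\<^sup>2 = (\<integral>x. (cmod (f x))\<^sup>2 \<partial>M)"
  by (simp add: L2_norm_def)

lemma L2_norm_nonneg [simp]: "0 <= L2_norm M f"
  by (simp add: L2_norm_def)

lemma nn_integral_L2: "f \<in> L2 M ==> (\<integral>\<^sup>+x. ennreal ((cmod (f x))\<^sup>2) \<partial>M) = ennreal ((L2_norm M f)\<^sup>2)"
  unfolding L2_norm_sq by (intro nn_integral_eq_integral L2_integrable) auto

lemma L2_norm_le_nn:
  assumes "f \<in> borel_measurable M" "(\<integral>\<^sup>+x. ennreal ((cmod (f x))\<^sup>2) \<partial>M) <= ennreal (c\<^sup>2)" "c \<ge> 0"
  shows "f \<in> L2 M" "L2_norm M f <= c"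
proof -
  show f: "f \<in> L2 M" using assms by (auto simp: L2_iff_nn intro: le_less_trans)
  have "(L2_norm M f)\<^sup>2 <= c\<^sup>2" using assms nn_integral_L2[OF f] by simp
  then show "L2_norm M f <= c" using assms(3) by (simp add: power2_le_iff_abs_le)
qed

lemma L2_add: "f \<in> L2 M ==> g \<in> L2 M ==> f + g \<in> L2 M"
proof -
  assume fg: "f \<in> L2 M" "g \<in> L2 M"
  note [measurable] = fg[THEN L2_measurable]
  have "integrable M (%x. (cmod (f x + g x))\<^sup>2)"
  proof (rule Bochner_Integration.integrable_bound)
    show "integrable M (%x. 2 * (cmod (f x))\<^sup>2 + 2 * (cmod (g x))\<^sup>2)"
      by (intro Bochner_Integration.integrable_add integrable_mult_right L2_integrable fg)
  qed (auto simp: cmod_add_sq_le)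
  moreover have "f + g \<in> borel_measurable M" unfolding plus_fun_def by measurable
  ultimately show ?thesis by (simp add: L2_def)
qed

lemma L2_fscale: "f \<in> L2 M ==> fscale c f \<in> L2 M"
proof -
  assume f: "f \<in> L2 M"
  note [measurable] = L2_measurable[OF f]
  have "fscale c f \<in> borel_measurable M" unfolding fscale_def by measurable
  then show ?thesis using L2_integrable[OF f] by (simp add: L2_def norm_mult power_mult_distrib)
qed

lemma L2_zero: "0 \<in> L2 M"
  by (simp add: L2_def zero_fun_def)

lemma subspace_L2: "fun_space.subspace (L2 M)"
  by (auto simp: fun_space.subspace_def L2_add L2_fscale L2_zero)

lemma borel_measurable_cnj [measurable]: "f \<in> borel_measurable M ==> (%x. cnj (f x)) \<in> borel_measurable M"
  by (rule borel_measurable_continuous_on[OF continuous_on_cnj[OF continuous_on_id]])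

lemma integrable_L2_product:
  assumes "f \<in> L2 M" "g \<in> L2 M"
  shows "integrable M (%x. f x * cnj (g x))" "integrable M (%x. f x * g x)"
proof -
  note [measurable] = assms[THEN L2_measurable]
  have b: "cmod x * cmod y <= (cmod x)\<^sup>2 + (cmod y)\<^sup>2" for x y :: complex
  proof -
    have "0 <= (cmod x - cmod y)\<^sup>2" by simp
    moreover have "0 <= cmod x * cmod y" by simp
    ultimately show ?thesis unfolding power2_diff by linarith
  qed
  have i: "integrable M (%x. (cmod (f x))\<^sup>2 + (cmod (g x))\<^sup>2)"
    by (intro Bochner_Integration.integrable_add L2_integrable assms)
  show "integrable M (%x. f x * cnj (g x))" "integrable M (%x. f x * g x)"
    by (rule Bochner_Integration.integrable_bound[OF i]; use b in \<open>auto simp: norm_mult abs_of_nonneg add_nonneg_nonneg\<close>)+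
qed

lemma L2_inner_self: "L2_inner M f f = of_real ((L2_norm M f)\<^sup>2)"
  unfolding L2_inner_def L2_norm_sq complex_norm_square[symmetric] by (rule integral_complex_of_real)

interpretation L2: semi_inner_product fscale "L2 M" "L2_inner M" for M
proof unfold_locales
  show "fun_space.subspace (L2 M)" by (rule subspace_L2)
  fix u v w assume uvw: "u \<in> L2 M" "v \<in> L2 M" "w \<in> L2 M"
  show "L2_inner M (u + v) w = L2_inner M u w + L2_inner M v w"
    using uvw by (simp add: L2_inner_def distrib_right integrable_L2_product)
next
  fix c u w assume "u \<in> L2 M" "w \<in> L2 M"
  then show "L2_inner M (fscale c u) w = c * L2_inner M u w"
    by (simp add: L2_inner_def mult.assoc integrable_L2_product)
next
  fix u v assume "u \<in> L2 M" "v \<in> L2 M"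
  have "cnj (L2_inner M u v) = (\<integral>x. cnj (u x * cnj (v x)) \<partial>M)"
    unfolding L2_inner_def by (rule Bochner_Integration.integral_cnj[symmetric])
  then show "cnj (L2_inner M u v) = L2_inner M v u" by (simp add: L2_inner_def mult.commute)
next
  show "0 <= Re (L2_inner M u u)" for u :: "'a => complex" by (simp add: L2_inner_self)
qed

lemma L2_N [simp]: "L2.N M f = L2_norm M f"
  by (simp add: L2.N_def L2_inner_self)

lemma L2_norm_zero_iff: "f \<in> L2 M ==> L2_norm M f = 0 \<longleftrightarrow> (AE x in M. f x = 0)"
  unfolding L2_norm_def using L2_integrable[of f M]
  by (simp add: integral_nonneg_eq_0_iff_AE)

lemma L2_norm_cong_AE: "f \<in> borel_measurable M ==> g \<in> borel_measurable M ==> AE x in M. f x = g x ==> L2_norm M f = L2_norm M g"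
  unfolding L2_norm_def by (intro arg_cong[where f = sqrt] integral_cong_AE) auto

lemma L2_inner_cong_AE:
  assumes "AE x in M. f x = f' x" "AE x in M. g x = g' x"
    and [measurable]: "f \<in> borel_measurable M" "f' \<in> borel_measurable M" "g \<in> borel_measurable M" "g' \<in> borel_measurable M"
  shows "L2_inner M f g = L2_inner M f' g'"
  unfolding L2_inner_def using assms(1,2) by (intro integral_cong_AE) (auto elim: eventually_elim2)

theorem L2_complete:
  assumes f: "\<And>k::nat. f k \<in> L2 M"
    and cauchy: "\<And>e. e > 0 ==> \<exists>N. \<forall>j\<ge>N. \<forall>k\<ge>N. L2_norm M (f j - f k) < e"
  shows "\<exists>g\<in>L2 M. (%k. L2_norm M (f k - g)) \<longlonglongrightarrow> 0"
proof -
  have "\<forall>n. \<exists>N. \<forall>j\<ge>N. \<forall>k\<ge>N. L2_norm M (f j - f k) < (1/4)^n" using cauchy by simp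
  then obtain N where N: "\<And>n j k. j \<ge> N n ==> k \<ge> N n ==> L2_norm M (f j - f k) < (1/4)^n" by metis
  define r where "r n = n + (\<Sum>i\<le>n. N i)" for n
  have rN: "N n <= r n" for n
    unfolding r_def using member_le_sum[of n "{..n}" N] by (simp add: trans_le_add2)
  have rSuc: "r n <= r (Suc n)" for n by (simp add: r_def)
  have rn: "n <= r n" for n by (simp add: r_def)
  note [measurable] = f[THEN L2_measurable]
  define d where "d n = f (r (Suc n)) - f (r n)" for n
  have d: "d n \<in> L2 M" for n unfolding d_def using f by (intro L2.V_closed)
  note [measurable] = d[THEN L2_measurable]
  have dn: "L2_norm M (d n) <= (1/4)^n" for n
    using N[of n "r (Suc n)" "r n"] rN[of n] rSuc[of n] unfolding d_def by simp
  have "(\<integral>\<^sup>+x. (\<Sum>n. ennreal (4^n * (cmod (d n x))\<^sup>2)) \<partial>M) = (\<Sum>n. \<integral>\<^sup>+x. ennreal (4^n * (cmod (d n x))\<^sup>2) \<partial>M)"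
    by (intro nn_integral_suminf) measurable
  also have "\<dots> <= (\<Sum>n. ennreal ((1/4)^n))"
  proof (intro suminf_le summableI)
    fix n
    have "(\<integral>\<^sup>+x. ennreal (4^n * (cmod (d n x))\<^sup>2) \<partial>M) = ennreal (4^n) * ennreal ((L2_norm M (d n))\<^sup>2)"
      by (simp add: ennreal_mult nn_integral_cmult nn_integral_L2[OF d, symmetric])
    also have "\<dots> = ennreal (4^n * (L2_norm M (d n))\<^sup>2)" by (simp add: ennreal_mult)
    also have "4^n * (L2_norm M (d n))\<^sup>2 <= 4^n * ((1/4)^n)\<^sup>2"
      using dn by (intro mult_left_mono power_mono) auto
    also have "4^n * ((1/4)^n)\<^sup>2 = (1/4::real)^n" by (simp add: power2_eq_square power_divide)
    finally show "(\<integral>\<^sup>+x. ennreal (4^n * (cmod (d n x))\<^sup>2) \<partial>M) <= ennreal ((1/4)^n)"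
      by (simp add: ennreal_leI)
  qed
  also have "\<dots> = ennreal (\<Sum>n. (1/4)^n)" by (intro suminf_ennreal2 summable_geometric) auto
  finally have "(\<integral>\<^sup>+x. (\<Sum>n. ennreal (4^n * (cmod (d n x))\<^sup>2)) \<partial>M) \<noteq> \<infinity>"
    by (auto simp: top_unique)
  then have "AE x in M. (\<Sum>n. ennreal (4^n * (cmod (d n x))\<^sup>2)) \<noteq> \<infinity>"
    by (intro nn_integral_noteq_infinite) auto
  then have conv: "AE x in M. convergent (%n. f (r n) x)"
  proof eventually_elim
    case (elim x)
    define S where "S = enn2real (\<Sum>n. ennreal (4^n * (cmod (d n x))\<^sup>2))"
    have S: "(\<Sum>n. ennreal (4^n * (cmod (d n x))\<^sup>2)) = ennreal S" "S \<ge> 0"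
      using elim by (auto simp: S_def less_top)
    have "norm (d n x) <= sqrt S * (1/2)^n" for n
    proof -
      have "ennreal (4^n * (cmod (d n x))\<^sup>2) <= (\<Sum>n. ennreal (4^n * (cmod (d n x))\<^sup>2))"
        using sum_le_suminf[OF summableI, of "{n}" "%n. ennreal (4^n * (cmod (d n x))\<^sup>2)"]
        by (simp only: finite.intros sum.insert sum.empty simp_thms empty_iff add_0_right zero_le)
      then have "4^n * (cmod (d n x))\<^sup>2 <= S" using S by simp
      moreover have "(2^n * cmod (d n x))\<^sup>2 = 4^n * (cmod (d n x))\<^sup>2"
      proof -
        have "((2::real)^n)\<^sup>2 = (2\<^sup>2)^n" by (simp only: power_mult[symmetric] mult.commute)
        then show ?thesis by (simp only: power_mult_distrib) simp
      qed
      ultimately have "(2^n * cmod (d n x))\<^sup>2 <= S" by simp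
      then have "2^n * cmod (d n x) <= sqrt S" by (rule real_le_rsqrt)
      then show ?thesis by (simp add: field_simps power_divide)
    qed
    moreover have "summable (%n. sqrt S * (1/2)^n)" by (intro summable_mult summable_geometric) simp
    ultimately have "summable (%n. d n x)"
      by (rule summable_comparison_test'[where N = 0, rotated])
    then have "convergent (%n. \<Sum>i<n. d i x)" by (simp add: summable_iff_convergent)
    moreover have "(\<Sum>i<n. d i x) = f (r n) x - f (r 0) x" for n
      unfolding d_def by (simp add: sum_lessThan_telescope[of "%n. f (r n) x"])
    ultimately have "convergent (%n. f (r n) x - f (r 0) x)" by simp
    then show ?case by (simp add: convergent_diff_const_right_iff)
  qed
  define g where "g x = lim (%n. f (r n) x)" for x
  have g[measurable]: "g \<in> borel_measurable M" unfolding g_def by measurable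
  have lim: "AE x in M. (%n. f (r n) x) \<longlonglongrightarrow> g x"
    using conv by eventually_elim (auto simp: g_def convergent_LIMSEQ_iff)
  have close: "(\<integral>\<^sup>+x. ennreal ((cmod ((f j - g) x))\<^sup>2) \<partial>M) <= ennreal (e\<^sup>2)"
    if e: "e > 0" and J: "\<And>k. k \<ge> J ==> L2_norm M (f j - f k) < e" for e j J
  proof -
    have "(\<integral>\<^sup>+x. ennreal ((cmod ((f j - g) x))\<^sup>2) \<partial>M) = (\<integral>\<^sup>+x. liminf (%n. ennreal ((cmod (f j x - f (r n) x))\<^sup>2)) \<partial>M)"
    proof (rule nn_integral_cong_AE)
      show "AE x in M. ennreal ((cmod ((f j - g) x))\<^sup>2) = liminf (%n. ennreal ((cmod (f j x - f (r n) x))\<^sup>2))"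
        using lim
      proof eventually_elim
        case (elim x)
        have "(%n. ennreal ((cmod (f j x - f (r n) x))\<^sup>2)) \<longlonglongrightarrow> ennreal ((cmod (f j x - g x))\<^sup>2)"
          by (intro tendsto_intros tendsto_ennrealI elim)
        from lim_imp_Liminf[OF sequentially_bot this] show ?case by simp
      qed
    qed
    also have "\<dots> <= liminf (%n. \<integral>\<^sup>+x. ennreal ((cmod (f j x - f (r n) x))\<^sup>2) \<partial>M)"
      by (intro nn_integral_liminf) measurable
    also have "\<dots> <= ennreal (e\<^sup>2)"
    proof -
      have "(\<integral>\<^sup>+x. ennreal ((cmod (f j x - f (r n) x))\<^sup>2) \<partial>M) <= ennreal (e\<^sup>2)" if "n \<ge> J" for n
      proof -
        have "r n \<ge> J" using rn[of n] that by simp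
        then have "(L2_norm M (f j - f (r n)))\<^sup>2 <= e\<^sup>2" using J[of "r n"] by (intro power_mono) auto
        moreover have "f j - f (r n) \<in> L2 M" using f by (intro L2.V_closed)
        ultimately show ?thesis using nn_integral_L2[of "f j - f (r n)" M] by (simp add: ennreal_leI)
      qed
      then have "\<forall>\<^sub>F n in sequentially. (\<integral>\<^sup>+x. ennreal ((cmod (f j x - f (r n) x))\<^sup>2) \<partial>M) <= ennreal (e\<^sup>2)"
        by (auto simp: eventually_sequentially)
      then have "liminf (%n. \<integral>\<^sup>+x. ennreal ((cmod (f j x - f (r n) x))\<^sup>2) \<partial>M) <= liminf (%n. ennreal (e\<^sup>2))"
        by (intro Liminf_mono)
      then show ?thesis by (simp add: Liminf_const)
    qed
    finally show ?thesis .
  qed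
  have meas: "f j - g \<in> borel_measurable M" for j unfolding fun_diff_def by measurable
  obtain J where J: "\<And>j k. j \<ge> J ==> k \<ge> J ==> L2_norm M (f j - f k) < 1" using cauchy[of 1] by auto
  have "f J - g \<in> L2 M" by (rule L2_norm_le_nn(1)[OF meas close[of 1 J J]]) (use J in auto)
  then have "f J - (f J - g) \<in> L2 M" by (rule L2.V_closed(3)[OF f])
  moreover have "f J - (f J - g) = g" by (simp add: fun_eq_iff)
  ultimately have gL: "g \<in> L2 M" by (simp only:)
  have "(%k. L2_norm M (f k - g)) \<longlonglongrightarrow> 0"
  proof (rule LIMSEQ_I)
    fix e :: real assume "e > 0"
    then obtain J where J: "\<And>j k. j \<ge> J ==> k \<ge> J ==> L2_norm M (f j - f k) < e / 2" using cauchy[of "e/2"] by auto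
    have "L2_norm M (f j - g) <= e / 2" if "j \<ge> J" for j
      by (rule L2_norm_le_nn(2)[OF meas close[of "e/2" J j]]) (use J[OF that] \<open>e > 0\<close> in auto)
    then show "\<exists>no. \<forall>n\<ge>no. norm (L2_norm M (f n - g) - 0) < e"
      using \<open>e > 0\<close> by (intro exI[of _ J]) force
  qed
  then show ?thesis using gL by blast
qed

section \<open>The spectrum of the associated operator\<close>

lemma SUP_enat_attained:
  assumes "enat n <= (SUP k\<in>X. enat k)" "X \<noteq> {}"
  shows "\<exists>k\<in>X. n <= k"
proof (cases n)
  case 0 then show ?thesis using assms(2) by auto
next
  case (Suc n')
  then have "enat n' < enat n" by simp
  then have "enat n' < (SUP k\<in>X. enat k)" using assms(1) by (rule less_le_trans)
  then show ?thesis using Suc by (auto simp: less_SUP_iff Suc_le_eq)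
qed

lemma AE_zero_L2_inner: "AE x in M. f x = 0 ==> L2_inner M f g = 0"
  unfolding L2_inner_def by (intro integral_eq_zero_AE) (auto elim: eventually_mono)

locale L2_closed_form = closed_form fscale "L2 M" "L2_inner M" D a b
  for M :: "'a measure" and D :: "('a => complex) set" and a :: "('a => complex) => ('a => complex) => complex" and b :: real
begin

abbreviation "A \<equiv> form_operator M D a"

lemma A_iff: "(u, f) \<in> A \<longleftrightarrow> u \<in> D \<and> f \<in> L2 M \<and> (\<forall>v\<in>D. a u v = L2_inner M f v)"
  by (simp add: form_operator_def)

lemma eigenspace_iff: "u \<in> eigenspace A z \<longleftrightarrow> eigenvector z u"
proof -
  have "(%x. z * u x) = fscale z u" by (simp add: fscale_def)
  then show ?thesis
    by (auto simp: eigenspace_def A_iff eigenvector_def L2.q_scale_left L2_fscale)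
qed

lemma op_eigenvalue_iff: "op_eigenvalue M A z \<longleftrightarrow> (\<exists>u. eigenvector z u \<and> L2_inner M u u \<noteq> 0)"
proof -
  have "L2_inner M u u \<noteq> 0 \<longleftrightarrow> \<not> (AE x in M. u x = 0)" if "eigenvector z u" for u
  proof -
    have "u \<in> L2 M" using that by (auto simp: eigenvector_def)
    then show ?thesis by (simp add: L2_inner_self L2_norm_zero_iff)
  qed
  then show ?thesis by (auto simp: op_eigenvalue_def eigenspace_iff)
qed

lemma normalized_eigenvector:
  assumes "op_eigenvalue M A z"
  obtains u where "eigenvector z u" "L2_inner M u u = 1"
proof -
  obtain u where u: "eigenvector z u" "L2_inner M u u \<noteq> 0" using assms by (auto simp: op_eigenvalue_iff)
  then have uL: "u \<in> L2 M" by (auto simp: eigenvector_def)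
  define r where "r = L2_norm M u"
  have r: "r \<noteq> 0" "L2_inner M u u = of_real (r\<^sup>2)" using u(2) by (auto simp: r_def L2_inner_self)
  let ?v = "fscale (of_real (1 / r)) u"
  have "eigenvector z ?v"
    using u(1) uL by (auto simp: eigenvector_def a.q_scale_left L2.q_scale_left)
  moreover have "L2_inner M ?v ?v = 1"
    using uL r by (simp add: L2.q_scale_left L2.q_scale_right L2_fscale power2_eq_square)
  ultimately show thesis by (rule that)
qed

lemma eigenvalue_real: "op_eigenvalue M A z ==> z = of_real (Re z)"
  using eigenvector_real by (auto simp: op_eigenvalue_iff)

lemma resolvent_setI:
  assumes "Re z < b" "\<not> op_eigenvalue M A z"
  shows "z \<in> resolvent_set M A"
proof -
  have no: "L2_inner M u u = 0" if "eigenvector z u" for u using assms(2) that by (auto simp: op_eigenvalue_iff)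
  note R = resolvent_below[OF assms(1) no]
  have "\<exists>u. (u, %x. f x + z * u x) \<in> A" if f: "f \<in> L2 M" for f
  proof -
    obtain u where u: "u \<in> D" "\<And>v. v \<in> D ==> a u v - z * L2_inner M u v = L2_inner M f v"
      using R(1) f by blast
    have eq: "(%x. f x + z * u x) = f + fscale z u" by (simp add: fun_eq_iff)
    have "a u v = L2_inner M (f + fscale z u) v" if "v \<in> D" for v
      using u(2)[OF that] L2.q_add_left[OF f L2_fscale[OF DH[OF u(1)]] DH[OF that], of z]
        L2.q_scale_left[OF DH[OF u(1)] DH[OF that], of z] by (simp add: algebra_simps)
    then have "(u, f + fscale z u) \<in> A"
      unfolding A_iff by (intro conjI ballI u(1) L2_add f L2_fscale DH[OF u(1)])
    then show ?thesis unfolding eq[symmetric] by blast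
  qed
  moreover obtain C where C: "\<And>u h. u \<in> D ==> h \<in> L2 M ==> (\<And>v. v \<in> D ==> a u v - z * L2_inner M u v = L2_inner M h v) ==>
      L2_norm M u <= C * L2_norm M h"
    using R(2) unfolding L2_N by blast
  moreover have "L2_norm M u <= C * L2_norm M (%x. f x - z * u x)" if "(u, f) \<in> A" for u f
  proof -
    have uf: "u \<in> D" "f \<in> L2 M" "\<And>v. v \<in> D ==> a u v = L2_inner M f v" using that by (auto simp: A_iff)
    have eq: "(%x. f x - z * u x) = f - fscale z u" by (simp add: fun_eq_iff)
    have "f - fscale z u \<in> L2 M" by (rule L2.V_closed(3)[OF uf(2) L2_fscale[OF DH[OF uf(1)]]])
    moreover have "a u v - z * L2_inner M u v = L2_inner M (f - fscale z u) v" if "v \<in> D" for v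
      using uf DH[OF uf(1)] DH[OF that] that by (simp add: L2.q_diff_left L2.q_scale_left L2_fscale)
    ultimately show ?thesis unfolding eq using uf(1) by (intro C)
  qed
  ultimately show ?thesis unfolding resolvent_set_def by blast
qed

lemma spectrum_below: "z \<in> op_spectrum M A ==> Re z < b ==> op_eigenvalue M A z"
  using resolvent_setI by (auto simp: op_spectrum_def)

lemma finite_eigenvalues:
  assumes "c < b"
  shows "finite {m::real. op_eigenvalue M A (of_real m) \<and> m <= c}" (is "finite ?X")
proof (rule ccontr)
  assume inf: "infinite ?X"
  obtain p where p: "\<And>(I::nat set) e m. eigensystem I e m ==> (\<And>i. i \<in> I ==> m i <= c) ==> card I <= p"
    using eigensystem_bounded[OF assms] by blast
  obtain m :: "nat => real" where m: "inj m" "range m \<subseteq> ?X" using infinite_countable_subset[OF inf] by blast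
  have "\<forall>i. \<exists>u. eigenvector (of_real (m i)) u \<and> L2_inner M u u = 1"
    using m(2) normalized_eigenvector by (metis (mono_tags, lifting) mem_Collect_eq range_subsetD)
  then obtain e where e: "\<And>i. eigenvector (of_real (m i)) (e i)" "\<And>i. L2_inner M (e i) (e i) = 1" by metis
  have "eigensystem {..<Suc p} e m"
    unfolding eigensystem_def
  proof (intro conjI ballI)
    fix i j assume "i \<in> {..<Suc p}" "j \<in> {..<Suc p}"
    show "L2_inner M (e i) (e j) = (if i = j then 1 else 0)"
      using eigenvectors_orthogonal[OF e(1) e(1), of i j] m(1) e(2) by (auto simp: inj_def)
  qed (use e in auto)
  then have "card {..<Suc p} <= p" using m(2) by (intro p) auto
  then show False by simp
qed

lemma finite_multiplicity:
  assumes "m < b"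
  shows "op_multiplicity M A (of_real m) < \<infinity>"
proof -
  obtain p :: nat where p: "\<And>(I::nat set) u. finite I ==> (\<And>i. i \<in> I ==> u i \<in> D) ==>
     (\<And>k x. x = (\<Sum>i\<in>I. fscale (k i) (u i)) ==> \<exists>i\<in>I. k i \<noteq> 0 ==> Re (L2_inner M x x) > 0 \<and> Re (a x x) <= m * Re (L2_inner M x x))
     ==> card I <= p"
    using dimension_bound[OF assms, where 'i = nat] by blast
  have "k <= p" if u: "\<forall>i<k. u i \<in> eigenspace A (of_real m)" "AE_independent M k u" for k u
  proof -
    have ev: "eigenvector (of_real m) (u i)" if "i \<in> {..<k}" for i using u(1) that by (simp add: eigenspace_iff)
    have "card {..<k} <= p"
    proof (rule p)
      show "u i \<in> D" if "i \<in> {..<k}" for i using ev[OF that] by (simp add: eigenvector_def)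
      fix c x assume x: "x = (\<Sum>i<k. fscale (c i) (u i))" and c: "\<exists>i\<in>{..<k}. c i \<noteq> 0"
      have xe: "eigenvector (of_real m) x" unfolding x by (rule eigenvector_combination[OF ev])
      then have xD: "x \<in> D" by (simp add: eigenvector_def)
      have xs: "x t = (\<Sum>i<k. c i * u i t)" for t
        unfolding x by (induction k) (simp_all add: zero_fun_def)
      have "\<not> (AE t in M. x t = 0)"
        using u(2) c unfolding AE_independent_def xs by auto
      then have "L2_norm M x \<noteq> 0" using L2_norm_zero_iff[OF DH[OF xD]] by simp
      then show "0 < Re (L2_inner M x x) \<and> Re (a x x) <= m * Re (L2_inner M x x)"
        using xe xD by (simp add: L2_inner_self eigenvector_def)
    qed simp
    then show ?thesis by simp
  qed
  then have "op_multiplicity M A (of_real m) <= enat p"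
    unfolding op_multiplicity_def by (intro SUP_least) auto
  also have "enat p < \<infinity>" by simp
  finally show ?thesis .
qed

text \<open>
  Below \<open>b\<close> the spectrum consists of eigenvalues, of which only finitely many lie below any \<open>c < b\<close>;
  so they are isolated, and their multiplicities are finite by \<open>dimension_bound\<close>.
\<close>

lemma inf_essential_spectrum_ge: "ereal b <= inf_essential_spectrum M A"
  unfolding inf_essential_spectrum_def
proof (rule INF_greatest)
  fix z assume z: "z \<in> essential_spectrum M A"
  show "ereal b <= ereal (Re z)"
  proof (rule ccontr)
    assume "\<not> ereal b <= ereal (Re z)"
    then have less: "Re z < b" by simp
    have spec: "z \<in> op_spectrum M A" using z by (simp add: essential_spectrum_def)
    have ev: "op_eigenvalue M A z" using spectrum_below[OF spec less] .
    have "op_multiplicity M A z < \<infinity>"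
      using finite_multiplicity[OF less] eigenvalue_real[OF ev] by simp
    moreover have "\<not> z islimpt op_spectrum M A"
    proof -
      define r where "r = (b - Re z) / 2"
      have r: "r > 0" using less by (simp add: r_def)
      define c where "c = (b + Re z) / 2"
      have "op_spectrum M A \<inter> ball z r \<subseteq> of_real ` {m::real. op_eigenvalue M A (of_real m) \<and> m <= c}"
      proof
        fix y assume y: "y \<in> op_spectrum M A \<inter> ball z r"
        have "\<bar>Re y - Re z\<bar> < r"
          using y abs_Re_le_cmod[of "y - z"] by (auto simp: dist_norm norm_minus_commute)
        then have "Re y <= c" "Re y < b" using less by (auto simp: r_def c_def field_simps abs_if split: if_splits)
        moreover have "op_eigenvalue M A y" using spectrum_below y calculation(2) by blast
        ultimately show "y \<in> of_real ` {m::real. op_eigenvalue M A (of_real m) \<and> m <= c}"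
          using eigenvalue_real[of y] by (intro image_eqI[of _ _ "Re y"]) auto
      qed
      moreover have "finite {m::real. op_eigenvalue M A (of_real m) \<and> m <= c}"
        using less by (intro finite_eigenvalues) (simp add: c_def)
      ultimately have "finite (op_spectrum M A \<inter> ball z r)" using finite_subset by blast
      then show ?thesis using r by (auto simp: islimpt_eq_infinite_ball)
    qed
    ultimately have "z \<in> discrete_spectrum M A" using spec ev by (simp add: discrete_spectrum_def)
    then show False using z by (simp add: essential_spectrum_def)
  qed
qed

lemma multiplicity_ge:
  assumes "eigensystem I e m"
  shows "enat (card {i\<in>I. m i = x}) <= op_multiplicity M A (of_real x)"
proof -
  note eD = eigensystemD[OF assms]
  let ?J = "{i\<in>I. m i = x}"
  have "finite ?J" using eD(1) by simp
  then obtain h where h: "bij_betw h {..<card ?J} ?J" using bij_betw_from_nat_into_finite by blast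
  have hI: "h i \<in> I" "m (h i) = x" if "i < card ?J" for i using h that by (auto simp: bij_betw_def)
  have "AE_independent M (card ?J) (%i. e (h i))"
    unfolding AE_independent_def
  proof (intro allI impI)
    fix c j assume z: "AE x in M. (\<Sum>i<card ?J. c i * e (h i) x) = 0" and j: "j < card ?J"
    let ?s = "\<Sum>i<card ?J. fscale (c i) (e (h i))"
    have xs: "(\<Sum>i<k. fscale (c i) (e (h i))) t = (\<Sum>i<k. c i * e (h i) t)" for t k
      by (induction k) (simp_all add: zero_fun_def)
    have "0 = L2_inner M ?s (e (h j))"
      using AE_zero_L2_inner[of ?s M "e (h j)"] z by (simp add: xs)
    also have "\<dots> = (\<Sum>i<card ?J. c i * L2_inner M (e (h i)) (e (h j)))"
      using eD(2) hI j by (subst L2.q_sum_left) (auto simp: L2.q_scale_left intro!: sum.cong L2_fscale)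
    also have "\<dots> = (\<Sum>i<card ?J. if i = j then c i else 0)"
      using h j hI eD(4) by (intro sum.cong) (auto simp: bij_betw_def inj_on_def)
    also have "\<dots> = c j" using j by simp
    finally show "c j = 0" by simp
  qed
  moreover have "\<forall>i<card ?J. e (h i) \<in> eigenspace A (of_real x)"
  proof (intro allI impI)
    fix i assume i: "i < card ?J"
    have "eigenvector (of_real (m (h i))) (e (h i))"
      using assms hI(1)[OF i] unfolding eigensystem_def by blast
    then show "e (h i) \<in> eigenspace A (of_real x)" by (simp add: eigenspace_iff hI(2)[OF i])
  qed
  ultimately have "card ?J \<in> {k. \<exists>u. (\<forall>i<k. u i \<in> eigenspace A (of_real x)) \<and> AE_independent M k u}" by auto
  then show ?thesis unfolding op_multiplicity_def by (intro SUP_upper)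
qed

theorem nth_eigenvalue_below:
  assumes l: "l < b" and n: "n \<ge> 1" and e: "eigensystem {..<N::nat} e m" and m: "\<And>i. i < N ==> m i < l" and N: "n <= N"
  shows "\<exists>l'. nth_eigenvalue M A n l' \<and> l' < l"
proof -
  let ?E = "%x::real. op_eigenvalue M A (of_real x)" and ?\<mu> = "%x::real. op_multiplicity M A (of_real x)"
  have finle: "finite {x. ?E x \<and> x <= y}" if "y < l" for y using finite_eigenvalues that l by simp
  define T where "T = {x. ?E x \<and> x < l}"
  have finT: "finite T" unfolding T_def by (rule finite_subset[OF _ finite_eigenvalues[OF l]]) auto
  note eD = eigensystemD[OF e]
  have mT: "m i \<in> T" if "i < N" for i
    using e m[OF that] that eD(4)[of i i] unfolding T_def op_eigenvalue_iff eigensystem_def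
    by (auto intro!: exI[of _ "e i"])
  have "N = card (\<Union>x\<in>T. {i\<in>{..<N}. m i = x})"
  proof -
    have "(\<Union>x\<in>T. {i\<in>{..<N}. m i = x}) = {..<N}" using mT by auto
    then show ?thesis by simp
  qed
  also have "\<dots> = (\<Sum>x\<in>T. card {i\<in>{..<N}. m i = x})"
    using finT by (intro card_UN_disjoint) auto
  finally have "enat N = (\<Sum>x\<in>T. enat (card {i\<in>{..<N}. m i = x}))" by (simp add: of_nat_eq_enat[symmetric] del: of_nat_sum) (metis of_nat_sum)
  also have "\<dots> <= (\<Sum>x\<in>T. ?\<mu> x)" by (intro sum_mono multiplicity_ge[OF e])
  finally have total: "enat n <= (\<Sum>x\<in>T. ?\<mu> x)" using N by (meson enat_ord_simps(1) order.trans)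
  have Tne: "T \<noteq> {}" using total n by (auto simp: zero_enat_def)
  define G where "G = {x\<in>T. enat n <= (\<Sum>y | ?E y \<and> y <= x. ?\<mu> y)}"
  have "Max T \<in> G"
  proof -
    have "Max T \<in> T" using finT Tne by simp
    moreover have "{y. ?E y \<and> y <= Max T} = T"
    proof (intro equalityI subsetI)
      fix y assume "y \<in> {y. ?E y \<and> y <= Max T}"
      moreover have "Max T < l" using \<open>Max T \<in> T\<close> unfolding T_def by blast
      ultimately show "y \<in> T" unfolding T_def by auto
    next
      fix y assume "y \<in> T"
      then show "y \<in> {y. ?E y \<and> y <= Max T}" using finT unfolding T_def by (auto intro: Max_ge)
    qed
    ultimately show ?thesis using total by (simp add: G_def)
  qed
  moreover have finG: "finite G" using finT by (simp add: G_def)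
  ultimately have minG: "Min G \<in> G" "\<And>x. x \<in> G ==> Min G <= x" by (auto intro: Min_in)
  define l' where "l' = Min G"
  have l': "l' \<in> T" "enat n <= (\<Sum>y | ?E y \<and> y <= l'. ?\<mu> y)" using minG(1) by (auto simp: G_def l'_def)
  then have l'l: "l' < l" "?E l'" by (auto simp: T_def)
  have "(\<Sum>y | ?E y \<and> y < l'. ?\<mu> y) < enat n"
  proof (cases "{y. ?E y \<and> y < l'} = {}")
    case True
    then have "(\<Sum>y | ?E y \<and> y < l'. ?\<mu> y) = 0" by (simp only: sum.empty)
    then show ?thesis using n by (simp add: zero_enat_def)
  next
    case False
    have fin: "finite {y. ?E y \<and> y < l'}" by (rule finite_subset[OF _ finle[OF l'l(1)]]) auto
    define x where "x = Max {y. ?E y \<and> y < l'}"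
    have x: "?E x" "x < l'" using Max_in[OF fin False] by (auto simp: x_def)
    have "{y. ?E y \<and> y < l'} = {y. ?E y \<and> y <= x}"
      using Max_ge[OF fin] x(2) by (auto simp: x_def)
    moreover have "x \<notin> G" using minG(2)[of x] x(2) by (auto simp: l'_def)
    moreover have "x \<in> T" using x l'l by (auto simp: T_def)
    ultimately show ?thesis by (auto simp: G_def not_le)
  qed
  moreover have "ereal l' < inf_essential_spectrum M A"
    using inf_essential_spectrum_ge l'l(1) l by (meson ereal_less_eq(3) le_less_trans less_ereal.simps(1) less_le_trans order.strict_trans)
  ultimately have "nth_eigenvalue M A n l'"
    unfolding nth_eigenvalue_def using l'l(2) l'(2) finle[OF l'l(1)] by simp
  then show ?thesis using l'l(1) by blast
qed

end

section \<open>Smooth functions\<close>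

abbreviation pderiv_dir :: "'a::euclidean_space => ('a => complex) => 'a => complex" where
  "pderiv_dir e f x \<equiv> frechet_derivative f (at x) e"

lemma pderiv_dirI: "(f has_derivative f') (at x) ==> pderiv_dir e f x = f' e"
  using frechet_derivative_at by metis

lemma Ck_SucD: "Ck (Suc k) f ==> Ck k f"
proof (induction k arbitrary: f)
  case 0
  then show ?case
    by (auto simp: continuous_on_eq_continuous_at intro: differentiable_imp_continuous_within)
next
  case (Suc k)
  then show ?case by (simp (no_asm_use)) blast
qed

lemma Ck_Suc_I:
  assumes "\<And>x. (f has_derivative f' x) (at x)" "\<And>e. e \<in> Basis ==> Ck k (%x. f' x e)"
  shows "Ck (Suc k) f"
proof -
  have "frechet_derivative f (at x) = f' x" for x using frechet_derivative_at[OF assms(1)] by simp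
  then show ?thesis using assms by (auto simp: differentiable_def)
qed

lemma Ck_derivative: "Ck (Suc k) f ==> (f has_derivative frechet_derivative f (at x)) (at x)"
  by (simp add: frechet_derivative_works[symmetric])

lemma Ck_const: "Ck k (%x. c)"
proof (induction k arbitrary: c)
  case (Suc k)
  show ?case by (rule Ck_Suc_I[where f' = "%x h. 0"]) (use Suc in auto)
qed auto

lemma Ck_add: "Ck k f ==> Ck k g ==> Ck k (%x. f x + g x)"
proof (induction k arbitrary: f g)
  case 0 then show ?case by (auto intro: continuous_intros)
next
  case (Suc k)
  show ?case
    by (rule Ck_Suc_I, rule has_derivative_add[OF Ck_derivative[OF Suc.prems(1)] Ck_derivative[OF Suc.prems(2)]])
       (use Suc in auto)
qed

lemma Ck_mult: "Ck k f ==> Ck k g ==> Ck k (%x. f x * g x)"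
proof (induction k arbitrary: f g)
  case 0 then show ?case by (auto intro: continuous_intros)
next
  case (Suc k)
  show ?case
  proof (rule Ck_Suc_I, rule has_derivative_mult[OF Ck_derivative[OF Suc.prems(1)] Ck_derivative[OF Suc.prems(2)]])
    fix e :: 'a assume e: "e \<in> Basis"
    show "Ck k (%x. f x * pderiv_dir e g x + pderiv_dir e f x * g x)"
      using Suc.prems e Ck_SucD[OF Suc.prems(1)] Ck_SucD[OF Suc.prems(2)] by (intro Ck_add Suc.IH) auto
  qed
qed

lemma Ck_affine: "Ck k f ==> Ck k (%x. f (a + s *\<^sub>R x))"
proof (induction k arbitrary: f)
  case 0
  then have c: "continuous_on UNIV f" by simp
  have "continuous_on UNIV (%x. f (a + s *\<^sub>R x))"
    by (rule continuous_on_compose2[OF c]) (auto intro!: continuous_intros)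
  then show ?case by simp
next
  case (Suc k)
  have d: "((%x. f (a + s *\<^sub>R x)) has_derivative (%h. frechet_derivative f (at (a + s *\<^sub>R x)) (s *\<^sub>R h))) (at x)" for x
    by (rule has_derivative_compose[OF _ Ck_derivative[OF Suc.prems], where f = "%x. a + s *\<^sub>R x"])
       (auto intro!: derivative_eq_intros)
  have lin: "frechet_derivative f (at y) (s *\<^sub>R h) = of_real s * frechet_derivative f (at y) h" for y h
    using linear_cmul[OF has_derivative_linear[OF Ck_derivative[OF Suc.prems]]] by (simp add: scaleR_conv_of_real)
  show ?case
  proof (rule Ck_Suc_I[OF d])
    fix e :: 'a assume "e \<in> Basis"
    then have "Ck k (%x. (%y. pderiv_dir e f y) (a + s *\<^sub>R x))" using Suc.prems by (intro Suc.IH) auto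
    then show "Ck k (%x. frechet_derivative f (at (a + s *\<^sub>R x)) (s *\<^sub>R e))"
      unfolding lin by (intro Ck_mult Ck_const)
  qed
qed

definition smooth :: "('a::euclidean_space => complex) => bool" where
  "smooth f \<longleftrightarrow> (\<forall>k. Ck k f)"

lemma smoothD:
  assumes "smooth f"
  shows "continuous_on UNIV f" "(f has_derivative frechet_derivative f (at x)) (at x)"
    "e \<in> Basis ==> smooth (pderiv_dir e f)"
  using assms Ck_derivative[of 0 f x] unfolding smooth_def by (metis Ck.simps(1), metis, metis Ck.simps(2))

lemma smooth_continuous: "smooth f ==> continuous_on S f"
  using smoothD(1) continuous_on_subset by blast

lemma smooth_measurable: "smooth f ==> f \<in> borel_measurable borel"
  using smoothD(1) by (rule borel_measurable_continuous_onI)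

lemma smooth_mult: "smooth f ==> smooth g ==> smooth (%x. f x * g x)"
  by (simp add: smooth_def Ck_mult)

lemma smooth_add: "smooth f ==> smooth g ==> smooth (%x. f x + g x)"
  by (simp add: smooth_def Ck_add)

lemma smooth_const: "smooth (%x. c)"
  by (simp add: smooth_def Ck_const)

lemma smooth_affine: "smooth f ==> smooth (%x. f (a + s *\<^sub>R x))"
  by (simp add: smooth_def Ck_affine)

lemma pderiv_dir_mult:
  "smooth f ==> smooth g ==> pderiv_dir e (%x. f x * g x) x = pderiv_dir e f x * g x + f x * pderiv_dir e g x"
  using pderiv_dirI[OF has_derivative_mult[OF smoothD(2)[of f x] smoothD(2)[of g x]], of e] by simp

lemma pderiv_dir_diff:
  "smooth f ==> smooth g ==> pderiv_dir e (%x. f x - g x) x = pderiv_dir e f x - pderiv_dir e g x"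
  using pderiv_dirI[OF has_derivative_diff[OF smoothD(2)[of f x] smoothD(2)[of g x]], of e] by simp

lemma pderiv_dir_affine:
  "smooth f ==> pderiv_dir e (%x. f (a + s *\<^sub>R x)) x = of_real s * pderiv_dir e f (a + s *\<^sub>R x)"
proof -
  assume f: "smooth f"
  have "((%x. f (a + s *\<^sub>R x)) has_derivative (%h. frechet_derivative f (at (a + s *\<^sub>R x)) (s *\<^sub>R h))) (at x)"
    by (rule has_derivative_compose[OF _ smoothD(2)[OF f], where f = "%x. a + s *\<^sub>R x"])
       (auto intro!: derivative_eq_intros)
  from pderiv_dirI[OF this, of e] show ?thesis
    using linear_cmul[OF has_derivative_linear[OF smoothD(2)[OF f]]] by (simp add: scaleR_conv_of_real)
qed

text \<open>
  For \<open>p = 1\<close> this is the standard smooth function that vanishes on the negative half-line. The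
  polynomial factor makes the family closed under differentiation, so that smoothness is an
  induction over the order.
\<close>

definition flat_exp :: "real poly => real => real" where
  "flat_exp p t = (if t > 0 then poly p (1 / t) * exp (- 1 / t) else 0)"

lemma poly_div_exp_tendsto_0: "((%y::real. poly p y / exp y) \<longlongrightarrow> 0) at_top"
proof (induction p)
  case 0 then show ?case by simp
next
  case (pCons c p)
  have "((%y::real. \<Sum>i\<le>degree (pCons c p). coeff (pCons c p) i * (y ^ i / exp y)) \<longlongrightarrow> (\<Sum>i\<le>degree (pCons c p). coeff (pCons c p) i * 0)) at_top"
    by (intro tendsto_intros tendsto_power_div_exp_0)
  then show ?case by (simp add: poly_altdef sum_divide_distrib)
qed

lemma flat_exp_derivative:
  "(flat_exp p has_real_derivative flat_exp ([:0, 0, 1:] * (p - pderiv p)) t) (at t)"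
proof -
  consider "t > 0" | "t < 0" | "t = 0" by linarith
  then show ?thesis
  proof cases
    case 1
    have "((%t. poly p (1 / t) * exp (- 1 / t)) has_real_derivative
        flat_exp ([:0, 0, 1:] * (p - pderiv p)) t) (at t)"
      using 1 by (auto intro!: derivative_eq_intros DERIV_chain2[OF poly_DERIV] simp: flat_exp_def field_simps power2_eq_square)
    then show ?thesis
      by (rule has_field_derivative_transform_within_open[where S = "{0<..}"]) (use 1 in \<open>auto simp: flat_exp_def\<close>)
  next
    case 2
    have "((%t. 0) has_real_derivative flat_exp ([:0, 0, 1:] * (p - pderiv p)) t) (at t)"
      using 2 by (simp add: flat_exp_def)
    then show ?thesis
      by (rule has_field_derivative_transform_within_open[where S = "{..<0}"]) (use 2 in \<open>auto simp: flat_exp_def\<close>)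
  next
    case 3
    have "((%y. flat_exp p y / y) \<longlongrightarrow> 0) (at 0)"
    proof (rule filterlim_split_at_real)
      have "\<forall>\<^sub>F y in at_left 0. flat_exp p y / y = (0::real)"
        by (auto simp: eventually_at_filter flat_exp_def)
      then show "((%y. flat_exp p y / y) \<longlongrightarrow> 0) (at_left 0)" by (rule tendsto_eventually)
      have "((%t. poly ([:0, 1:] * p) (inverse t) / exp (inverse t)) \<longlongrightarrow> 0) (at_right (0::real))"
        by (rule filterlim_compose[OF poly_div_exp_tendsto_0 filterlim_inverse_at_top_right])
      moreover have "\<forall>\<^sub>F y in at_right 0. poly ([:0, 1:] * p) (inverse y) / exp (inverse y) = flat_exp p y / (y::real)"
        by (auto simp: eventually_at_filter flat_exp_def field_simps exp_minus)
      ultimately show "((%y. flat_exp p y / y) \<longlongrightarrow> 0) (at_right 0)" by (rule Lim_transform_eventually)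
    qed
    then show ?thesis using 3 by (simp add: has_field_derivative_iff flat_exp_def)
  qed
qed

lemma Ck_flat_exp: "Ck k (%x. complex_of_real (flat_exp p (c + x \<bullet> d)))"
proof (induction k arbitrary: p)
  case 0
  have "continuous_on UNIV (flat_exp p)"
    by (intro continuous_at_imp_continuous_on ballI DERIV_isCont[OF flat_exp_derivative])
  then have "continuous_on UNIV (%x. flat_exp p (c + x \<bullet> d))"
    by (rule continuous_on_compose2) (auto intro!: continuous_intros)
  then show ?case by (auto intro: continuous_intros)
next
  case (Suc k)
  show ?case
  proof (rule Ck_Suc_I)
    fix x
    have "((%x. flat_exp p (c + x \<bullet> d)) has_derivative (%h. flat_exp ([:0, 0, 1:] * (p - pderiv p)) (c + x \<bullet> d) * (h \<bullet> d))) (at x)"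
    proof -
      have "((%x. c + x \<bullet> d) has_derivative (%h. h \<bullet> d)) (at x)"
        by (auto intro!: derivative_eq_intros)
      from DERIV_compose_FDERIV[OF flat_exp_derivative this, of p] show ?thesis by (simp add: mult.commute)
    qed
    then show "((%x. complex_of_real (flat_exp p (c + x \<bullet> d))) has_derivative
       (%h. complex_of_real (flat_exp ([:0, 0, 1:] * (p - pderiv p)) (c + x \<bullet> d)) * of_real (h \<bullet> d))) (at x)"
      by (auto dest: has_derivative_of_real)
  qed (intro Ck_mult Ck_const Suc)
qed

definition bump :: "'a::euclidean_space => real" where
  "bump x = (\<Prod>i\<in>Basis. flat_exp 1 (1 + x \<bullet> i) * flat_exp 1 (1 + x \<bullet> (- i)))"

lemma smooth_bump: "smooth (%x. complex_of_real (bump x))"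
proof -
  have "smooth (%x. complex_of_real (\<Prod>i\<in>B. flat_exp 1 (1 + x \<bullet> i) * flat_exp 1 (1 + x \<bullet> (- i))))" if "finite B" for B :: "'a set"
    using that
  proof induction
    case empty then show ?case by (simp add: smooth_const)
  next
    case (insert i B)
    have "smooth (%x. complex_of_real (flat_exp 1 (1 + x \<bullet> i)) * complex_of_real (flat_exp 1 (1 + x \<bullet> (- i))) *
       complex_of_real (\<Prod>i\<in>B. flat_exp 1 (1 + x \<bullet> i) * flat_exp 1 (1 + x \<bullet> (- i))))"
      using insert Ck_flat_exp by (intro smooth_mult) (auto simp only: smooth_def)
    then show ?case using insert by simp
  qed
  from this[OF finite_Basis] show ?thesis unfolding bump_def .
qed

lemma bump_nonneg: "0 <= bump x"
  unfolding bump_def by (intro prod_nonneg) (auto simp: flat_exp_def)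

lemma bump_0: "bump 0 > 0"
  unfolding bump_def by (intro prod_pos) (auto simp: flat_exp_def)

lemma bump_support: "norm x > real DIM('a) ==> bump (x::'a::euclidean_space) = 0"
proof (rule ccontr)
  assume n: "norm x > real DIM('a)" and "bump x \<noteq> 0"
  then have "\<bar>x \<bullet> i\<bar> <= 1" if "i \<in> Basis" for i
    using that by (force simp: bump_def flat_exp_def split: if_splits)
  then have "(\<Sum>i\<in>Basis. \<bar>x \<bullet> i\<bar>) <= (\<Sum>i\<in>(Basis::'a set). 1)" by (intro sum_mono)
  then show False using n norm_le_l1[of x] by simp
qed

section \<open>Test functions and convolution\<close>

definition test_fun :: "('a::euclidean_space => complex) => bool" where
  "test_fun \<phi> \<longleftrightarrow> smooth \<phi> \<and> (\<exists>R. \<forall>x. norm x > R \<longrightarrow> \<phi> x = 0)"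

lemma Cc_infty_iff:
  "\<phi> \<in> Cc_infty W \<longleftrightarrow> test_fun \<phi> \<and> closure {x. \<phi> x \<noteq> 0} \<subseteq> W"
proof -
  have "compact (closure {x. \<phi> x \<noteq> 0}) \<longleftrightarrow> (\<exists>R. \<forall>x. norm x > R \<longrightarrow> \<phi> x = 0)"
    unfolding compact_closure bounded_iff using not_le by (auto; blast)
  then show ?thesis by (auto simp: Cc_infty_def test_fun_def smooth_def)
qed

lemma Cc_infty_UNIV: "\<phi> \<in> Cc_infty UNIV \<longleftrightarrow> test_fun \<phi>"
  by (simp add: Cc_infty_iff)

lemma test_fun_smooth: "test_fun \<phi> ==> smooth \<phi>" by (simp add: test_fun_def)

lemma test_fun_support:
  assumes "test_fun \<phi>" obtains R where "R > 0" "\<And>x. norm x > R ==> \<phi> x = 0"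
proof -
  obtain R where "\<And>x. norm x > R ==> \<phi> x = 0" using assms by (auto simp: test_fun_def)
  then show thesis using that[of "\<bar>R\<bar> + 1"] by auto
qed

lemma pderiv_dir_zero_outside:
  assumes "\<And>x. norm x > R ==> \<phi> x = 0" "norm x > R"
  shows "(\<phi> has_derivative (%h. 0)) (at x)" "pderiv_dir e \<phi> x = 0"
proof -
  have "open {x::'a. norm x > R}" by (intro open_Collect_less continuous_intros)
  then show d: "(\<phi> has_derivative (%h. 0)) (at x)"
  proof (rule has_derivative_transform_within_open[OF has_derivative_const])
    show "x \<in> {x. norm x > R}" using assms(2) by simp
    show "0 = \<phi> y" if "y \<in> {x. norm x > R}" for y using assms(1)[of y] that by simp
  qed
  show "pderiv_dir e \<phi> x = 0" using pderiv_dirI[OF d] .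
qed

lemma test_fun_pderiv: "test_fun \<phi> ==> e \<in> Basis ==> test_fun (pderiv_dir e \<phi>)"
  unfolding test_fun_def using pderiv_dir_zero_outside(2) smoothD(3) by metis

lemma test_fun_mult: "test_fun \<phi> ==> smooth \<psi> ==> test_fun (%x. \<phi> x * \<psi> x)"
  unfolding test_fun_def by (metis smooth_mult mult_zero_left)

lemma test_fun_diff: "test_fun \<phi> ==> test_fun \<psi> ==> test_fun (%x. \<phi> x - \<psi> x)"
proof -
  assume a: "test_fun \<phi>" "test_fun \<psi>"
  obtain R S where "\<And>x. norm x > R ==> \<phi> x = 0" "\<And>x. norm x > S ==> \<psi> x = 0" using a unfolding test_fun_def by metis
  then have "\<forall>x. norm x > max R S \<longrightarrow> \<phi> x - \<psi> x = 0" by simp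
  moreover have "smooth (%x. \<phi> x + (-1) * \<psi> x)" using a by (intro smooth_add smooth_mult smooth_const test_fun_smooth)
  ultimately show ?thesis unfolding test_fun_def by (auto intro!: exI[of _ "max R S"])
qed

lemma test_fun_affine: "test_fun \<phi> ==> s \<noteq> 0 ==> test_fun (%x. \<phi> (a + s *\<^sub>R x))"
proof -
  assume a: "test_fun \<phi>" "s \<noteq> 0"
  obtain R where R: "\<And>x. norm x > R ==> \<phi> x = 0" using a(1) unfolding test_fun_def by metis
  have "\<phi> (a + s *\<^sub>R x) = 0" if "norm x > (R + norm a) / \<bar>s\<bar>" for x
  proof (rule R)
    have "R + norm a < norm (s *\<^sub>R x)" using that a(2) by (simp add: field_simps)
    then show "R < norm (a + s *\<^sub>R x)" using norm_diff_ineq[of "s *\<^sub>R x" a] by (simp add: add.commute)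
  qed
  then show ?thesis using a smooth_affine unfolding test_fun_def by blast
qed

lemma test_fun_bounded:
  assumes "test_fun \<phi>" obtains B where "B > 0" "\<And>x. cmod (\<phi> x) <= B"
proof -
  obtain R where R: "R > 0" "\<And>x. norm x > R ==> \<phi> x = 0" using test_fun_support[OF assms] by blast
  have "compact (\<phi> ` cball 0 R)"
    by (intro compact_continuous_image smooth_continuous test_fun_smooth assms compact_cball)
  then obtain B where B: "B > 0" "\<And>y. y \<in> \<phi> ` cball 0 R ==> norm y <= B"
    using compact_imp_bounded bounded_pos by metis
  have "cmod (\<phi> x) <= B" for x using B R(2)[of x] by (cases "norm x <= R") auto
  then show thesis using that B by blast
qed

lemma test_fun_measurable: "test_fun \<phi> ==> \<phi> \<in> borel_measurable borel"
  using smooth_measurable test_fun_smooth by blast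

lemma bounded_support_integrable:
  assumes [measurable]: "\<phi> \<in> borel_measurable borel" and "\<And>x::'a::euclidean_space. cmod (\<phi> x) <= B" "\<And>x. norm x > R ==> \<phi> x = 0"
  shows "integrable lborel \<phi>"
proof (rule Bochner_Integration.integrable_bound)
  have "emeasure lborel (cball (0::'a) R) < \<infinity>" using emeasure_lborel_cbox emeasure_bounded_finite[of "cball (0::'a) R"] by auto
  then show "integrable lborel (%x. indicator (cball (0::'a) R) x *\<^sub>R B)"
    by (intro integrable_indicator integrable_scaleR_left) auto
  have "norm (\<phi> x) <= norm (indicator (cball 0 R) x *\<^sub>R B)" for x
    using assms(2)[of x] assms(3)[of x] by (cases "norm x <= R") (auto simp: indicator_def)
  then show "AE x in lborel. norm (\<phi> x) <= norm (indicator (cball 0 R) x *\<^sub>R B)" by simp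
qed simp

lemma test_fun_integrable: "test_fun \<phi> ==> integrable lborel \<phi>"
  by (metis bounded_support_integrable test_fun_bounded test_fun_measurable test_fun_support)

lemma test_fun_L2: "test_fun \<phi> ==> \<phi> \<in> L2 lborel"
proof -
  assume \<phi>: "test_fun \<phi>"
  note [measurable] = test_fun_measurable[OF \<phi>]
  have "test_fun (%x. \<phi> x * \<phi> x)" using \<phi> by (intro test_fun_mult test_fun_smooth)
  then have "integrable lborel (%x. norm (\<phi> x * \<phi> x))" by (intro integrable_norm test_fun_integrable)
  then show ?thesis by (simp add: L2_def norm_mult power2_eq_square)
qed

definition locally_integrable :: "('a::euclidean_space => complex) => bool" where
  "locally_integrable u \<longleftrightarrow> u \<in> borel_measurable borel \<and> (\<forall>R. integrable lborel (%x. indicator (cball 0 R) x *\<^sub>R u x))"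

lemma indicator_ball_L2: "(%x. indicator (cball (0::'a::euclidean_space) R) x) \<in> L2 lborel"
proof -
  have "emeasure lborel (cball (0::'a) R) < \<infinity>" using emeasure_bounded_finite[of "cball (0::'a) R"] by auto
  then have "integrable lborel (%x. indicator (cball (0::'a) R) x :: real)" by (intro integrable_real_indicator) auto
  moreover have "(cmod (indicator (cball (0::'a) R) x))\<^sup>2 = indicator (cball 0 R) x" for x by (auto simp: indicator_def)
  moreover have "(%x. indicator (cball (0::'a) R) x :: complex) \<in> borel_measurable lborel"
    by (intro borel_measurable_indicator) auto
  ultimately show ?thesis by (simp add: L2_def)
qed

lemma L2_locally_integrable: "u \<in> L2 lborel ==> locally_integrable u"
proof -
  assume u: "u \<in> L2 lborel"
  have "integrable lborel (%x. indicator (cball 0 R) x *\<^sub>R u x)" for R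
    using integrable_L2_product(2)[OF indicator_ball_L2 u, of R]
    by (simp add: scaleR_conv_of_real of_real_indicator)
  then show ?thesis using L2_measurable[OF u] by (simp add: locally_integrable_def)
qed

lemma const_locally_integrable: "locally_integrable (%x. c)"
proof -
  have "emeasure lborel (cball (0::'a::euclidean_space) R) < \<infinity>" for R using emeasure_bounded_finite[of "cball (0::'a) R"] by auto
  then show ?thesis by (auto simp: locally_integrable_def intro!: integrable_scaleR_left integrable_real_indicator)
qed

definition conv :: "('a::euclidean_space => complex) => ('a => complex) => 'a => complex" where
  "conv u \<phi> x = (\<integral>z. u z * \<phi> (x - z) \<partial>lborel)"

lemma conv_integrable:
  assumes u: "locally_integrable u" and [measurable]: "\<phi> \<in> borel_measurable borel"
    and B: "\<And>y. cmod (\<phi> y) <= B" "\<And>y. norm y > R ==> \<phi> y = 0"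
  shows "integrable lborel (%z. u z * \<phi> (x - z))"
proof (rule Bochner_Integration.integrable_bound)
  have [measurable]: "u \<in> borel_measurable borel" using u by (simp add: locally_integrable_def)
  show "integrable lborel (%z. B *\<^sub>R norm (indicator (cball 0 (R + norm x)) z *\<^sub>R u z))"
    using u unfolding locally_integrable_def by (intro integrable_scaleR_right integrable_norm) auto
  have B0: "0 <= B" using order_trans[OF norm_ge_zero B(1)] .
  have "norm (u z * \<phi> (x - z)) <= norm (B *\<^sub>R norm (indicator (cball 0 (R + norm x)) z *\<^sub>R u z))" for z
  proof (cases "norm z <= R + norm x")
    case True
    have "cmod (\<phi> (x - z)) * cmod (u z) <= B * cmod (u z)" by (intro mult_right_mono B) auto
    then show ?thesis using True B0 by (simp add: norm_mult abs_mult mult.commute)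
  next
    case False
    then have "norm (x - z) > R" using norm_triangle_ineq2[of z x] by (simp add: norm_minus_commute)
    then show ?thesis using B(2) by simp
  qed
  then show "AE z in lborel. norm (u z * \<phi> (x - z)) <= norm (B *\<^sub>R norm (indicator (cball 0 (R + norm x)) z *\<^sub>R u z))" by simp
  show "(%z. u z * \<phi> (x - z)) \<in> borel_measurable lborel" by simp
qed

lemma conv_test_integrable:
  assumes "locally_integrable u" "test_fun \<phi>"
  shows "integrable lborel (%z. u z * \<phi> (x - z))"
  by (metis assms conv_integrable test_fun_bounded test_fun_measurable test_fun_support)

lemma derivative_expand:
  assumes "smooth \<phi>"
  shows "frechet_derivative \<phi> (at x) h = (\<Sum>e\<in>Basis. of_real (h \<bullet> e) * pderiv_dir e \<phi> x)"
proof -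
  interpret L: bounded_linear "frechet_derivative \<phi> (at x)" using smoothD(2)[OF assms] by (rule has_derivative_bounded_linear)
  have "frechet_derivative \<phi> (at x) h = frechet_derivative \<phi> (at x) (\<Sum>e\<in>Basis. (h \<bullet> e) *\<^sub>R e)"
    by (simp add: euclidean_representation)
  also have "\<dots> = (\<Sum>e\<in>Basis. of_real (h \<bullet> e) * pderiv_dir e \<phi> x)"
    by (simp add: L.sum L.scaleR scaleR_conv_of_real)
  finally show ?thesis .
qed

lemma test_fun_Lipschitz:
  assumes "test_fun \<phi>"
  obtains L where "L > 0" "\<And>x h. cmod (frechet_derivative \<phi> (at x) h) <= L * norm h"
    "\<And>x h. cmod (\<phi> (x + h) - \<phi> x) <= L * norm h"
proof -
  note sm = test_fun_smooth[OF assms]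
  have "\<exists>B. B > 0 \<and> (\<forall>x. cmod (pderiv_dir e \<phi> x) <= B)" if "e \<in> Basis" for e
    using test_fun_bounded[OF test_fun_pderiv[OF assms that]] by blast
  then obtain B where B: "\<And>e. e \<in> Basis ==> B e > 0" "\<And>e x. e \<in> Basis ==> cmod (pderiv_dir e \<phi> x) <= B e" by metis
  define L where "L = (\<Sum>e\<in>Basis. B e)"
  have L: "L > 0" unfolding L_def using B(1) by (intro sum_pos) auto
  have d: "cmod (frechet_derivative \<phi> (at x) h) <= L * norm h" for x h
  proof -
    have "cmod (frechet_derivative \<phi> (at x) h) <= (\<Sum>e\<in>Basis. cmod (of_real (h \<bullet> e) * pderiv_dir e \<phi> x))"
      unfolding derivative_expand[OF sm, where h = h] by (rule norm_sum)
    also have "\<dots> <= (\<Sum>e\<in>Basis. B e * norm h)"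
      using B Basis_le_norm[of _ h] by (intro sum_mono) (auto simp: norm_mult mult.commute[of "B _"] intro!: mult_mono)
    finally show ?thesis by (simp add: L_def sum_distrib_right)
  qed
  have "cmod (\<phi> (x + h) - \<phi> x) <= L * norm (x + h - x)" for x h
  proof (rule differentiable_bound[of UNIV])
    show "(\<phi> has_derivative frechet_derivative \<phi> (at y)) (at y within UNIV)" for y using smoothD(2)[OF sm] by simp
    show "onorm (frechet_derivative \<phi> (at y)) <= L" for y using d by (intro onorm_le) auto
  qed auto
  then have "cmod (\<phi> (x + h) - \<phi> x) <= L * norm h" for x h by simp
  with L d show thesis by (rule that)
qed

lemma conv_has_derivative:
  assumes u: "locally_integrable u" and \<phi>: "test_fun \<phi>"
  shows "(conv u \<phi> has_derivative (%h. \<Sum>e\<in>Basis. of_real (h \<bullet> e) * conv u (pderiv_dir e \<phi>) x)) (at x)"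
proof -
  note sm = test_fun_smooth[OF \<phi>]
  obtain R where R: "R > 0" "\<And>x. norm x > R ==> \<phi> x = 0" using test_fun_support[OF \<phi>] by blast
  obtain L where L: "L > 0" "\<And>x h. cmod (frechet_derivative \<phi> (at x) h) <= L * norm h"
    "\<And>x h. cmod (\<phi> (x + h) - \<phi> x) <= L * norm h" using test_fun_Lipschitz[OF \<phi>] by blast
  have [measurable]: "u \<in> borel_measurable borel" using u by (simp add: locally_integrable_def)
  note [measurable] = test_fun_measurable[OF \<phi>]
  have [measurable]: "pderiv_dir e \<phi> \<in> borel_measurable borel" if "e \<in> Basis" for e
    using test_fun_measurable[OF test_fun_pderiv[OF \<phi> that]] .
  define r where "r h y = (\<phi> (y + h) - \<phi> y - frechet_derivative \<phi> (at y) h) / of_real (norm h)" for h y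
  have r_meas [measurable]: "r h \<in> borel_measurable borel" for h
    unfolding r_def[abs_def] derivative_expand[OF sm, where h = h] by measurable
  have r_bound: "cmod (r h y) <= 2 * L" if "h \<noteq> 0" for h y
  proof -
    have "cmod (\<phi> (y + h) - \<phi> y - frechet_derivative \<phi> (at y) h) <= L * norm h + L * norm h"
      using norm_triangle_ineq4 L(2)[of y h] L(3)[of y h] by (meson add_mono order_trans)
    then show ?thesis using that by (simp add: r_def norm_divide divide_le_eq)
  qed
  have r_supp: "r h y = 0" if "norm h <= 1" "norm y > R + 1" for h y
  proof -
    have "norm (y + h) > R" using that norm_diff_ineq[of y h] by linarith
    moreover have "norm y > R" using that by simp
    moreover have "frechet_derivative \<phi> (at y) = (%h. 0)"
      using frechet_derivative_at[OF pderiv_dir_zero_outside(1)[OF R(2) \<open>norm y > R\<close>]] by simp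
    ultimately show ?thesis using R(2) by (simp add: r_def)
  qed
  have r_lim: "(%n. r (X n) y) \<longlonglongrightarrow> 0" if "X \<longlonglongrightarrow> 0" "\<And>n. X n \<noteq> 0" for X :: "nat => 'a" and y
  proof -
    have "((%h. norm (\<phi> (y + h) - \<phi> y - frechet_derivative \<phi> (at y) h) / norm h) \<longlongrightarrow> 0) (at 0)"
      using smoothD(2)[OF sm, of y] unfolding has_derivative_at by simp
    then have "((%h. r h y) \<longlongrightarrow> 0) (at 0)"
      by (subst tendsto_norm_zero_iff[symmetric]) (simp add: r_def norm_divide)
    then show ?thesis using that by (auto simp: tendsto_at_iff_sequentially o_def)
  qed
  define D where "D h = (\<Sum>e\<in>Basis. complex_of_real (h \<bullet> e) * conv u (pderiv_dir e \<phi>) x)" for h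
  have key: "conv u \<phi> (x + h) - conv u \<phi> x - D h = of_real (norm h) * (\<integral>z. u z * r h (x - z) \<partial>lborel)"
    if h: "h \<noteq> 0" for h
  proof -
    have "D h = (\<integral>z. (\<Sum>e\<in>Basis. of_real (h \<bullet> e) * (u z * pderiv_dir e \<phi> (x - z))) \<partial>lborel)"
      unfolding D_def conv_def
      by (subst Bochner_Integration.integral_sum) (auto intro!: conv_test_integrable u test_fun_pderiv \<phi>)
    also have "\<dots> = (\<integral>z. u z * frechet_derivative \<phi> (at (x - z)) h \<partial>lborel)"
      by (simp add: derivative_expand[OF sm, where h = h] sum_distrib_left mult.left_commute)
    finally have D: "D h = (\<integral>z. u z * frechet_derivative \<phi> (at (x - z)) h \<partial>lborel)" .
    have i1: "integrable lborel (%z. u z * \<phi> (x + h - z))" "integrable lborel (%z. u z * \<phi> (x - z))"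
      using u \<phi> by (auto intro: conv_test_integrable)
    have i2: "integrable lborel (%z. u z * frechet_derivative \<phi> (at (x - z)) h)"
      unfolding derivative_expand[OF sm, where h = h] sum_distrib_left mult.left_commute[of "u _"]
      by (auto intro!: integrable_mult_right conv_test_integrable u test_fun_pderiv \<phi>)
    have "conv u \<phi> (x + h) - conv u \<phi> x - D h =
      (\<integral>z. u z * \<phi> (x + h - z) - u z * \<phi> (x - z) - u z * frechet_derivative \<phi> (at (x - z)) h \<partial>lborel)"
      unfolding D conv_def using i1 i2 by simp
    also have "\<dots> = (\<integral>z. of_real (norm h) * (u z * r h (x - z)) \<partial>lborel)"
    proof (intro Bochner_Integration.integral_cong refl)
      fix z
      have "of_real (norm h) * r h (x - z) = \<phi> (x - z + h) - \<phi> (x - z) - frechet_derivative \<phi> (at (x - z)) h"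
        using h by (simp add: r_def)
      then have "of_real (norm h) * (u z * r h (x - z)) = u z * (\<phi> (x - z + h) - \<phi> (x - z) - frechet_derivative \<phi> (at (x - z)) h)"
        by (simp only: mult.left_commute)
      then show "u z * \<phi> (x + h - z) - u z * \<phi> (x - z) - u z * frechet_derivative \<phi> (at (x - z)) h
         = of_real (norm h) * (u z * r h (x - z))" by (simp add: right_diff_distrib algebra_simps)
    qed
    finally show ?thesis by simp
  qed
  have "((%h. norm (conv u \<phi> (x + h) - conv u \<phi> x - D h) / norm h) \<longlongrightarrow> 0) (at 0)"
    unfolding tendsto_at_iff_sequentially
  proof (intro allI impI)
    fix X :: "nat => 'a" assume X0: "\<forall>i. X i \<in> UNIV - {0}" and X: "X \<longlonglongrightarrow> 0"
    have "\<forall>\<^sub>F n in sequentially. norm (X n) < 1" using X by (auto simp: tendsto_iff dist_norm)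
    then obtain N where N: "\<And>n. n \<ge> N ==> norm (X n) < 1" by (auto simp: eventually_sequentially)
    define Y where "Y n = X (n + N)" for n
    have Y: "Y \<longlonglongrightarrow> 0" "\<And>n. Y n \<noteq> 0" "\<And>n. norm (Y n) <= 1"
      using LIMSEQ_ignore_initial_segment[OF X, of N] X0 N by (auto simp: Y_def[abs_def] less_imp_le)
    have "(%n. \<integral>z. u z * r (Y n) (x - z) \<partial>lborel) \<longlonglongrightarrow> integral\<^sup>L lborel (%z::'a. 0)"
    proof (rule integral_dominated_convergence)
      show "integrable lborel (%z. (2 * L) *\<^sub>R norm (indicator (cball 0 (R + 1 + norm x)) z *\<^sub>R u z))"
        using u unfolding locally_integrable_def by (intro integrable_scaleR_right integrable_norm) auto
      show "AE z in lborel. (%n. u z * r (Y n) (x - z)) \<longlonglongrightarrow> 0"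
        using tendsto_mult_left[OF r_lim[OF Y(1,2)]] by simp
      have "norm (u z * r (Y n) (x - z)) <= (2 * L) *\<^sub>R norm (indicator (cball 0 (R + 1 + norm x)) z *\<^sub>R u z)" for n z
      proof (cases "norm z <= R + 1 + norm x")
        case True
        then show ?thesis
          using mult_left_mono[OF r_bound[OF Y(2)[of n], of "x - z"] norm_ge_zero[of "u z"]] L(1)
          by (simp add: norm_mult abs_mult mult_ac)
      next
        case False
        then have "norm (x - z) > R + 1" using norm_triangle_ineq2[of z x] by (simp add: norm_minus_commute)
        then show ?thesis using r_supp[OF Y(3)] L(1) by simp
      qed
      then show "AE z in lborel. norm (u z * r (Y n) (x - z)) <= (2 * L) *\<^sub>R norm (indicator (cball 0 (R + 1 + norm x)) z *\<^sub>R u z)" for n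
        by simp
    qed (measurable)
    then have "(%n. norm (\<integral>z. u z * r (Y n) (x - z) \<partial>lborel)) \<longlonglongrightarrow> 0" by (simp add: tendsto_norm_zero)
    then have "(%n. norm (conv u \<phi> (x + Y n) - conv u \<phi> x - D (Y n)) / norm (Y n)) \<longlonglongrightarrow> 0"
      using key[OF Y(2)] Y(2) by (simp add: norm_mult)
    then show "((%h. norm (conv u \<phi> (x + h) - conv u \<phi> x - D h) / norm h) \<circ> X) \<longlonglongrightarrow> 0"
      unfolding o_def Y_def by (rule LIMSEQ_offset)
  qed
  moreover have "bounded_linear D"
    unfolding D_def by (intro bounded_linear_sum bounded_linear_mult_const bounded_linear_compose[OF bounded_linear_of_real] bounded_linear_inner_left)
  ultimately show ?thesis unfolding has_derivative_at D_def by simp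
qed

lemma pderiv_dir_conv:
  assumes "locally_integrable u" "test_fun \<phi>" "e \<in> Basis"
  shows "pderiv_dir e (conv u \<phi>) x = conv u (pderiv_dir e \<phi>) x"
  using pderiv_dirI[OF conv_has_derivative[OF assms(1,2), of x], of e] assms(3)
  by (simp add: inner_Basis if_distrib[of of_real] if_distrib[of "%x. x * _"] cong: if_cong)

lemma smooth_conv:
  assumes "locally_integrable u" "test_fun \<phi>"
  shows "smooth (conv u \<phi>)"
proof -
  have "Ck k (conv u \<phi>)" for k
    using assms(2)
  proof (induction k arbitrary: \<phi>)
    case 0
    have "isCont (conv u \<phi>) x" for x using conv_has_derivative[OF assms(1) 0] has_derivative_continuous by blast
    then show ?case by (simp add: continuous_on_eq_continuous_at)
  next
    case (Suc k)
    have "conv u \<phi> differentiable at x" for x using conv_has_derivative[OF assms(1) Suc.prems] by (auto simp: differentiable_def)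
    then show ?case using Suc.IH[OF test_fun_pderiv[OF Suc.prems]] by (simp add: pderiv_dir_conv[OF assms(1) Suc.prems])
  qed
  then show ?thesis by (simp add: smooth_def)
qed

lemma integral_lborel_reflect:
  fixes f :: "'a::euclidean_space => complex"
  assumes [measurable]: "f \<in> borel_measurable borel"
  shows "(\<integral>z. f (x - z) \<partial>lborel) = (\<integral>z. f z \<partial>lborel)"
proof -
  have "(\<integral>z. f z \<partial>lborel) = (\<integral>z. f z \<partial>(density (distr lborel borel (%z. x + (-1) *\<^sub>R z)) (%_. ennreal (\<bar>-1\<bar> ^ DIM('a)))))"
    by (subst lborel_affine[of "-1" x]) auto
  also have "\<dots> = (\<integral>z. f (x - z) \<partial>lborel)"
    by (simp add: density_1 integral_distr)
  finally show ?thesis by simp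
qed

lemma integral_pderiv_zero:
  assumes "test_fun \<phi>" "e \<in> Basis"
  shows "(\<integral>x. pderiv_dir e \<phi> x \<partial>lborel) = 0"
proof -
  have "conv (%_. 1) \<phi> = (%x. \<integral>z. \<phi> z \<partial>lborel)"
    using integral_lborel_reflect[OF test_fun_measurable[OF assms(1)]] by (simp add: conv_def fun_eq_iff)
  then have "pderiv_dir e (conv (%_. 1) \<phi>) 0 = 0"
    using pderiv_dirI[of "%x. \<integral>z. \<phi> z \<partial>lborel" "%h. 0" 0 e] by simp
  moreover have "pderiv_dir e (conv (%_. 1) \<phi>) 0 = (\<integral>z. pderiv_dir e \<phi> z \<partial>lborel)"
    using pderiv_dir_conv[OF const_locally_integrable assms, of 1 0]
      integral_lborel_reflect[OF test_fun_measurable[OF test_fun_pderiv[OF assms]], of 0] by (simp add: conv_def)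
  ultimately show ?thesis by simp
qed

lemma integration_by_parts:
  assumes "smooth \<phi>" "test_fun \<psi>" "e \<in> Basis"
  shows "(\<integral>x. \<phi> x * pderiv_dir e \<psi> x \<partial>lborel) = - (\<integral>x. pderiv_dir e \<phi> x * \<psi> x \<partial>lborel)"
proof -
  have t: "test_fun (%x. \<psi> x * \<phi> x)" "test_fun (%x. \<psi> x * pderiv_dir e \<phi> x)" "test_fun (%x. pderiv_dir e \<psi> x * \<phi> x)"
    using assms by (auto intro!: test_fun_mult test_fun_pderiv smoothD(3))
  have "0 = (\<integral>x. pderiv_dir e \<psi> x * \<phi> x + \<psi> x * pderiv_dir e \<phi> x \<partial>lborel)"
    using integral_pderiv_zero[OF t(1) assms(3)] pderiv_dir_mult[OF test_fun_smooth[OF assms(2)] assms(1), where e = e] by simp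
  also have "\<dots> = (\<integral>x. pderiv_dir e \<psi> x * \<phi> x \<partial>lborel) + (\<integral>x. \<psi> x * pderiv_dir e \<phi> x \<partial>lborel)"
    using t by (intro Bochner_Integration.integral_add test_fun_integrable)
  finally show ?thesis by (simp add: mult.commute eq_neg_iff_add_eq_0)
qed

section \<open>Continuity of translations\<close>

definition shift_cont_L1 :: "('a::euclidean_space => complex) => bool" where
  "shift_cont_L1 f \<longleftrightarrow> (\<forall>e>0. \<exists>d>0. \<forall>h. norm h < d \<longrightarrow> (\<integral>\<^sup>+x. ennreal (cmod (f (x + h) - f x)) \<partial>lborel) <= ennreal e)"

lemma nn_integral_shift:
  fixes f :: "'a::euclidean_space => ennreal"
  assumes [measurable]: "f \<in> borel_measurable borel"
  shows "(\<integral>\<^sup>+x. f (x + h) \<partial>lborel) = (\<integral>\<^sup>+x. f x \<partial>lborel)"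
proof -
  have "(\<integral>\<^sup>+x. f x \<partial>lborel) = (\<integral>\<^sup>+x. f x \<partial>distr lborel borel ((+) h))" by (simp add: lborel_distr_plus)
  also have "\<dots> = (\<integral>\<^sup>+x. f (h + x) \<partial>lborel)" by (subst nn_integral_distr) auto
  finally show ?thesis by (simp add: add.commute)
qed

lemma shift_cont_bounded_set:
  fixes B :: "'a::euclidean_space set"
  assumes [measurable]: "B \<in> sets borel" and bdd: "bounded B"
  shows "shift_cont_L1 (%x. indicator B x *\<^sub>R c)"
  unfolding shift_cont_L1_def
proof (intro allI impI)
  fix e :: real assume e: "e > 0"
  define r where "r = e / (cmod c + 1) / 4"
  have r: "r > 0" using e by (simp add: r_def add_nonneg_pos)
  have BL: "B \<in> sets lebesgue" using assms(1) by simp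
  obtain U where U: "open U" "B \<subseteq> U" "emeasure lebesgue (U - B) < ennreal r"
    using sets_lebesgue_outer_open[OF BL r] by metis
  obtain T where T: "closed T" "T \<subseteq> B" "emeasure lebesgue (B - T) < ennreal r"
    using sets_lebesgue_inner_closed[OF BL r] by metis
  have [measurable]: "U \<in> sets borel" "T \<in> sets borel" using U T by auto
  have "compact T" using T bdd bounded_subset compact_eq_bounded_closed by blast
  then obtain d where d: "d > 0" "(\<Union>x\<in>T. ball x d) \<subseteq> U"
    using compact_subset_open_imp_ball_epsilon_subset[of T U] U T by blast
  have meas: "emeasure lborel (U - T) <= ennreal (2 * r)"
  proof -
    have "U - T = (U - B) \<union> (B - T)" using U T by auto
    then have "emeasure lborel (U - T) <= emeasure lborel (U - B) + emeasure lborel (B - T)"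
      by (simp add: emeasure_subadditive)
    also have "\<dots> = emeasure lebesgue (U - B) + emeasure lebesgue (B - T)" by simp
    also have "\<dots> <= ennreal r + ennreal r" using U T by (intro add_mono) auto
    also have "\<dots> = ennreal (2 * r)" using r by (simp add: ennreal_plus[symmetric] del: ennreal_plus)
    finally show ?thesis .
  qed
  have "(\<integral>\<^sup>+x. ennreal (cmod (indicator B (x + h) *\<^sub>R c - indicator B x *\<^sub>R c)) \<partial>lborel) <= ennreal e" if h: "norm h < d" for h
  proof -
    have pt: "ennreal (cmod (indicator B (x + h) *\<^sub>R c - indicator B x *\<^sub>R c))
        <= ennreal (cmod c) * (indicator (U - T) (x + h) + indicator (U - T) x)" for x
    proof (cases "(x \<in> B) = (x + h \<in> B)")
      case True then show ?thesis by (auto simp: indicator_def)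
    next
      case False
      have 1: "x + h \<in> U" if "x \<in> T" using d(2) that h by (auto simp: dist_norm subset_eq)
      have 2: "x \<in> U" if "x + h \<in> T" using d(2) that h by (auto simp: dist_norm subset_eq)
      have "x + h \<in> U - T \<or> x \<in> U - T" using False 1 2 U(2) T(2) by blast
      moreover have "y <= y * 2" for y :: ennreal using mult_left_mono[of 1 2 y] by simp
      ultimately show ?thesis
        using False by (auto simp: indicator_def)
    qed
    have "(\<integral>\<^sup>+x. ennreal (cmod (indicator B (x + h) *\<^sub>R c - indicator B x *\<^sub>R c)) \<partial>lborel)
      <= (\<integral>\<^sup>+x. ennreal (cmod c) * (indicator (U - T) (x + h) + indicator (U - T) x) \<partial>lborel)"
      by (intro nn_integral_mono pt)
    also have "\<dots> = ennreal (cmod c) * ((\<integral>\<^sup>+x. indicator (U - T) (x + h) \<partial>lborel) + (\<integral>\<^sup>+x. indicator (U - T) x \<partial>lborel))"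
      by (simp add: nn_integral_cmult nn_integral_add)
    also have "(\<integral>\<^sup>+x. indicator (U - T) (x + h) \<partial>lborel) = (\<integral>\<^sup>+x. indicator (U - T) x \<partial>lborel)"
      by (rule nn_integral_shift) simp
    also have "ennreal (cmod c) * ((\<integral>\<^sup>+x. indicator (U - T) x \<partial>lborel) + (\<integral>\<^sup>+x. indicator (U - T) x \<partial>lborel))
        <= ennreal (cmod c) * (ennreal (2 * r) + ennreal (2 * r))"
      using meas by (intro mult_left_mono add_mono) auto
    also have "\<dots> = ennreal (cmod c * (4 * r))"
      using r by (simp add: ennreal_plus[symmetric] ennreal_mult[symmetric] del: ennreal_plus)
    also have "\<dots> <= ennreal e"
    proof (rule ennreal_leI)
      have "cmod c * (4 * r) = e * (cmod c / (cmod c + 1))"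
      proof -
        have q: "4 * (t / 4) = t" for t :: real by simp
        show ?thesis unfolding r_def q by (simp only: times_divide_eq_right mult.commute)
      qed
      also have "\<dots> <= e * 1" using e by (intro mult_left_mono) (auto simp: divide_simps add_nonneg_pos)
      finally show "cmod c * (4 * r) <= e" by simp
    qed
    finally show ?thesis .
  qed
  then show "\<exists>d>0. \<forall>h. norm h < d \<longrightarrow> (\<integral>\<^sup>+x. ennreal (cmod (indicator B (x + h) *\<^sub>R c - indicator B x *\<^sub>R c)) \<partial>lborel) <= ennreal e"
    using d(1) by blast
qed

lemma shift_cont_add:
  assumes "shift_cont_L1 f" "shift_cont_L1 g" and [measurable]: "f \<in> borel_measurable borel" "g \<in> borel_measurable borel"
  shows "shift_cont_L1 (%x. f x + g x)"
  unfolding shift_cont_L1_def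
proof (intro allI impI)
  fix e :: real assume e: "e > 0"
  then have e2: "e / 2 > 0" by simp
  obtain d1 where d1: "d1 > 0" "\<And>h. norm h < d1 ==> (\<integral>\<^sup>+x. ennreal (cmod (f (x + h) - f x)) \<partial>lborel) <= ennreal (e/2)"
    using assms(1) e2 unfolding shift_cont_L1_def by blast
  obtain d2 where d2: "d2 > 0" "\<And>h. norm h < d2 ==> (\<integral>\<^sup>+x. ennreal (cmod (g (x + h) - g x)) \<partial>lborel) <= ennreal (e/2)"
    using assms(2) e2 unfolding shift_cont_L1_def by blast
  have "(\<integral>\<^sup>+x. ennreal (cmod (f (x + h) + g (x + h) - (f x + g x))) \<partial>lborel) <= ennreal e" if h: "norm h < min d1 d2" for h
  proof -
    have "(\<integral>\<^sup>+x. ennreal (cmod (f (x + h) + g (x + h) - (f x + g x))) \<partial>lborel) \<le>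
       (\<integral>\<^sup>+x. ennreal (cmod (f (x + h) - f x)) + ennreal (cmod (g (x + h) - g x)) \<partial>lborel)"
    proof (intro nn_integral_mono)
      fix x
      have "f (x + h) + g (x + h) - (f x + g x) = (f (x + h) - f x) + (g (x + h) - g x)" by simp
      then show "ennreal (cmod (f (x + h) + g (x + h) - (f x + g x))) <= ennreal (cmod (f (x + h) - f x)) + ennreal (cmod (g (x + h) - g x))"
        by (metis ennreal_leI ennreal_plus norm_ge_zero norm_triangle_ineq)
    qed
    also have "\<dots> = (\<integral>\<^sup>+x. ennreal (cmod (f (x + h) - f x)) \<partial>lborel) + (\<integral>\<^sup>+x. ennreal (cmod (g (x + h) - g x)) \<partial>lborel)"
      by (intro nn_integral_add) measurable
    also have "\<dots> <= ennreal (e/2) + ennreal (e/2)" using h d1 d2 by (intro add_mono) auto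
    also have "\<dots> = ennreal e" using e by (simp add: ennreal_plus[symmetric] del: ennreal_plus)
    finally show ?thesis .
  qed
  then show "\<exists>d>0. \<forall>h. norm h < d \<longrightarrow> (\<integral>\<^sup>+x. ennreal (cmod (f (x + h) + g (x + h) - (f x + g x))) \<partial>lborel) <= ennreal e"
    using d1(1) d2(1) by (intro exI[of _ "min d1 d2"]) auto
qed

lemma shift_cont_approx:
  assumes approx: "\<And>e. e > 0 ==> \<exists>g. g \<in> borel_measurable borel \<and> shift_cont_L1 g \<and> (\<integral>\<^sup>+x. ennreal (cmod (f x - g x)) \<partial>lborel) <= ennreal e"
    and [measurable]: "f \<in> borel_measurable borel"
  shows "shift_cont_L1 f"
  unfolding shift_cont_L1_def
proof (intro allI impI)
  fix e :: real assume e: "e > 0"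
  then have e3: "e / 3 > 0" by simp
  obtain g where g[measurable]: "g \<in> borel_measurable borel" and gs: "shift_cont_L1 g"
    and fg: "(\<integral>\<^sup>+x. ennreal (cmod (f x - g x)) \<partial>lborel) <= ennreal (e/3)" using approx[OF e3] by blast
  obtain d where d: "d > 0" "\<And>h. norm h < d ==> (\<integral>\<^sup>+x. ennreal (cmod (g (x + h) - g x)) \<partial>lborel) <= ennreal (e/3)"
    using gs e3 unfolding shift_cont_L1_def by blast
  have "(\<integral>\<^sup>+x. ennreal (cmod (f (x + h) - f x)) \<partial>lborel) <= ennreal e" if h: "norm h < d" for h
  proof -
    have "(\<integral>\<^sup>+x. ennreal (cmod (f (x + h) - f x)) \<partial>lborel) \<le>
       (\<integral>\<^sup>+x. ennreal (cmod (f (x + h) - g (x + h))) + ennreal (cmod (g (x + h) - g x)) + ennreal (cmod (f x - g x)) \<partial>lborel)"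
    proof (intro nn_integral_mono)
      fix x
      have "f (x + h) - f x = (f (x + h) - g (x + h)) + (g (x + h) - g x) - (f x - g x)" by simp
      then have "cmod (f (x + h) - f x) <= cmod (f (x + h) - g (x + h)) + cmod (g (x + h) - g x) + cmod (f x - g x)"
        by (metis (no_types, lifting) norm_triangle_ineq norm_triangle_ineq4 add_right_mono order_trans)
      then have "ennreal (cmod (f (x + h) - f x)) <= ennreal (cmod (f (x + h) - g (x + h)) + cmod (g (x + h) - g x) + cmod (f x - g x))"
        by (rule ennreal_leI)
      then show "ennreal (cmod (f (x + h) - f x)) <= ennreal (cmod (f (x + h) - g (x + h))) + ennreal (cmod (g (x + h) - g x)) + ennreal (cmod (f x - g x))"
        by simp
    qed
    also have "\<dots> = (\<integral>\<^sup>+x. ennreal (cmod (f (x + h) - g (x + h))) \<partial>lborel) + (\<integral>\<^sup>+x. ennreal (cmod (g (x + h) - g x)) \<partial>lborel) + (\<integral>\<^sup>+x. ennreal (cmod (f x - g x)) \<partial>lborel)"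
      by (subst nn_integral_add; (subst nn_integral_add)?; (measurable | simp))
    also have "(\<integral>\<^sup>+x. ennreal (cmod (f (x + h) - g (x + h))) \<partial>lborel) = (\<integral>\<^sup>+x. ennreal (cmod (f x - g x)) \<partial>lborel)"
      by (rule nn_integral_shift) measurable
    also have "(\<integral>\<^sup>+x. ennreal (cmod (f x - g x)) \<partial>lborel) + (\<integral>\<^sup>+x. ennreal (cmod (g (x + h) - g x)) \<partial>lborel) + (\<integral>\<^sup>+x. ennreal (cmod (f x - g x)) \<partial>lborel)
        <= ennreal (e/3) + ennreal (e/3) + ennreal (e/3)" using fg d(2)[OF h] by (intro add_mono)
    also have "\<dots> = ennreal e" using e by (simp add: ennreal_plus[symmetric] del: ennreal_plus)
    finally show ?thesis .
  qed
  then show "\<exists>d>0. \<forall>h. norm h < d \<longrightarrow> (\<integral>\<^sup>+x. ennreal (cmod (f (x + h) - f x)) \<partial>lborel) <= ennreal e" using d(1) by blast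
qed

lemma ball_restrict_measurable [measurable]:
  fixes f :: "'a::euclidean_space => complex"
  assumes "f \<in> borel_measurable borel"
  shows "(%x. indicat_real (cball 0 R) x *\<^sub>R f x) \<in> borel_measurable borel"
  using assms by (intro borel_measurable_scaleR borel_measurable_indicator) auto

lemma shift_cont_bounded_support:
  fixes f :: "'a::euclidean_space => complex"
  assumes "integrable lborel f"
  shows "shift_cont_L1 (%x. indicator (cball 0 R) x *\<^sub>R f x)"
  using assms
proof (induction rule: integrable_induct)
  case (base A c)
  have "shift_cont_L1 (%x. indicator (cball 0 R \<inter> A) x *\<^sub>R c)"
    using base by (intro shift_cont_bounded_set) auto
  then show ?case by (simp add: indicator_inter_arith)
next
  case (add f g)
  have [measurable]: "f \<in> borel_measurable borel" "g \<in> borel_measurable borel" using add.hyps by auto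
  have "shift_cont_L1 (%x. indicator (cball 0 R) x *\<^sub>R f x + indicator (cball 0 R) x *\<^sub>R g x)"
    by (rule shift_cont_add[OF add.IH]) (intro ball_restrict_measurable; fact)+
  then show ?case by (simp add: scaleR_add_right)
next
  case (lim f s)
  have [measurable]: "f \<in> borel_measurable borel" "s i \<in> borel_measurable borel" for i
    using borel_measurable_integrable[OF lim.hyps(1)] borel_measurable_integrable[OF lim.hyps(4)] by simp_all
  show ?case
  proof (rule shift_cont_approx)
    fix e :: real assume e: "e > 0"
    have "(%i. \<integral>\<^sup>+x. norm (f x - s i x) \<partial>lborel) \<longlonglongrightarrow> 0"
    proof (rule nn_integral_dominated_convergence_norm[where w = "%x. 2 * norm (f x)"])
      show "(\<integral>\<^sup>+x. ennreal (2 * norm (f x)) \<partial>lborel) < \<infinity>"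
      proof -
        have "integrable lborel (%x. 2 * norm (f x))" by (intro integrable_mult_right integrable_norm lim.hyps(4))
        then show ?thesis unfolding integrable_iff_bounded by simp
      qed
    qed (use lim.hyps(2,3) in auto)
    then have "\<forall>\<^sub>F i in sequentially. (\<integral>\<^sup>+x. norm (f x - s i x) \<partial>lborel) < ennreal e"
      using e by (intro order_tendstoD(2)) auto
    then obtain i where i: "(\<integral>\<^sup>+x. norm (f x - s i x) \<partial>lborel) < ennreal e" by (auto simp: eventually_sequentially)
    have "(\<integral>\<^sup>+x. ennreal (cmod (indicator (cball 0 R) x *\<^sub>R f x - indicator (cball 0 R) x *\<^sub>R s i x)) \<partial>lborel) <= (\<integral>\<^sup>+x. norm (f x - s i x) \<partial>lborel)"
      by (intro nn_integral_mono) (auto simp: indicator_def norm_minus_commute)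
    then show "\<exists>g. g \<in> borel_measurable borel \<and> shift_cont_L1 g \<and> (\<integral>\<^sup>+x. ennreal (cmod (indicator (cball 0 R) x *\<^sub>R f x - g x)) \<partial>lborel) <= ennreal e"
      using i lim.IH[of i] by (intro exI[of _ "%x. indicator (cball 0 R) x *\<^sub>R s i x"]) (auto)
  qed (intro ball_restrict_measurable; fact)
qed

text \<open>
  Truncation reduces this to bounded functions of bounded support, for which the square is dominated
  by the first power. There approximation by simple functions and regularity of the Lebesgue
  measure give continuity in \<open>L\<^sup>1\<close>.
\<close>

theorem shift_cont_L2:
  fixes u :: "'a::euclidean_space => complex"
  assumes u: "u \<in> L2 lborel" and e: "e > 0"
  shows "\<exists>d>0. \<forall>h. norm h < d \<longrightarrow> (\<integral>\<^sup>+x. ennreal ((cmod (u (x + h) - u x))\<^sup>2) \<partial>lborel) <= ennreal e"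
proof -
  have [measurable]: "u \<in> borel_measurable borel" using L2_measurable[OF u] by simp
  define v where "v n x = (if cmod (u x) <= real n \<and> norm x <= real n then u x else 0)" for n :: nat and x
  have [measurable]: "v n \<in> borel_measurable borel" for n unfolding v_def by measurable
  have vb: "cmod (v n x) <= real n" for n x by (auto simp: v_def)
  have vint: "integrable lborel (v n)" for n
    by (rule bounded_support_integrable[where B = "real n" and R = "real n"]) (auto simp: v_def)
  have tail: "(%n. \<integral>\<^sup>+x. ennreal ((cmod (u x - v n x))\<^sup>2) \<partial>lborel) \<longlonglongrightarrow> integral\<^sup>N lborel (%x::'a. 0)"
  proof (rule nn_integral_dominated_convergence[where w = "%x. ennreal ((cmod (u x))\<^sup>2)"])
    show "(\<integral>\<^sup>+x. ennreal ((cmod (u x))\<^sup>2) \<partial>lborel) < \<infinity>" using u by (simp add: L2_iff_nn)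
    show "AE x in lborel. (%n. ennreal ((cmod (u x - v n x))\<^sup>2)) \<longlonglongrightarrow> 0"
    proof (rule AE_I2)
      fix x
      obtain N where N: "cmod (u x) <= real N" "norm x <= real N"
        using real_arch_simple[of "max (cmod (u x)) (norm x)"] by auto
      have "\<forall>\<^sub>F n in sequentially. ennreal ((cmod (u x - v n x))\<^sup>2) = 0"
        unfolding eventually_sequentially using N by (intro exI[of _ N]) (auto simp: v_def)
      then show "(%n. ennreal ((cmod (u x - v n x))\<^sup>2)) \<longlonglongrightarrow> 0" by (rule tendsto_eventually)
    qed
  qed (auto simp: v_def)
  have e9: "e / 9 > 0" using e by simp
  have "\<forall>\<^sub>F n in sequentially. (\<integral>\<^sup>+x. ennreal ((cmod (u x - v n x))\<^sup>2) \<partial>lborel) < ennreal (e/9)"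
    using tail e9 by (intro order_tendstoD(2)) (auto simp: ennreal_less_zero_iff)
  then obtain n where n: "(\<integral>\<^sup>+x. ennreal ((cmod (u x - v n x))\<^sup>2) \<partial>lborel) < ennreal (e/9)" by (auto simp: eventually_sequentially)
  have "shift_cont_L1 (%x. indicator (cball 0 (real n)) x *\<^sub>R v n x)" using vint by (rule shift_cont_bounded_support)
  also have "(%x. indicator (cball 0 (real n)) x *\<^sub>R v n x) = v n" by (auto simp: v_def indicator_def fun_eq_iff)
  finally have sc: "shift_cont_L1 (v n)" .
  define r where "r = e / (9 * (2 * real n + 1))"
  have r: "r > 0" using e by (simp add: r_def add_nonneg_pos)
  obtain d where d: "d > 0" "\<And>h. norm h < d ==> (\<integral>\<^sup>+x. ennreal (cmod (v n (x + h) - v n x)) \<partial>lborel) <= ennreal r"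
    using sc r unfolding shift_cont_L1_def by blast
  have "(\<integral>\<^sup>+x. ennreal ((cmod (u (x + h) - u x))\<^sup>2) \<partial>lborel) <= ennreal e" if h: "norm h < d" for h
  proof -
    have pt: "ennreal ((cmod (u (x + h) - u x))\<^sup>2) <= ennreal 3 * (ennreal ((cmod (u (x + h) - v n (x + h)))\<^sup>2) +
       ennreal (2 * real n) * ennreal (cmod (v n (x + h) - v n x)) + ennreal ((cmod (u x - v n x))\<^sup>2))" for x
    proof -
      define a where "a = cmod (u (x + h) - v n (x + h))"
      define b where "b = cmod (v n (x + h) - v n x)"
      define c where "c = cmod (u x - v n x)"
      have "u (x + h) - u x = (u (x + h) - v n (x + h)) + (v n (x + h) - v n x) - (u x - v n x)" by simp
      then have "cmod (u (x + h) - u x) <= a + b + c" unfolding a_def b_def c_def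
        by (metis (no_types, lifting) norm_triangle_ineq norm_triangle_ineq4 add_right_mono order_trans)
      then have "(cmod (u (x + h) - u x))\<^sup>2 <= (a + b + c)\<^sup>2" by (intro power_mono) auto
      also have "\<dots> <= 3 * (a\<^sup>2 + b\<^sup>2 + c\<^sup>2)"
      proof -
        have "0 <= (a - b)\<^sup>2 + (b - c)\<^sup>2 + (a - c)\<^sup>2" by simp
        then show ?thesis by (simp add: power2_eq_square algebra_simps)
      qed
      also have "b\<^sup>2 <= 2 * real n * b"
      proof -
        have "b <= 2 * real n" using vb[of n "x + h"] vb[of n x] norm_triangle_ineq4[of "v n (x + h)" "v n x"] by (simp add: b_def)
        then show ?thesis by (simp add: power2_eq_square b_def mult_right_mono)
      qed
      finally have "(cmod (u (x + h) - u x))\<^sup>2 <= 3 * (a\<^sup>2 + 2 * real n * b + c\<^sup>2)" by simp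
      then have "ennreal ((cmod (u (x + h) - u x))\<^sup>2) <= ennreal (3 * (a\<^sup>2 + 2 * real n * b + c\<^sup>2))" by (rule ennreal_leI)
      also have "\<dots> = ennreal 3 * (ennreal (a\<^sup>2) + ennreal (2 * real n) * ennreal b + ennreal (c\<^sup>2))"
        by (subst ennreal_mult) (auto simp: a_def b_def c_def ennreal_mult)
      finally show ?thesis by (simp add: a_def b_def c_def)
    qed
    have "(\<integral>\<^sup>+x. ennreal ((cmod (u (x + h) - u x))\<^sup>2) \<partial>lborel) <= (\<integral>\<^sup>+x. ennreal 3 * (ennreal ((cmod (u (x + h) - v n (x + h)))\<^sup>2) +
       ennreal (2 * real n) * ennreal (cmod (v n (x + h) - v n x)) + ennreal ((cmod (u x - v n x))\<^sup>2)) \<partial>lborel)"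
      by (intro nn_integral_mono pt)
    also have "\<dots> = ennreal 3 * ((\<integral>\<^sup>+x. ennreal ((cmod (u (x + h) - v n (x + h)))\<^sup>2) \<partial>lborel) +
       ennreal (2 * real n) * (\<integral>\<^sup>+x. ennreal (cmod (v n (x + h) - v n x)) \<partial>lborel) + (\<integral>\<^sup>+x. ennreal ((cmod (u x - v n x))\<^sup>2) \<partial>lborel))"
      by (subst nn_integral_cmult, measurable, subst nn_integral_add, measurable, subst nn_integral_add, measurable, subst nn_integral_cmult, measurable)
    also have "(\<integral>\<^sup>+x. ennreal ((cmod (u (x + h) - v n (x + h)))\<^sup>2) \<partial>lborel) = (\<integral>\<^sup>+x. ennreal ((cmod (u x - v n x))\<^sup>2) \<partial>lborel)"
      by (rule nn_integral_shift[where f = "%x. ennreal ((cmod (u x - v n x))\<^sup>2)"]) measurable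
    also have "ennreal 3 * ((\<integral>\<^sup>+x. ennreal ((cmod (u x - v n x))\<^sup>2) \<partial>lborel) +
       ennreal (2 * real n) * (\<integral>\<^sup>+x. ennreal (cmod (v n (x + h) - v n x)) \<partial>lborel) + (\<integral>\<^sup>+x. ennreal ((cmod (u x - v n x))\<^sup>2) \<partial>lborel))
       <= ennreal 3 * (ennreal (e/9) + ennreal (2 * real n) * ennreal r + ennreal (e/9))"
      using n d(2)[OF h] by (intro mult_left_mono add_mono) auto
    also have "\<dots> = ennreal 3 * ennreal (e/9 + 2 * real n * r + e/9)"
    proof -
      have nn: "0 <= e/9" "0 <= 2 * real n" "0 <= r" "0 <= 2 * real n * r" "0 <= e/9 + 2 * real n * r"
        using e r by auto
      show ?thesis by (simp only: ennreal_plus[OF nn(5,1)] ennreal_plus[OF nn(1,4)] ennreal_mult[OF nn(2,3)])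
    qed
    also have "\<dots> = ennreal (3 * (e/9 + 2 * real n * r + e/9))"
      using e r by (intro ennreal_mult[symmetric]) auto
    also have "\<dots> <= ennreal e"
    proof (rule ennreal_leI)
      have "2 * real n * r = (e / 9) * (2 * real n / (2 * real n + 1))" by (simp add: r_def)
      also have "\<dots> <= (e / 9) * 1" using e by (intro mult_left_mono) (auto simp: divide_simps)
      finally show "3 * (e/9 + 2 * real n * r + e/9) <= e" by simp
    qed
    finally show ?thesis .
  qed
  then show ?thesis using d(1) by blast
qed

section \<open>Mollifiers\<close>

lemma prob_Jensen_sq:
  assumes P: "emeasure P (space P) = 1" and [measurable]: "g \<in> borel_measurable P"
  shows "ennreal ((cmod (\<integral>x. g x \<partial>P))\<^sup>2) <= (\<integral>\<^sup>+x. ennreal ((cmod (g x))\<^sup>2) \<partial>P)"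
proof (cases "(\<integral>\<^sup>+x. ennreal ((cmod (g x))\<^sup>2) \<partial>P) < \<infinity>")
  case True
  then have g: "g \<in> L2 P" by (simp add: L2_iff_nn)
  have mP: "measure P (space P) = 1" using P by (simp add: measure_def)
  have one: "(%x. 1) \<in> L2 P" using P by (simp add: L2_iff_nn)
  have "(cmod (L2_inner P g (%x. 1)))\<^sup>2 <= (L2_norm P g)\<^sup>2 * (L2_norm P (%x. 1))\<^sup>2"
    using L2.Cauchy_Schwarz_sq[OF g one] by (simp add: L2_inner_self)
  moreover have "(L2_norm P (%x. 1))\<^sup>2 = 1" using mP by (simp add: L2_norm_sq)
  ultimately have "(cmod (\<integral>x. g x \<partial>P))\<^sup>2 <= (L2_norm P g)\<^sup>2" by (simp add: L2_inner_def)
  then show ?thesis using nn_integral_L2[OF g] by (simp add: ennreal_leI)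
qed (simp add: not_less top_unique)

text \<open>
  The center \<open>c\<close> is not fixed at the origin: near the boundary of a domain the convolution has to
  look at points strictly inside.
\<close>

definition mollifier :: "'a::euclidean_space => real => ('a => real) => bool" where
  "mollifier c s r \<longleftrightarrow> test_fun (%x. complex_of_real (r x)) \<and> (\<forall>x. 0 <= r x) \<and> (\<forall>x. r x \<noteq> 0 \<longrightarrow> dist x c <= s) \<and>
     (\<integral>x. r x \<partial>lborel) = 1"

lemma test_fun_bump: "test_fun (%x::'a::euclidean_space. complex_of_real (bump x))"
  unfolding test_fun_def using smooth_bump bump_support by (auto intro!: exI[of _ "real DIM('a)"])

lemma mollifier_exists:
  fixes c :: "'a::euclidean_space"
  assumes s: "s > 0"
  shows "\<exists>r. mollifier c s r"
proof -
  define n where "n = real DIM('a)"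
  have n: "n > 0" by (simp add: n_def)
  define f where "f x = bump (- (n / s) *\<^sub>R c + (n / s) *\<^sub>R x)" for x :: 'a
  have tf: "test_fun (%x. complex_of_real (f x))"
    unfolding f_def using test_fun_affine[OF test_fun_bump, of "n / s" "- (n / s) *\<^sub>R c"] n s by simp
  then have fi: "integrable lborel f" using integrable_Re[OF test_fun_integrable[OF tf]] by simp
  have supp: "dist x c <= s" if "f x \<noteq> 0" for x
  proof -
    have "norm (- (n / s) *\<^sub>R c + (n / s) *\<^sub>R x) <= n"
      using bump_support[of "- (n / s) *\<^sub>R c + (n / s) *\<^sub>R x"] that by (force simp: f_def n_def)
    also have "- (n / s) *\<^sub>R c + (n / s) *\<^sub>R x = (n / s) *\<^sub>R (x - c)" by (simp add: algebra_simps)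
    finally have "norm ((n / s) *\<^sub>R (x - c)) <= n" .
    moreover have "norm ((n / s) *\<^sub>R (x - c)) = n * (norm (x - c) / s)" using n s by simp
    ultimately have "n * (norm (x - c) / s) <= n * 1" by (simp only: mult_1_right)
    then have "norm (x - c) / s <= 1" using n by (simp only: mult_le_cancel_left_pos)
    then show ?thesis using s by (simp add: dist_norm)
  qed
  define Z where "Z = (\<integral>x. f x \<partial>lborel)"
  have f0: "0 <= f x" for x by (simp add: f_def bump_nonneg)
  have "Z \<noteq> 0"
  proof
    assume "Z = 0"
    then have "AE x in lborel. f x = 0"
      unfolding Z_def using integral_nonneg_eq_0_iff_AE[OF fi] f0 by simp
    moreover have cont: "continuous_on UNIV f"
    proof -
      have "continuous_on UNIV (%x. Re (complex_of_real (f x)))"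
        by (intro continuous_on_Re smooth_continuous test_fun_smooth tf)
      then show ?thesis by simp
    qed
    then have op: "open {x. f x > 0}" by (intro open_Collect_less continuous_on_const)
    ultimately have "{x. f x > 0} \<in> null_sets lborel"
      by (subst AE_iff_null_sets) (auto elim: eventually_mono)
    then have "negligible {x. f x > 0}"
      by (simp add: negligible_iff_null_sets null_sets_completionI)
    moreover have "f c > 0" by (simp add: f_def bump_0)
    ultimately show False using open_not_negligible[OF op] by blast
  qed
  moreover have "Z \<ge> 0" unfolding Z_def using f0 by simp
  ultimately have Z: "Z > 0" by simp
  have "test_fun (%x. complex_of_real (f x) * of_real (1 / Z))" by (intro test_fun_mult tf smooth_const)
  then have "mollifier c s (%x. f x / Z)"
    unfolding mollifier_def using f0 Z supp fi by (auto simp: Z_def)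
  then show ?thesis by blast
qed

lemma integrable_lborel_reflect:
  fixes f :: "'a::euclidean_space => complex"
  assumes f: "integrable lborel f"
  shows "integrable lborel (%z. f (x - z))"
proof -
  have [measurable]: "f \<in> borel_measurable borel" using borel_measurable_integrable[OF f] by simp
  have "integrable (density (distr lborel borel (%z. x + (-1) *\<^sub>R z)) (%_. ennreal (\<bar>-1\<bar> ^ DIM('a)))) f"
    using f by (subst (asm) lborel_affine[of "-1" x]) auto
  then show ?thesis by (simp add: density_1 integrable_distr_eq)
qed

text \<open>
  Jensen's inequality bounds the error by an average of shifts of \<open>u\<close> of size at most \<open>norm c + s\<close>.
\<close>

lemma mollifier_approx:
  fixes u :: "'a::euclidean_space => complex"
  assumes u: "u \<in> L2 lborel" and e: "e > 0"
  shows "\<exists>d>0. \<forall>c s r. mollifier c s r \<and> norm c + s < d \<longrightarrow>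
     conv u (%x. of_real (r x)) \<in> L2 lborel \<and> L2_norm lborel (conv u (%x. of_real (r x)) - u) <= e"
proof -
  have [measurable]: "u \<in> borel_measurable borel" using L2_measurable[OF u] by simp
  obtain d where d: "d > 0" "\<And>h. norm h < d ==> (\<integral>\<^sup>+x. ennreal ((cmod (u (x + h) - u x))\<^sup>2) \<partial>lborel) <= ennreal (e\<^sup>2)"
    using shift_cont_L2[OF u, of "e\<^sup>2"] e by auto
  have "conv u (%x. of_real (r x)) \<in> L2 lborel \<and> L2_norm lborel (conv u (%x. of_real (r x)) - u) <= e"
    if m: "mollifier c s r" and cs: "norm c + s < d" for c s r
  proof -
    let ?\<rho> = "%x. complex_of_real (r x)"
    have tf: "test_fun ?\<rho>" and r0: "\<And>x. 0 <= r x" and supp: "\<And>x. r x \<noteq> 0 ==> dist x c <= s" and int: "(\<integral>x. r x \<partial>lborel) = 1"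
      using m by (auto simp: mollifier_def)
    have ri: "integrable lborel r" using integrable_Re[OF test_fun_integrable[OF tf]] by simp
    have [measurable]: "r \<in> borel_measurable borel" using borel_measurable_integrable[OF ri] by simp
    have rnn: "(\<integral>\<^sup>+x. ennreal (r x) \<partial>lborel) = 1"
      using nn_integral_eq_integral[OF ri] r0 int by simp
    define P where "P = density lborel (%w. ennreal (r w))"
    have P: "emeasure P (space P) = 1" using rnn by (simp add: P_def emeasure_density)
    have setsP [measurable_cong]: "sets P = sets borel" by (simp add: P_def)
    have cm: "conv u ?\<rho> \<in> borel_measurable borel"
      by (intro smooth_measurable smooth_conv L2_locally_integrable u tf)
    note [measurable] = cm
    have conv_eq: "conv u ?\<rho> x - u x = (\<integral>w. (u (x - w) - u x) \<partial>P)" for x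
    proof -
      have "conv u ?\<rho> x = (\<integral>w. u (x - w) * ?\<rho> w \<partial>lborel)"
        unfolding conv_def using integral_lborel_reflect[of "%w. u (x - w) * ?\<rho> w" x] by simp
      also have "\<dots> = (\<integral>w. r w *\<^sub>R u (x - w) \<partial>lborel)" by (simp add: scaleR_conv_of_real mult.commute)
      finally have c1: "conv u ?\<rho> x = (\<integral>w. r w *\<^sub>R u (x - w) \<partial>lborel)" .
      have "integrable lborel (%z. u z * ?\<rho> (x - z))"
        by (intro conv_test_integrable L2_locally_integrable u tf)
      from integrable_lborel_reflect[OF this, of x]
      have "integrable lborel (%w. u (x - w) * ?\<rho> (x - (x - w)))" .
      then have i1: "integrable lborel (%w. r w *\<^sub>R u (x - w))" by (simp add: scaleR_conv_of_real mult.commute)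
      have i2: "integrable lborel (%w. r w *\<^sub>R u x)" using ri by (intro integrable_scaleR_left) auto
      have "(\<integral>w. (u (x - w) - u x) \<partial>P) = (\<integral>w. r w *\<^sub>R (u (x - w) - u x) \<partial>lborel)"
        unfolding P_def using r0 by (intro integral_density) auto
      also have "\<dots> = (\<integral>w. r w *\<^sub>R u (x - w) \<partial>lborel) - (\<integral>w. r w *\<^sub>R u x \<partial>lborel)"
        unfolding scaleR_diff_right using i1 i2 by (rule Bochner_Integration.integral_diff)
      also have "(\<integral>w. r w *\<^sub>R u x \<partial>lborel) = u x" using int ri by (subst integral_scaleR_left) auto
      finally show ?thesis using c1 by simp
    qed
    have "(\<integral>\<^sup>+x. ennreal ((cmod ((conv u ?\<rho> - u) x))\<^sup>2) \<partial>lborel)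
       <= (\<integral>\<^sup>+x. \<integral>\<^sup>+w. ennreal ((cmod (u (x - w) - u x))\<^sup>2) \<partial>P \<partial>lborel)"
    proof (rule nn_integral_mono)
      fix x
      have "(%w. u (x - w) - u x) \<in> borel_measurable P" by measurable
      from prob_Jensen_sq[OF P this] show "ennreal ((cmod ((conv u ?\<rho> - u) x))\<^sup>2) <= (\<integral>\<^sup>+w. ennreal ((cmod (u (x - w) - u x))\<^sup>2) \<partial>P)"
        by (simp add: conv_eq)
    qed
    also have "\<dots> = (\<integral>\<^sup>+x. \<integral>\<^sup>+w. ennreal (r w) * ennreal ((cmod (u (x - w) - u x))\<^sup>2) \<partial>lborel \<partial>lborel)"
      unfolding P_def by (intro nn_integral_cong nn_integral_density) auto
    also have "\<dots> = (\<integral>\<^sup>+w. \<integral>\<^sup>+x. ennreal (r w) * ennreal ((cmod (u (x - w) - u x))\<^sup>2) \<partial>lborel \<partial>lborel)"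
      by (intro lborel_pair.Fubini') measurable
    also have "\<dots> = (\<integral>\<^sup>+w. ennreal (r w) * (\<integral>\<^sup>+x. ennreal ((cmod (u (x + (- w)) - u x))\<^sup>2) \<partial>lborel) \<partial>lborel)"
      by (intro nn_integral_cong) (simp add: nn_integral_cmult)
    also have "\<dots> <= (\<integral>\<^sup>+w. ennreal (r w) * ennreal (e\<^sup>2) \<partial>lborel)"
    proof (rule nn_integral_mono)
      fix w
      show "ennreal (r w) * (\<integral>\<^sup>+x. ennreal ((cmod (u (x + (- w)) - u x))\<^sup>2) \<partial>lborel) <= ennreal (r w) * ennreal (e\<^sup>2)"
      proof (cases "r w = 0")
        case False
        have "norm (- w) <= norm c + dist w c" using norm_triangle_ineq2[of w c] by (simp add: dist_norm)
        then have "norm (- w) < d" using supp[OF False] cs by linarith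
        then show ?thesis by (intro mult_left_mono d) auto
      qed simp
    qed
    also have "\<dots> = ennreal (e\<^sup>2)" using rnn by (simp add: nn_integral_multc)
    finally have le: "(\<integral>\<^sup>+x. ennreal ((cmod ((conv u ?\<rho> - u) x))\<^sup>2) \<partial>lborel) <= ennreal (e\<^sup>2)" .
    have md: "conv u ?\<rho> - u \<in> borel_measurable lborel" unfolding fun_diff_def by measurable
    note nn = L2_norm_le_nn[OF md le less_imp_le[OF e]]
    have "conv u ?\<rho> - u + u \<in> L2 lborel" by (intro L2_add nn u)
    moreover have "conv u ?\<rho> - u + u = conv u ?\<rho>" by (simp add: fun_eq_iff)
    ultimately show ?thesis by (intro conjI nn(2)) (simp only:)
  qed
  then show ?thesis using d(1) by blast
qed

definition extend0 :: "'a set => ('a => complex) => 'a => complex" where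
  "extend0 W u x = (if x \<in> W then u x else 0)"

lemma integral_leb_on: "open W ==> (\<integral>x. f x \<partial>leb_on W) = (\<integral>x. extend0 W f x \<partial>lborel)" for f :: "'a::euclidean_space => complex"
  by (subst integral_restrict_space) (auto intro!: Bochner_Integration.integral_cong simp: extend0_def)

lemma nn_integral_leb_on: "open W ==> (\<integral>\<^sup>+x. f x \<partial>leb_on W) = (\<integral>\<^sup>+x. f x * indicator W x \<partial>lborel)" for W :: "'a::euclidean_space set"
  by (subst nn_integral_restrict_space) auto

lemma measurable_leb_on: "open W ==> f \<in> borel_measurable (leb_on W) \<longleftrightarrow> extend0 W f \<in> borel_measurable borel" for f :: "'a::euclidean_space => complex"
proof -
  assume o: "open W"
  have "(%x. indicator W x *\<^sub>R f x) = extend0 W f" by (auto simp: extend0_def fun_eq_iff)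
  then show ?thesis using o by (subst borel_measurable_restrict_space_iff) auto
qed

lemma L2_leb_on: "open W ==> f \<in> L2 (leb_on W) \<longleftrightarrow> extend0 W f \<in> L2 lborel"
  and L2_norm_leb_on: "open W ==> norm_on W f = L2_norm lborel (extend0 W f)"
proof -
  assume o: "open W"
  have eq: "(\<integral>\<^sup>+x. ennreal ((cmod (f x))\<^sup>2) \<partial>leb_on W) = (\<integral>\<^sup>+x. ennreal ((cmod (extend0 W f x))\<^sup>2) \<partial>lborel)"
    unfolding nn_integral_leb_on[OF o] by (intro nn_integral_cong) (auto simp: extend0_def)
  then show "f \<in> L2 (leb_on W) \<longleftrightarrow> extend0 W f \<in> L2 lborel"
    using measurable_leb_on[OF o] by (auto simp: L2_iff_nn)
  have "(\<integral>x. (cmod (f x))\<^sup>2 \<partial>leb_on W) = (\<integral>x. indicator W x *\<^sub>R (cmod (f x))\<^sup>2 \<partial>lborel)"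
    using o by (subst integral_restrict_space) auto
  also have "\<dots> = (\<integral>x. (cmod (extend0 W f x))\<^sup>2 \<partial>lborel)"
    by (intro Bochner_Integration.integral_cong) (auto simp: extend0_def)
  finally show "norm_on W f = L2_norm lborel (extend0 W f)" by (simp add: L2_norm_def)
qed

lemma L2_restrict:
  assumes o: "open W" and f: "f \<in> L2 lborel"
  shows "f \<in> L2 (leb_on W)" "norm_on W f <= L2_norm lborel f"
proof -
  have [measurable]: "f \<in> borel_measurable borel" "W \<in> sets borel" using L2_measurable[OF f] o by auto
  have "extend0 W f \<in> borel_measurable lborel" unfolding extend0_def[abs_def] by measurable
  moreover have "(\<integral>\<^sup>+x. ennreal ((cmod (extend0 W f x))\<^sup>2) \<partial>lborel) <= (\<integral>\<^sup>+x. ennreal ((cmod (f x))\<^sup>2) \<partial>lborel)"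
    by (intro nn_integral_mono) (auto simp: extend0_def)
  ultimately show "f \<in> L2 (leb_on W)" "norm_on W f <= L2_norm lborel f"
    unfolding L2_leb_on[OF o] L2_norm_leb_on[OF o] nn_integral_L2[OF f] by (auto intro: L2_norm_le_nn)
qed

section \<open>Weak derivatives\<close>

lemma extend0_L2_product:
  assumes o: "open W" and u: "u \<in> L2 (leb_on W)" and \<phi>: "\<phi> \<in> L2 lborel"
  shows "integrable (leb_on W) (%x. u x * \<phi> x)"
  using integrable_L2_product(2)[OF u L2_restrict(1)[OF o \<phi>]] .

lemma leb_on_UNIV: "leb_on UNIV = lborel"
  by (rule measure_eqI) (auto simp: sets_restrict_space emeasure_restrict_space)

lemma has_weak_deriv_restrict:
  fixes W :: "'a::euclidean_space set"
  assumes o: "open W" and g: "has_weak_deriv UNIV e u g"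
  shows "has_weak_deriv W e u g"
  unfolding has_weak_deriv_def
proof (intro conjI ballI)
  show "g \<in> L2 (leb_on W)" using g by (intro L2_restrict(1) o) (simp add: has_weak_deriv_def leb_on_UNIV)
  fix \<psi> assume "\<psi> \<in> Cc_infty W"
  then have \<psi>: "test_fun \<psi>" and supp: "closure {x. \<psi> x \<noteq> 0} \<subseteq> W" by (auto simp: Cc_infty_iff)
  have z0: "\<psi> x = 0" if "x \<notin> closure {x. \<psi> x \<noteq> 0}" for x
    using that subsetD[OF closure_subset, of x "{x. \<psi> x \<noteq> 0}"] by auto
  have z: "\<psi> x = 0" if "x \<notin> W" for x using that supp z0 by (meson subsetD)
  have dz: "pderiv_dir e \<psi> x = 0" if "x \<notin> W" for x
  proof -
    have "(\<psi> has_derivative (%h. 0)) (at x)"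
    proof (rule has_derivative_transform_within_open[OF has_derivative_const])
      show "x \<in> - closure {x. \<psi> x \<noteq> 0}" using that supp by (meson ComplI subsetD)
      show "open (- closure {x. \<psi> x \<noteq> 0})" by (intro open_Compl closed_closure)
      show "0 = \<psi> y" if "y \<in> - closure {x. \<psi> x \<noteq> 0}" for y using z0[of y] that by (metis ComplD)
    qed
    then show ?thesis by (rule pderiv_dirI)
  qed
  have "extend0 W (%x. u x * pderiv_dir e \<psi> x) = (%x. u x * pderiv_dir e \<psi> x)"
    "extend0 W (%x. g x * \<psi> x) = (%x. g x * \<psi> x)"
    using z dz by (auto simp: extend0_def fun_eq_iff)
  then show "(\<integral>x. u x * pderiv_dir e \<psi> x \<partial>leb_on W) = - (\<integral>x. g x * \<psi> x \<partial>leb_on W)"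
    using g \<psi> by (simp add: integral_leb_on[OF o] has_weak_deriv_def leb_on_UNIV Cc_infty_UNIV)
qed

lemma has_weak_deriv_smooth:
  assumes o: "open W" and \<phi>: "test_fun \<phi>" and e: "e \<in> Basis"
  shows "has_weak_deriv W e \<phi> (pderiv_dir e \<phi>)"
proof (rule has_weak_deriv_restrict[OF o])
  show "has_weak_deriv UNIV e \<phi> (pderiv_dir e \<phi>)"
    using test_fun_L2[OF test_fun_pderiv[OF \<phi> e]] integration_by_parts[OF test_fun_smooth[OF \<phi>] _ e]
    by (simp add: has_weak_deriv_def leb_on_UNIV Cc_infty_UNIV)
qed

lemma has_weak_deriv_add:
  assumes o: "open W" and e: "e \<in> Basis" and uv: "u \<in> L2 (leb_on W)" "v \<in> L2 (leb_on W)"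
    and g: "has_weak_deriv W e u g" and h: "has_weak_deriv W e v h"
  shows "has_weak_deriv W e (u + v) (g + h)"
  unfolding has_weak_deriv_def
proof (intro conjI ballI)
  have L: "g \<in> L2 (leb_on W)" "h \<in> L2 (leb_on W)" using g h by (auto simp: has_weak_deriv_def)
  then show "g + h \<in> L2 (leb_on W)" by (rule L2_add)
  fix \<psi> assume \<psi>: "\<psi> \<in> Cc_infty W"
  then have t: "test_fun \<psi>" "test_fun (pderiv_dir e \<psi>)" using e by (auto simp: Cc_infty_iff intro: test_fun_pderiv)
  note i = extend0_L2_product[OF o uv(1) test_fun_L2[OF t(2)]] extend0_L2_product[OF o uv(2) test_fun_L2[OF t(2)]]
     extend0_L2_product[OF o L(1) test_fun_L2[OF t(1)]] extend0_L2_product[OF o L(2) test_fun_L2[OF t(1)]]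
  show "(\<integral>x. (u + v) x * pderiv_dir e \<psi> x \<partial>leb_on W) = - (\<integral>x. (g + h) x * \<psi> x \<partial>leb_on W)"
    using g h \<psi> i by (simp add: has_weak_deriv_def distrib_right)
qed

lemma has_weak_deriv_scale:
  assumes g: "has_weak_deriv W e u g"
  shows "has_weak_deriv W e (fscale c u) (fscale c g)"
  using g by (auto simp: has_weak_deriv_def mult.assoc intro: L2_fscale)

lemma has_weak_deriv_diff:
  assumes "open W" "e \<in> Basis" "u \<in> L2 (leb_on W)" "v \<in> L2 (leb_on W)"
    "has_weak_deriv W e u g" "has_weak_deriv W e v h"
  shows "has_weak_deriv W e (u - v) (g - h)"
proof -
  have "has_weak_deriv W e (u + fscale (-1) v) (g + fscale (-1) h)"
    using assms by (intro has_weak_deriv_add has_weak_deriv_scale L2_fscale)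
  moreover have "u + fscale (-1) v = u - v" "g + fscale (-1) h = g - h" by (auto simp: fun_eq_iff)
  ultimately show ?thesis by simp
qed

text \<open>
  A domain that is mapped strictly into itself by small translations, as a set above or below a
  Lipschitz graph. For such domains a mollifier with shifted center commutes with weak derivatives
  up to the boundary.
\<close>

locale admissible =
  fixes W :: "'a::euclidean_space set"
  assumes op: "open W"
    and shrink: "\<And>d. d > 0 ==> \<exists>c s. s > 0 \<and> norm c + s < d \<and> (\<forall>x\<in>W. \<forall>y. dist y (x - c) <= s \<longrightarrow> y \<in> W)"
begin

lemma good_mollifier:
  assumes d: "d > 0"
  obtains c s r where "mollifier c s r" "norm c + s < d" "\<And>x. x \<in> W ==> (%z. complex_of_real (r (x - z))) \<in> Cc_infty W"
proof -
  obtain c s where cs: "s > 0" "norm c + s < d" "\<And>x y. x \<in> W ==> dist y (x - c) <= s ==> y \<in> W" using shrink[OF d] by blast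
  obtain r where r: "mollifier c s r" using mollifier_exists[OF cs(1)] by blast
  have "(%z. complex_of_real (r (x - z))) \<in> Cc_infty W" if x: "x \<in> W" for x
    unfolding Cc_infty_iff
  proof
    have "test_fun (%x. complex_of_real (r x))" using r by (simp add: mollifier_def)
    from test_fun_affine[OF this, of "-1" x] show "test_fun (%z. complex_of_real (r (x - z)))" by simp
    have "{z. complex_of_real (r (x - z)) \<noteq> 0} \<subseteq> cball (x - c) s"
    proof
      fix z assume "z \<in> {z. complex_of_real (r (x - z)) \<noteq> 0}"
      then have "dist (x - z) c <= s" using r by (auto simp: mollifier_def)
      then show "z \<in> cball (x - c) s" by (simp add: dist_norm algebra_simps)
    qed
    then have "closure {z. complex_of_real (r (x - z)) \<noteq> 0} \<subseteq> cball (x - c) s" by (simp add: closure_minimal)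
    also have "\<dots> \<subseteq> W" using cs(3)[OF x] by (auto simp: dist_commute)
    finally show "closure {z. complex_of_real (r (x - z)) \<noteq> 0} \<subseteq> W" .
  qed
  then show thesis using that r cs(2) by blast
qed

lemma weak_conv:
  assumes m: "mollifier c s r" "(%z. complex_of_real (r (x - z))) \<in> Cc_infty W"
    and g: "has_weak_deriv W e u g" and e: "e \<in> Basis"
  shows "conv (extend0 W u) (pderiv_dir e (%x. complex_of_real (r x))) x = conv (extend0 W g) (%x. complex_of_real (r x)) x"
proof -
  let ?\<rho> = "%x. complex_of_real (r x)"
  have sm: "smooth ?\<rho>" using m(1) by (simp add: mollifier_def test_fun_def)
  have d: "pderiv_dir e (%z. ?\<rho> (x - z)) z = - pderiv_dir e ?\<rho> (x - z)" for z
    using pderiv_dir_affine[OF sm, where e = e and a = x and s = "-1" and x = z] by simp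
  have "(\<integral>z. u z * pderiv_dir e (%z. ?\<rho> (x - z)) z \<partial>leb_on W) = - (\<integral>z. g z * ?\<rho> (x - z) \<partial>leb_on W)"
    using g m(2) by (auto simp: has_weak_deriv_def)
  then have "(\<integral>z. u z * pderiv_dir e ?\<rho> (x - z) \<partial>leb_on W) = (\<integral>z. g z * ?\<rho> (x - z) \<partial>leb_on W)"
    by (simp add: d)
  moreover have "extend0 W (%z. h z * k z) = (%z. extend0 W h z * k z)" for h k :: "'a => complex"
    by (auto simp: extend0_def)
  ultimately show ?thesis by (simp add: conv_def integral_leb_on[OF op])
qed

lemma test_orthogonal_zero:
  assumes d: "d \<in> L2 (leb_on W)" and orth: "\<And>\<phi>. \<phi> \<in> Cc_infty W ==> (\<integral>x. d x * \<phi> x \<partial>leb_on W) = 0"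
  shows "AE x in leb_on W. d x = 0"
proof -
  have dL: "extend0 W d \<in> L2 lborel" using d by (simp add: L2_leb_on[OF op])
  have "norm_on W d <= e" if e: "e > 0" for e
  proof -
    obtain \<delta> where \<delta>: "\<delta> > 0" "\<And>c s r. mollifier c s r ==> norm c + s < \<delta> ==>
       conv (extend0 W d) (%x. of_real (r x)) \<in> L2 lborel \<and> L2_norm lborel (conv (extend0 W d) (%x. of_real (r x)) - extend0 W d) <= e"
      using mollifier_approx[OF dL e] by blast
    obtain c s r where m: "mollifier c s r" "norm c + s < \<delta>" "\<And>x. x \<in> W ==> (%z. complex_of_real (r (x - z))) \<in> Cc_infty W"
      using good_mollifier[OF \<delta>(1)] by blast
    let ?C = "conv (extend0 W d) (%x. of_real (r x))"
    have C0: "?C x = 0" if "x \<in> W" for x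
    proof -
      have "extend0 W (%z. d z * complex_of_real (r (x - z))) = (%z. extend0 W d z * complex_of_real (r (x - z)))"
        by (auto simp: extend0_def)
      then show ?thesis using orth[OF m(3)[OF that]] by (simp add: conv_def integral_leb_on[OF op])
    qed
    have L: "?C - extend0 W d \<in> L2 lborel" using \<delta>(2)[OF m(1,2)] by (intro L2.V_closed(3) dL) auto
    have "norm_on W d = norm_on W (?C - extend0 W d)"
      unfolding L2_norm_leb_on[OF op] L2_norm_def using C0
      by (intro arg_cong[where f = sqrt] Bochner_Integration.integral_cong) (auto simp: extend0_def space_restrict_space)
    also have "\<dots> <= L2_norm lborel (?C - extend0 W d)" by (rule L2_restrict(2)[OF op L])
    also have "\<dots> <= e" using \<delta>(2)[OF m(1,2)] by simp
    finally show ?thesis .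
  qed
  then have "norm_on W d <= 0" by (rule field_le_epsilon) (simp add: add.commute)
  then have "norm_on W d = 0" using L2_norm_nonneg[of "leb_on W" d] by linarith
  then show ?thesis using L2_norm_zero_iff[OF d] by simp
qed

lemma weak_deriv_unique:
  assumes g: "has_weak_deriv W e u g" and h: "has_weak_deriv W e u h"
  shows "AE x in leb_on W. g x = h x"
proof -
  have L: "g \<in> L2 (leb_on W)" "h \<in> L2 (leb_on W)" using g h by (auto simp: has_weak_deriv_def)
  have "AE x in leb_on W. (g - h) x = 0"
  proof (rule test_orthogonal_zero)
    show "g - h \<in> L2 (leb_on W)" by (intro L2.V_closed(3) L)
    fix \<phi> assume \<phi>: "\<phi> \<in> Cc_infty W"
    then have "\<phi> \<in> L2 lborel" by (auto simp: Cc_infty_iff intro: test_fun_L2)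
    note i = extend0_L2_product[OF op L(1) this] extend0_L2_product[OF op L(2) this]
    have "(\<integral>x. g x * \<phi> x \<partial>leb_on W) = (\<integral>x. h x * \<phi> x \<partial>leb_on W)"
      using g h \<phi> unfolding has_weak_deriv_def by (metis neg_equal_iff_equal)
    then show "(\<integral>x. (g - h) x * \<phi> x \<partial>leb_on W) = 0" using i by (simp add: left_diff_distrib)
  qed
  then show ?thesis by simp
qed

lemma H1_L2: "u \<in> H1 W ==> u \<in> L2 (leb_on W)" by (simp add: H1_def)

lemma weak_deriv_works: "u \<in> H1 W ==> e \<in> Basis ==> has_weak_deriv W e u (weak_deriv W e u)"
  unfolding weak_deriv_def H1_def using someI_ex[of "has_weak_deriv W e u"] by auto

lemma weak_deriv_L2: "u \<in> H1 W ==> e \<in> Basis ==> weak_deriv W e u \<in> L2 (leb_on W)"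
  using weak_deriv_works by (auto simp: has_weak_deriv_def)

lemma weak_deriv_eq:
  assumes "has_weak_deriv W e u g" shows "AE x in leb_on W. weak_deriv W e u x = g x"
  using weak_deriv_unique[OF _ assms] assms unfolding weak_deriv_def by (metis someI_ex)

lemma H1_I: "u \<in> L2 (leb_on W) ==> (\<And>e. e \<in> Basis ==> has_weak_deriv W e u (g e)) ==> u \<in> H1 W"
  by (auto simp: H1_def)

lemma test_fun_H1: "test_fun \<phi> ==> \<phi> \<in> H1 W"
  by (rule H1_I[where g = "%e. pderiv_dir e \<phi>"]) (auto intro: L2_restrict op test_fun_L2 has_weak_deriv_smooth)

lemma subspace_H1: "fun_space.subspace (H1 W)"
  unfolding fun_space.subspace_def
proof (intro conjI ballI allI)
  show "0 \<in> H1 W"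
    by (rule H1_I[where g = "%e. 0"]) (auto simp: L2_zero has_weak_deriv_def)
  show "u + v \<in> H1 W" if "u \<in> H1 W" "v \<in> H1 W" for u v
    by (rule H1_I[where g = "%e. weak_deriv W e u + weak_deriv W e v"])
      (intro L2_add H1_L2 that, intro has_weak_deriv_add op weak_deriv_works H1_L2 that)
  show "fscale c u \<in> H1 W" if "u \<in> H1 W" for c u
    by (rule H1_I[where g = "%e. fscale c (weak_deriv W e u)"])
      (intro L2_fscale H1_L2 that, intro has_weak_deriv_scale weak_deriv_works that)
qed

lemma H1_closed: "u \<in> H1 W ==> v \<in> H1 W ==> u + v \<in> H1 W" "u \<in> H1 W ==> fscale c u \<in> H1 W"
  "u \<in> H1 W ==> v \<in> H1 W ==> u - v \<in> H1 W"
  using subspace_H1 by (auto intro: fun_space.subspace_add fun_space.subspace_scale fun_space.subspace_diff)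

lemma weak_deriv_add: "u \<in> H1 W ==> v \<in> H1 W ==> e \<in> Basis ==>
   AE x in leb_on W. weak_deriv W e (u + v) x = (weak_deriv W e u + weak_deriv W e v) x"
  by (intro weak_deriv_eq has_weak_deriv_add op H1_L2 weak_deriv_works)

lemma weak_deriv_diff: "u \<in> H1 W ==> v \<in> H1 W ==> e \<in> Basis ==>
   AE x in leb_on W. weak_deriv W e (u - v) x = (weak_deriv W e u - weak_deriv W e v) x"
  by (intro weak_deriv_eq has_weak_deriv_diff op H1_L2 weak_deriv_works)

lemma weak_deriv_scale: "u \<in> H1 W ==> e \<in> Basis ==>
   AE x in leb_on W. weak_deriv W e (fscale c u) x = fscale c (weak_deriv W e u) x"
  by (intro weak_deriv_eq has_weak_deriv_scale weak_deriv_works)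

lemma weak_deriv_test: "test_fun \<phi> ==> e \<in> Basis ==> AE x in leb_on W. weak_deriv W e \<phi> x = pderiv_dir e \<phi> x"
  by (intro weak_deriv_eq has_weak_deriv_smooth op)

end

definition cutoff :: "nat => 'a::euclidean_space => complex" where
  "cutoff n x = of_real (bump (0 + (1 / real (Suc n)) *\<^sub>R x)) * of_real (1 / bump (0::'a))"

lemma test_fun_cutoff: "test_fun (cutoff n)"
  unfolding cutoff_def[abs_def] by (intro test_fun_mult test_fun_affine[OF test_fun_bump] smooth_const) auto

lemma cutoff_bounds:
  obtains B where "B > 0" "\<And>n x. cmod (cutoff n (x::'a::euclidean_space)) <= B"
    "\<And>n e x. e \<in> Basis ==> cmod (pderiv_dir e (cutoff n) (x::'a)) <= B / real (Suc n)"
proof -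
  let ?b = "%x::'a. complex_of_real (bump x)" and ?z = "1 / bump (0::'a)"
  have z: "?z > 0" using bump_0 by simp
  obtain B1 where B1: "B1 > 0" "\<And>x. cmod (?b x) <= B1" using test_fun_bounded[OF test_fun_bump] by blast
  obtain L where L: "L > 0" "\<And>x h. cmod (frechet_derivative ?b (at x) h) <= L * norm h"
    "\<And>x h. cmod (?b (x + h) - ?b x) <= L * norm h" by (rule test_fun_Lipschitz[OF test_fun_bump], rule that)
  have b1: "cmod (cutoff n x) <= (B1 + L) * ?z" for n and x :: 'a
  proof -
    have "cmod (cutoff n x) = cmod (?b (0 + (1 / real (Suc n)) *\<^sub>R x)) * ?z" using z by (simp only: cutoff_def norm_mult norm_of_real; simp)
    also have "\<dots> <= (B1 + L) * ?z" using B1(2)[of "0 + (1 / real (Suc n)) *\<^sub>R x"] L(1) z by (intro mult_right_mono) auto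
    finally show ?thesis .
  qed
  have "cmod (pderiv_dir e (cutoff n) x) <= (B1 + L) * ?z / real (Suc n)" if e: "e \<in> Basis" for n and e x :: 'a
  proof -
    let ?f = "%x. ?b (0 + (1 / real (Suc n)) *\<^sub>R x)"
    have sf: "smooth ?f" by (intro smooth_affine smooth_bump)
    have "pderiv_dir e (cutoff n) x = pderiv_dir e ?f x * of_real ?z + ?f x * pderiv_dir e (%x. of_real ?z) x"
      unfolding cutoff_def[abs_def] by (rule pderiv_dir_mult[OF sf smooth_const])
    also have "pderiv_dir e (%x::'a. complex_of_real ?z) x = 0" by (rule pderiv_dirI) simp
    also have "pderiv_dir e ?f x = of_real (1 / real (Suc n)) * pderiv_dir e ?b (0 + (1 / real (Suc n)) *\<^sub>R x)"
      by (rule pderiv_dir_affine[OF smooth_bump])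
    finally have "cmod (pderiv_dir e (cutoff n) x) = (1 / real (Suc n)) * cmod (pderiv_dir e ?b (0 + (1 / real (Suc n)) *\<^sub>R x)) * ?z"
      using z by (simp only: mult_zero_right add_0_right norm_mult norm_of_real; simp)
    also have "\<dots> <= (1 / real (Suc n)) * (B1 + L) * ?z"
      using L(2)[of "0 + (1 / real (Suc n)) *\<^sub>R x" e] e z B1(1) by (intro mult_right_mono mult_left_mono) auto
    finally show ?thesis by (simp add: mult.commute)
  qed
  moreover have "(B1 + L) * ?z > 0" using B1 L z by simp
  ultimately show thesis using b1 that by blast
qed

lemma cutoff_tendsto: "(%n. cutoff n (x::'a::euclidean_space)) \<longlonglongrightarrow> 1"
proof -
  have "(%n. (1 / real (Suc n)) *\<^sub>R x) \<longlonglongrightarrow> 0 *\<^sub>R x"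
    using LIMSEQ_inverse_real_of_nat by (intro tendsto_scaleR tendsto_const) (simp add: inverse_eq_divide)
  then have "(%n. 0 + (1 / real (Suc n)) *\<^sub>R x) \<longlonglongrightarrow> 0" by simp
  moreover have "isCont (%x::'a. complex_of_real (bump x)) 0"
    using smooth_continuous[OF smooth_bump, of UNIV] unfolding continuous_on_eq_continuous_at[OF open_UNIV] by blast
  ultimately have "(%n. complex_of_real (bump (0 + (1 / real (Suc n)) *\<^sub>R x))) \<longlonglongrightarrow> complex_of_real (bump (0::'a))"
    using isCont_tendsto_compose by blast
  then have "(%n. cutoff n x) \<longlonglongrightarrow> complex_of_real (bump (0::'a)) * of_real (1 / bump (0::'a))"
    unfolding cutoff_def by (intro tendsto_mult tendsto_const)
  moreover have "complex_of_real (bump (0::'a)) * of_real (1 / bump (0::'a)) = 1" using bump_0[where 'a = 'a] by simp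
  ultimately show ?thesis by simp
qed

lemma L2_bounded_mult:
  assumes f: "f \<in> L2 M" and [measurable]: "h \<in> borel_measurable M" and B: "\<And>x. cmod (h x) <= B" "B \<ge> 0"
  shows "(%x. h x * f x) \<in> L2 M" "L2_norm M (%x. h x * f x) <= B * L2_norm M f"
proof -
  note [measurable] = L2_measurable[OF f]
  have "(\<integral>\<^sup>+x. ennreal ((cmod (h x * f x))\<^sup>2) \<partial>M) <= (\<integral>\<^sup>+x. ennreal (B\<^sup>2) * ennreal ((cmod (f x))\<^sup>2) \<partial>M)"
  proof (rule nn_integral_mono)
    fix x
    have "(cmod (h x * f x))\<^sup>2 <= B\<^sup>2 * (cmod (f x))\<^sup>2"
      using B by (auto simp: norm_mult power_mult_distrib intro!: mult_right_mono power_mono)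
    then show "ennreal ((cmod (h x * f x))\<^sup>2) <= ennreal (B\<^sup>2) * ennreal ((cmod (f x))\<^sup>2)"
      by (simp add: ennreal_leI ennreal_mult[symmetric])
  qed
  also have "\<dots> = ennreal (B\<^sup>2) * ennreal ((L2_norm M f)\<^sup>2)"
    by (subst nn_integral_cmult) (auto simp: nn_integral_L2[OF f])
  also have "\<dots> = ennreal ((B * L2_norm M f)\<^sup>2)" by (simp add: ennreal_mult power_mult_distrib)
  finally have le: "(\<integral>\<^sup>+x. ennreal ((cmod (h x * f x))\<^sup>2) \<partial>M) <= ennreal ((B * L2_norm M f)\<^sup>2)" .
  have m: "(%x. h x * f x) \<in> borel_measurable M" by measurable
  show "(%x. h x * f x) \<in> L2 M" "L2_norm M (%x. h x * f x) <= B * L2_norm M f"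
    using L2_norm_le_nn[OF m le] B by auto
qed

lemma cutoff_L2:
  fixes f :: "'a::euclidean_space => complex"
  assumes f: "f \<in> L2 lborel"
  shows "(%n. L2_norm lborel (%x. cutoff n x * f x - f x)) \<longlonglongrightarrow> 0"
proof -
  note [measurable] = L2_measurable[OF f] test_fun_measurable[OF test_fun_cutoff]
  obtain B where B: "B > 0" "\<And>n x. cmod (cutoff n (x::'a)) <= B" using cutoff_bounds[where 'a = 'a] by metis
  have "(%n. \<integral>x. (cmod (cutoff n x * f x - f x))\<^sup>2 \<partial>lborel) \<longlonglongrightarrow> integral\<^sup>L lborel (%x::'a. 0::real)"
  proof (rule integral_dominated_convergence)
    show "integrable lborel (%x. (B + 1)\<^sup>2 * (cmod (f x))\<^sup>2)" by (intro integrable_mult_right L2_integrable f)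
    show "AE x in lborel. (%n. (cmod (cutoff n x * f x - f x))\<^sup>2) \<longlonglongrightarrow> 0"
    proof (rule AE_I2)
      fix x
      have "(%n. (cmod (cutoff n x * f x - f x))\<^sup>2) \<longlonglongrightarrow> (cmod (1 * f x - f x))\<^sup>2"
        by (intro tendsto_intros cutoff_tendsto)
      then show "(%n. (cmod (cutoff n x * f x - f x))\<^sup>2) \<longlonglongrightarrow> 0" by simp
    qed
    show "AE x in lborel. norm ((cmod (cutoff n x * f x - f x))\<^sup>2) <= (B + 1)\<^sup>2 * (cmod (f x))\<^sup>2" for n
    proof (rule AE_I2)
      fix x
      have "cutoff n x * f x - f x = (cutoff n x - 1) * f x" by (simp add: algebra_simps)
      moreover have "cmod (cutoff n x - 1) <= B + 1" using norm_triangle_ineq4[of "cutoff n x" 1] B(2)[of n x] by simp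
      ultimately show "norm ((cmod (cutoff n x * f x - f x))\<^sup>2) <= (B + 1)\<^sup>2 * (cmod (f x))\<^sup>2"
        by (auto simp: norm_mult power_mult_distrib intro!: mult_right_mono power_mono)
    qed
  qed measurable
  then have "(%n. sqrt (\<integral>x. (cmod (cutoff n x * f x - f x))\<^sup>2 \<partial>lborel)) \<longlonglongrightarrow> sqrt 0"
    by (intro tendsto_real_sqrt) simp
  then show ?thesis by (simp add: L2_norm_def)
qed

section \<open>Density of test functions\<close>

lemma L2_norm_triangle: "f \<in> L2 M ==> g \<in> L2 M ==> L2_norm M (f + g) <= L2_norm M f + L2_norm M g"
  using L2.N_triangle[of f M g] by simp

context admissible begin

text \<open>
  On the domain, convolving the extension by zero with a mollifier from \<open>good_mollifier\<close> commutes
  with weak derivatives (\<open>weak_conv\<close>); a cutoff then makes the support bounded.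
\<close>

lemma smooth_approximation:
  assumes u: "u \<in> H1 W" and e: "\<epsilon> > 0"
  shows "\<exists>\<phi>. test_fun \<phi> \<and> norm_on W (\<phi> - u) < \<epsilon> \<and>
     (\<forall>e\<in>Basis. norm_on W (pderiv_dir e \<phi> - weak_deriv W e u) < \<epsilon>)"
proof -
  let ?E = "extend0 W"
  define g where "g e = weak_deriv W e u" for e
  have g: "has_weak_deriv W e u (g e)" "?E (g e) \<in> L2 lborel" "g e \<in> L2 (leb_on W)" if "e \<in> Basis" for e
    using weak_deriv_works[OF u that] weak_deriv_L2[OF u that] by (auto simp: g_def L2_leb_on[OF op])
  have uL: "?E u \<in> L2 lborel" "u \<in> L2 (leb_on W)" using H1_L2[OF u] by (auto simp: L2_leb_on[OF op])
  define \<eta> where "\<eta> = \<epsilon> / 4"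
  have eta: "\<eta> > 0" using e by (simp add: \<eta>_def)
  have "\<exists>d>0. \<forall>c s r. mollifier c s r \<and> norm c + s < d \<longrightarrow>
     conv f (%x. of_real (r x)) \<in> L2 lborel \<and> L2_norm lborel (conv f (%x. of_real (r x)) - f) <= \<eta>" if "f \<in> L2 lborel" for f :: "'a => complex"
    by (rule mollifier_approx[OF that eta])
  then obtain d where d: "\<And>f::'a => complex. f \<in> L2 lborel ==> d f > 0" "\<And>f c s r. f \<in> L2 lborel ==> mollifier c s r ==> norm c + s < d f ==>
     conv f (%x. of_real (r x)) \<in> L2 lborel \<and> L2_norm lborel (conv f (%x. of_real (r x)) - f) <= \<eta>"
    by metis
  define \<delta> where "\<delta> = Min (insert (d (?E u)) ((%e. d (?E (g e))) ` Basis))"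
  have delta: "\<delta> > 0" "\<delta> <= d (?E u)" "\<And>e. e \<in> Basis ==> \<delta> <= d (?E (g e))"
  proof -
    show "\<delta> > 0" unfolding \<delta>_def using d(1)[OF uL(1)] d(1)[OF g(2)] by (subst Min_gr_iff) auto
    show "\<delta> <= d (?E u)" unfolding \<delta>_def by (intro Min_le) auto
    show "\<delta> <= d (?E (g e))" if "e \<in> Basis" for e unfolding \<delta>_def using that by (intro Min_le) auto
  qed
  obtain c s r where m: "mollifier c s r" "norm c + s < \<delta>" "\<And>x. x \<in> W ==> (%z. complex_of_real (r (x - z))) \<in> Cc_infty W"
    using good_mollifier[OF delta(1)] by blast
  let ?\<rho> = "%x. complex_of_real (r x)"
  have tf: "test_fun ?\<rho>" using m(1) by (simp add: mollifier_def)
  define \<psi> where "\<psi> = conv (?E u) ?\<rho>"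
  define G where "G e = conv (?E (g e)) ?\<rho>" for e
  have psi: "\<psi> \<in> L2 lborel" "L2_norm lborel (\<psi> - ?E u) <= \<eta>" "smooth \<psi>"
    using d(2)[OF uL(1) m(1)] m(2) delta(2) smooth_conv[OF L2_locally_integrable[OF uL(1)] tf] by (auto simp: \<psi>_def)
  have G: "G e \<in> L2 lborel" "L2_norm lborel (G e - ?E (g e)) <= \<eta>" if "e \<in> Basis" for e
    using d(2)[OF g(2)[OF that] m(1)] m(2) delta(3)[OF that] by (auto simp: G_def)
  have pd: "pderiv_dir e \<psi> x = G e x" if "e \<in> Basis" "x \<in> W" for e x
    unfolding \<psi>_def G_def pderiv_dir_conv[OF L2_locally_integrable[OF uL(1)] tf that(1)]
    using weak_conv[OF m(1) m(3)[OF that(2)] g(1)[OF that(1)] that(1)] .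
  obtain B where B: "B > 0" "\<And>n x. cmod (cutoff n (x::'a)) <= B"
    "\<And>n e x. e \<in> Basis ==> cmod (pderiv_dir e (cutoff n) (x::'a)) <= B / real (Suc n)"
    by (rule cutoff_bounds, rule that)
  have "\<forall>\<^sub>F n in sequentially. L2_norm lborel (%x. cutoff n x * f x - f x) < \<eta>" if "f \<in> L2 lborel" for f :: "'a => complex"
    using cutoff_L2[OF that] eta by (rule order_tendstoD)
  then have "\<forall>\<^sub>F n in sequentially. L2_norm lborel (%x. cutoff n x * \<psi> x - \<psi> x) < \<eta> \<and>
     (\<forall>e\<in>Basis. L2_norm lborel (%x. cutoff n x * G e x - G e x) < \<eta>)"
    using psi(1) G(1) by (intro eventually_conj eventually_ball_finite) auto
  moreover have "(%n. (B / real (Suc n)) * L2_norm lborel \<psi>) \<longlonglongrightarrow> 0"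
  proof -
    have "(%n. B * inverse (real (Suc n)) * L2_norm lborel \<psi>) \<longlonglongrightarrow> B * 0 * L2_norm lborel \<psi>"
      by (intro tendsto_intros LIMSEQ_inverse_real_of_nat)
    then show ?thesis by (simp add: divide_inverse)
  qed
  then have "\<forall>\<^sub>F n in sequentially. (B / real (Suc n)) * L2_norm lborel \<psi> < \<eta>" using eta by (rule order_tendstoD)
  ultimately have "\<forall>\<^sub>F n in sequentially. (L2_norm lborel (%x. cutoff n x * \<psi> x - \<psi> x) < \<eta> \<and>
     (\<forall>e\<in>Basis. L2_norm lborel (%x. cutoff n x * G e x - G e x) < \<eta>)) \<and> (B / real (Suc n)) * L2_norm lborel \<psi> < \<eta>"
    by (rule eventually_conj)
  then obtain n where n: "L2_norm lborel (%x. cutoff n x * \<psi> x - \<psi> x) < \<eta>"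
     "\<And>e. e \<in> Basis ==> L2_norm lborel (%x. cutoff n x * G e x - G e x) < \<eta>" "(B / real (Suc n)) * L2_norm lborel \<psi> < \<eta>"
    unfolding eventually_sequentially by blast
  define \<phi> where "\<phi> x = cutoff n x * \<psi> x" for x
  have tphi: "test_fun \<phi>" unfolding \<phi>_def[abs_def] by (intro test_fun_mult test_fun_cutoff psi)
  note phiL = test_fun_L2[OF tphi]
  have local_le: "norm_on W f <= L2_norm lborel h" if "\<And>x. x \<in> W ==> f x = h x" "h \<in> L2 lborel" for f h :: "'a => complex"
  proof -
    have "norm_on W f = norm_on W h"
      unfolding L2_norm_def using that(1)
      by (intro arg_cong[where f = sqrt] Bochner_Integration.integral_cong) (auto simp: space_restrict_space)
    then show ?thesis using L2_restrict(2)[OF op that(2)] by simp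
  qed
  have "norm_on W (\<phi> - u) <= L2_norm lborel ((\<phi> - \<psi>) + (\<psi> - ?E u))"
  proof (rule local_le)
    show "(\<phi> - u) x = ((\<phi> - \<psi>) + (\<psi> - ?E u)) x" if "x \<in> W" for x using that by (simp add: extend0_def)
    show "(\<phi> - \<psi>) + (\<psi> - ?E u) \<in> L2 lborel" by (intro L2_add L2.V_closed(3) phiL psi uL)
  qed
  also have "\<dots> <= L2_norm lborel (\<phi> - \<psi>) + L2_norm lborel (\<psi> - ?E u)"
    by (intro L2_norm_triangle L2.V_closed(3) phiL psi uL)
  also have "\<phi> - \<psi> = (%x. cutoff n x * \<psi> x - \<psi> x)" by (simp add: \<phi>_def fun_eq_iff)
  also have "L2_norm lborel (%x. cutoff n x * \<psi> x - \<psi> x) + L2_norm lborel (\<psi> - ?E u) < \<epsilon>"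
    using n(1) psi(2) eta by (simp add: \<eta>_def)
  finally have 1: "norm_on W (\<phi> - u) < \<epsilon>" .
  have 2: "norm_on W (pderiv_dir e \<phi> - weak_deriv W e u) < \<epsilon>" if eB: "e \<in> Basis" for e
  proof -
    define h1 where "h1 x = pderiv_dir e (cutoff n) x * \<psi> x" for x
    define h2 where "h2 x = cutoff n x * G e x - G e x" for x
    have hm: "pderiv_dir e (cutoff n) \<in> borel_measurable lborel"
      using test_fun_measurable[OF test_fun_pderiv[OF test_fun_cutoff eB]] by simp
    have h1: "h1 \<in> L2 lborel" "L2_norm lborel h1 <= (B / real (Suc n)) * L2_norm lborel \<psi>"
      unfolding h1_def[abs_def] using L2_bounded_mult[OF psi(1) hm B(3)[OF eB]] B(1)
      by (simp_all del: of_nat_Suc)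
    have "(%x. cutoff n x * G e x) \<in> L2 lborel"
      using B(1,2) by (intro L2_bounded_mult(1)[where B = B] G eB) (auto intro: test_fun_measurable test_fun_cutoff)
    then have "(%x. cutoff n x * G e x) - G e \<in> L2 lborel" by (intro L2.V_closed(3) G eB)
    moreover have "(%x. cutoff n x * G e x) - G e = h2" by (simp add: h2_def fun_eq_iff)
    ultimately have h2: "h2 \<in> L2 lborel" by simp
    have h3: "G e - ?E (g e) \<in> L2 lborel" by (intro L2.V_closed(3) G g eB)
    have "norm_on W (pderiv_dir e \<phi> - weak_deriv W e u) <= L2_norm lborel ((h1 + h2) + (G e - ?E (g e)))"
    proof (rule local_le)
      fix x assume x: "x \<in> W"
      have "pderiv_dir e \<phi> x = pderiv_dir e (cutoff n) x * \<psi> x + cutoff n x * pderiv_dir e \<psi> x"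
        unfolding \<phi>_def[abs_def] by (rule pderiv_dir_mult[OF test_fun_smooth[OF test_fun_cutoff] psi(3)])
      then show "(pderiv_dir e \<phi> - weak_deriv W e u) x = ((h1 + h2) + (G e - ?E (g e))) x"
        using x pd[OF eB x] by (simp add: h1_def h2_def extend0_def g_def)
    qed (intro L2_add h1 h2 h3)
    also have "\<dots> <= L2_norm lborel h1 + L2_norm lborel h2 + L2_norm lborel (G e - ?E (g e))"
      using L2_norm_triangle[OF L2_add[OF h1(1) h2] h3] L2_norm_triangle[OF h1(1) h2] by linarith
    also have "\<dots> < \<epsilon>"
    proof -
      have "\<epsilon> = 4 * \<eta>" by (simp add: \<eta>_def)
      then show ?thesis
        using h1(2) n(2)[OF eB] n(3) G(2)[OF eB] eta unfolding h2_def[abs_def] by linarith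
    qed
    finally show ?thesis .
  qed
  show ?thesis using tphi 1 2 by blast
qed

lemma H1_norm_test_diff:
  assumes "test_fun \<phi>" "u \<in> H1 W"
  shows "H1_norm W (%x. \<phi> x - u x) =
     sqrt ((norm_on W (\<phi> - u))\<^sup>2 + (\<Sum>e\<in>Basis. (norm_on W (pderiv_dir e \<phi> - weak_deriv W e u))\<^sup>2))"
proof -
  have eq: "(%x. \<phi> x - u x) = \<phi> - u" by (simp add: fun_eq_iff)
  have "norm_on W (weak_deriv W e (\<phi> - u)) = norm_on W (pderiv_dir e \<phi> - weak_deriv W e u)" if e: "e \<in> Basis" for e
  proof (rule L2_norm_cong_AE)
    have w: "has_weak_deriv W e (\<phi> - u) (pderiv_dir e \<phi> - weak_deriv W e u)"
      by (intro has_weak_deriv_diff op e has_weak_deriv_smooth weak_deriv_works assms H1_L2 test_fun_H1)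
    show "AE x in leb_on W. weak_deriv W e (\<phi> - u) x = (pderiv_dir e \<phi> - weak_deriv W e u) x"
      by (rule weak_deriv_eq[OF w])
    show "pderiv_dir e \<phi> - weak_deriv W e u \<in> borel_measurable (leb_on W)"
      using w by (auto simp: has_weak_deriv_def L2_def)
    show "weak_deriv W e (\<phi> - u) \<in> borel_measurable (leb_on W)"
      by (intro L2_measurable weak_deriv_L2 e H1_closed(3) test_fun_H1 assms)
  qed
  then show ?thesis by (simp add: H1_norm_def eq)
qed

lemma H1_approximating_sequence:
  assumes u: "u \<in> H1 W"
  shows "\<exists>\<phi>. (\<forall>k::nat. test_fun (\<phi> k)) \<and> (%k. H1_norm W (%x. \<phi> k x - u x)) \<longlonglongrightarrow> 0"
proof -
  have "\<forall>k::nat. \<exists>\<phi>. test_fun \<phi> \<and> norm_on W (\<phi> - u) < inverse (real (Suc k)) \<and>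
     (\<forall>e\<in>Basis. norm_on W (pderiv_dir e \<phi> - weak_deriv W e u) < inverse (real (Suc k)))"
    using smooth_approximation[OF u] by simp
  then obtain \<phi> where p: "\<And>k. test_fun (\<phi> k)" "\<And>k. norm_on W (\<phi> k - u) < inverse (real (Suc k))"
     "\<And>k e. e \<in> Basis ==> norm_on W (pderiv_dir e (\<phi> k) - weak_deriv W e u) < inverse (real (Suc k))" by metis
  have lim: "(%k. norm_on W (f k)) \<longlonglongrightarrow> 0" if "\<And>k. norm_on W (f k) < inverse (real (Suc k))" for f :: "nat => 'a => complex"
    by (rule tendsto_sandwich[OF _ _ tendsto_const LIMSEQ_inverse_real_of_nat]) (auto intro!: always_eventually less_imp_le that simp del: of_nat_Suc)
  have "(%k. sqrt ((norm_on W (\<phi> k - u))\<^sup>2 + (\<Sum>e\<in>Basis. (norm_on W (pderiv_dir e (\<phi> k) - weak_deriv W e u))\<^sup>2)))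
     \<longlonglongrightarrow> sqrt (0\<^sup>2 + (\<Sum>e\<in>(Basis::'a set). 0\<^sup>2))"
    by (intro tendsto_intros lim p)
  then show ?thesis using p(1) by (intro exI[of _ \<phi>]) (simp add: H1_norm_test_diff[OF p(1) u])
qed

lemma H1_approx_parts:
  assumes u: "u \<in> H1 W" and \<phi>: "\<And>k::nat. test_fun (\<phi> k)" and lim: "(%k. H1_norm W (%x. \<phi> k x - u x)) \<longlonglongrightarrow> 0"
  shows "(%k. norm_on W (\<phi> k - u)) \<longlonglongrightarrow> 0"
    "e \<in> Basis ==> (%k. norm_on W (pderiv_dir e (\<phi> k) - weak_deriv W e u)) \<longlonglongrightarrow> 0"
proof -
  have a: "norm_on W (\<phi> k - u) <= H1_norm W (%x. \<phi> k x - u x)" for k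
    unfolding H1_norm_test_diff[OF \<phi> u] by (intro real_le_rsqrt) (simp add: sum_nonneg)
  show "(%k. norm_on W (\<phi> k - u)) \<longlonglongrightarrow> 0"
    by (rule tendsto_sandwich[OF _ _ tendsto_const lim]) (auto simp: a)
  assume e: "e \<in> Basis"
  have b: "norm_on W (pderiv_dir e (\<phi> k) - weak_deriv W e u) <= H1_norm W (%x. \<phi> k x - u x)" for k
  proof -
    have "(norm_on W (pderiv_dir e (\<phi> k) - weak_deriv W e u))\<^sup>2 \<le>
      (\<Sum>e\<in>Basis. (norm_on W (pderiv_dir e (\<phi> k) - weak_deriv W e u))\<^sup>2)"
      using member_le_sum[OF e, of "%e. (norm_on W (pderiv_dir e (\<phi> k) - weak_deriv W e u))\<^sup>2"] by simp
    then show ?thesis unfolding H1_norm_test_diff[OF \<phi> u] by (intro real_le_rsqrt) (simp add: add_increasing)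
  qed
  show "(%k. norm_on W (pderiv_dir e (\<phi> k) - weak_deriv W e u)) \<longlonglongrightarrow> 0"
    by (rule tendsto_sandwich[OF _ _ tendsto_const lim]) (auto simp: b)
qed

lemma weak_deriv_closed:
  assumes e: "e \<in> Basis" and u: "\<And>k::nat. u k \<in> L2 (leb_on W)" "v \<in> L2 (leb_on W)" "g \<in> L2 (leb_on W)"
    and w: "\<And>k. has_weak_deriv W e (u k) (h k)"
    and lim: "(%k. norm_on W (u k - v)) \<longlonglongrightarrow> 0" "(%k. norm_on W (h k - g)) \<longlonglongrightarrow> 0"
  shows "has_weak_deriv W e v g"
  unfolding has_weak_deriv_def
proof (intro conjI ballI)
  show "g \<in> L2 (leb_on W)" by fact
  fix \<phi> assume \<phi>: "\<phi> \<in> Cc_infty W"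
  have hL: "h k \<in> L2 (leb_on W)" for k using w by (auto simp: has_weak_deriv_def)
  have t: "test_fun \<phi>" using \<phi> by (simp add: Cc_infty_iff)
  have cn: "(%x. cnj (f x)) \<in> L2 (leb_on W)" if "test_fun f" for f
  proof -
    have "f \<in> L2 (leb_on W)" by (intro L2_restrict op test_fun_L2 that)
    then show ?thesis by (auto simp: L2_def)
  qed
  have lim1: "(%k. \<integral>x. u k x * pderiv_dir e \<phi> x \<partial>leb_on W) \<longlonglongrightarrow> (\<integral>x. v x * pderiv_dir e \<phi> x \<partial>leb_on W)"
    using L2.q_tendsto[OF u(1) u(2) _ cn[OF test_fun_pderiv[OF t e]]] lim(1) by (simp add: L2_inner_def)
  have lim2: "(%k. - (\<integral>x. h k x * \<phi> x \<partial>leb_on W)) \<longlonglongrightarrow> - (\<integral>x. g x * \<phi> x \<partial>leb_on W)"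
    using tendsto_minus[OF L2.q_tendsto[OF hL u(3) _ cn[OF t]]] lim(2) by (simp add: L2_inner_def)
  have "(\<integral>x. u k x * pderiv_dir e \<phi> x \<partial>leb_on W) = - (\<integral>x. h k x * \<phi> x \<partial>leb_on W)" for k
    using w \<phi> by (auto simp: has_weak_deriv_def)
  then show "(\<integral>x. v x * pderiv_dir e \<phi> x \<partial>leb_on W) = - (\<integral>x. g x * \<phi> x \<partial>leb_on W)"
    using lim1 lim2 LIMSEQ_unique by simp
qed

end

section \<open>One-dimensional inequalities\<close>

lemma nn_integral_continuous_Ioo:
  fixes h :: "real => real"
  assumes "(h has_integral I) {a..b}" "\<And>x. x \<in> {a<..<b} ==> 0 <= h x"
  shows "(\<integral>\<^sup>+t. ennreal (h t) * indicator {a<..<b} t \<partial>lborel) = ennreal I"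
proof -
  have "(h has_integral I) {a<..<b}"
    using assms(1) has_integral_open_interval[of h I a b] by (simp add: cbox_interval box_real)
  then show ?thesis using nn_integral_has_integral_lebesgue'[of "{a<..<b}" h I] assms(2) by simp
qed

text \<open>
  Integrate the derivative of \<open>\<gamma> (1 - t / L) |f|\<^sup>2\<close> over \<open>(0, L)\<close> and use \<open>2 k |f f'| \<le> |f'|\<^sup>2 + k\<^sup>2 |f|\<^sup>2\<close>.
\<close>

lemma Robin_inequality_1d:
  fixes f f' :: "real => complex"
  assumes f: "\<And>t. (f has_vector_derivative f' t) (at t)" and f': "continuous_on UNIV f'"
    and \<gamma>: "\<gamma> \<ge> 0" and L: "L > 0"
  shows "ennreal (\<gamma> * (cmod (f 0))\<^sup>2) \<le>
    (\<integral>\<^sup>+t. ennreal ((cmod (f' t))\<^sup>2 + (\<gamma>\<^sup>2 + \<gamma> / L) * (cmod (f t))\<^sup>2) * indicator {0<..<L} t \<partial>lborel)"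
proof -
  define k where "k t = \<gamma> * (1 - t / L)" for t
  define h where "h t = (cmod (f' t))\<^sup>2 + (\<gamma>\<^sup>2 + \<gamma> / L) * (cmod (f t))\<^sup>2" for t
  define d where "d t = - (\<gamma> / L) * (cmod (f t))\<^sup>2 + k t * (2 * (f t \<bullet> f' t))" for t
  have cf: "continuous_on UNIV f"
    by (intro continuous_at_imp_continuous_on ballI has_vector_derivative_continuous[OF f])
  have "continuous_on {0..L} h"
    unfolding h_def by (intro continuous_intros continuous_on_subset[OF cf] continuous_on_subset[OF f']) auto
  then have hI: "(h has_integral integral {0..L} h) {0..L}"
    using integrable_continuous_interval integrable_integral by blast
  have "((%t. k t * (f t \<bullet> f t)) has_real_derivative d t) (at t)" for t
  proof -
    have "((%t. f t \<bullet> f t) has_real_derivative 2 * (f t \<bullet> f' t)) (at t)"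
      unfolding has_real_derivative_iff_has_vector_derivative has_vector_derivative_def
      using has_derivative_inner[OF f[of t, unfolded has_vector_derivative_def] f[of t, unfolded has_vector_derivative_def]]
      by (simp add: inner_commute algebra_simps)
    moreover have "(k has_real_derivative - (\<gamma> / L)) (at t)"
      unfolding k_def[abs_def] using L by (auto intro!: derivative_eq_intros)
    ultimately have "((%t. k t * (f t \<bullet> f t)) has_real_derivative - (\<gamma> / L) * (f t \<bullet> f t) + 2 * (f t \<bullet> f' t) * k t) (at t)"
      by (rule DERIV_mult[rotated])
    then show ?thesis by (simp add: d_def power2_norm_eq_inner[symmetric] mult.commute)
  qed
  then have "(d has_integral (k L * (f L \<bullet> f L) - k 0 * (f 0 \<bullet> f 0))) {0..L}"
    using L by (intro fundamental_theorem_of_calculus)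
      (auto simp: has_real_derivative_iff_has_vector_derivative[symmetric] intro: has_field_derivative_at_within)
  moreover have "k L * (f L \<bullet> f L) - k 0 * (f 0 \<bullet> f 0) = - \<gamma> * (cmod (f 0))\<^sup>2"
    using L by (simp add: k_def power2_norm_eq_inner)
  ultimately have dI: "(d has_integral (- \<gamma> * (cmod (f 0))\<^sup>2)) {0..L}" by simp
  have "0 <= integral {0..L} h + (- \<gamma> * (cmod (f 0))\<^sup>2)"
  proof (rule has_integral_nonneg[OF has_integral_add[OF hI dI]])
    fix t assume t: "t \<in> {0..L}"
    have "0 <= 1 - t / L" "1 - t / L <= 1" using t L by auto
    then have k: "0 <= k t" "k t <= \<gamma>" unfolding k_def using \<gamma> by (auto intro: mult_left_le)
    have "0 <= (norm (f' t + k t *\<^sub>R f t))\<^sup>2" by simp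
    also have "\<dots> = (cmod (f' t))\<^sup>2 + 2 * k t * (f t \<bullet> f' t) + (k t)\<^sup>2 * (cmod (f t))\<^sup>2"
      unfolding power2_norm_eq_inner by (simp add: inner_add_left inner_add_right inner_commute power2_eq_square algebra_simps)
    also have "(k t)\<^sup>2 * (cmod (f t))\<^sup>2 <= \<gamma>\<^sup>2 * (cmod (f t))\<^sup>2"
      using k by (intro mult_right_mono power_mono) auto
    finally show "0 <= h t + d t" by (simp add: h_def d_def algebra_simps)
  qed
  then have "\<gamma> * (cmod (f 0))\<^sup>2 <= integral {0..L} h" by simp
  moreover have "(\<integral>\<^sup>+t. ennreal (h t) * indicator {0<..<L} t \<partial>lborel) = ennreal (integral {0..L} h)"
    using \<gamma> L by (intro nn_integral_continuous_Ioo[OF hI]) (auto simp: h_def)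
  ultimately show ?thesis unfolding h_def[symmetric] by (simp add: ennreal_leI)
qed

lemma difference_bound_1d:
  fixes f f' :: "real => complex"
  assumes f: "\<And>t. (f has_vector_derivative f' t) (at t)" and f': "continuous_on UNIV f'"
    and pq: "p \<in> {a..b}" "q \<in> {a..b}"
  shows "ennreal ((cmod (f p - f q))\<^sup>2) <= ennreal (b - a) * (\<integral>\<^sup>+t. ennreal ((cmod (f' t))\<^sup>2) * indicator {a<..<b} t \<partial>lborel)"
proof -
  have *: "ennreal ((cmod (f p - f q))\<^sup>2) <= ennreal (b - a) * (\<integral>\<^sup>+t. ennreal ((cmod (f' t))\<^sup>2) * indicator {a<..<b} t \<partial>lborel)"
    if "q <= p" "p \<in> {a..b}" "q \<in> {a..b}" for p q
  proof -
    have ff: "(f' has_integral (f p - f q)) {q..p}"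
      using that(1) f by (intro fundamental_theorem_of_calculus) (auto intro: has_vector_derivative_at_within)
    have cont: "continuous_on {q..p} (%t. norm (f' t))" "continuous_on {q..p} (%t. (norm (f' t))\<^sup>2)" "continuous_on {q..p} f'"
      by (auto intro!: continuous_intros continuous_on_subset[OF f'])
    define I where "I = integral {q..p} (%t. (norm (f' t))\<^sup>2)"
    have I: "((%t. (norm (f' t))\<^sup>2) has_integral I) {q..p}"
      unfolding I_def using cont(2) integrable_continuous_interval integrable_integral by blast
    have I0: "I \<ge> 0" using has_integral_nonneg[OF I] by simp
    \<comment> \<open>Young's inequality with every parameter replaces Cauchy--Schwarz\<close>
    have young: "norm (f p - f q) <= (c * (p - q) + I / c) / 2" if c: "c > 0" for c
    proof -
      have "((%t. c / 2 + (norm (f' t))\<^sup>2 / (2 * c)) has_integral ((p - q) * (c / 2) + I / (2 * c))) {q..p}"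
        using \<open>q <= p\<close> has_integral_const_real[of "c / 2" q p]
        by (intro has_integral_add has_integral_divide I) simp
      from integral_unique[OF this] integral_unique[OF ff]
      have "norm (f p - f q) <= (p - q) * (c / 2) + I / (2 * c)"
        using integral_norm_bound_integral[of f' "{q..p}" "%t. c / 2 + (norm (f' t))\<^sup>2 / (2 * c)"]
          ff \<open>((%t. c / 2 + (norm (f' t))\<^sup>2 / (2 * c)) has_integral _) _\<close> c
      proof -
        have "norm (f' t) <= c / 2 + (norm (f' t))\<^sup>2 / (2 * c)" for t
        proof -
          have "0 <= (c - norm (f' t))\<^sup>2" by simp
          then show ?thesis using c by (simp add: power2_eq_square field_simps)
        qed
        then show ?thesis
          using integral_norm_bound_integral[of f' "{q..p}" "%t. c / 2 + (norm (f' t))\<^sup>2 / (2 * c)"]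
            has_integral_integrable[OF ff] has_integral_integrable[OF \<open>((%t. c / 2 + (norm (f' t))\<^sup>2 / (2 * c)) has_integral _) _\<close>]
            integral_unique[OF ff] integral_unique[OF \<open>((%t. c / 2 + (norm (f' t))\<^sup>2 / (2 * c)) has_integral _) _\<close>]
          by simp
      qed
      then show ?thesis by (simp add: field_simps)
    qed
    have "(norm (f p - f q))\<^sup>2 <= (p - q) * I"
    proof (rule field_le_epsilon)
      fix e :: real assume e: "e > 0"
      show "(norm (f p - f q))\<^sup>2 <= (p - q) * I + e"
      proof (cases "p = q")
        case False
        then have pq0: "p - q > 0" using that by simp
        define J where "J = I + e / (p - q)"
        have J: "J > 0" "I <= J" using I0 e pq0 by (auto simp: J_def add_nonneg_pos)
        define c where "c = sqrt (J / (p - q))"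
        have c: "c > 0" "c * c = J / (p - q)" using J pq0 by (auto simp: c_def)
        have "norm (f p - f q) <= (c * (p - q) + I / c) / 2" by (rule young[OF c(1)])
        also have "\<dots> <= (c * (p - q) + J / c) / 2" using J c by (simp add: divide_right_mono)
        also have "J / c = c * (p - q)" using c pq0 by (simp add: field_simps)
        finally have "norm (f p - f q) <= c * (p - q)" by simp
        then have "(norm (f p - f q))\<^sup>2 <= (c * (p - q))\<^sup>2" by (intro power_mono) auto
        also have "\<dots> = (c * c) * (p - q) * (p - q)" by (simp add: power2_eq_square)
        also have "\<dots> = J * (p - q)" using c(2) pq0 by simp
        also have "\<dots> = (p - q) * I + e" using pq0 by (simp add: J_def field_simps)
        finally show ?thesis .
      qed (use e in simp)
    qed
    also have "\<dots> <= (b - a) * I" using that I0 by (intro mult_right_mono) auto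
    finally have "ennreal ((cmod (f p - f q))\<^sup>2) <= ennreal (b - a) * ennreal I"
      using that I0 by (simp add: ennreal_leI ennreal_mult[symmetric])
    also have "ennreal I = (\<integral>\<^sup>+t. ennreal ((cmod (f' t))\<^sup>2) * indicator {q<..<p} t \<partial>lborel)"
      by (rule nn_integral_continuous_Ioo[OF I, symmetric]) simp
    also have "\<dots> <= (\<integral>\<^sup>+t. ennreal ((cmod (f' t))\<^sup>2) * indicator {a<..<b} t \<partial>lborel)"
      using that by (intro nn_integral_mono) (auto simp: indicator_def)
    finally show ?thesis by (simp add: mult_left_mono)
  qed
  show ?thesis
    using *[of q p] *[of p q] pq by (cases "q <= p") (auto simp: norm_minus_commute)
qed

lemma nn_integral_linear_plane:
  fixes F :: "real \<times> real => ennreal"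
  assumes [measurable]: "F \<in> borel_measurable borel" and a: "a \<noteq> 0" and det: "\<bar>a * d - b * c\<bar> = 1"
  shows "(\<integral>\<^sup>+s. \<integral>\<^sup>+t. F (a * s + b * t, c * s + d * t) \<partial>lborel \<partial>lborel) = (\<integral>\<^sup>+z. F z \<partial>lborel)"
proof -
  have [measurable]: "F \<in> borel_measurable (borel \<Otimes>\<^sub>M borel)" by (simp add: borel_prod)
  define B where "B = (a * d - b * c) / a"
  have B: "B \<noteq> 0" "\<bar>B\<bar> = 1 / \<bar>a\<bar>" using a det by (auto simp: B_def)
  have "(\<integral>\<^sup>+s. \<integral>\<^sup>+t. F (a * s + b * t, c * s + d * t) \<partial>lborel \<partial>lborel)
      = (\<integral>\<^sup>+t. \<integral>\<^sup>+s. F (a * s + b * t, c * s + d * t) \<partial>lborel \<partial>lborel)"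
    by (intro lborel_pair.Fubini') measurable
  also have "\<dots> = (\<integral>\<^sup>+t. ennreal (1 / \<bar>a\<bar>) * (\<integral>\<^sup>+x. F (x, c / a * x + B * t) \<partial>lborel) \<partial>lborel)"
  proof (intro nn_integral_cong)
    fix t
    have "(\<integral>\<^sup>+x. F (x, c / a * x + B * t) \<partial>lborel) = ennreal \<bar>a\<bar> * (\<integral>\<^sup>+s. F (b * t + a * s, c / a * (b * t + a * s) + B * t) \<partial>lborel)"
      by (rule nn_integral_real_affine[OF _ a]) measurable
    also have "(%s. F (b * t + a * s, c / a * (b * t + a * s) + B * t)) = (%s. F (a * s + b * t, c * s + d * t))"
    proof
      fix s
      have "c / a * (b * t + a * s) + B * t = c * s + d * t" using a by (simp add: B_def field_simps)
      then show "F (b * t + a * s, c / a * (b * t + a * s) + B * t) = F (a * s + b * t, c * s + d * t)" by (simp add: add.commute)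
    qed
    finally have eq: "(\<integral>\<^sup>+x. F (x, c / a * x + B * t) \<partial>lborel) = ennreal \<bar>a\<bar> * (\<integral>\<^sup>+s. F (a * s + b * t, c * s + d * t) \<partial>lborel)" .
    have "ennreal (1 / \<bar>a\<bar>) * ennreal \<bar>a\<bar> = 1" using a by (simp add: ennreal_mult[symmetric])
    then show "(\<integral>\<^sup>+s. F (a * s + b * t, c * s + d * t) \<partial>lborel) = ennreal (1 / \<bar>a\<bar>) * (\<integral>\<^sup>+x. F (x, c / a * x + B * t) \<partial>lborel)"
      unfolding eq by (simp add: mult.assoc[symmetric])
  qed
  also have "\<dots> = ennreal (1 / \<bar>a\<bar>) * (\<integral>\<^sup>+t. \<integral>\<^sup>+x. F (x, c / a * x + B * t) \<partial>lborel \<partial>lborel)"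
    by (intro nn_integral_cmult) measurable
  also have "(\<integral>\<^sup>+t. \<integral>\<^sup>+x. F (x, c / a * x + B * t) \<partial>lborel \<partial>lborel) = (\<integral>\<^sup>+x. \<integral>\<^sup>+t. F (x, c / a * x + B * t) \<partial>lborel \<partial>lborel)"
    by (intro lborel_pair.Fubini') measurable
  also have "ennreal (1 / \<bar>a\<bar>) * \<dots> = (\<integral>\<^sup>+x. ennreal (1 / \<bar>a\<bar>) * (\<integral>\<^sup>+t. F (x, c / a * x + B * t) \<partial>lborel) \<partial>lborel)"
    by (intro nn_integral_cmult[symmetric]) measurable
  also have "\<dots> = (\<integral>\<^sup>+x. \<integral>\<^sup>+y. F (x, y) \<partial>lborel \<partial>lborel)"
  proof (intro nn_integral_cong)
    fix x
    have "(\<integral>\<^sup>+y. F (x, y) \<partial>lborel) = ennreal \<bar>B\<bar> * (\<integral>\<^sup>+t. F (x, c / a * x + B * t) \<partial>lborel)"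
      by (rule nn_integral_real_affine[OF _ B(1)]) measurable
    then show "ennreal (1 / \<bar>a\<bar>) * (\<integral>\<^sup>+t. F (x, c / a * x + B * t) \<partial>lborel) = (\<integral>\<^sup>+y. F (x, y) \<partial>lborel)" by (simp add: B(2))
  qed
  also have "\<dots> = (\<integral>\<^sup>+z. F z \<partial>(lborel \<Otimes>\<^sub>M lborel))"
    by (intro lborel.nn_integral_fst) measurable
  finally show ?thesis by (simp add: lborel_prod)
qed

section \<open>Robin inequalities along the normals of the broken line\<close>

definition grad_sq :: "('a::euclidean_space => complex) => 'a => real" where
  "grad_sq \<phi> z = (\<Sum>e\<in>Basis. (cmod (pderiv_dir e \<phi> z))\<^sup>2)"

lemma grad_sq_nonneg [simp]: "0 <= grad_sq \<phi> z"
  by (simp add: grad_sq_def sum_nonneg)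

lemma grad_sq_measurable: "smooth \<phi> ==> grad_sq \<phi> \<in> borel_measurable borel"
  unfolding grad_sq_def[abs_def]
proof (rule borel_measurable_sum)
  fix e :: 'a assume "smooth \<phi>" "e \<in> Basis"
  then have [measurable]: "pderiv_dir e \<phi> \<in> borel_measurable borel" by (intro smooth_measurable smoothD(3))
  show "(%z. (cmod (pderiv_dir e \<phi> z))\<^sup>2) \<in> borel_measurable borel" by measurable
qed

lemma directional_derivative_bound:
  assumes "smooth \<phi>"
  shows "(cmod (frechet_derivative \<phi> (at z) w))\<^sup>2 <= grad_sq \<phi> z * (norm w)\<^sup>2"
proof -
  have "cmod (frechet_derivative \<phi> (at z) w) <= (\<Sum>e\<in>Basis. \<bar>w \<bullet> e\<bar> * cmod (pderiv_dir e \<phi> z))"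
    unfolding derivative_expand[OF assms, where h = w] by (rule order_trans[OF norm_sum]) (simp add: norm_mult)
  then have "(cmod (frechet_derivative \<phi> (at z) w))\<^sup>2 <= (\<Sum>e\<in>Basis. \<bar>w \<bullet> e\<bar> * cmod (pderiv_dir e \<phi> z))\<^sup>2"
    by (intro power_mono) auto
  also have "\<dots> <= (\<Sum>e\<in>Basis. \<bar>w \<bullet> e\<bar>\<^sup>2) * (\<Sum>e\<in>Basis. (cmod (pderiv_dir e \<phi> z))\<^sup>2)"
    by (rule Cauchy_Schwarz_ineq_sum)
  also have "(\<Sum>e\<in>Basis. \<bar>w \<bullet> e\<bar>\<^sup>2) = (norm w)\<^sup>2"
    unfolding power2_norm_eq_inner euclidean_inner[of w w] by (simp add: power2_eq_square)
  finally show ?thesis by (simp add: grad_sq_def mult.commute)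
qed

lemma line_derivative:
  assumes "smooth \<phi>"
  shows "((%t. \<phi> (p + t *\<^sub>R w)) has_vector_derivative frechet_derivative \<phi> (at (p + t *\<^sub>R w)) w) (at t)"
    "continuous_on UNIV (%t. frechet_derivative \<phi> (at (p + t *\<^sub>R w)) w)"
proof -
  have "((%t. \<phi> (p + t *\<^sub>R w)) has_derivative (%h. frechet_derivative \<phi> (at (p + t *\<^sub>R w)) (h *\<^sub>R w))) (at t)"
    by (rule has_derivative_compose[OF _ smoothD(2)[OF assms], where f = "%t. p + t *\<^sub>R w"])
       (auto intro!: derivative_eq_intros)
  then show "((%t. \<phi> (p + t *\<^sub>R w)) has_vector_derivative frechet_derivative \<phi> (at (p + t *\<^sub>R w)) w) (at t)"
    unfolding has_vector_derivative_def
    using linear_cmul[OF has_derivative_linear[OF smoothD(2)[OF assms]]] by simp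
  have "continuous_on UNIV (%t. pderiv_dir e \<phi> (p + t *\<^sub>R w))" if "e \<in> Basis" for e
    by (rule continuous_on_compose2[OF smooth_continuous[OF smoothD(3)[OF assms that], of UNIV]])
       (auto intro!: continuous_intros)
  then show "continuous_on UNIV (%t. frechet_derivative \<phi> (at (p + t *\<^sub>R w)) w)"
    unfolding derivative_expand[OF assms, where h = w] by (intro continuous_on_sum continuous_on_mult continuous_on_const) auto
qed

text \<open>
  The point at distance \<open>t\<close> from the broken line on the normal through the point at arc length \<open>s\<close>;
  \<open>\<kappa> = \<plusminus>1\<close> selects the ray and \<open>\<sigma> = \<plusminus>1\<close> the side.
\<close>

definition ray_point :: "real => real => real => real => real => real \<times> real" where
  "ray_point \<theta> \<kappa> \<sigma> s t = (\<kappa> * (s * sin \<theta> - \<sigma> * t * cos \<theta>), s * cos \<theta> + \<sigma> * t * sin \<theta>)"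

lemma strip_inequality:
  assumes \<phi>: "test_fun \<phi>" and th: "sin \<theta> \<noteq> 0" and sg: "\<bar>\<kappa>\<bar> = 1" "\<bar>\<sigma>\<bar> = 1" and \<gamma>: "\<gamma> \<ge> 0" and L: "L > 0"
    and [measurable]: "E \<in> sets borel" "J \<in> sets borel"
    and JE: "\<And>s t. s \<in> J ==> 0 < t ==> t < L ==> ray_point \<theta> \<kappa> \<sigma> s t \<in> E"
  shows "(\<integral>\<^sup>+s. ennreal (\<gamma> * (cmod (\<phi> (ray_point \<theta> \<kappa> \<sigma> s 0)))\<^sup>2) * indicator J s \<partial>lborel)
     <= (\<integral>\<^sup>+z. ennreal (grad_sq \<phi> z + (\<gamma>\<^sup>2 + \<gamma> / L) * (cmod (\<phi> z))\<^sup>2) * indicator E z \<partial>lborel)"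
proof -
  note sm = test_fun_smooth[OF \<phi>]
  note [measurable] = smooth_measurable[OF sm] grad_sq_measurable[OF sm]
  define F where "F z = ennreal (grad_sq \<phi> z + (\<gamma>\<^sup>2 + \<gamma> / L) * (cmod (\<phi> z))\<^sup>2) * indicator E z" for z
  have [measurable]: "F \<in> borel_measurable borel" unfolding F_def by measurable
  have sq: "\<kappa> * \<kappa> = 1" "\<sigma> * \<sigma> = 1" using sg by (auto simp: abs_if split: if_splits)
  have rp: "ray_point \<theta> \<kappa> \<sigma> s t = ray_point \<theta> \<kappa> \<sigma> s 0 + t *\<^sub>R (- \<kappa> * \<sigma> * cos \<theta>, \<sigma> * sin \<theta>)" for s t
    by (simp add: ray_point_def algebra_simps)
  define w where "w = (- \<kappa> * \<sigma> * cos \<theta>, \<sigma> * sin \<theta>)"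
  have nw: "(norm w)\<^sup>2 = 1"
  proof -
    have "(norm w)\<^sup>2 = (\<kappa> * \<kappa>) * (\<sigma> * \<sigma>) * (cos \<theta>)\<^sup>2 + (\<sigma> * \<sigma>) * (sin \<theta>)\<^sup>2"
      unfolding power2_norm_eq_inner w_def by (simp add: power2_eq_square algebra_simps)
    then show ?thesis by (simp add: sq)
  qed
  have inner: "ennreal (\<gamma> * (cmod (\<phi> (ray_point \<theta> \<kappa> \<sigma> s 0)))\<^sup>2) * indicator J s <= (\<integral>\<^sup>+t. F (ray_point \<theta> \<kappa> \<sigma> s t) \<partial>lborel)" for s
  proof (cases "s \<in> J")
    case True
    let ?p = "ray_point \<theta> \<kappa> \<sigma> s 0"
    have "ennreal (\<gamma> * (cmod (\<phi> (?p + 0 *\<^sub>R w)))\<^sup>2) \<le>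
       (\<integral>\<^sup>+t. ennreal ((cmod (frechet_derivative \<phi> (at (?p + t *\<^sub>R w)) w))\<^sup>2 + (\<gamma>\<^sup>2 + \<gamma> / L) * (cmod (\<phi> (?p + t *\<^sub>R w)))\<^sup>2) * indicator {0<..<L} t \<partial>lborel)"
      by (rule Robin_inequality_1d[OF line_derivative[OF sm] \<gamma> L])
    also have "\<dots> <= (\<integral>\<^sup>+t. F (ray_point \<theta> \<kappa> \<sigma> s t) \<partial>lborel)"
    proof (rule nn_integral_mono)
      fix t
      have eq: "?p + t *\<^sub>R w = ray_point \<theta> \<kappa> \<sigma> s t" using rp[of s t] by (simp add: w_def)
      have "(cmod (frechet_derivative \<phi> (at (?p + t *\<^sub>R w)) w))\<^sup>2 <= grad_sq \<phi> (?p + t *\<^sub>R w)"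
        using directional_derivative_bound[OF sm, of "?p + t *\<^sub>R w" w] by (simp add: nw)
      then show "ennreal ((cmod (frechet_derivative \<phi> (at (?p + t *\<^sub>R w)) w))\<^sup>2 + (\<gamma>\<^sup>2 + \<gamma> / L) * (cmod (\<phi> (?p + t *\<^sub>R w)))\<^sup>2) * indicator {0<..<L} t
         <= F (ray_point \<theta> \<kappa> \<sigma> s t)"
        unfolding F_def eq using JE[OF True, of t] by (auto simp: indicator_def intro!: ennreal_leI)
    qed
    finally show ?thesis using True by simp
  qed simp
  have "(\<integral>\<^sup>+s. ennreal (\<gamma> * (cmod (\<phi> (ray_point \<theta> \<kappa> \<sigma> s 0)))\<^sup>2) * indicator J s \<partial>lborel) <= (\<integral>\<^sup>+s. \<integral>\<^sup>+t. F (ray_point \<theta> \<kappa> \<sigma> s t) \<partial>lborel \<partial>lborel)"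
    by (intro nn_integral_mono inner)
  also have "\<dots> = (\<integral>\<^sup>+s. \<integral>\<^sup>+t. F ((\<kappa> * sin \<theta>) * s + (- \<kappa> * \<sigma> * cos \<theta>) * t, cos \<theta> * s + (\<sigma> * sin \<theta>) * t) \<partial>lborel \<partial>lborel)"
    by (simp add: ray_point_def algebra_simps)
  also have "\<dots> = (\<integral>\<^sup>+z. F z \<partial>lborel)"
  proof (rule nn_integral_linear_plane)
    show "\<kappa> * sin \<theta> \<noteq> 0" using th sg by auto
    have "\<kappa> * sin \<theta> * (\<sigma> * sin \<theta>) - - \<kappa> * \<sigma> * cos \<theta> * cos \<theta> = \<kappa> * \<sigma> * ((sin \<theta>)\<^sup>2 + (cos \<theta>)\<^sup>2)"
      unfolding power2_eq_square by algebra
    also have "\<dots> = \<kappa> * \<sigma>" by (simp only: sin_cos_squared_add mult_1_right)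
    finally have "\<kappa> * sin \<theta> * (\<sigma> * sin \<theta>) - - \<kappa> * \<sigma> * cos \<theta> * cos \<theta> = \<kappa> * \<sigma>" .
    then show "\<bar>\<kappa> * sin \<theta> * (\<sigma> * sin \<theta>) - - \<kappa> * \<sigma> * cos \<theta> * cos \<theta>\<bar> = 1"
      using sg by (simp only: abs_mult mult_1)
  qed measurable
  finally show ?thesis by (simp add: F_def)
qed

lemma arc_param_measurable [measurable]: "arc_param \<theta> \<in> borel_measurable borel"
proof -
  have "continuous_on UNIV (arc_param \<theta>)"
    unfolding arc_param_def[abs_def] by (intro continuous_intros)
  then show ?thesis by (rule borel_measurable_continuous_onI)
qed

lemma nn_integral_arc:
  assumes [measurable]: "F \<in> borel_measurable borel"
  shows "(\<integral>\<^sup>+z. F z \<partial>arc_measure \<theta>) = (\<integral>\<^sup>+s. F (arc_param \<theta> s) \<partial>lborel)"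
  unfolding arc_measure_def by (subst nn_integral_distr) auto

lemma two_sided_strip_inequality:
  assumes \<phi>: "test_fun \<phi>" and th: "sin \<theta> \<noteq> 0" and sg: "\<bar>\<sigma>\<bar> = 1" and \<gamma>: "\<gamma> \<ge> 0" and L: "L > 0" and R: "R \<ge> 0"
    and E [measurable]: "E \<in> sets borel"
    and JE: "\<And>\<kappa> s t. \<bar>\<kappa>\<bar> = 1 ==> R < s ==> 0 < t ==> t < L ==> ray_point \<theta> \<kappa> \<sigma> s t \<in> E \<and> 0 < \<kappa> * fst (ray_point \<theta> \<kappa> \<sigma> s t)"
  shows "(\<integral>\<^sup>+s. ennreal (\<gamma> * (cmod (\<phi> (arc_param \<theta> s)))\<^sup>2) * indicator {s. R < \<bar>s\<bar>} s \<partial>lborel)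
     <= (\<integral>\<^sup>+z. ennreal (grad_sq \<phi> z + (\<gamma>\<^sup>2 + \<gamma> / L) * (cmod (\<phi> z))\<^sup>2) * indicator E z \<partial>lborel)"
proof -
  note sm = test_fun_smooth[OF \<phi>]
  note [measurable] = smooth_measurable[OF sm] grad_sq_measurable[OF sm]
  define F where "F z = ennreal (grad_sq \<phi> z + (\<gamma>\<^sup>2 + \<gamma> / L) * (cmod (\<phi> z))\<^sup>2)" for z
  have [measurable]: "F \<in> borel_measurable borel" unfolding F_def by measurable
  define H where "H s = ennreal (\<gamma> * (cmod (\<phi> (arc_param \<theta> s)))\<^sup>2)" for s
  have [measurable]: "H \<in> borel_measurable borel" unfolding H_def by measurable
  define E' where "E' \<kappa> = E \<inter> {z. 0 < \<kappa> * fst z}" for \<kappa> :: real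
  have [measurable]: "{z::real \<times> real. 0 < \<kappa> * fst z} \<in> sets borel" for \<kappa>
    by (intro borel_open open_Collect_less continuous_intros)
  have [measurable]: "E' \<kappa> \<in> sets borel" for \<kappa> unfolding E'_def by measurable
  have side: "(\<integral>\<^sup>+s. ennreal (\<gamma> * (cmod (\<phi> (ray_point \<theta> \<kappa> \<sigma> s 0)))\<^sup>2) * indicator {R<..} s \<partial>lborel) <= (\<integral>\<^sup>+z. F z * indicator (E' \<kappa>) z \<partial>lborel)"
    if "\<bar>\<kappa>\<bar> = 1" for \<kappa>
    unfolding F_def using JE[OF that] by (intro strip_inequality[OF \<phi> th that sg \<gamma> L]) (auto simp: E'_def)
  have p1: "ray_point \<theta> 1 \<sigma> s 0 = arc_param \<theta> s" if "s > R" for s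
    using that R by (simp add: ray_point_def arc_param_def)
  have p2: "ray_point \<theta> (-1) \<sigma> s 0 = arc_param \<theta> (- s)" if "s > R" for s
    using that R by (simp add: ray_point_def arc_param_def)
  have "(\<integral>\<^sup>+s. H s * indicator {s. R < \<bar>s\<bar>} s \<partial>lborel) = (\<integral>\<^sup>+s. H s * indicator {R<..} s + H s * indicator {..<-R} s \<partial>lborel)"
    using R by (intro nn_integral_cong) (auto simp: indicator_def abs_if split: if_splits)
  also have "\<dots> = (\<integral>\<^sup>+s. H s * indicator {R<..} s \<partial>lborel) + (\<integral>\<^sup>+s. H s * indicator {..<-R} s \<partial>lborel)"
    by (intro nn_integral_add) measurable
  also have "(\<integral>\<^sup>+s. H s * indicator {..<-R} s \<partial>lborel) = (\<integral>\<^sup>+s. H (- s) * indicator {R<..} s \<partial>lborel)"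
    using nn_integral_real_affine[of "%s. H s * indicator {..<-R} s" "-1" 0]
    by (simp add: indicator_def less_minus_iff cong: if_cong)
  also have "(\<integral>\<^sup>+s. H (- s) * indicator {R<..} s \<partial>lborel) = (\<integral>\<^sup>+s. ennreal (\<gamma> * (cmod (\<phi> (ray_point \<theta> (-1) \<sigma> s 0)))\<^sup>2) * indicator {R<..} s \<partial>lborel)"
    by (intro nn_integral_cong) (auto simp: H_def p2 indicator_def)
  also have "(\<integral>\<^sup>+s. H s * indicator {R<..} s \<partial>lborel) = (\<integral>\<^sup>+s. ennreal (\<gamma> * (cmod (\<phi> (ray_point \<theta> 1 \<sigma> s 0)))\<^sup>2) * indicator {R<..} s \<partial>lborel)"
    by (intro nn_integral_cong) (auto simp: H_def p1 indicator_def)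
  also have "(\<integral>\<^sup>+s. ennreal (\<gamma> * (cmod (\<phi> (ray_point \<theta> 1 \<sigma> s 0)))\<^sup>2) * indicator {R<..} s \<partial>lborel) +
     (\<integral>\<^sup>+s. ennreal (\<gamma> * (cmod (\<phi> (ray_point \<theta> (-1) \<sigma> s 0)))\<^sup>2) * indicator {R<..} s \<partial>lborel)
     <= (\<integral>\<^sup>+z. F z * indicator (E' 1) z \<partial>lborel) + (\<integral>\<^sup>+z. F z * indicator (E' (-1)) z \<partial>lborel)"
    by (intro add_mono side) auto
  also have "\<dots> = (\<integral>\<^sup>+z. F z * indicator (E' 1) z + F z * indicator (E' (-1)) z \<partial>lborel)"
    by (intro nn_integral_add[symmetric]) measurable
  also have "\<dots> <= (\<integral>\<^sup>+z. F z * indicator E z \<partial>lborel)"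
    by (intro nn_integral_mono) (auto simp: E'_def indicator_def)
  finally show ?thesis unfolding H_def F_def .
qed

lemma Omega_open: "open (Omega1 \<theta>)" "open (Omega2 \<theta>)"
proof -
  have "Omega1 \<theta> = {z. cot \<theta> * \<bar>fst z\<bar> < snd z}" "Omega2 \<theta> = {z. snd z < cot \<theta> * \<bar>fst z\<bar>}"
    by (auto simp: Omega1_def Omega2_def)
  then show "open (Omega1 \<theta>)" "open (Omega2 \<theta>)"
    by (auto intro!: open_Collect_less continuous_intros)
qed

text \<open>
  On this side the angle is reflex, so the strips over the two rays are disjoint for every length \<open>L\<close>.
\<close>

lemma Robin_Omega2:
  assumes \<phi>: "test_fun \<phi>" and th: "0 < \<theta>" "\<theta> < pi / 2" and \<gamma>: "\<gamma> \<ge> 0" and L: "L > 0"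
  shows "(\<integral>\<^sup>+z. ennreal (\<gamma> * (cmod (\<phi> z))\<^sup>2) \<partial>arc_measure \<theta>)
     <= (\<integral>\<^sup>+z. ennreal (grad_sq \<phi> z + (\<gamma>\<^sup>2 + \<gamma> / L) * (cmod (\<phi> z))\<^sup>2) * indicator (Omega2 \<theta>) z \<partial>lborel)"
proof -
  note [measurable] = smooth_measurable[OF test_fun_smooth[OF \<phi>]]
  have s: "sin \<theta> > 0" "cos \<theta> > 0" using th by (auto intro: sin_gt_zero cos_gt_zero)
  have "(\<integral>\<^sup>+z. ennreal (\<gamma> * (cmod (\<phi> z))\<^sup>2) \<partial>arc_measure \<theta>) = (\<integral>\<^sup>+s. ennreal (\<gamma> * (cmod (\<phi> (arc_param \<theta> s)))\<^sup>2) \<partial>lborel)"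
    by (rule nn_integral_arc) measurable
  also have "\<dots> = (\<integral>\<^sup>+s. ennreal (\<gamma> * (cmod (\<phi> (arc_param \<theta> s)))\<^sup>2) * indicator {s. 0 < \<bar>s\<bar>} s \<partial>lborel)"
    by (intro nn_integral_cong_AE eventually_mono[OF AE_lborel_singleton[of 0]]) (auto simp: indicator_def)
  also have "\<dots> <= (\<integral>\<^sup>+z. ennreal (grad_sq \<phi> z + (\<gamma>\<^sup>2 + \<gamma> / L) * (cmod (\<phi> z))\<^sup>2) * indicator (Omega2 \<theta>) z \<partial>lborel)"
  proof (rule two_sided_strip_inequality[OF \<phi> _ _ \<gamma> L, where \<sigma> = "-1"])
    fix \<kappa> s' t :: real assume k: "\<bar>\<kappa>\<bar> = 1" and st: "0 < s'" "0 < t"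
    have kk: "\<kappa> * \<kappa> = 1" using k by (auto simp: abs_if split: if_splits)
    have pos: "0 < s' * sin \<theta> + t * cos \<theta>" using s st by (simp add: add_pos_pos)
    have "s' * cos \<theta> - t * sin \<theta> < cot \<theta> * (s' * sin \<theta> + t * cos \<theta>)"
    proof -
      have "cot \<theta> * (s' * sin \<theta> + t * cos \<theta>) = s' * cos \<theta> + t * (cos \<theta> * cos \<theta> / sin \<theta>)"
        using s by (simp add: cot_def field_simps)
      moreover have "0 < t * sin \<theta>" "0 < t * (cos \<theta> * cos \<theta> / sin \<theta>)" using s st by auto
      ultimately show ?thesis by linarith
    qed
    moreover have "\<bar>\<kappa> * (s' * sin \<theta> + t * cos \<theta>)\<bar> = s' * sin \<theta> + t * cos \<theta>" using pos k by (simp add: abs_mult)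
      ultimately have "ray_point \<theta> \<kappa> (- 1) s' t \<in> Omega2 \<theta>"
      by (simp add: ray_point_def Omega2_def)
    moreover have "\<kappa> * fst (ray_point \<theta> \<kappa> (- 1) s' t) = (\<kappa> * \<kappa>) * (s' * sin \<theta> + t * cos \<theta>)" by (simp add: ray_point_def)
    then have "\<kappa> * fst (ray_point \<theta> \<kappa> (- 1) s' t) = s' * sin \<theta> + t * cos \<theta>" by (simp only: kk mult_1)
    then have "0 < \<kappa> * fst (ray_point \<theta> \<kappa> (- 1) s' t)" using pos by (simp only:)
    ultimately show "ray_point \<theta> \<kappa> (- 1) s' t \<in> Omega2 \<theta> \<and> 0 < \<kappa> * fst (ray_point \<theta> \<kappa> (- 1) s' t)" by blast
  qed (use s Omega_open in auto)
  finally show ?thesis .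
qed

text \<open>
  In the convex sector the normals of the two rays meet on the symmetry axis. Those of length \<open>L\<close>
  remain on their own side if they start at arc length greater than \<open>L cot \<theta>\<close>.
\<close>

lemma Robin_Omega1_far:
  assumes \<phi>: "test_fun \<phi>" and th: "0 < \<theta>" "\<theta> < pi / 2" and \<gamma>: "\<gamma> \<ge> 0" and L: "L > 0"
  shows "(\<integral>\<^sup>+s. ennreal (\<gamma> * (cmod (\<phi> (arc_param \<theta> s)))\<^sup>2) * indicator {s. L * cot \<theta> < \<bar>s\<bar>} s \<partial>lborel)
     <= (\<integral>\<^sup>+z. ennreal (grad_sq \<phi> z + (\<gamma>\<^sup>2 + \<gamma> / L) * (cmod (\<phi> z))\<^sup>2) * indicator (Omega1 \<theta>) z \<partial>lborel)"
proof (rule two_sided_strip_inequality[OF \<phi> _ _ \<gamma> L, where \<sigma> = 1])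
  have s: "sin \<theta> > 0" "cos \<theta> > 0" using th by (auto intro: sin_gt_zero cos_gt_zero)
  then show "sin \<theta> \<noteq> 0" "0 <= L * cot \<theta>" using L by (auto simp: cot_def)
  fix \<kappa> s' t :: real assume k: "\<bar>\<kappa>\<bar> = 1" and st: "L * cot \<theta> < s'" "0 < t" "t < L"
  have kk: "\<kappa> * \<kappa> = 1" using k by (auto simp: abs_if split: if_splits)
  have "t * cos \<theta> < L * cos \<theta>" using s st by simp
  also have "L * cos \<theta> = L * cot \<theta> * sin \<theta>" using s by (simp add: cot_def)
  also have "\<dots> < s' * sin \<theta>" using s st by simp
  finally have pos: "0 < s' * sin \<theta> - t * cos \<theta>" by simp
  have "cot \<theta> * (s' * sin \<theta> - t * cos \<theta>) < s' * cos \<theta> + t * sin \<theta>"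
  proof -
    have "cot \<theta> * (s' * sin \<theta> - t * cos \<theta>) = s' * cos \<theta> - t * (cos \<theta> * cos \<theta> / sin \<theta>)"
      using s by (simp add: cot_def field_simps)
    moreover have "0 < t * sin \<theta>" "0 < t * (cos \<theta> * cos \<theta> / sin \<theta>)" using s st by auto
    ultimately show ?thesis by linarith
  qed
  moreover have "\<bar>\<kappa> * (s' * sin \<theta> - t * cos \<theta>)\<bar> = s' * sin \<theta> - t * cos \<theta>" using pos k by (simp add: abs_mult)
  ultimately have "ray_point \<theta> \<kappa> 1 s' t \<in> Omega1 \<theta>"
      by (simp add: ray_point_def Omega1_def)
    moreover have "\<kappa> * fst (ray_point \<theta> \<kappa> 1 s' t) = (\<kappa> * \<kappa>) * (s' * sin \<theta> - t * cos \<theta>)" by (simp add: ray_point_def)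
    then have "\<kappa> * fst (ray_point \<theta> \<kappa> 1 s' t) = s' * sin \<theta> - t * cos \<theta>" by (simp only: kk mult_1)
    then have "0 < \<kappa> * fst (ray_point \<theta> \<kappa> 1 s' t)" using pos by (simp only:)
    ultimately show "ray_point \<theta> \<kappa> 1 s' t \<in> Omega1 \<theta> \<and> 0 < \<kappa> * fst (ray_point \<theta> \<kappa> 1 s' t)" by blast
qed (use Omega_open in auto)

section \<open>Trace estimates on cells along the boundary\<close>

text \<open>
  The value at a boundary point differs from the mean over the cell by at most the integrals of the
  partial derivatives along one vertical and one horizontal segment.
\<close>

lemma cell_inequality:
  fixes v vx vy :: "real => real => complex" and x0 h M :: real
  assumes vx: "\<And>x y. ((%x. v x y) has_vector_derivative vx x y) (at x)" "\<And>y. continuous_on UNIV (%x. vx x y)"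
    and vy: "\<And>x y. (v x has_vector_derivative vy x y) (at y)" "\<And>x. continuous_on UNIV (vy x)"
    and meas: "(%z. v (fst z) (snd z)) \<in> borel_measurable borel" "(%z. vx (fst z) (snd z)) \<in> borel_measurable borel"
      "(%z. vy (fst z) (snd z)) \<in> borel_measurable borel"
    and bdd: "\<And>x y. cmod (v x y) <= M" and h: "h > 0"
  defines "Q \<equiv> {x0..<x0+h} \<times> {0<..<h}"
  shows "(\<integral>\<^sup>+x. ennreal ((cmod (v x 0))\<^sup>2) * indicator {x0..<x0+h} x \<partial>lborel) \<le>
     ennreal (4 * h) * (\<integral>\<^sup>+z. ennreal ((cmod (vx (fst z) (snd z)))\<^sup>2 + (cmod (vy (fst z) (snd z)))\<^sup>2) * indicator Q z \<partial>lborel)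
     + ennreal (2 / h^3 * (cmod (\<integral>z. v (fst z) (snd z) * indicator Q z \<partial>lborel))\<^sup>2)"
proof -
  note [measurable] = meas
  have Qm [measurable]: "Q \<in> sets borel" unfolding Q_def borel_prod[symmetric] by measurable
  have Qe: "emeasure lborel Q = ennreal (h * h)"
  proof -
    have "emeasure (lborel \<Otimes>\<^sub>M lborel) Q = emeasure lborel {x0..<x0+h} * emeasure lborel {0<..<h}"
      unfolding Q_def by (intro lborel.emeasure_pair_measure_Times) auto
    then show ?thesis using h by (simp add: lborel_prod ennreal_mult)
  qed
  let ?I = "%x. indicator {x0..<x0+h} x :: ennreal" and ?J = "%y. indicator {0<..<h} y :: ennreal"
  have Qind: "indicator Q (x, y) = ?I x * ?J y" for x y by (auto simp: Q_def indicator_def)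
  have tonelli: "(\<integral>\<^sup>+z. F z * indicator Q z \<partial>lborel) = (\<integral>\<^sup>+x. (\<integral>\<^sup>+y. F (x, y) * ?J y \<partial>lborel) * ?I x \<partial>lborel)"
    "(\<integral>\<^sup>+z. F z * indicator Q z \<partial>lborel) = (\<integral>\<^sup>+y. (\<integral>\<^sup>+x. F (x, y) * ?I x \<partial>lborel) * ?J y \<partial>lborel)"
    if [measurable]: "F \<in> borel_measurable borel" for F :: "real \<times> real => ennreal"
  proof -
    have [measurable]: "F \<in> borel_measurable (borel \<Otimes>\<^sub>M borel)" by (simp add: borel_prod)
    have [measurable]: "Q \<in> sets (borel \<Otimes>\<^sub>M borel)" using Qm unfolding borel_prod .
    have "(\<integral>\<^sup>+z. F z * indicator Q z \<partial>lborel) = (\<integral>\<^sup>+z. F z * indicator Q z \<partial>(lborel \<Otimes>\<^sub>M lborel))" by (simp add: lborel_prod)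
    also have "\<dots> = (\<integral>\<^sup>+x. \<integral>\<^sup>+y. F (x, y) * indicator Q (x, y) \<partial>lborel \<partial>lborel)"
      by (intro lborel.nn_integral_fst[symmetric]) measurable
    finally have 1: "(\<integral>\<^sup>+z. F z * indicator Q z \<partial>lborel) = (\<integral>\<^sup>+x. \<integral>\<^sup>+y. F (x, y) * ?J y * ?I x \<partial>lborel \<partial>lborel)"
      by (simp add: Qind mult_ac)
    then show "(\<integral>\<^sup>+z. F z * indicator Q z \<partial>lborel) = (\<integral>\<^sup>+x. (\<integral>\<^sup>+y. F (x, y) * ?J y \<partial>lborel) * ?I x \<partial>lborel)"
      by (simp add: nn_integral_multc)
    have "(\<integral>\<^sup>+x. \<integral>\<^sup>+y. F (x, y) * ?J y * ?I x \<partial>lborel \<partial>lborel) = (\<integral>\<^sup>+y. \<integral>\<^sup>+x. F (x, y) * ?J y * ?I x \<partial>lborel \<partial>lborel)"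
      by (intro lborel_pair.Fubini') measurable
    also have "\<dots> = (\<integral>\<^sup>+y. \<integral>\<^sup>+x. F (x, y) * ?I x * ?J y \<partial>lborel \<partial>lborel)" by (simp add: mult_ac)
    also have "\<dots> = (\<integral>\<^sup>+y. (\<integral>\<^sup>+x. F (x, y) * ?I x \<partial>lborel) * ?J y \<partial>lborel)" by (simp add: nn_integral_multc)
    finally show "(\<integral>\<^sup>+z. F z * indicator Q z \<partial>lborel) = (\<integral>\<^sup>+y. (\<integral>\<^sup>+x. F (x, y) * ?I x \<partial>lborel) * ?J y \<partial>lborel)"
      using 1 by simp
  qed
  define A where "A x = (\<integral>\<^sup>+y. ennreal ((cmod (vy x y))\<^sup>2) * ?J y \<partial>lborel)" for x
  define B where "B y = (\<integral>\<^sup>+x. ennreal ((cmod (vx x y))\<^sup>2) * ?I x \<partial>lborel)" for y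
  have mvy: "(%z. ennreal ((cmod (vy (fst z) (snd z)))\<^sup>2)) \<in> borel_measurable borel"
    and mvx: "(%z. ennreal ((cmod (vx (fst z) (snd z)))\<^sup>2)) \<in> borel_measurable borel" by measurable
  have mp: "(%z. vy (fst z) (snd z)) \<in> borel_measurable (borel \<Otimes>\<^sub>M borel)" "(%z. vx (fst z) (snd z)) \<in> borel_measurable (borel \<Otimes>\<^sub>M borel)"
    "(%z. v (fst z) (snd z)) \<in> borel_measurable (borel \<Otimes>\<^sub>M borel)"
    using meas by (auto simp: borel_prod)
  have mvy2: "(%(x, y). vy x y) \<in> borel_measurable (borel \<Otimes>\<^sub>M borel)" and mvx2: "(%(x, y). vx x y) \<in> borel_measurable (borel \<Otimes>\<^sub>M borel)"
    and mv2: "(%(x, y). v x y) \<in> borel_measurable (borel \<Otimes>\<^sub>M borel)"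
    using mp by (auto simp: case_prod_beta')
  note [measurable] = mvy2 mvx2 mv2
  have [measurable]: "A \<in> borel_measurable borel" "B \<in> borel_measurable borel" unfolding A_def B_def by measurable
  have Bsnd [measurable]: "(%z::real \<times> real. B (snd z)) \<in> borel_measurable borel"
    unfolding borel_prod[symmetric] by measurable
  have SA: "(\<integral>\<^sup>+x. A x * ?I x \<partial>lborel) = (\<integral>\<^sup>+z. ennreal ((cmod (vy (fst z) (snd z)))\<^sup>2) * indicator Q z \<partial>lborel)"
    using tonelli(1)[OF mvy] by (simp add: A_def)
  have SB: "(\<integral>\<^sup>+y. B y * ?J y \<partial>lborel) = (\<integral>\<^sup>+z. ennreal ((cmod (vx (fst z) (snd z)))\<^sup>2) * indicator Q z \<partial>lborel)"
    using tonelli(2)[OF mvx] by (simp add: B_def)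
  have dA: "ennreal ((cmod (v x 0 - v x y))\<^sup>2) <= ennreal h * A x" if "y \<in> {0<..<h}" for x y
    using difference_bound_1d[OF vy(1) vy(2), of 0 0 h y x] that h by (simp add: A_def)
  have dB: "ennreal ((cmod (v x y - v x' y))\<^sup>2) <= ennreal h * B y" if "x \<in> {x0..<x0+h}" "x' \<in> {x0..<x0+h}" for x x' y
  proof -
    have "ennreal ((cmod (v x y - v x' y))\<^sup>2) <= ennreal (x0 + h - x0) * (\<integral>\<^sup>+t. ennreal ((cmod (vx t y))\<^sup>2) * indicator {x0<..<x0+h} t \<partial>lborel)"
      by (rule difference_bound_1d[OF vx(1) vx(2)]) (use that in auto)
    also have "\<dots> <= ennreal h * B y"
      unfolding B_def by (intro mult_mono nn_integral_mono) (auto simp: indicator_def)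
    finally show ?thesis .
  qed
  define m where "m = (\<integral>z. v (fst z) (snd z) * indicator Q z \<partial>lborel) / of_real (h * h)"
  have mean: "ennreal ((cmod (v x 0 - m))\<^sup>2) <= 2 * ennreal h * A x + 2 * (\<integral>\<^sup>+y. B y * ?J y \<partial>lborel)" if x: "x \<in> {x0..<x0+h}" for x
  proof -
    define P where "P = density lborel (%z. ennreal (indicator Q z / (h * h)))"
    have Pint: "(\<integral>\<^sup>+z. F z \<partial>P) = ennreal (1 / (h * h)) * (\<integral>\<^sup>+z. F z * indicator Q z \<partial>lborel)" if [measurable]: "F \<in> borel_measurable borel" for F
    proof -
      have "(\<integral>\<^sup>+z. F z \<partial>P) = (\<integral>\<^sup>+z. ennreal (indicator Q z / (h * h)) * F z \<partial>lborel)"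
        unfolding P_def by (intro nn_integral_density) measurable
      also have "\<dots> = (\<integral>\<^sup>+z. ennreal (1 / (h * h)) * (F z * indicator Q z) \<partial>lborel)"
        by (intro nn_integral_cong) (auto simp: indicator_def)
      finally show ?thesis by (simp add: nn_integral_cmult)
    qed
    have P1: "emeasure P (space P) = 1"
    proof -
      have "emeasure P (space P) = (\<integral>\<^sup>+z. 1 \<partial>P)" by simp
      also have "\<dots> = ennreal (1 / (h * h)) * emeasure lborel Q" by (subst Pint) auto
      also have "\<dots> = 1" unfolding Qe using h by (simp add: ennreal_mult[symmetric])
      finally show ?thesis .
    qed
    have setsP [measurable_cong]: "sets P = sets borel" by (simp add: P_def)
    have vint: "integrable P (%z. v (fst z) (snd z))"
    proof (rule integrableI_bounded)
      have "(\<integral>\<^sup>+z. ennreal (norm (v (fst z) (snd z))) \<partial>P) <= (\<integral>\<^sup>+z. ennreal M \<partial>P)"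
        using bdd by (intro nn_integral_mono ennreal_leI) auto
      also have "\<dots> < \<infinity>" using P1 by simp
      finally show "(\<integral>\<^sup>+z. ennreal (norm (v (fst z) (snd z))) \<partial>P) < \<infinity>" .
    qed measurable
    have Pc: "measure P (space P) = 1" using P1 by (simp add: measure_def)
    have fP: "integrable P (%z. c)" for c :: complex using P1 by (intro finite_measure.integrable_const finite_measureI) simp
    have "(\<integral>z. v (fst z) (snd z) \<partial>P) = (\<integral>z. (indicator Q z / (h * h)) *\<^sub>R v (fst z) (snd z) \<partial>lborel)"
      unfolding P_def by (rule integral_density) (use h in auto)
    also have "\<dots> = (\<integral>z. (v (fst z) (snd z) * indicator Q z) / of_real (h * h) \<partial>lborel)"
      by (intro Bochner_Integration.integral_cong) (auto simp: indicator_def scaleR_conv_of_real)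
    also have "\<dots> = m" unfolding m_def by (rule integral_divide_zero)
    finally have mP: "(\<integral>z. v (fst z) (snd z) \<partial>P) = m" .
    have "v x 0 - m = (\<integral>z. v x 0 - v (fst z) (snd z) \<partial>P)"
      using vint fP Pc by (simp add: mP)
    then have "ennreal ((cmod (v x 0 - m))\<^sup>2) <= (\<integral>\<^sup>+z. ennreal ((cmod (v x 0 - v (fst z) (snd z)))\<^sup>2) \<partial>P)"
      using prob_Jensen_sq[OF P1, of "%z. v x 0 - v (fst z) (snd z)"] by simp
    also have "\<dots> = ennreal (1 / (h * h)) * (\<integral>\<^sup>+z. ennreal ((cmod (v x 0 - v (fst z) (snd z)))\<^sup>2) * indicator Q z \<partial>lborel)"
      by (rule Pint) measurable
    also have "\<dots> <= ennreal (1 / (h * h)) * (\<integral>\<^sup>+z. (2 * ennreal h * A x + 2 * ennreal h * B (snd z)) * indicator Q z \<partial>lborel)"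
    proof (intro mult_left_mono nn_integral_mono)
      fix z :: "real \<times> real"
      show "ennreal ((cmod (v x 0 - v (fst z) (snd z)))\<^sup>2) * indicator Q z <= (2 * ennreal h * A x + 2 * ennreal h * B (snd z)) * indicator Q z"
      proof (cases "z \<in> Q")
        case True
        then have z: "fst z \<in> {x0..<x0+h}" "snd z \<in> {0<..<h}" by (auto simp: Q_def)
        have "(cmod (v x 0 - v (fst z) (snd z)))\<^sup>2 <= 2 * (cmod (v x 0 - v x (snd z)))\<^sup>2 + 2 * (cmod (v x (snd z) - v (fst z) (snd z)))\<^sup>2"
          using cmod_add_sq_le[of "v x 0 - v x (snd z)" "v x (snd z) - v (fst z) (snd z)"] by simp
        then have "ennreal ((cmod (v x 0 - v (fst z) (snd z)))\<^sup>2) <= 2 * ennreal ((cmod (v x 0 - v x (snd z)))\<^sup>2) + 2 * ennreal ((cmod (v x (snd z) - v (fst z) (snd z)))\<^sup>2)"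
          by (subst (asm) ennreal_le_iff[symmetric]) (auto simp: ennreal_mult)
        also have "\<dots> <= 2 * (ennreal h * A x) + 2 * (ennreal h * B (snd z))"
          by (intro add_mono mult_left_mono dA dB z x) auto
        finally show ?thesis using True by (simp add: mult.assoc)
      qed simp
    qed simp
    also have "(\<integral>\<^sup>+z. (2 * ennreal h * A x + 2 * ennreal h * B (snd z)) * indicator Q z \<partial>lborel)
       = (\<integral>\<^sup>+y. (\<integral>\<^sup>+x'. (2 * ennreal h * A x + 2 * ennreal h * B y) * ?I x' \<partial>lborel) * ?J y \<partial>lborel)"
      by (subst tonelli(2)) auto
    also have "\<dots> = (\<integral>\<^sup>+y. ennreal h * (2 * ennreal h * A x * ?J y + 2 * ennreal h * (B y * ?J y)) \<partial>lborel)"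
    proof (intro nn_integral_cong)
      fix y
      have "(\<integral>\<^sup>+x'. K * ?I x' \<partial>lborel) = K * ennreal h" for K
        using h by (subst nn_integral_cmult_indicator) auto
      then show "(\<integral>\<^sup>+x'. (2 * ennreal h * A x + 2 * ennreal h * B y) * ?I x' \<partial>lborel) * ?J y
        = ennreal h * (2 * ennreal h * A x * ?J y + 2 * ennreal h * (B y * ?J y))"
        by (simp only:) (simp add: distrib_left distrib_right mult_ac)
    qed
    also have "\<dots> = ennreal h * (2 * ennreal h * A x * ennreal h + 2 * ennreal h * (\<integral>\<^sup>+y. B y * ?J y \<partial>lborel))"
    proof -
      have J: "(\<integral>\<^sup>+y. K * ?J y \<partial>lborel) = K * ennreal h" for K
        using h by (subst nn_integral_cmult_indicator) auto
      have "(\<integral>\<^sup>+y. ennreal h * (2 * ennreal h * A x * ?J y + 2 * ennreal h * (B y * ?J y)) \<partial>lborel)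
         = ennreal h * (\<integral>\<^sup>+y. 2 * ennreal h * A x * ?J y + 2 * ennreal h * (B y * ?J y) \<partial>lborel)"
        by (intro nn_integral_cmult) measurable
      also have "(\<integral>\<^sup>+y. 2 * ennreal h * A x * ?J y + 2 * ennreal h * (B y * ?J y) \<partial>lborel)
         = (\<integral>\<^sup>+y. 2 * ennreal h * A x * ?J y \<partial>lborel) + (\<integral>\<^sup>+y. 2 * ennreal h * (B y * ?J y) \<partial>lborel)"
        by (intro nn_integral_add) measurable
      also have "(\<integral>\<^sup>+y. 2 * ennreal h * (B y * ?J y) \<partial>lborel) = 2 * ennreal h * (\<integral>\<^sup>+y. B y * ?J y \<partial>lborel)"
        by (intro nn_integral_cmult) measurable
      finally show ?thesis unfolding J .
    qed
    also have "ennreal (1 / (h * h)) * \<dots> = (ennreal (1 / (h * h)) * ennreal h * ennreal h) * (2 * ennreal h * A x + 2 * (\<integral>\<^sup>+y. B y * ?J y \<partial>lborel))"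
      by (simp add: algebra_simps)
    also have "ennreal (1 / (h * h)) * ennreal h * ennreal h = 1" using h by (simp add: ennreal_mult[symmetric])
    finally show ?thesis by simp
  qed
  have "(\<integral>\<^sup>+x. ennreal ((cmod (v x 0))\<^sup>2) * ?I x \<partial>lborel) \<le>
    (\<integral>\<^sup>+x. (4 * ennreal h * A x + (4 * (\<integral>\<^sup>+y. B y * ?J y \<partial>lborel) + 2 * ennreal ((cmod m)\<^sup>2))) * ?I x \<partial>lborel)"
  proof (rule nn_integral_mono)
    fix x
    show "ennreal ((cmod (v x 0))\<^sup>2) * ?I x <= (4 * ennreal h * A x + (4 * (\<integral>\<^sup>+y. B y * ?J y \<partial>lborel) + 2 * ennreal ((cmod m)\<^sup>2))) * ?I x"
    proof (cases "x \<in> {x0..<x0+h}")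
      case True
      have "(cmod (v x 0))\<^sup>2 <= 2 * (cmod (v x 0 - m))\<^sup>2 + 2 * (cmod m)\<^sup>2" using cmod_add_sq_le[of "v x 0 - m" m] by simp
      then have "ennreal ((cmod (v x 0))\<^sup>2) <= 2 * ennreal ((cmod (v x 0 - m))\<^sup>2) + 2 * ennreal ((cmod m)\<^sup>2)"
        by (subst (asm) ennreal_le_iff[symmetric]) (auto simp: ennreal_mult)
      also have "\<dots> <= 2 * (2 * ennreal h * A x + 2 * (\<integral>\<^sup>+y. B y * ?J y \<partial>lborel)) + 2 * ennreal ((cmod m)\<^sup>2)"
        by (intro add_mono mult_left_mono mean True) auto
      also have "\<dots> = 4 * ennreal h * A x + (4 * (\<integral>\<^sup>+y. B y * ?J y \<partial>lborel) + 2 * ennreal ((cmod m)\<^sup>2))"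
        by (simp add: distrib_left mult.assoc[symmetric] add.assoc)
      finally show ?thesis using True by simp
    qed simp
  qed
  also have "\<dots> = (\<integral>\<^sup>+x. 4 * ennreal h * (A x * ?I x) + (4 * (\<integral>\<^sup>+y. B y * ?J y \<partial>lborel) + 2 * ennreal ((cmod m)\<^sup>2)) * ?I x \<partial>lborel)"
    by (intro nn_integral_cong) (simp add: distrib_right mult.assoc)
  also have "\<dots> = 4 * ennreal h * (\<integral>\<^sup>+x. A x * ?I x \<partial>lborel) + (4 * (\<integral>\<^sup>+y. B y * ?J y \<partial>lborel) + 2 * ennreal ((cmod m)\<^sup>2)) * ennreal h"
  proof -
    have I: "(\<integral>\<^sup>+x. K * ?I x \<partial>lborel) = K * ennreal h" for K
      using h by (subst nn_integral_cmult_indicator) auto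
    have "(\<integral>\<^sup>+x. 4 * ennreal h * (A x * ?I x) \<partial>lborel) = 4 * ennreal h * (\<integral>\<^sup>+x. A x * ?I x \<partial>lborel)"
      by (intro nn_integral_cmult) measurable
    then show ?thesis
      by (subst nn_integral_add) (measurable, simp only: I)
  qed
  also have "\<dots> = 4 * ennreal h * ((\<integral>\<^sup>+y. B y * ?J y \<partial>lborel) + (\<integral>\<^sup>+x. A x * ?I x \<partial>lborel)) + 2 * ennreal ((cmod m)\<^sup>2) * ennreal h"
    by (simp add: distrib_left distrib_right mult_ac add_ac)
  also have "(\<integral>\<^sup>+y. B y * ?J y \<partial>lborel) + (\<integral>\<^sup>+x. A x * ?I x \<partial>lborel) =
     (\<integral>\<^sup>+z. ennreal ((cmod (vx (fst z) (snd z)))\<^sup>2 + (cmod (vy (fst z) (snd z)))\<^sup>2) * indicator Q z \<partial>lborel)"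
    unfolding SA SB by (subst nn_integral_add[symmetric]) (auto simp: distrib_right)
  also have "4 * ennreal h = ennreal (4 * h)" using h by (simp add: ennreal_mult)
  also have "2 * ennreal ((cmod m)\<^sup>2) * ennreal h = ennreal (2 / h^3 * (cmod (\<integral>z. v (fst z) (snd z) * indicator Q z \<partial>lborel))\<^sup>2)"
  proof -
    have "2 * (cmod m)\<^sup>2 * h = 2 / h^3 * (cmod (\<integral>z. v (fst z) (snd z) * indicator Q z \<partial>lborel))\<^sup>2"
      using h by (simp add: m_def norm_divide norm_mult power_divide power2_eq_square power3_eq_cube field_simps)
    moreover have "2 * ennreal ((cmod m)\<^sup>2) * ennreal h = ennreal (2 * (cmod m)\<^sup>2 * h)" using h by (simp add: ennreal_mult)
    ultimately show ?thesis by simp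
  qed
  finally show ?thesis .
qed

lemma distr_shear:
  fixes c :: real
  shows "distr lborel borel (%z::real \<times> real. (fst z, c * fst z + snd z)) = lborel"
proof (rule measure_eqI)
  fix X :: "(real \<times> real) set" assume "X \<in> sets (distr lborel borel (%z::real \<times> real. (fst z, c * fst z + snd z)))"
  then have X [measurable]: "X \<in> sets borel" by simp
  have cont: "continuous_on UNIV (%z::real \<times> real. (fst z, c * fst z + snd z))" by (intro continuous_intros)
  then have T [measurable]: "(%z::real \<times> real. (fst z, c * fst z + snd z)) \<in> borel_measurable borel"
    by (rule borel_measurable_continuous_onI)
  have T2: "(%z::real \<times> real. indicator X (fst z, c * fst z + snd z) :: ennreal) \<in> borel_measurable (borel \<Otimes>\<^sub>M borel)"
    unfolding borel_prod by measurable
  have "emeasure (distr lborel borel (%z::real \<times> real. (fst z, c * fst z + snd z))) X = (\<integral>\<^sup>+z. indicator X z \<partial>distr lborel borel (%z::real \<times> real. (fst z, c * fst z + snd z)))"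
    by simp
  also have "\<dots> = (\<integral>\<^sup>+z. indicator X (fst z, c * fst z + snd z) \<partial>lborel)" by (subst nn_integral_distr) auto
  also have "\<dots> = (\<integral>\<^sup>+z. indicator X (fst z, c * fst z + snd z) \<partial>(lborel \<Otimes>\<^sub>M lborel))" by (simp add: lborel_prod)
  also have "\<dots> = (\<integral>\<^sup>+s. \<integral>\<^sup>+t. indicator X (fst (s, t), c * fst (s, t) + snd (s, t)) \<partial>lborel \<partial>lborel)"
    by (rule lborel.nn_integral_fst[symmetric]) (use T2 in simp)
  also have "\<dots> = (\<integral>\<^sup>+s. \<integral>\<^sup>+t. indicator X (1 * s + 0 * t, c * s + 1 * t) \<partial>lborel \<partial>lborel)" by simp
  also have "\<dots> = (\<integral>\<^sup>+z. indicator X z \<partial>lborel)" by (rule nn_integral_linear_plane) auto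
  finally show "emeasure (distr lborel borel (%z::real \<times> real. (fst z, c * fst z + snd z))) X = emeasure lborel X" by simp
qed simp

definition boundary_cell :: "real => real => int => (real \<times> real) set" where
  "boundary_cell \<theta> h j = {(x, y). of_int j * h <= x \<and> x < of_int j * h + h \<and> 0 < y - cot \<theta> * \<bar>x\<bar> \<and> y - cot \<theta> * \<bar>x\<bar> < h}"

lemma boundary_cell_borel [measurable]: "boundary_cell \<theta> h j \<in> sets borel"
proof -
  have "boundary_cell \<theta> h j = {z. of_int j * h <= fst z} \<inter> {z. fst z < of_int j * h + h} \<inter> {z. 0 < snd z - cot \<theta> * \<bar>fst z\<bar>} \<inter> {z. snd z - cot \<theta> * \<bar>fst z\<bar> < h}"
    by (auto simp: boundary_cell_def)
  also have "\<dots> \<in> sets borel"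
    by (intro sets.Int borel_open borel_closed open_Collect_less closed_Collect_le continuous_intros)
  finally show ?thesis .
qed

lemma cell_trace_inequality:
  assumes \<phi>: "test_fun \<phi>" and h: "h > 0"
  shows "(\<integral>\<^sup>+x. ennreal ((cmod (\<phi> (x, cot \<theta> * \<bar>x\<bar>)))\<^sup>2) * indicator {of_int j * h..<of_int j * h + h} x \<partial>lborel) \<le>
     ennreal (4 * h * (2 + (cot \<theta>)\<^sup>2)) * (\<integral>\<^sup>+z. ennreal (grad_sq \<phi> z) * indicator (boundary_cell \<theta> h j) z \<partial>lborel)
     + ennreal (2 / h^3 * (cmod (\<integral>z. \<phi> z * indicator (boundary_cell \<theta> h j) z \<partial>lborel))\<^sup>2)"
proof -
  note sm = test_fun_smooth[OF \<phi>]
  note [measurable] = smooth_measurable[OF sm] grad_sq_measurable[OF sm]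
  define \<kappa> where "\<kappa> = (if j \<ge> 0 then 1 else - 1 :: real)"
  define c where "c = \<kappa> * cot \<theta>"
  define x0 where "x0 = of_int j * h"
  have absx: "cot \<theta> * \<bar>x\<bar> = c * x" if "x \<in> {x0..<x0+h}" for x
  proof (cases "j \<ge> 0")
    case True
    then have "x \<ge> 0" using that h by (auto simp: x0_def intro: order_trans[rotated])
    then show ?thesis using True by (simp add: c_def \<kappa>_def)
  next
    case False
    then have "j + 1 <= 0" by simp
    then have "of_int (j + 1) * h <= (0::real)" using h by (intro mult_nonpos_nonneg) (auto simp del: of_int_add)
    then have "x <= 0" using that by (auto simp: x0_def algebra_simps)
    then show ?thesis using False by (simp add: c_def \<kappa>_def)
  qed
  define T where "T z = (fst z, c * fst z + snd z)" for z :: "real \<times> real"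
  have "continuous_on UNIV T" unfolding T_def by (intro continuous_intros)
  then have T [measurable]: "T \<in> borel_measurable borel" by (rule borel_measurable_continuous_onI)
  have dT: "distr lborel borel T = lborel" using distr_shear[of c] by (simp add: T_def[abs_def])
  define v where "v x y = \<phi> (x, c * x + y)" for x y
  define vx where "vx x y = frechet_derivative \<phi> (at (x, c * x + y)) (1, c)" for x y
  define vy where "vy x y = frechet_derivative \<phi> (at (x, c * x + y)) (0, 1)" for x y
  let ?Q = "{x0..<x0+h} \<times> {0<..<h}"
  have lx: "(x, c * x + y) = (0, y) + x *\<^sub>R (1, c)" and ly: "(x, c * x + y) = (x, c * x) + y *\<^sub>R (0, 1)" for x y
    by (simp_all add: mult.commute)
  have mD: "(%z. frechet_derivative \<phi> (at z) w) \<in> borel_measurable borel" for w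
    unfolding derivative_expand[OF sm, where h = w]
    by (intro borel_measurable_sum borel_measurable_times borel_measurable_const smooth_measurable smoothD(3)[OF sm])
  obtain M where M: "\<And>x. cmod (\<phi> x) <= M" using test_fun_bounded[OF \<phi>] by blast
  have QT: "indicator ?Q z = (indicator (boundary_cell \<theta> h j) (T z) :: 'b::zero_neq_one)" for z
  proof (cases "fst z \<in> {x0..<x0+h}")
    case True
    show ?thesis using absx[OF True] True by (cases z) (auto simp: T_def boundary_cell_def x0_def indicator_def)
  next
    case False
    then show ?thesis by (cases z) (auto simp: T_def boundary_cell_def x0_def indicator_def)
  qed
  have "(\<integral>\<^sup>+x. ennreal ((cmod (v x 0))\<^sup>2) * indicator {x0..<x0+h} x \<partial>lborel) \<le>
     ennreal (4 * h) * (\<integral>\<^sup>+z. ennreal ((cmod (vx (fst z) (snd z)))\<^sup>2 + (cmod (vy (fst z) (snd z)))\<^sup>2) * indicator ?Q z \<partial>lborel)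
     + ennreal (2 / h^3 * (cmod (\<integral>z. v (fst z) (snd z) * indicator ?Q z \<partial>lborel))\<^sup>2)"
  proof (rule cell_inequality[OF _ _ _ _ _ _ _ _ h])
    show "((%x. v x y) has_vector_derivative vx x y) (at x)" for x y
      unfolding v_def vx_def lx by (rule line_derivative[OF sm])
    show "continuous_on UNIV (%x. vx x y)" for y unfolding vx_def lx by (rule line_derivative[OF sm])
    show "(v x has_vector_derivative vy x y) (at y)" for x y
      unfolding v_def vy_def ly by (rule line_derivative[OF sm])
    show "continuous_on UNIV (vy x)" for x unfolding vy_def ly by (rule line_derivative[OF sm])
    show "(%z. v (fst z) (snd z)) \<in> borel_measurable borel"
      using measurable_compose[OF T smooth_measurable[OF sm]] by (simp add: v_def T_def)
    show "(%z. vx (fst z) (snd z)) \<in> borel_measurable borel" "(%z. vy (fst z) (snd z)) \<in> borel_measurable borel"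
      using measurable_compose[OF T mD] by (simp_all add: vx_def vy_def T_def)
    show "cmod (v x y) <= M" for x y using M by (simp add: v_def)
  qed
  also have "(\<integral>\<^sup>+x. ennreal ((cmod (v x 0))\<^sup>2) * indicator {x0..<x0+h} x \<partial>lborel) =
    (\<integral>\<^sup>+x. ennreal ((cmod (\<phi> (x, cot \<theta> * \<bar>x\<bar>)))\<^sup>2) * indicator {x0..<x0+h} x \<partial>lborel)"
    by (intro nn_integral_cong) (auto simp: v_def absx indicator_def)
  also have "(\<integral>z. v (fst z) (snd z) * indicator ?Q z \<partial>lborel) = (\<integral>z. \<phi> z * indicator (boundary_cell \<theta> h j) z \<partial>lborel)"
  proof -
    have "(\<integral>z. \<phi> z * indicator (boundary_cell \<theta> h j) z \<partial>lborel) = (\<integral>z. \<phi> z * indicator (boundary_cell \<theta> h j) z \<partial>distr lborel borel T)"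
      by (simp add: dT)
    also have "\<dots> = (\<integral>z. \<phi> (T z) * indicator (boundary_cell \<theta> h j) (T z) \<partial>lborel)"
      by (rule integral_distr) auto
    finally show ?thesis by (simp add: QT v_def T_def)
  qed
  also have "(\<integral>\<^sup>+z. ennreal ((cmod (vx (fst z) (snd z)))\<^sup>2 + (cmod (vy (fst z) (snd z)))\<^sup>2) * indicator ?Q z \<partial>lborel)
     <= (\<integral>\<^sup>+z. ennreal (2 + (cot \<theta>)\<^sup>2) * (ennreal (grad_sq \<phi> (T z)) * indicator (boundary_cell \<theta> h j) (T z)) \<partial>lborel)"
  proof (rule nn_integral_mono)
    fix z
    have "(norm (1::real, c))\<^sup>2 = 1 + c\<^sup>2" "(norm (0::real, 1::real))\<^sup>2 = 1" by (simp_all add: norm_Pair)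
    moreover have "c\<^sup>2 = (cot \<theta>)\<^sup>2" by (simp add: c_def \<kappa>_def power_mult_distrib)
    ultimately have "(cmod (vx (fst z) (snd z)))\<^sup>2 + (cmod (vy (fst z) (snd z)))\<^sup>2 <= grad_sq \<phi> (T z) * (1 + (cot \<theta>)\<^sup>2) + grad_sq \<phi> (T z) * 1"
      using directional_derivative_bound[OF sm, of "T z" "(1, c)"] directional_derivative_bound[OF sm, of "T z" "(0, 1)"]
      unfolding vx_def vy_def T_def by (intro add_mono) simp_all
    also have "\<dots> = (2 + (cot \<theta>)\<^sup>2) * grad_sq \<phi> (T z)" by (simp add: algebra_simps)
    finally have "ennreal ((cmod (vx (fst z) (snd z)))\<^sup>2 + (cmod (vy (fst z) (snd z)))\<^sup>2) <= ennreal ((2 + (cot \<theta>)\<^sup>2) * grad_sq \<phi> (T z))"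
      by (rule ennreal_leI)
    also have "\<dots> = ennreal (2 + (cot \<theta>)\<^sup>2) * ennreal (grad_sq \<phi> (T z))" by (rule ennreal_mult) auto
    finally have "ennreal ((cmod (vx (fst z) (snd z)))\<^sup>2 + (cmod (vy (fst z) (snd z)))\<^sup>2) <= ennreal (2 + (cot \<theta>)\<^sup>2) * ennreal (grad_sq \<phi> (T z))" .
    then show "ennreal ((cmod (vx (fst z) (snd z)))\<^sup>2 + (cmod (vy (fst z) (snd z)))\<^sup>2) * indicator ?Q z
      <= ennreal (2 + (cot \<theta>)\<^sup>2) * (ennreal (grad_sq \<phi> (T z)) * indicator (boundary_cell \<theta> h j) (T z))"
      unfolding QT mult.assoc[symmetric] by (rule mult_right_mono) simp
  qed
  also have "(\<integral>\<^sup>+z. ennreal (2 + (cot \<theta>)\<^sup>2) * (ennreal (grad_sq \<phi> (T z)) * indicator (boundary_cell \<theta> h j) (T z)) \<partial>lborel)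
     = ennreal (2 + (cot \<theta>)\<^sup>2) * (\<integral>\<^sup>+z. ennreal (grad_sq \<phi> z) * indicator (boundary_cell \<theta> h j) z \<partial>lborel)"
  proof -
    have "(\<integral>\<^sup>+z. ennreal (2 + (cot \<theta>)\<^sup>2) * (ennreal (grad_sq \<phi> (T z)) * indicator (boundary_cell \<theta> h j) (T z)) \<partial>lborel)
       = (\<integral>\<^sup>+z. ennreal (2 + (cot \<theta>)\<^sup>2) * (ennreal (grad_sq \<phi> z) * indicator (boundary_cell \<theta> h j) z) \<partial>distr lborel borel T)"
      by (subst nn_integral_distr) auto
    then show ?thesis by (simp add: dT nn_integral_cmult)
  qed
  finally have fin: "(\<integral>\<^sup>+x. ennreal ((cmod (\<phi> (x, cot \<theta> * \<bar>x\<bar>)))\<^sup>2) * indicator {x0..<x0+h} x \<partial>lborel) \<le>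
    ennreal (4 * h) * (ennreal (2 + (cot \<theta>)\<^sup>2) * (\<integral>\<^sup>+z. ennreal (grad_sq \<phi> z) * indicator (boundary_cell \<theta> h j) z \<partial>lborel)) +
    ennreal (2 / h^3 * (cmod (\<integral>z. \<phi> z * indicator (boundary_cell \<theta> h j) z \<partial>lborel))\<^sup>2)"
    by (simp add: mult_left_mono add_mono)
  have "ennreal (4 * h) * (ennreal (2 + (cot \<theta>)\<^sup>2) * y) = ennreal (4 * h * (2 + (cot \<theta>)\<^sup>2)) * y" for y
    using h by (simp add: ennreal_mult mult.assoc)
  then show ?thesis using fin by (simp add: x0_def)
qed

text \<open>
  A fraction \<open>\<delta>\<close> of the gradient energy is reserved for the cells at the corner, whose size \<open>h\<close> is so
  small that \<open>cell_trace_inequality\<close> needs no more than that; the rest serves \<open>Robin_Omega1_far\<close>.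
\<close>

theorem Robin_Omega1:
  assumes th: "0 < \<theta>" "\<theta> < pi / 2" and \<gamma>: "\<gamma> > 0" and \<epsilon>: "\<epsilon> > 0"
  shows "\<exists>(p::nat) Q C. (\<forall>i<p. Q i \<in> sets borel \<and> Q i \<subseteq> Omega1 \<theta> \<and> bounded (Q i)) \<and> C \<ge> 0 \<and>
    (\<forall>\<phi>. test_fun \<phi> \<longrightarrow> (\<integral>\<^sup>+z. ennreal (\<gamma> * (cmod (\<phi> z))\<^sup>2) \<partial>arc_measure \<theta>) \<le>
      (\<integral>\<^sup>+z. ennreal (grad_sq \<phi> z + (\<gamma>\<^sup>2 + \<epsilon>) * (cmod (\<phi> z))\<^sup>2) * indicator (Omega1 \<theta>) z \<partial>lborel)
      + ennreal (C * (\<Sum>i<p. (cmod (\<integral>z. \<phi> z * indicator (Q i) z \<partial>lborel))\<^sup>2)))"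
proof -
  have s: "sin \<theta> > 0" "cos \<theta> > 0" using th by (auto intro: sin_gt_zero cos_gt_zero)
  \<comment> \<open>this choice makes \<open>\<gamma>\<^sup>2 / (1 - \<delta>) = \<gamma>\<^sup>2 + \<epsilon> / 2\<close>\<close>
  define \<delta> where "\<delta> = (\<epsilon> / 2) / (\<gamma>\<^sup>2 + \<epsilon> / 2)"
  have g2: "\<gamma>\<^sup>2 + \<epsilon> / 2 > 0" using \<gamma> \<epsilon> by (simp add: add_pos_pos)
  have \<delta>: "\<delta> > 0" "1 - \<delta> = \<gamma>\<^sup>2 / (\<gamma>\<^sup>2 + \<epsilon> / 2)" "1 - \<delta> > 0"
  proof -
    show "\<delta> > 0" using g2 \<epsilon> by (simp add: \<delta>_def)
    show e: "1 - \<delta> = \<gamma>\<^sup>2 / (\<gamma>\<^sup>2 + \<epsilon> / 2)" using g2 by (simp add: \<delta>_def field_simps)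
    show "1 - \<delta> > 0" unfolding e using g2 \<gamma> by simp
  qed
  define \<gamma>1 where "\<gamma>1 = \<gamma> / (1 - \<delta>)"
  define L where "L = 2 * \<gamma> / \<epsilon>"
  have L: "L > 0" using \<gamma> \<epsilon> by (simp add: L_def)
  have \<gamma>1: "\<gamma>1 > 0" "(1 - \<delta>) * \<gamma>1 = \<gamma>" using \<gamma> \<delta>(3) by (auto simp: \<gamma>1_def)
  have const: "(1 - \<delta>) * (\<gamma>1\<^sup>2 + \<gamma>1 / L) = \<gamma>\<^sup>2 + \<epsilon>"
  proof -
    have "(1 - \<delta>) * (\<gamma>1\<^sup>2 + \<gamma>1 / L) = ((1 - \<delta>) * \<gamma>1) * \<gamma>1 + ((1 - \<delta>) * \<gamma>1) / L" by (simp add: power2_eq_square algebra_simps)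
    also have "\<dots> = \<gamma> * \<gamma>1 + \<gamma> / L" by (simp only: \<gamma>1(2))
    also have "\<gamma> * \<gamma>1 = \<gamma>\<^sup>2 + \<epsilon> / 2" using \<gamma> g2 by (simp add: \<gamma>1_def \<delta>(2) power2_eq_square)
    also have "\<gamma> / L = \<epsilon> / 2" using \<gamma> \<epsilon> by (simp add: L_def)
    finally show ?thesis by simp
  qed
  define h where "h = \<delta> * sin \<theta> / (4 * \<gamma> * (2 + (cot \<theta>)\<^sup>2))"
  have c0: "2 + (cot \<theta>)\<^sup>2 > 0" by (simp add: add_pos_nonneg)
  have h: "h > 0" "\<gamma> / sin \<theta> * (4 * h * (2 + (cot \<theta>)\<^sup>2)) = \<delta>"
  proof -
    show "h > 0" unfolding h_def using \<delta>(1) s \<gamma> c0 by (intro divide_pos_pos mult_pos_pos) auto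
    have "\<gamma> / sin \<theta> * (4 * h * (2 + (cot \<theta>)\<^sup>2)) = h * (4 * \<gamma> * (2 + (cot \<theta>)\<^sup>2)) / sin \<theta>" by simp
    also have "h * (4 * \<gamma> * (2 + (cot \<theta>)\<^sup>2)) = \<delta> * sin \<theta>" unfolding h_def using \<gamma> c0 by simp
    finally show "\<gamma> / sin \<theta> * (4 * h * (2 + (cot \<theta>)\<^sup>2)) = \<delta>" using s by simp
  qed
  obtain N where N: "L * cos \<theta> / h < real N" using reals_Archimedean2 by blast
  then have N: "L * cos \<theta> < real N * h" using h by (simp add: field_simps)
  define J where "J i = int i - int N" for i
  define Q where "Q i = boundary_cell \<theta> h (J i)" for i
  define C where "C = \<gamma> / sin \<theta> * (2 / h^3)"
  have C: "C \<ge> 0" using \<gamma> s h by (simp add: C_def)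
  have Q1: "Q i \<in> sets borel \<and> Q i \<subseteq> Omega1 \<theta> \<and> bounded (Q i)" for i
  proof (intro conjI)
    show "Q i \<in> sets borel" unfolding Q_def by measurable
    show "Q i \<subseteq> Omega1 \<theta>" by (auto simp: Q_def boundary_cell_def Omega1_def)
    define m where "m = \<bar>of_int (J i) * h\<bar> + h"
    have "Q i \<subseteq> cbox (- m, - (h + cot \<theta> * m)) (m, h + cot \<theta> * m)"
    proof
      fix z assume z: "z \<in> Q i"
      obtain x y where xy: "z = (x, y)" by (cases z)
      have x: "\<bar>x\<bar> <= m" using z h by (auto simp: xy Q_def boundary_cell_def m_def abs_if)
      have ct: "cot \<theta> > 0" using s by (simp add: cot_def)
      then have "0 <= cot \<theta> * \<bar>x\<bar>" "cot \<theta> * \<bar>x\<bar> <= cot \<theta> * m" using x by (auto intro: mult_left_mono)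
      then have "\<bar>y\<bar> <= h + cot \<theta> * m" using z h by (auto simp: xy Q_def boundary_cell_def)
      then show "z \<in> cbox (- m, - (h + cot \<theta> * m)) (m, h + cot \<theta> * m)" using x by (auto simp: xy cbox_Pair_eq)
    qed
    then show "bounded (Q i)" using bounded_cbox bounded_subset by blast
  qed
  have main: "(\<integral>\<^sup>+z. ennreal (\<gamma> * (cmod (\<phi> z))\<^sup>2) \<partial>arc_measure \<theta>) \<le>
      (\<integral>\<^sup>+z. ennreal (grad_sq \<phi> z + (\<gamma>\<^sup>2 + \<epsilon>) * (cmod (\<phi> z))\<^sup>2) * indicator (Omega1 \<theta>) z \<partial>lborel)
      + ennreal (C * (\<Sum>i<2*N. (cmod (\<integral>z. \<phi> z * indicator (Q i) z \<partial>lborel))\<^sup>2))" if \<phi>: "test_fun \<phi>" for \<phi>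
  proof -
    note sm = test_fun_smooth[OF \<phi>]
    have mphi [measurable]: "\<phi> \<in> borel_measurable borel" "grad_sq \<phi> \<in> borel_measurable borel"
      using smooth_measurable[OF sm] grad_sq_measurable[OF sm] by auto
    have mO [measurable]: "Omega1 \<theta> \<in> sets borel" using Omega_open by auto
    let ?G = "%z. ennreal (grad_sq \<phi> z)"
    let ?c = "%i. (cmod (\<integral>z. \<phi> z * indicator (Q i) z \<partial>lborel))\<^sup>2"
    define H where "H s = ennreal (\<gamma> * (cmod (\<phi> (arc_param \<theta> s)))\<^sup>2)" for s
    have [measurable]: "H \<in> borel_measurable borel" unfolding H_def by measurable
    define R where "R = L * cot \<theta>"
    have far: "(\<integral>\<^sup>+s. H s * indicator {s. R < \<bar>s\<bar>} s \<partial>lborel) \<le>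
       (\<integral>\<^sup>+z. ennreal ((1 - \<delta>) * grad_sq \<phi> z + (\<gamma>\<^sup>2 + \<epsilon>) * (cmod (\<phi> z))\<^sup>2) * indicator (Omega1 \<theta>) z \<partial>lborel)"
    proof -
      have "(\<integral>\<^sup>+s. H s * indicator {s. R < \<bar>s\<bar>} s \<partial>lborel) = (\<integral>\<^sup>+s. ennreal (1 - \<delta>) * (ennreal (\<gamma>1 * (cmod (\<phi> (arc_param \<theta> s)))\<^sup>2) * indicator {s. R < \<bar>s\<bar>} s) \<partial>lborel)"
      proof (intro nn_integral_cong)
        fix s
        have "H s = ennreal (1 - \<delta>) * ennreal (\<gamma>1 * (cmod (\<phi> (arc_param \<theta> s)))\<^sup>2)"
          unfolding H_def using \<delta>(3) \<gamma>1 by (simp add: ennreal_mult[symmetric] mult.assoc[symmetric])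
        then show "H s * indicator {s. R < \<bar>s\<bar>} s = ennreal (1 - \<delta>) * (ennreal (\<gamma>1 * (cmod (\<phi> (arc_param \<theta> s)))\<^sup>2) * indicator {s. R < \<bar>s\<bar>} s)"
          by (simp add: mult.assoc)
      qed
      also have "\<dots> = ennreal (1 - \<delta>) * (\<integral>\<^sup>+s. ennreal (\<gamma>1 * (cmod (\<phi> (arc_param \<theta> s)))\<^sup>2) * indicator {s. R < \<bar>s\<bar>} s \<partial>lborel)"
        by (intro nn_integral_cmult) measurable
      also have "\<dots> <= ennreal (1 - \<delta>) * (\<integral>\<^sup>+z. ennreal (grad_sq \<phi> z + (\<gamma>1\<^sup>2 + \<gamma>1 / L) * (cmod (\<phi> z))\<^sup>2) * indicator (Omega1 \<theta>) z \<partial>lborel)"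
        unfolding R_def using \<gamma>1 by (intro mult_left_mono Robin_Omega1_far[OF \<phi> th _ L]) auto
      also have "\<dots> = (\<integral>\<^sup>+z. ennreal (1 - \<delta>) * (ennreal (grad_sq \<phi> z + (\<gamma>1\<^sup>2 + \<gamma>1 / L) * (cmod (\<phi> z))\<^sup>2) * indicator (Omega1 \<theta>) z) \<partial>lborel)"
        by (intro nn_integral_cmult[symmetric]) measurable
      also have "\<dots> = (\<integral>\<^sup>+z. ennreal ((1 - \<delta>) * grad_sq \<phi> z + (\<gamma>\<^sup>2 + \<epsilon>) * (cmod (\<phi> z))\<^sup>2) * indicator (Omega1 \<theta>) z \<partial>lborel)"
      proof (intro nn_integral_cong)
        fix z
        have "(1 - \<delta>) * (grad_sq \<phi> z + (\<gamma>1\<^sup>2 + \<gamma>1 / L) * (cmod (\<phi> z))\<^sup>2) = (1 - \<delta>) * grad_sq \<phi> z + ((1 - \<delta>) * (\<gamma>1\<^sup>2 + \<gamma>1 / L)) * (cmod (\<phi> z))\<^sup>2"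
          by (simp only: distrib_left[of "1 - \<delta>" "grad_sq \<phi> z"] mult.assoc)
        also have "\<dots> = (1 - \<delta>) * grad_sq \<phi> z + (\<gamma>\<^sup>2 + \<epsilon>) * (cmod (\<phi> z))\<^sup>2" by (simp only: const)
        finally have "ennreal (1 - \<delta>) * ennreal (grad_sq \<phi> z + (\<gamma>1\<^sup>2 + \<gamma>1 / L) * (cmod (\<phi> z))\<^sup>2) = ennreal ((1 - \<delta>) * grad_sq \<phi> z + (\<gamma>\<^sup>2 + \<epsilon>) * (cmod (\<phi> z))\<^sup>2)"
          using \<delta>(3) \<gamma>1 L by (subst ennreal_mult[symmetric]) auto
        then show "ennreal (1 - \<delta>) * (ennreal (grad_sq \<phi> z + (\<gamma>1\<^sup>2 + \<gamma>1 / L) * (cmod (\<phi> z))\<^sup>2) * indicator (Omega1 \<theta>) z)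
          = ennreal ((1 - \<delta>) * grad_sq \<phi> z + (\<gamma>\<^sup>2 + \<epsilon>) * (cmod (\<phi> z))\<^sup>2) * indicator (Omega1 \<theta>) z"
          by (simp add: mult.assoc[symmetric])
      qed
      finally show ?thesis .
    qed
    define V where "V x = ennreal ((cmod (\<phi> (x, cot \<theta> * \<bar>x\<bar>)))\<^sup>2)" for x
    have "continuous_on UNIV (%x::real. (x, cot \<theta> * \<bar>x\<bar>))" by (intro continuous_intros)
    then have [measurable]: "(%x::real. (x, cot \<theta> * \<bar>x\<bar>)) \<in> borel_measurable borel" by (rule borel_measurable_continuous_onI)
    have [measurable]: "V \<in> borel_measurable borel" unfolding V_def by measurable
    have Vc: "V (0 + sin \<theta> * s) = ennreal ((cmod (\<phi> (arc_param \<theta> s)))\<^sup>2)" for s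
      using s(1) by (simp add: V_def arc_param_def abs_mult cot_def mult_ac)
    have cover: "indicator {x. \<bar>x\<bar> <= L * cos \<theta>} x <= (\<Sum>i<2*N. indicator {of_int (J i) * h..<of_int (J i) * h + h} x :: ennreal)" for x
    proof (cases "\<bar>x\<bar> <= L * cos \<theta>")
      case True
      then have xN: "\<bar>x\<bar> < real N * h" using N by simp
      define j where "j = \<lfloor>x / h\<rfloor>"
      have j: "of_int j * h <= x" "x < of_int j * h + h"
        using floor_divide_lower[OF h(1), of x] floor_divide_upper[OF h(1), of x] by (auto simp: j_def algebra_simps)
      have "- real N <= x / h" "x / h < real N" using xN h(1) by (auto simp: field_simps abs_if split: if_splits)
      then have jN: "- int N <= j" "j < int N" by (auto simp: j_def le_floor_iff floor_less_iff)
      define i where "i = nat (j + int N)"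
      have i: "i < 2 * N" "J i = j" using jN by (auto simp: i_def J_def)
      have "(1::ennreal) = indicator {of_int (J i) * h..<of_int (J i) * h + h} x" using j i by simp
      also have "\<dots> <= (\<Sum>i<2*N. indicator {of_int (J i) * h..<of_int (J i) * h + h} x)"
        using i(1) by (intro member_le_sum) auto
      finally show ?thesis using True by simp
    qed simp
    have cells: "(\<Sum>i<2*N. indicator (Q i) z) <= (indicator (Omega1 \<theta>) z :: ennreal)" for z
    proof -
      have disj: "disjoint_family_on Q {..<2*N}"
        unfolding disjoint_family_on_def
      proof (intro ballI impI)
        fix i k :: nat assume "i \<noteq> k"
        then consider "J i + 1 <= J k" | "J k + 1 <= J i" unfolding J_def by linarith
        then have "of_int (J i) * h + h <= of_int (J k) * h \<or> of_int (J k) * h + h <= of_int (J i) * h"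
        proof cases
          case 1
          then have "of_int (J i + 1) * h <= of_int (J k) * h" using h(1) by (intro mult_right_mono) (auto simp del: of_int_add)
          then show ?thesis by (simp add: algebra_simps)
        next
          case 2
          then have "of_int (J k + 1) * h <= of_int (J i) * h" using h(1) by (intro mult_right_mono) (auto simp del: of_int_add)
          then show ?thesis by (simp add: algebra_simps)
        qed
        then show "Q i \<inter> Q k = {}" by (auto simp: Q_def boundary_cell_def)
      qed
      have "(\<Sum>i<2*N. indicator (Q i) z) = (indicator (\<Union>i<2*N. Q i) z :: ennreal)"
        using disj by (intro indicator_UN_disjoint[symmetric]) auto
      also have "\<dots> <= indicator (Omega1 \<theta>) z" using Q1 by (intro indicator_leI) auto
      finally show ?thesis .
    qed
    have near: "(\<integral>\<^sup>+s. H s * indicator {s. \<bar>s\<bar> <= R} s \<partial>lborel) <= ennreal \<delta> * (\<integral>\<^sup>+z. ?G z * indicator (Omega1 \<theta>) z \<partial>lborel) + ennreal (C * (\<Sum>i<2*N. ?c i))"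
    proof -
      have Rs: "L * cos \<theta> = R * sin \<theta>" using s by (simp add: R_def cot_def)
      have ind: "indicator {x. \<bar>x\<bar> <= L * cos \<theta>} (0 + sin \<theta> * t) = (indicator {s. \<bar>s\<bar> <= R} t :: ennreal)" for t
        unfolding Rs using s by (auto simp: indicator_def abs_mult mult.commute)
      have "(\<integral>\<^sup>+x. V x * indicator {x. \<bar>x\<bar> <= L * cos \<theta>} x \<partial>lborel) = ennreal \<bar>sin \<theta>\<bar> * (\<integral>\<^sup>+t. V (0 + sin \<theta> * t) * indicator {x. \<bar>x\<bar> <= L * cos \<theta>} (0 + sin \<theta> * t) \<partial>lborel)"
        using s by (intro nn_integral_real_affine) auto
      also have "\<dots> = ennreal (sin \<theta>) * (\<integral>\<^sup>+t. ennreal ((cmod (\<phi> (arc_param \<theta> t)))\<^sup>2) * indicator {s. \<bar>s\<bar> <= R} t \<partial>lborel)"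
        unfolding Vc ind using s by simp
      finally have VV: "(\<integral>\<^sup>+x. V x * indicator {x. \<bar>x\<bar> <= L * cos \<theta>} x \<partial>lborel) = ennreal (sin \<theta>) * (\<integral>\<^sup>+t. ennreal ((cmod (\<phi> (arc_param \<theta> t)))\<^sup>2) * indicator {s. \<bar>s\<bar> <= R} t \<partial>lborel)" .
      have "(\<integral>\<^sup>+s. H s * indicator {s. \<bar>s\<bar> <= R} s \<partial>lborel) = ennreal (\<gamma> / sin \<theta>) * (ennreal (sin \<theta>) * (\<integral>\<^sup>+t. ennreal ((cmod (\<phi> (arc_param \<theta> t)))\<^sup>2) * indicator {s. \<bar>s\<bar> <= R} t \<partial>lborel))"
      proof -
        have "(\<integral>\<^sup>+s. H s * indicator {s. \<bar>s\<bar> <= R} s \<partial>lborel) = (\<integral>\<^sup>+s. ennreal \<gamma> * (ennreal ((cmod (\<phi> (arc_param \<theta> s)))\<^sup>2) * indicator {s. \<bar>s\<bar> <= R} s) \<partial>lborel)"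
          unfolding H_def using \<gamma> by (intro nn_integral_cong) (simp add: ennreal_mult mult.assoc)
        also have "\<dots> = ennreal \<gamma> * (\<integral>\<^sup>+t. ennreal ((cmod (\<phi> (arc_param \<theta> t)))\<^sup>2) * indicator {s. \<bar>s\<bar> <= R} t \<partial>lborel)"
          by (intro nn_integral_cmult) measurable
        also have "ennreal \<gamma> = ennreal (\<gamma> / sin \<theta>) * ennreal (sin \<theta>)" using s \<gamma> by (simp add: ennreal_mult[symmetric])
        finally show ?thesis by (simp add: mult.assoc)
      qed
      also have "\<dots> = ennreal (\<gamma> / sin \<theta>) * (\<integral>\<^sup>+x. V x * indicator {x. \<bar>x\<bar> <= L * cos \<theta>} x \<partial>lborel)" by (simp add: VV)
      also have "\<dots> <= ennreal (\<gamma> / sin \<theta>) * (\<integral>\<^sup>+x. (\<Sum>i<2*N. V x * indicator {of_int (J i) * h..<of_int (J i) * h + h} x) \<partial>lborel)"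
        unfolding sum_distrib_left[symmetric] using cover by (intro mult_left_mono nn_integral_mono) auto
      also have "(\<integral>\<^sup>+x. (\<Sum>i<2*N. V x * indicator {of_int (J i) * h..<of_int (J i) * h + h} x) \<partial>lborel) = (\<Sum>i<2*N. \<integral>\<^sup>+x. V x * indicator {of_int (J i) * h..<of_int (J i) * h + h} x \<partial>lborel)"
        by (intro nn_integral_sum) measurable
      also have "ennreal (\<gamma> / sin \<theta>) * (\<Sum>i<2*N. \<integral>\<^sup>+x. V x * indicator {of_int (J i) * h..<of_int (J i) * h + h} x \<partial>lborel) <= ennreal (\<gamma> / sin \<theta>) * (\<Sum>i<2*N. ennreal (4 * h * (2 + (cot \<theta>)\<^sup>2)) * (\<integral>\<^sup>+z. ?G z * indicator (Q i) z \<partial>lborel) + ennreal (2 / h^3 * ?c i))"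
        unfolding V_def Q_def by (intro mult_left_mono sum_mono cell_trace_inequality[OF \<phi> h(1)]) simp
      also have "\<dots> = ennreal (\<gamma> / sin \<theta>) * ennreal (4 * h * (2 + (cot \<theta>)\<^sup>2)) * (\<Sum>i<2*N. \<integral>\<^sup>+z. ?G z * indicator (Q i) z \<partial>lborel) + ennreal (\<gamma> / sin \<theta>) * (\<Sum>i<2*N. ennreal (2 / h^3 * ?c i))"
        by (simp add: sum.distrib sum_distrib_left[symmetric] distrib_left mult.assoc)
      also have "ennreal (\<gamma> / sin \<theta>) * ennreal (4 * h * (2 + (cot \<theta>)\<^sup>2)) = ennreal \<delta>"
        unfolding h(2)[symmetric] using \<gamma> s h(1) c0 by (intro ennreal_mult[symmetric]) auto
      also have "ennreal (\<gamma> / sin \<theta>) * (\<Sum>i<2*N. ennreal (2 / h^3 * ?c i)) = ennreal (C * (\<Sum>i<2*N. ?c i))"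
      proof -
        have "(\<Sum>i<2*N. ennreal (2 / h^3 * ?c i)) = ennreal (2 / h^3 * (\<Sum>i<2*N. ?c i))"
          using h(1) by (subst sum_ennreal) (auto simp: sum_distrib_left)
        then show ?thesis using \<gamma> s h(1) by (simp add: C_def ennreal_mult[symmetric] sum_nonneg mult.assoc)
      qed
      also have "(\<Sum>i<2*N. \<integral>\<^sup>+z. ?G z * indicator (Q i) z \<partial>lborel) = (\<integral>\<^sup>+z. ?G z * (\<Sum>i<2*N. indicator (Q i) z) \<partial>lborel)"
      proof -
        have [measurable]: "Q i \<in> sets borel" for i using Q1 by simp
        have "(%z. ?G z * indicator (Q i) z) \<in> borel_measurable lborel" for i by measurable
        then show ?thesis unfolding sum_distrib_left by (intro nn_integral_sum[symmetric]) auto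
      qed
      also have "ennreal \<delta> * (\<integral>\<^sup>+z. ?G z * (\<Sum>i<2*N. indicator (Q i) z) \<partial>lborel) + ennreal (C * (\<Sum>i<2*N. ?c i)) <= ennreal \<delta> * (\<integral>\<^sup>+z. ?G z * indicator (Omega1 \<theta>) z \<partial>lborel) + ennreal (C * (\<Sum>i<2*N. ?c i))"
        using cells by (intro add_mono mult_left_mono nn_integral_mono) auto
      finally show ?thesis .
    qed
    have "(\<integral>\<^sup>+z. ennreal (\<gamma> * (cmod (\<phi> z))\<^sup>2) \<partial>arc_measure \<theta>) = (\<integral>\<^sup>+s. H s \<partial>lborel)"
      unfolding H_def by (rule nn_integral_arc) measurable
    also have "\<dots> = (\<integral>\<^sup>+s. H s * indicator {s. R < \<bar>s\<bar>} s + H s * indicator {s. \<bar>s\<bar> <= R} s \<partial>lborel)"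
      by (intro nn_integral_cong) (auto simp: indicator_def)
    also have "\<dots> = (\<integral>\<^sup>+s. H s * indicator {s. R < \<bar>s\<bar>} s \<partial>lborel) + (\<integral>\<^sup>+s. H s * indicator {s. \<bar>s\<bar> <= R} s \<partial>lborel)"
      by (intro nn_integral_add) measurable
    also have "\<dots> <= (\<integral>\<^sup>+z. ennreal ((1 - \<delta>) * grad_sq \<phi> z + (\<gamma>\<^sup>2 + \<epsilon>) * (cmod (\<phi> z))\<^sup>2) * indicator (Omega1 \<theta>) z \<partial>lborel)
        + (ennreal \<delta> * (\<integral>\<^sup>+z. ?G z * indicator (Omega1 \<theta>) z \<partial>lborel) + ennreal (C * (\<Sum>i<2*N. ?c i)))"
      by (intro add_mono far near)
    also have "\<dots> = (\<integral>\<^sup>+z. ennreal ((1 - \<delta>) * grad_sq \<phi> z + (\<gamma>\<^sup>2 + \<epsilon>) * (cmod (\<phi> z))\<^sup>2) * indicator (Omega1 \<theta>) z + ennreal \<delta> * (?G z * indicator (Omega1 \<theta>) z) \<partial>lborel)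
        + ennreal (C * (\<Sum>i<2*N. ?c i))"
    proof -
      define f1 f2 where "f1 = (%z. ennreal ((1 - \<delta>) * grad_sq \<phi> z + (\<gamma>\<^sup>2 + \<epsilon>) * (cmod (\<phi> z))\<^sup>2) * indicator (Omega1 \<theta>) z)"
        and "f2 = (%z. ?G z * indicator (Omega1 \<theta>) z)"
      have [measurable]: "f1 \<in> borel_measurable lborel" "f2 \<in> borel_measurable lborel" unfolding f1_def f2_def by measurable
      have "(\<integral>\<^sup>+z. f1 z + ennreal \<delta> * f2 z \<partial>lborel) = (\<integral>\<^sup>+z. f1 z \<partial>lborel) + ennreal \<delta> * (\<integral>\<^sup>+z. f2 z \<partial>lborel)"
        by (simp add: nn_integral_add nn_integral_cmult)
      then show ?thesis unfolding f1_def f2_def by (simp only: add.assoc)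
    qed
    also have "(\<integral>\<^sup>+z. ennreal ((1 - \<delta>) * grad_sq \<phi> z + (\<gamma>\<^sup>2 + \<epsilon>) * (cmod (\<phi> z))\<^sup>2) * indicator (Omega1 \<theta>) z + ennreal \<delta> * (?G z * indicator (Omega1 \<theta>) z) \<partial>lborel)
       = (\<integral>\<^sup>+z. ennreal (grad_sq \<phi> z + (\<gamma>\<^sup>2 + \<epsilon>) * (cmod (\<phi> z))\<^sup>2) * indicator (Omega1 \<theta>) z \<partial>lborel)"
    proof (intro nn_integral_cong)
      fix z
      have "ennreal ((1 - \<delta>) * grad_sq \<phi> z + (\<gamma>\<^sup>2 + \<epsilon>) * (cmod (\<phi> z))\<^sup>2) + ennreal \<delta> * ?G z = ennreal (((1 - \<delta>) * grad_sq \<phi> z + (\<gamma>\<^sup>2 + \<epsilon>) * (cmod (\<phi> z))\<^sup>2) + \<delta> * grad_sq \<phi> z)"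
        using \<delta> \<epsilon> by (simp add: ennreal_mult[symmetric] ennreal_plus[symmetric] del: ennreal_plus)
      also have "((1 - \<delta>) * grad_sq \<phi> z + (\<gamma>\<^sup>2 + \<epsilon>) * (cmod (\<phi> z))\<^sup>2) + \<delta> * grad_sq \<phi> z = grad_sq \<phi> z + (\<gamma>\<^sup>2 + \<epsilon>) * (cmod (\<phi> z))\<^sup>2"
        by (simp add: algebra_simps)
      finally show "ennreal ((1 - \<delta>) * grad_sq \<phi> z + (\<gamma>\<^sup>2 + \<epsilon>) * (cmod (\<phi> z))\<^sup>2) * indicator (Omega1 \<theta>) z + ennreal \<delta> * (?G z * indicator (Omega1 \<theta>) z)
         = ennreal (grad_sq \<phi> z + (\<gamma>\<^sup>2 + \<epsilon>) * (cmod (\<phi> z))\<^sup>2) * indicator (Omega1 \<theta>) z"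
        by (auto simp: indicator_def)
    qed
    finally show ?thesis .
  qed
  show ?thesis using Q1 C main by blast
qed

section \<open>Traces on Sobolev spaces\<close>

lemma admissible_UNIV: "admissible (UNIV :: 'a::euclidean_space set)"
proof
  fix d :: real assume "d > 0"
  then show "\<exists>(c::'a) s. s > 0 \<and> norm c + s < d \<and> (\<forall>x\<in>UNIV. \<forall>y. dist y (x - c) <= s \<longrightarrow> y \<in> UNIV)"
    by (intro exI[of _ 0] exI[of _ "d / 2"]) auto
qed simp

lemma admissible_Omega:
  assumes th: "0 < \<theta>" "\<theta> < pi / 2"
  shows "admissible (Omega1 \<theta>)" "admissible (Omega2 \<theta>)"
proof -
  have ct: "cot \<theta> > 0" using th by (simp add: cot_def sin_gt_zero cos_gt_zero)
  have move: "cot \<theta> * \<bar>x'\<bar> <= cot \<theta> * \<bar>x\<bar> + s * cot \<theta>" "\<bar>y' - y\<bar> <= s" if "dist (x', y') (x, y) <= s" for x x' y y' s :: real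
  proof -
    have "\<bar>x' - x\<bar> <= s" "\<bar>y' - y\<bar> <= s"
      using that dist_fst_le[of "(x', y')" "(x, y)"] dist_snd_le[of "(x', y')" "(x, y)"] by (auto simp: dist_real_def)
    then have "\<bar>x'\<bar> <= \<bar>x\<bar> + s" by linarith
    then have "cot \<theta> * \<bar>x'\<bar> <= cot \<theta> * (\<bar>x\<bar> + s)" using ct by (intro mult_left_mono) auto
    then show "cot \<theta> * \<bar>x'\<bar> <= cot \<theta> * \<bar>x\<bar> + s * cot \<theta>" by (simp add: algebra_simps)
    show "\<bar>y' - y\<bar> <= s" by fact
  qed
  have size: "\<exists>s>0. s * (1 + cot \<theta>) + s < d" if "d > 0" for d
  proof (intro exI[of _ "d / (2 * (2 + cot \<theta>))"] conjI)
    show "d / (2 * (2 + cot \<theta>)) > 0" using that ct by simp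
    have half: "d / (2 * c) * c = d / 2" if "c > 0" for c :: real using that by simp
    define k where "k = d / (2 * (2 + cot \<theta>))"
    have "k * (1 + cot \<theta>) + k = k * (2 + cot \<theta>)" by (simp add: algebra_simps)
    also have "\<dots> = d / 2" unfolding k_def using ct by (intro half) simp
    finally have "k * (1 + cot \<theta>) + k < d" using that by linarith
    then show "d / (2 * (2 + cot \<theta>)) * (1 + cot \<theta>) + d / (2 * (2 + cot \<theta>)) < d" unfolding k_def .
  qed
  show "admissible (Omega1 \<theta>)"
  proof
    fix d :: real assume "d > 0"
    then obtain s where s: "s > 0" "s * (1 + cot \<theta>) + s < d" using size by blast
    let ?c = "(0, - (s * (1 + cot \<theta>))) :: real \<times> real"
    have "norm ?c + s < d" using s ct by (simp add: norm_Pair abs_mult)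
    moreover have "y \<in> Omega1 \<theta>" if x: "x \<in> Omega1 \<theta>" and y: "dist y (x - ?c) <= s" for x y
    proof -
      obtain a b where x': "x = (a, b)" by (cases x)
      obtain a' b' where y': "y = (a', b')" by (cases y)
      have "dist (a', b') (a, b + s * (1 + cot \<theta>)) <= s" using y by (simp add: x' y')
      from move[OF this] show ?thesis using x by (simp add: x' y' Omega1_def algebra_simps)
    qed
    ultimately show "\<exists>c s. s > 0 \<and> norm c + s < d \<and> (\<forall>x\<in>Omega1 \<theta>. \<forall>y. dist y (x - c) <= s \<longrightarrow> y \<in> Omega1 \<theta>)"
      using s(1) by blast
  qed (rule Omega_open)
  show "admissible (Omega2 \<theta>)"
  proof
    fix d :: real assume "d > 0"
    then obtain s where s: "s > 0" "s * (1 + cot \<theta>) + s < d" using size by blast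
    let ?c = "(0, s * (1 + cot \<theta>)) :: real \<times> real"
    have "norm ?c + s < d" using s ct by (simp add: norm_Pair abs_mult)
    moreover have "y \<in> Omega2 \<theta>" if x: "x \<in> Omega2 \<theta>" and y: "dist y (x - ?c) <= s" for x y
    proof -
      obtain a b where x': "x = (a, b)" by (cases x)
      obtain a' b' where y': "y = (a', b')" by (cases y)
      have d: "dist (a', b') (a, b - s * (1 + cot \<theta>)) <= s" using y by (simp add: x' y')
      then have "dist (a, b - s * (1 + cot \<theta>)) (a', b') <= s" by (simp add: dist_commute)
      from move(1)[OF this] move(2)[OF d] show ?thesis using x by (simp add: x' y' Omega2_def algebra_simps)
    qed
    ultimately show "\<exists>c s. s > 0 \<and> norm c + s < d \<and> (\<forall>x\<in>Omega2 \<theta>. \<forall>y. dist y (x - c) <= s \<longrightarrow> y \<in> Omega2 \<theta>)"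
      using s(1) by blast
  qed (rule Omega_open)
qed

definition grad_norm_sq :: "'a::euclidean_space set => ('a => complex) => real" where
  "grad_norm_sq W u = (\<Sum>e\<in>Basis. (norm_on W (weak_deriv W e u))\<^sup>2)"

lemma grad_norm_sq_nonneg [simp]: "0 <= grad_norm_sq W u"
  by (simp add: grad_norm_sq_def sum_nonneg)

lemma (in admissible) grad_norm_sq_test:
  "test_fun \<phi> ==> grad_norm_sq W \<phi> = (\<Sum>e\<in>Basis. (norm_on W (pderiv_dir e \<phi>))\<^sup>2)"
  unfolding grad_norm_sq_def
  by (intro sum.cong refl arg_cong[where f = "%x. x\<^sup>2"] L2_norm_cong_AE weak_deriv_test L2_measurable weak_deriv_L2 test_fun_H1
      L2_restrict op test_fun_L2 test_fun_pderiv)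

lemma (in admissible) nn_integral_test_energy:
  assumes \<phi>: "test_fun \<phi>" and c: "c \<ge> 0"
  shows "(\<integral>\<^sup>+z. ennreal (grad_sq \<phi> z + c * (cmod (\<phi> z))\<^sup>2) * indicator W z \<partial>lborel) = ennreal (grad_norm_sq W \<phi> + c * (norm_on W \<phi>)\<^sup>2)"
proof -
  have L: "\<phi> \<in> L2 (leb_on W)" by (intro L2_restrict op test_fun_L2 \<phi>)
  have Ld: "pderiv_dir e \<phi> \<in> L2 (leb_on W)" if "e \<in> Basis" for e by (intro L2_restrict op test_fun_L2 test_fun_pderiv \<phi> that)
  have [measurable]: "\<phi> \<in> borel_measurable (leb_on W)" using L by (rule L2_measurable)
  have [measurable]: "e \<in> Basis ==> pderiv_dir e \<phi> \<in> borel_measurable (leb_on W)" for e using Ld by (rule L2_measurable)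
  have "(\<integral>\<^sup>+z. ennreal (grad_sq \<phi> z + c * (cmod (\<phi> z))\<^sup>2) * indicator W z \<partial>lborel) = (\<integral>\<^sup>+z. ennreal (grad_sq \<phi> z + c * (cmod (\<phi> z))\<^sup>2) \<partial>leb_on W)"
    by (rule nn_integral_leb_on[OF op, symmetric])
  also have "\<dots> = (\<integral>\<^sup>+z. (\<Sum>e\<in>Basis. ennreal ((cmod (pderiv_dir e \<phi> z))\<^sup>2)) + ennreal c * ennreal ((cmod (\<phi> z))\<^sup>2) \<partial>leb_on W)"
    using c by (intro nn_integral_cong) (simp add: grad_sq_def ennreal_mult sum_nonneg sum_ennreal)
  also have "\<dots> = (\<integral>\<^sup>+z. (\<Sum>e\<in>Basis. ennreal ((cmod (pderiv_dir e \<phi> z))\<^sup>2)) \<partial>leb_on W) + (\<integral>\<^sup>+z. ennreal c * ennreal ((cmod (\<phi> z))\<^sup>2) \<partial>leb_on W)"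
    by (intro nn_integral_add) measurable
  also have "(\<integral>\<^sup>+z. (\<Sum>e\<in>Basis. ennreal ((cmod (pderiv_dir e \<phi> z))\<^sup>2)) \<partial>leb_on W) = (\<Sum>e\<in>Basis. \<integral>\<^sup>+z. ennreal ((cmod (pderiv_dir e \<phi> z))\<^sup>2) \<partial>leb_on W)"
    by (intro nn_integral_sum) measurable
  also have "\<dots> = (\<Sum>e\<in>Basis. ennreal ((norm_on W (pderiv_dir e \<phi>))\<^sup>2))"
    by (intro sum.cong refl nn_integral_L2 Ld)
  also have "\<dots> = ennreal (grad_norm_sq W \<phi>)" by (simp add: grad_norm_sq_test[OF \<phi>] sum_ennreal)
  also have "(\<integral>\<^sup>+z. ennreal c * ennreal ((cmod (\<phi> z))\<^sup>2) \<partial>leb_on W) = ennreal c * (\<integral>\<^sup>+z. ennreal ((cmod (\<phi> z))\<^sup>2) \<partial>leb_on W)"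
    by (intro nn_integral_cmult) measurable
  also have "(\<integral>\<^sup>+z. ennreal ((cmod (\<phi> z))\<^sup>2) \<partial>leb_on W) = ennreal ((norm_on W \<phi>)\<^sup>2)" by (rule nn_integral_L2[OF L])
  finally show ?thesis using c by (simp add: ennreal_mult[symmetric])
qed

lemma L2_norm_fscale: "L2_norm M (fscale c f) = cmod c * L2_norm M f"
  by (simp add: L2_norm_def norm_mult power_mult_distrib real_sqrt_mult)

lemma sets_arc [simp, measurable_cong]: "sets (arc_measure \<theta>) = sets borel"
  by (simp add: arc_measure_def)

lemma L2_from_energy:
  assumes [measurable]: "\<phi> \<in> borel_measurable S" and \<gamma>: "\<gamma> > 0" and E: "E \<ge> 0" and le: "(\<integral>\<^sup>+z. ennreal (\<gamma> * (cmod (\<phi> z))\<^sup>2) \<partial>S) <= ennreal E"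
  shows "\<phi> \<in> L2 S" "\<gamma> * (L2_norm S \<phi>)\<^sup>2 <= E"
proof -
  have eq: "(\<integral>\<^sup>+z. ennreal (\<gamma> * (cmod (\<phi> z))\<^sup>2) \<partial>S) = ennreal \<gamma> * (\<integral>\<^sup>+z. ennreal ((cmod (\<phi> z))\<^sup>2) \<partial>S)"
    using \<gamma> by (simp add: ennreal_mult nn_integral_cmult)
  have "ennreal \<gamma> * (\<integral>\<^sup>+z. ennreal ((cmod (\<phi> z))\<^sup>2) \<partial>S) < top" using le unfolding eq by (auto intro: le_less_trans)
  then have "(\<integral>\<^sup>+z. ennreal ((cmod (\<phi> z))\<^sup>2) \<partial>S) < top" using \<gamma> by (auto simp: ennreal_mult_less_top)
  then show L: "\<phi> \<in> L2 S" by (simp add: L2_iff_nn)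
  show "\<gamma> * (L2_norm S \<phi>)\<^sup>2 <= E" using le E \<gamma> unfolding eq nn_integral_L2[OF L] by (simp add: ennreal_mult[symmetric])
qed

text \<open>
  The bound for test functions makes the restriction to the curve continuous with respect to the
  \<open>H\<^sup>1\<close>-norm, so that traces exist and are unique up to null sets.
\<close>

locale trace_domain = admissible W for W :: "'a::euclidean_space set" +
  fixes S :: "'a measure" and K :: real
  assumes trace_bound: "\<And>\<phi>. test_fun \<phi> ==> \<phi> \<in> L2 S \<and> (L2_norm S \<phi>)\<^sup>2 <= K * (grad_norm_sq W \<phi> + (norm_on W \<phi>)\<^sup>2)"
    and K: "K \<ge> 0"
begin

definition approximates :: "(nat => 'a => complex) => ('a => complex) => bool" where
  "approximates \<phi> u \<longleftrightarrow> (\<forall>k. test_fun (\<phi> k)) \<and> (%k. norm_on W (\<phi> k - u)) \<longlonglongrightarrow> 0 \<and>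
     (\<forall>e\<in>Basis. (%k. norm_on W (pderiv_dir e (\<phi> k) - weak_deriv W e u)) \<longlonglongrightarrow> 0)"

lemma is_trace_iff:
  assumes u: "u \<in> H1 W"
  shows "is_trace S W u g \<longleftrightarrow> g \<in> L2 S \<and> (\<exists>\<phi>. approximates \<phi> u \<and> (%k. L2_norm S (\<phi> k - g)) \<longlonglongrightarrow> 0)"
proof -
  have eq: "(%x. \<phi> k x - g x) = \<phi> k - g" for \<phi> :: "nat => 'a => complex" and k by (simp add: fun_eq_iff)
  have "(\<forall>k. \<phi> k \<in> Cc_infty UNIV) \<and> (%k. H1_norm W (%x. \<phi> k x - u x)) \<longlonglongrightarrow> 0 \<longleftrightarrow> approximates \<phi> u" for \<phi>
  proof
    assume a: "(\<forall>k. \<phi> k \<in> Cc_infty UNIV) \<and> (%k. H1_norm W (%x. \<phi> k x - u x)) \<longlonglongrightarrow> 0"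
    then have t: "test_fun (\<phi> k)" for k by (simp add: Cc_infty_UNIV)
    show "approximates \<phi> u"
      unfolding approximates_def using t H1_approx_parts[where \<phi> = \<phi>, OF u t conjunct2[OF a]] by simp
  next
    assume a: "approximates \<phi> u"
    then have t: "test_fun (\<phi> k)" for k by (simp add: approximates_def)
    have "(%k. sqrt ((norm_on W (\<phi> k - u))\<^sup>2 + (\<Sum>e\<in>Basis. (norm_on W (pderiv_dir e (\<phi> k) - weak_deriv W e u))\<^sup>2)))
      \<longlonglongrightarrow> sqrt (0\<^sup>2 + (\<Sum>e\<in>(Basis::'a set). 0\<^sup>2))"
      using a by (intro tendsto_intros) (auto simp: approximates_def)
    then show "(\<forall>k. \<phi> k \<in> Cc_infty UNIV) \<and> (%k. H1_norm W (%x. \<phi> k x - u x)) \<longlonglongrightarrow> 0"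
      using t by (simp add: H1_norm_test_diff[OF t u] Cc_infty_UNIV)
  qed
  then show ?thesis unfolding is_trace_def eq by (metis (no_types, lifting))
qed

lemma test_L2: "test_fun \<phi> ==> \<phi> \<in> L2 (leb_on W)" "test_fun \<phi> ==> e \<in> Basis ==> pderiv_dir e \<phi> \<in> L2 (leb_on W)"
  "test_fun \<phi> ==> \<phi> \<in> L2 S"
  using trace_bound by (auto intro!: L2_restrict op test_fun_L2 test_fun_pderiv)

lemma test_fun_minus: "test_fun \<phi> ==> test_fun \<psi> ==> test_fun (\<phi> - \<psi>)"
  using test_fun_diff[of \<phi> \<psi>] by (simp add: fun_diff_def)

lemma pderiv_dir_minus: "test_fun \<phi> ==> test_fun \<psi> ==> pderiv_dir e (\<phi> - \<psi>) = pderiv_dir e \<phi> - pderiv_dir e \<psi>"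
  using pderiv_dir_diff[OF test_fun_smooth test_fun_smooth, of \<phi> \<psi>] by (simp add: fun_diff_def fun_eq_iff)

lemma Cauchy_from_limit:
  assumes f: "\<And>k::nat. f k \<in> L2 M" "g \<in> L2 M" "(%k. L2_norm M (f k - g)) \<longlonglongrightarrow> 0" and e: "e > 0"
  shows "\<exists>N. \<forall>j\<ge>N. \<forall>k\<ge>N. L2_norm M (f j - f k) < e"
proof -
  have "\<forall>\<^sub>F k in sequentially. L2_norm M (f k - g) < e / 2" using f(3) e by (intro order_tendstoD) auto
  then obtain N where N: "\<And>k. k \<ge> N ==> L2_norm M (f k - g) < e / 2" by (auto simp: eventually_sequentially)
  have "L2_norm M (f j - f k) < e" if "j \<ge> N" "k \<ge> N" for j k
  proof -
    have "L2_norm M ((f j - g) + (g - f k)) <= L2_norm M (f j - g) + L2_norm M (g - f k)"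
      by (intro L2_norm_triangle L2.V_closed(3) f)
    moreover have "L2_norm M (g - f k) = L2_norm M (f k - g)" using L2.N_minus[OF f(2) f(1)] by simp
    moreover have "(f j - g) + (g - f k) = f j - f k" by (simp add: fun_eq_iff)
    ultimately show ?thesis using N[OF that(1)] N[OF that(2)] by simp
  qed
  then show ?thesis by blast
qed

lemma trace_exists:
  assumes u: "u \<in> H1 W"
  shows "is_trace S W u (sobolev_trace S W u)"
proof -
  obtain \<phi> where t: "\<And>k::nat. test_fun (\<phi> k)" and l: "(%k. H1_norm W (%x. \<phi> k x - u x)) \<longlonglongrightarrow> 0"
    using H1_approximating_sequence[OF u] by blast
  note p = H1_approx_parts[OF u t l]
  have ap: "approximates \<phi> u" using t p by (simp add: approximates_def)
  have "\<exists>N. \<forall>j\<ge>N. \<forall>k\<ge>N. L2_norm S (\<phi> j - \<phi> k) < \<epsilon>" if eps: "\<epsilon> > 0" for \<epsilon>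
  proof -
    define n where "n = real DIM('a) + 1"
    define \<eta> where "\<eta> = \<epsilon> / sqrt ((K + 1) * n)"
    have n: "n > 0" by (simp add: n_def add_nonneg_pos)
    have eta: "\<eta> > 0" "(K + 1) * n * \<eta>\<^sup>2 = \<epsilon>\<^sup>2" using eps K n by (auto simp: \<eta>_def power_divide)
    obtain N0 where N0: "\<And>j k. j \<ge> N0 ==> k \<ge> N0 ==> norm_on W (\<phi> j - \<phi> k) < \<eta>"
      using Cauchy_from_limit[OF test_L2(1)[OF t] H1_L2[OF u] p(1) eta(1)] by blast
    have "\<forall>e\<in>Basis. \<exists>N. \<forall>j\<ge>N. \<forall>k\<ge>N. norm_on W (pderiv_dir e (\<phi> j) - pderiv_dir e (\<phi> k)) < \<eta>"
      using Cauchy_from_limit[OF test_L2(2)[OF t] weak_deriv_L2[OF u] p(2) eta(1)] by blast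
    then obtain N1 where N1: "\<And>e j k. e \<in> Basis ==> j \<ge> N1 e ==> k \<ge> N1 e ==> norm_on W (pderiv_dir e (\<phi> j) - pderiv_dir e (\<phi> k)) < \<eta>" by metis
    define N where "N = N0 + (\<Sum>e\<in>Basis. N1 e)"
    have N1le: "N1 e <= N" if "e \<in> Basis" for e
      using member_le_sum[OF that, of N1] by (simp add: N_def)
    have "L2_norm S (\<phi> j - \<phi> k) < \<epsilon>" if jk: "j \<ge> N" "k \<ge> N" for j k
    proof -
      have tt: "test_fun (\<phi> j - \<phi> k)" by (intro test_fun_minus t)
      have "grad_norm_sq W (\<phi> j - \<phi> k) = (\<Sum>e\<in>Basis. (norm_on W (pderiv_dir e (\<phi> j) - pderiv_dir e (\<phi> k)))\<^sup>2)"
        by (simp add: grad_norm_sq_test[OF tt] pderiv_dir_minus[OF t t])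
      also have "\<dots> <= (\<Sum>e\<in>(Basis::'a set). \<eta>\<^sup>2)"
      proof (intro sum_mono power_mono)
        fix e :: 'a assume e: "e \<in> Basis"
        have "N1 e <= j" "N1 e <= k" using N1le[OF e] jk by linarith+
        from N1[OF e this] show "norm_on W (pderiv_dir e (\<phi> j) - pderiv_dir e (\<phi> k)) <= \<eta>" by simp
      qed (simp add: L2_norm_def)
      finally have "grad_norm_sq W (\<phi> j - \<phi> k) <= real DIM('a) * \<eta>\<^sup>2" by simp
      moreover have "(norm_on W (\<phi> j - \<phi> k))\<^sup>2 <= \<eta>\<^sup>2" using N0[of j k] jk by (intro power_mono) (auto simp: N_def)
      ultimately have "grad_norm_sq W (\<phi> j - \<phi> k) + (norm_on W (\<phi> j - \<phi> k))\<^sup>2 <= n * \<eta>\<^sup>2" by (simp add: n_def algebra_simps)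
      then have "K * (grad_norm_sq W (\<phi> j - \<phi> k) + (norm_on W (\<phi> j - \<phi> k))\<^sup>2) <= K * (n * \<eta>\<^sup>2)" using K by (intro mult_left_mono)
      also have "\<dots> < (K + 1) * n * \<eta>\<^sup>2" using n eta(1) by (simp add: algebra_simps)
      finally have "(L2_norm S (\<phi> j - \<phi> k))\<^sup>2 < \<epsilon>\<^sup>2" using trace_bound[OF tt] eta(2) by linarith
      then show ?thesis using eps by (simp add: power_less_imp_less_base)
    qed
    then show ?thesis by blast
  qed
  from L2_complete[OF test_L2(3)[OF t] this] obtain g where "g \<in> L2 S" "(%k. L2_norm S (\<phi> k - g)) \<longlonglongrightarrow> 0" by blast
  then have "is_trace S W u g" using ap is_trace_iff[OF u] by blast
  then show ?thesis unfolding sobolev_trace_def by (rule someI[of "is_trace S W u"])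
qed

lemma trace_L2: "u \<in> H1 W ==> sobolev_trace S W u \<in> L2 S"
  using trace_exists is_trace_iff by blast

lemma energy_inequality_extends:
  assumes test: "\<And>\<phi>. test_fun \<phi> ==> \<gamma> * (L2_norm S \<phi>)\<^sup>2 <= c' * grad_norm_sq W \<phi> + c * (norm_on W \<phi>)\<^sup>2 + C * (\<Sum>i<p::nat. (cmod (L2_inner (leb_on W) \<phi> (q i)))\<^sup>2)"
    and q: "\<And>i. i < p ==> q i \<in> L2 (leb_on W)" and u: "u \<in> H1 W" and g: "is_trace S W u g"
  shows "\<gamma> * (L2_norm S g)\<^sup>2 <= c' * grad_norm_sq W u + c * (norm_on W u)\<^sup>2 + C * (\<Sum>i<p. (cmod (L2_inner (leb_on W) u (q i)))\<^sup>2)"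
proof -
  obtain \<phi> where ap: "approximates \<phi> u" and gl: "(%k. L2_norm S (\<phi> k - g)) \<longlonglongrightarrow> 0" and gL: "g \<in> L2 S"
    using g is_trace_iff[OF u] by blast
  have t: "test_fun (\<phi> k)" for k using ap by (simp add: approximates_def)
  have l0: "(%k. norm_on W (\<phi> k - u)) \<longlonglongrightarrow> 0" using ap by (simp add: approximates_def)
  have l1: "(%k. norm_on W (pderiv_dir e (\<phi> k) - weak_deriv W e u)) \<longlonglongrightarrow> 0" if "e \<in> Basis" for e using ap that by (simp add: approximates_def)
  have a: "(%k. L2_norm S (\<phi> k)) \<longlonglongrightarrow> L2_norm S g" using L2.N_tendsto[OF test_L2(3)[OF t] gL] gl by simp
  have b: "(%k. norm_on W (\<phi> k)) \<longlonglongrightarrow> norm_on W u" using L2.N_tendsto[OF test_L2(1)[OF t] H1_L2[OF u]] l0 by simp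
  have d: "(%k. norm_on W (pderiv_dir e (\<phi> k))) \<longlonglongrightarrow> norm_on W (weak_deriv W e u)" if "e \<in> Basis" for e
    using L2.N_tendsto[OF test_L2(2)[OF t that] weak_deriv_L2[OF u that]] l1[OF that] by simp
  have i: "(%k. L2_inner (leb_on W) (\<phi> k) (q i)) \<longlonglongrightarrow> L2_inner (leb_on W) u (q i)" if "i < p" for i
    using L2.q_tendsto[OF test_L2(1)[OF t] H1_L2[OF u] _ q[OF that]] l0 by simp
  have G: "(%k. grad_norm_sq W (\<phi> k)) \<longlonglongrightarrow> grad_norm_sq W u"
    unfolding grad_norm_sq_test[OF t] grad_norm_sq_def[of _ u] by (intro tendsto_intros d)
  show ?thesis
  proof (rule LIMSEQ_le)
    show "(%k. \<gamma> * (L2_norm S (\<phi> k))\<^sup>2) \<longlonglongrightarrow> \<gamma> * (L2_norm S g)\<^sup>2" by (intro tendsto_intros a)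
    show "(%k. c' * grad_norm_sq W (\<phi> k) + c * (norm_on W (\<phi> k))\<^sup>2 + C * (\<Sum>i<p. (cmod (L2_inner (leb_on W) (\<phi> k) (q i)))\<^sup>2))
       \<longlonglongrightarrow> c' * grad_norm_sq W u + c * (norm_on W u)\<^sup>2 + C * (\<Sum>i<p. (cmod (L2_inner (leb_on W) u (q i)))\<^sup>2)"
      by (intro tendsto_add tendsto_mult tendsto_const tendsto_power tendsto_sum tendsto_norm G b i) auto
    show "\<exists>N. \<forall>k\<ge>N. \<gamma> * (L2_norm S (\<phi> k))\<^sup>2 <= c' * grad_norm_sq W (\<phi> k) + c * (norm_on W (\<phi> k))\<^sup>2 + C * (\<Sum>i<p. (cmod (L2_inner (leb_on W) (\<phi> k) (q i)))\<^sup>2)"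
      using test t by blast
  qed
qed

lemma trace_inequality:
  assumes "u \<in> H1 W" "is_trace S W u g"
  shows "(L2_norm S g)\<^sup>2 <= K * (grad_norm_sq W u + (norm_on W u)\<^sup>2)"
  using energy_inequality_extends[of 1 K K 0 0, OF _ _ assms] trace_bound by (simp add: distrib_left)

lemma is_trace_diff:
  assumes u: "u \<in> H1 W" "is_trace S W u g" and v: "v \<in> H1 W" "is_trace S W v h"
  shows "is_trace S W (u - v) (g - h)"
proof -
  obtain \<phi> where p: "approximates \<phi> u" "(%k. L2_norm S (\<phi> k - g)) \<longlonglongrightarrow> 0" and g: "g \<in> L2 S" using u is_trace_iff[OF u(1)] by blast
  obtain \<psi> where q: "approximates \<psi> v" "(%k. L2_norm S (\<psi> k - h)) \<longlonglongrightarrow> 0" and h: "h \<in> L2 S" using v is_trace_iff[OF v(1)] by blast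
  have t: "test_fun (\<phi> k)" "test_fun (\<psi> k)" for k using p q by (auto simp: approximates_def)
  have conv: "(%k. L2_norm M ((f k - f') - (r k - r'))) \<longlonglongrightarrow> 0"
    if "\<And>k::nat. f k \<in> L2 M" "f' \<in> L2 M" "\<And>k. r k \<in> L2 M" "r' \<in> L2 M" "(%k. L2_norm M (f k - f')) \<longlonglongrightarrow> 0" "(%k. L2_norm M (r k - r')) \<longlonglongrightarrow> 0"
    for M :: "'a measure" and f f' r r'
  proof (rule tendsto_sandwich[OF _ _ tendsto_const])
    show "(%k. L2_norm M (f k - f') + L2_norm M (r k - r')) \<longlonglongrightarrow> 0" using tendsto_add[OF that(5,6)] by simp
    have "L2_norm M ((f k - f') - (r k - r')) <= L2_norm M (f k - f') + L2_norm M (r k - r')" for k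
    proof -
      have "(f k - f') - (r k - r') = (f k - f') + (r' - r k)" by (simp add: fun_eq_iff)
      moreover have "L2_norm M (r' - r k) = L2_norm M (r k - r')" using L2.N_minus[OF that(4) that(3)] by simp
      ultimately show ?thesis using L2_norm_triangle[OF L2.V_closed(3)[OF that(1,2)] L2.V_closed(3)[OF that(4,3)]] by metis
    qed
    then show "\<forall>\<^sub>F k in sequentially. L2_norm M ((f k - f') - (r k - r')) <= L2_norm M (f k - f') + L2_norm M (r k - r')" by simp
  qed simp
  have "approximates (%k. \<phi> k - \<psi> k) (u - v)"
    unfolding approximates_def
  proof (intro conjI allI ballI)
    show "test_fun (\<phi> k - \<psi> k)" for k by (intro test_fun_minus t)
    have "(\<phi> k - \<psi> k) - (u - v) = (\<phi> k - u) - (\<psi> k - v)" for k by (simp add: fun_eq_iff)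
    then show "(%k. norm_on W (\<phi> k - \<psi> k - (u - v))) \<longlonglongrightarrow> 0"
      using conv[OF test_L2(1)[OF t(1)] H1_L2[OF u(1)] test_L2(1)[OF t(2)] H1_L2[OF v(1)]] p q by (simp only: approximates_def)
    fix e :: 'a assume e: "e \<in> Basis"
    have "norm_on W (pderiv_dir e (\<phi> k - \<psi> k) - weak_deriv W e (u - v)) =
       norm_on W ((pderiv_dir e (\<phi> k) - weak_deriv W e u) - (pderiv_dir e (\<psi> k) - weak_deriv W e v))" for k
    proof (rule L2_norm_cong_AE)
      show "AE x in leb_on W. (pderiv_dir e (\<phi> k - \<psi> k) - weak_deriv W e (u - v)) x =
         ((pderiv_dir e (\<phi> k) - weak_deriv W e u) - (pderiv_dir e (\<psi> k) - weak_deriv W e v)) x"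
        using weak_deriv_diff[OF u(1) v(1) e] by eventually_elim (simp add: pderiv_dir_minus[OF t])
      show "pderiv_dir e (\<phi> k - \<psi> k) - weak_deriv W e (u - v) \<in> borel_measurable (leb_on W)"
        by (rule L2_measurable[OF L2.V_closed(3)[OF test_L2(2)[OF test_fun_minus[OF t] e] weak_deriv_L2[OF H1_closed(3)[OF u(1) v(1)] e]]])
      show "(pderiv_dir e (\<phi> k) - weak_deriv W e u) - (pderiv_dir e (\<psi> k) - weak_deriv W e v) \<in> borel_measurable (leb_on W)"
        by (rule L2_measurable[OF L2.V_closed(3)[OF L2.V_closed(3)[OF test_L2(2)[OF t(1) e] weak_deriv_L2[OF u(1) e]] L2.V_closed(3)[OF test_L2(2)[OF t(2) e] weak_deriv_L2[OF v(1) e]]]])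
    qed
    then show "(%k. norm_on W (pderiv_dir e (\<phi> k - \<psi> k) - weak_deriv W e (u - v))) \<longlonglongrightarrow> 0"
      using conv[OF test_L2(2)[OF t(1) e] weak_deriv_L2[OF u(1) e] test_L2(2)[OF t(2) e] weak_deriv_L2[OF v(1) e]] p q e by (simp only: approximates_def)
  qed
  moreover have "(\<phi> k - \<psi> k) - (g - h) = (\<phi> k - g) - (\<psi> k - h)" for k by (simp add: fun_eq_iff)
  then have "(%k. L2_norm S ((\<phi> k - \<psi> k) - (g - h))) \<longlonglongrightarrow> 0"
    using conv[OF test_L2(3)[OF t(1)] g test_L2(3)[OF t(2)] h p(2) q(2)] by (simp only:)
  ultimately show ?thesis using is_trace_iff[OF H1_closed(3)[OF u(1) v(1)]] L2.V_closed(3)[OF g h] by blast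
qed

lemma pderiv_dir_fscale:
  assumes "test_fun \<phi>" shows "pderiv_dir e (fscale c \<phi>) = fscale c (pderiv_dir e \<phi>)"
proof
  fix x
  have "(\<phi> has_derivative frechet_derivative \<phi> (at x)) (at x)"
    by (rule smoothD(2)[OF test_fun_smooth[OF assms]])
  from has_derivative_mult_right[OF this, of c]
  have "(%h. c * frechet_derivative \<phi> (at x) h) = frechet_derivative (fscale c \<phi>) (at x)"
    unfolding fscale_def by (rule frechet_derivative_at)
  then show "pderiv_dir e (fscale c \<phi>) x = fscale c (pderiv_dir e \<phi>) x" by (simp add: fun_eq_iff)
qed

lemma is_trace_scale:
  assumes u: "u \<in> H1 W" "is_trace S W u g"
  shows "is_trace S W (fscale c u) (fscale c g)"
proof -
  obtain \<phi> where p: "approximates \<phi> u" "(%k. L2_norm S (\<phi> k - g)) \<longlonglongrightarrow> 0" and g: "g \<in> L2 S" using u is_trace_iff[OF u(1)] by blast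
  have t: "test_fun (\<phi> k)" for k using p by (auto simp: approximates_def)
  have conv: "(%k. L2_norm M (fscale c (f k) - fscale c f')) \<longlonglongrightarrow> 0" if "(%k. L2_norm M (f k - f')) \<longlonglongrightarrow> 0"
    for M :: "'a measure" and f f'
  proof -
    have "fscale c (f k) - fscale c f' = fscale c (f k - f')" for k by (simp add: fun_eq_iff right_diff_distrib)
    moreover have "(%k. cmod c * L2_norm M (f k - f')) \<longlonglongrightarrow> 0" using tendsto_mult_right_zero[OF that] by simp
    ultimately show ?thesis by (simp only: L2_norm_fscale)
  qed
  have t': "test_fun (fscale c (\<phi> k))" for k
    using test_fun_mult[OF t smooth_const, of k c] by (simp add: fscale_def mult.commute)
  have "approximates (%k. fscale c (\<phi> k)) (fscale c u)"
    unfolding approximates_def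
  proof (intro conjI allI ballI)
    show "test_fun (fscale c (\<phi> k))" for k by (rule t')
    show "(%k. norm_on W (fscale c (\<phi> k) - fscale c u)) \<longlonglongrightarrow> 0" using conv p by (simp only: approximates_def)
    fix e :: 'a assume e: "e \<in> Basis"
    have "norm_on W (pderiv_dir e (fscale c (\<phi> k)) - weak_deriv W e (fscale c u)) =
       norm_on W (fscale c (pderiv_dir e (\<phi> k)) - fscale c (weak_deriv W e u))" for k
    proof (rule L2_norm_cong_AE)
      show "AE x in leb_on W. (pderiv_dir e (fscale c (\<phi> k)) - weak_deriv W e (fscale c u)) x =
         (fscale c (pderiv_dir e (\<phi> k)) - fscale c (weak_deriv W e u)) x"
        using weak_deriv_scale[OF u(1) e, of c] by eventually_elim (simp add: pderiv_dir_fscale[OF t])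
      show "pderiv_dir e (fscale c (\<phi> k)) - weak_deriv W e (fscale c u) \<in> borel_measurable (leb_on W)"
        by (rule L2_measurable[OF L2.V_closed(3)[OF test_L2(2)[OF t' e] weak_deriv_L2[OF H1_closed(2)[OF u(1)] e]]])
      show "fscale c (pderiv_dir e (\<phi> k)) - fscale c (weak_deriv W e u) \<in> borel_measurable (leb_on W)"
        by (rule L2_measurable[OF L2.V_closed(3)[OF L2_fscale[OF test_L2(2)[OF t e]] L2_fscale[OF weak_deriv_L2[OF u(1) e]]]])
    qed
    then show "(%k. norm_on W (pderiv_dir e (fscale c (\<phi> k)) - weak_deriv W e (fscale c u))) \<longlonglongrightarrow> 0"
      using conv p e by (simp only: approximates_def)
  qed
  then show ?thesis using is_trace_iff[OF H1_closed(2)[OF u(1)]] L2_fscale[OF g] conv[OF p(2)] by blast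
qed

lemma is_trace_add:
  assumes "u \<in> H1 W" "is_trace S W u g" "v \<in> H1 W" "is_trace S W v h"
  shows "is_trace S W (u + v) (g + h)"
proof -
  have "f - fscale (-1) f' = f + f'" for f f' :: "'a => complex" by (simp add: fun_eq_iff)
  then show ?thesis using is_trace_diff[OF assms(1,2) H1_closed(2)[OF assms(3), of "-1"] is_trace_scale[OF assms(3,4), of "-1"]] by simp
qed

lemma grad_norm_sq_zero: "grad_norm_sq W 0 = 0"
proof -
  have "norm_on W (weak_deriv W e 0) = 0" if e: "e \<in> Basis" for e
  proof -
    have z: "0 \<in> H1 W" using subspace_H1 by (rule fun_space.subspace_0)
    have "fscale 0 (0::'a => complex) = 0" by (simp add: fun_eq_iff)
    then have "AE x in leb_on W. weak_deriv W e 0 x = 0" using weak_deriv_scale[OF z e, of 0] by simp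
    then show ?thesis using L2_norm_zero_iff[OF weak_deriv_L2[OF z e]] by simp
  qed
  then show ?thesis by (simp add: grad_norm_sq_def)
qed

lemma trace_unique:
  assumes u: "u \<in> H1 W" and g: "is_trace S W u g" and h: "is_trace S W u h"
  shows "AE x in S. g x = h x"
proof -
  have "norm_on W 0 = 0" by (simp add: L2_norm_def)
  then have "(L2_norm S (g - h))\<^sup>2 <= 0"
    using trace_inequality[OF H1_closed(3)[OF u u] is_trace_diff[OF u g u h]] by (simp add: grad_norm_sq_zero)
  moreover have "g - h \<in> L2 S" using g h is_trace_iff[OF u] L2.V_closed(3) by blast
  ultimately show ?thesis using L2_norm_zero_iff[of "g - h" S] by simp
qed

lemma trace_add: "u \<in> H1 W ==> v \<in> H1 W ==> AE x in S. sobolev_trace S W (u + v) x = (sobolev_trace S W u + sobolev_trace S W v) x"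
  by (rule trace_unique[OF H1_closed(1) trace_exists[OF H1_closed(1)] is_trace_add[OF _ trace_exists _ trace_exists]])

lemma trace_scale: "u \<in> H1 W ==> AE x in S. sobolev_trace S W (fscale c u) x = fscale c (sobolev_trace S W u) x"
  by (rule trace_unique[OF H1_closed(2) trace_exists[OF H1_closed(2)] is_trace_scale[OF _ trace_exists]])

end

section \<open>Sesquilinear forms on the broken plane\<close>

text \<open>
  Weak derivatives and traces are chosen by a description operator and are linear only up to null
  sets.
\<close>

definition AE_linear :: "('a => complex) set => 'b measure => (('a => complex) => 'b => complex) => bool" where
  "AE_linear V M T \<longleftrightarrow> (\<forall>u\<in>V. T u \<in> L2 M) \<and> (\<forall>u\<in>V. \<forall>v\<in>V. AE x in M. T (u + v) x = (T u + T v) x) \<and>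
     (\<forall>c. \<forall>u\<in>V. AE x in M. T (fscale c u) x = fscale c (T u) x)"

lemma AE_linear_diff:
  assumes T: "AE_linear V M T" and R: "AE_linear V M R"
  shows "AE_linear V M (%u. T u - R u)"
  unfolding AE_linear_def
proof (intro conjI ballI allI)
  fix u c assume u: "u \<in> V"
  show "T u - R u \<in> L2 M" using T R u by (intro L2.V_closed(3)) (auto simp: AE_linear_def)
  have "AE x in M. T (fscale c u) x = fscale c (T u) x" "AE x in M. R (fscale c u) x = fscale c (R u) x"
    using T R u by (auto simp: AE_linear_def)
  then show "AE x in M. (T (fscale c u) - R (fscale c u)) x = fscale c (T u - R u) x"
    by eventually_elim (simp add: right_diff_distrib)
  fix v assume v: "v \<in> V"
  have "AE x in M. T (u + v) x = (T u + T v) x" "AE x in M. R (u + v) x = (R u + R v) x"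
    using T R u v unfolding AE_linear_def by blast+
  then show "AE x in M. (T (u + v) - R (u + v)) x = ((T u - R u) + (T v - R v)) x"
    by eventually_elim simp
qed

lemma hermitian_form_pullback:
  assumes V: "fun_space.subspace V" and T: "AE_linear V M T"
  shows "hermitian_form fscale V (%u v. L2_inner M (T u) (T v))"
proof (unfold_locales, rule V)
  have L: "u \<in> V ==> T u \<in> L2 M" for u using T by (simp add: AE_linear_def)
  fix u v w c assume u: "u \<in> V" and v: "v \<in> V" and w: "w \<in> V"
  have "L2_inner M (T (u + v)) (T w) = L2_inner M (T u + T v) (T w)"
    using T u v fun_space.subspace_add[OF V u v] by (intro L2_inner_cong_AE L2_measurable L L2_add w) (auto simp: AE_linear_def)
  then show "L2_inner M (T (u + v)) (T w) = L2_inner M (T u) (T w) + L2_inner M (T v) (T w)"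
    by (simp add: L2.q_add_left[OF L[OF u] L[OF v] L[OF w]])
next
  have L: "u \<in> V ==> T u \<in> L2 M" for u using T by (simp add: AE_linear_def)
  fix c u w assume u: "u \<in> V" and w: "w \<in> V"
  have "L2_inner M (T (fscale c u)) (T w) = L2_inner M (fscale c (T u)) (T w)"
    using T u fun_space.subspace_scale[OF V u] by (intro L2_inner_cong_AE L2_measurable L L2_fscale w) (auto simp: AE_linear_def)
  then show "L2_inner M (T (fscale c u)) (T w) = c * L2_inner M (T u) (T w)"
    by (simp add: L2.q_scale_left[OF L[OF u] L[OF w]])
next
  have L: "u \<in> V ==> T u \<in> L2 M" for u using T by (simp add: AE_linear_def)
  fix u w assume u: "u \<in> V" and w: "w \<in> V"
  show "cnj (L2_inner M (T u) (T w)) = L2_inner M (T w) (T u)" by (rule L2.q_cnj[OF L[OF u] L[OF w]])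
qed

lemma hermitian_form_sum:
  assumes V: "fun_space.subspace V" and q: "\<And>i. i \<in> I ==> hermitian_form fscale V (q i)"
  shows "hermitian_form fscale V (%u v. \<Sum>i\<in>I. of_real (c i) * q i u v)"
proof (unfold_locales, rule V)
  fix u v w z assume u: "u \<in> V" and v: "v \<in> V" and w: "w \<in> V"
  show "(\<Sum>i\<in>I. of_real (c i) * q i (u + v) w) = (\<Sum>i\<in>I. of_real (c i) * q i u w) + (\<Sum>i\<in>I. of_real (c i) * q i v w)"
    unfolding sum.distrib[symmetric] distrib_left[symmetric] by (intro sum.cong refl) (simp only: hermitian_form.q_add_left[OF q u v w])
next
  fix z u w assume u: "u \<in> V" and w: "w \<in> V"
  show "(\<Sum>i\<in>I. of_real (c i) * q i (fscale z u) w) = z * (\<Sum>i\<in>I. of_real (c i) * q i u w)"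
    unfolding sum_distrib_left by (intro sum.cong refl) (simp only: hermitian_form.q_scale_left[OF q u w] mult.left_commute)
next
  fix u w assume u: "u \<in> V" and w: "w \<in> V"
  show "cnj (\<Sum>i\<in>I. of_real (c i) * q i u w) = (\<Sum>i\<in>I. of_real (c i) * q i w u)"
    unfolding cnj_sum by (intro sum.cong refl) (simp only: complex_cnj_mult complex_cnj_complex_of_real hermitian_form.q_cnj[OF q u w])
qed

lemma hermitian_form_cong:
  assumes q: "hermitian_form fscale V q" and eq: "\<And>u v. u \<in> V ==> v \<in> V ==> r u v = q u v"
  shows "hermitian_form fscale V r"
proof -
  interpret q: hermitian_form fscale V q by (rule q)
  show ?thesis
    by (unfold_locales, rule q.V) (simp_all add: eq q.q_add_left q.q_scale_left q.q_cnj q.V_closed)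
qed

lemma grad_inner_self: "grad_inner W u u = of_real (grad_norm_sq W u)"
  by (simp add: grad_inner_def grad_norm_sq_def L2_inner_self)

lemma (in admissible) AE_linear_weak_deriv: "e \<in> Basis ==> V \<subseteq> H1 W ==> AE_linear V (leb_on W) (weak_deriv W e)"
  unfolding AE_linear_def by (intro conjI ballI allI weak_deriv_L2 weak_deriv_add weak_deriv_scale) auto

lemma (in admissible) hermitian_grad_inner:
  assumes "fun_space.subspace V" "V \<subseteq> H1 W"
  shows "hermitian_form fscale V (grad_inner W)"
proof -
  have "hermitian_form fscale V (%u v. \<Sum>e\<in>Basis. of_real ((%_. 1) e) * L2_inner (leb_on W) (weak_deriv W e u) (weak_deriv W e v))"
    using assms by (intro hermitian_form_sum hermitian_form_pullback AE_linear_weak_deriv)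
  then show ?thesis by (simp add: grad_inner_def[abs_def])
qed

lemma (in trace_domain) AE_linear_trace: "V \<subseteq> H1 W ==> AE_linear V S (sobolev_trace S W)"
  unfolding AE_linear_def by (intro conjI ballI allI trace_L2 trace_add trace_scale) auto

lemma (in admissible) H1_complete:
  assumes w: "\<And>k::nat. w k \<in> H1 W" and x: "x \<in> L2 (leb_on W)" and lim: "(%k. norm_on W (w k - x)) \<longlonglongrightarrow> 0"
    and cauchy: "\<And>e. e > 0 ==> \<exists>N. \<forall>j\<ge>N. \<forall>k\<ge>N. grad_norm_sq W (w j - w k) < e"
  shows "x \<in> H1 W" "(%k. grad_norm_sq W (w k - x)) \<longlonglongrightarrow> 0"
proof -
  have diff: "norm_on W (weak_deriv W e (u - v)) = norm_on W (weak_deriv W e u - weak_deriv W e v)"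
    if "u \<in> H1 W" "v \<in> H1 W" "e \<in> Basis" for u v e
    by (rule L2_norm_cong_AE[OF L2_measurable[OF weak_deriv_L2[OF H1_closed(3)[OF that(1,2)] that(3)]]
        L2_measurable[OF L2.V_closed(3)[OF weak_deriv_L2[OF that(1,3)] weak_deriv_L2[OF that(2,3)]]] weak_deriv_diff[OF that]])
  have "\<exists>g\<in>L2 (leb_on W). (%k. norm_on W (weak_deriv W e (w k) - g)) \<longlonglongrightarrow> 0" if e: "e \<in> Basis" for e
  proof (rule L2_complete[OF weak_deriv_L2[OF w e]])
    fix r :: real assume r: "r > 0"
    then obtain N where N: "\<And>j k. j \<ge> N ==> k \<ge> N ==> grad_norm_sq W (w j - w k) < r\<^sup>2" using cauchy[of "r\<^sup>2"] by auto
    have "norm_on W (weak_deriv W e (w j) - weak_deriv W e (w k)) < r" if "j \<ge> N" "k \<ge> N" for j k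
    proof -
      have "(norm_on W (weak_deriv W e (w j - w k)))\<^sup>2 <= grad_norm_sq W (w j - w k)"
        unfolding grad_norm_sq_def using e by (intro member_le_sum) auto
      then have "(norm_on W (weak_deriv W e (w j) - weak_deriv W e (w k)))\<^sup>2 < r\<^sup>2"
        using N[OF that] diff[OF w w e] by (metis le_less_trans)
      then show ?thesis using r by (simp add: power_less_imp_less_base)
    qed
    then show "\<exists>N. \<forall>j\<ge>N. \<forall>k\<ge>N. norm_on W (weak_deriv W e (w j) - weak_deriv W e (w k)) < r" by blast
  qed
  then obtain g where g: "\<And>e. e \<in> Basis ==> g e \<in> L2 (leb_on W)"
      "\<And>e. e \<in> Basis ==> (%k. norm_on W (weak_deriv W e (w k) - g e)) \<longlonglongrightarrow> 0" by metis
  have wd: "has_weak_deriv W e x (g e)" if e: "e \<in> Basis" for e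
    by (rule weak_deriv_closed[OF e H1_L2[OF w] x g(1)[OF e] weak_deriv_works[OF w e] lim g(2)[OF e]])
  show xH: "x \<in> H1 W" using x wd by (rule H1_I)
  have "norm_on W (weak_deriv W e (w k - x)) = norm_on W (weak_deriv W e (w k) - g e)" if e: "e \<in> Basis" for e k
    unfolding diff[OF w xH e]
  proof (rule L2_norm_cong_AE)
    show "AE z in leb_on W. (weak_deriv W e (w k) - weak_deriv W e x) z = (weak_deriv W e (w k) - g e) z"
      using weak_deriv_eq[OF wd[OF e]] by eventually_elim simp
  qed (rule L2_measurable[OF L2.V_closed(3)[OF weak_deriv_L2[OF w e] weak_deriv_L2[OF xH e]]]
      L2_measurable[OF L2.V_closed(3)[OF weak_deriv_L2[OF w e] g(1)[OF e]]])+
  then have "(%k. grad_norm_sq W (w k - x)) = (%k. \<Sum>e\<in>Basis. (norm_on W (weak_deriv W e (w k) - g e))\<^sup>2)"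
    by (simp add: grad_norm_sq_def)
  moreover have "\<dots> \<longlonglongrightarrow> (\<Sum>e\<in>(Basis::'a set). 0\<^sup>2)" by (intro tendsto_sum tendsto_power g)
  ultimately show "(%k. grad_norm_sq W (w k - x)) \<longlonglongrightarrow> 0" by simp
qed

lemma L2_inner_leb_on:
  assumes "open W" "\<And>x. x \<notin> W ==> g x = 0"
  shows "L2_inner (leb_on W) f g = L2_inner lborel f g"
  unfolding L2_inner_def integral_leb_on[OF assms(1)] using assms(2)
  by (intro Bochner_Integration.integral_cong) (auto simp: extend0_def)

locale broken_line_geometry =
  fixes \<theta> :: real
  assumes th: "0 < \<theta>" "\<theta> < pi / 2"
begin

abbreviation "S \<equiv> arc_measure \<theta>"
abbreviation "O1 \<equiv> Omega1 \<theta>"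
abbreviation "O2 \<equiv> Omega2 \<theta>"

lemma test_fun_measurable_S: "test_fun \<phi> ==> \<phi> \<in> borel_measurable S"
  using test_fun_measurable measurable_cong_sets[OF sets_arc refl] by blast

lemma AE_Omega: "AE z in lborel. z \<in> O1 \<union> O2"
proof -
  have "AE z in lborel \<Otimes>\<^sub>M lborel. z \<in> O1 \<union> O2"
  proof (rule lborel_pair.AE_pair_measure)
    have "O1 \<union> O2 \<in> sets borel" using Omega_open by auto
    then show "{z \<in> space (lborel \<Otimes>\<^sub>M lborel). z \<in> O1 \<union> O2} \<in> sets (lborel \<Otimes>\<^sub>M lborel)"
      unfolding lborel_prod by (simp add: Un_def)
    have "AE y in lborel. (x, y) \<in> O1 \<union> O2" for x
      using AE_lborel_singleton[of "cot \<theta> * \<bar>x\<bar>"] by eventually_elim (auto simp: Omega1_def Omega2_def)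
    then show "AE x in lborel. AE y in lborel. (x, y) \<in> O1 \<union> O2" by simp
  qed
  then show ?thesis unfolding lborel_prod .
qed

lemma Omega_disjoint: "O1 \<inter> O2 = {}" by (auto simp: Omega1_def Omega2_def)

lemma L2_norm_split:
  assumes u: "u \<in> L2 lborel"
  shows "(L2_norm lborel u)\<^sup>2 = (norm_on O1 u)\<^sup>2 + (norm_on O2 u)\<^sup>2"
proof -
  have [measurable]: "u \<in> borel_measurable borel" using L2_measurable[OF u] by simp
  have [measurable]: "O1 \<in> sets borel" "O2 \<in> sets borel" using Omega_open by auto
  have "ennreal ((L2_norm lborel u)\<^sup>2) = (\<integral>\<^sup>+z. ennreal ((cmod (u z))\<^sup>2) \<partial>lborel)" by (simp add: nn_integral_L2[OF u])
  also have "\<dots> = (\<integral>\<^sup>+z. ennreal ((cmod (u z))\<^sup>2) * indicator O1 z + ennreal ((cmod (u z))\<^sup>2) * indicator O2 z \<partial>lborel)"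
  proof (rule nn_integral_cong_AE)
    show "AE z in lborel. ennreal ((cmod (u z))\<^sup>2) = ennreal ((cmod (u z))\<^sup>2) * indicator O1 z + ennreal ((cmod (u z))\<^sup>2) * indicator O2 z"
      using AE_Omega by eventually_elim (use Omega_disjoint in \<open>auto simp: indicator_def\<close>)
  qed
  also have "\<dots> = (\<integral>\<^sup>+z. ennreal ((cmod (u z))\<^sup>2) * indicator O1 z \<partial>lborel) + (\<integral>\<^sup>+z. ennreal ((cmod (u z))\<^sup>2) * indicator O2 z \<partial>lborel)"
    by (intro nn_integral_add) measurable
  also have "\<dots> = ennreal ((norm_on O1 u)\<^sup>2) + ennreal ((norm_on O2 u)\<^sup>2)"
    by (simp add: nn_integral_leb_on[OF Omega_open(1), symmetric] nn_integral_leb_on[OF Omega_open(2), symmetric]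
        nn_integral_L2[OF L2_restrict(1)[OF Omega_open(1) u]] nn_integral_L2[OF L2_restrict(1)[OF Omega_open(2) u]])
  finally show ?thesis by (simp add: ennreal_plus[symmetric] del: ennreal_plus)
qed

lemma Robin2:
  assumes \<phi>: "test_fun \<phi>" and \<gamma>: "\<gamma> > 0" and L: "L > 0"
  shows "\<phi> \<in> L2 S" "\<gamma> * (L2_norm S \<phi>)\<^sup>2 <= grad_norm_sq O2 \<phi> + (\<gamma>\<^sup>2 + \<gamma> / L) * (norm_on O2 \<phi>)\<^sup>2"
proof -
  interpret admissible O2 by (rule admissible_Omega[OF th])
  have c: "\<gamma>\<^sup>2 + \<gamma> / L \<ge> 0" using \<gamma> L by simp
  have le: "(\<integral>\<^sup>+z. ennreal (\<gamma> * (cmod (\<phi> z))\<^sup>2) \<partial>S) <= ennreal (grad_norm_sq O2 \<phi> + (\<gamma>\<^sup>2 + \<gamma> / L) * (norm_on O2 \<phi>)\<^sup>2)"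
    using Robin_Omega2[OF \<phi> th less_imp_le[OF \<gamma>] L] by (simp only: nn_integral_test_energy[OF \<phi> c])
  have E: "0 <= grad_norm_sq O2 \<phi> + (\<gamma>\<^sup>2 + \<gamma> / L) * (norm_on O2 \<phi>)\<^sup>2" using c by simp
  show "\<phi> \<in> L2 S" "\<gamma> * (L2_norm S \<phi>)\<^sup>2 <= grad_norm_sq O2 \<phi> + (\<gamma>\<^sup>2 + \<gamma> / L) * (norm_on O2 \<phi>)\<^sup>2"
    by (rule L2_from_energy[OF test_fun_measurable_S[OF \<phi>] \<gamma> E le])+
qed

lemma Robin1:
  assumes \<gamma>: "\<gamma> > 0" and \<epsilon>: "\<epsilon> > 0"
  obtains p :: nat and q C where "\<And>i. i < p ==> q i \<in> L2 lborel" "\<And>i z. i < p ==> z \<notin> O1 ==> q i z = 0" "C \<ge> 0"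
    "\<And>\<phi>. test_fun \<phi> ==> \<phi> \<in> L2 S \<and> \<gamma> * (L2_norm S \<phi>)\<^sup>2 <= 1 * grad_norm_sq O1 \<phi> + (\<gamma>\<^sup>2 + \<epsilon>) * (norm_on O1 \<phi>)\<^sup>2
       + C * (\<Sum>i<p. (cmod (L2_inner (leb_on O1) \<phi> (q i)))\<^sup>2)"
proof -
  interpret admissible O1 by (rule admissible_Omega[OF th])
  obtain p Q C where Q: "\<forall>i<p::nat. Q i \<in> sets borel \<and> Q i \<subseteq> O1 \<and> bounded (Q i)" and C: "C \<ge> 0"
    and le: "\<And>\<phi>. test_fun \<phi> ==> (\<integral>\<^sup>+z. ennreal (\<gamma> * (cmod (\<phi> z))\<^sup>2) \<partial>S) \<le>
      (\<integral>\<^sup>+z. ennreal (grad_sq \<phi> z + (\<gamma>\<^sup>2 + \<epsilon>) * (cmod (\<phi> z))\<^sup>2) * indicator O1 z \<partial>lborel)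
      + ennreal (C * (\<Sum>i<p. (cmod (\<integral>z. \<phi> z * indicator (Q i) z \<partial>lborel))\<^sup>2))"
    using Robin_Omega1[OF th \<gamma> \<epsilon>] by blast
  let ?q = "%i z. indicator (Q i) z :: complex"
  have c: "\<gamma>\<^sup>2 + \<epsilon> \<ge> 0" using \<epsilon> by simp
  have q0: "?q i z = 0" if "i < p" "z \<notin> O1" for i z using Q that by (auto simp: indicator_def)
  show thesis
  proof (rule that[of p ?q C])
    fix i assume i: "i < p"
    have [measurable]: "Q i \<in> sets borel" using Q i by blast
    have "emeasure lborel (Q i) < \<infinity>" using Q i emeasure_bounded_finite by blast
    then have "integrable lborel (indicator (Q i) :: real \<times> real => real)" by (intro integrable_real_indicator) auto
    moreover have "(cmod (?q i z))\<^sup>2 = indicator (Q i) z" for z by (simp add: indicator_def)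
    ultimately show "?q i \<in> L2 lborel" by (simp add: L2_def)
  next
    fix \<phi> :: "real \<times> real => complex" assume \<phi>: "test_fun \<phi>"
    have "cnj (?q i z) = ?q i z" for i z by (simp add: indicator_def)
    then have "(\<integral>z. \<phi> z * indicator (Q i) z \<partial>lborel) = L2_inner (leb_on O1) \<phi> (?q i)" if "i < p" for i
      using q0[OF that] by (subst L2_inner_leb_on[OF op]) (auto simp: L2_inner_def)
    then have s: "(\<Sum>i<p. (cmod (\<integral>z. \<phi> z * indicator (Q i) z \<partial>lborel))\<^sup>2) = (\<Sum>i<p. (cmod (L2_inner (leb_on O1) \<phi> (?q i)))\<^sup>2)"
      by (intro sum.cong) auto
    let ?E = "1 * grad_norm_sq O1 \<phi> + (\<gamma>\<^sup>2 + \<epsilon>) * (norm_on O1 \<phi>)\<^sup>2 + C * (\<Sum>i<p. (cmod (L2_inner (leb_on O1) \<phi> (?q i)))\<^sup>2)"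
    have E: "0 <= grad_norm_sq O1 \<phi> + (\<gamma>\<^sup>2 + \<epsilon>) * (norm_on O1 \<phi>)\<^sup>2" "0 <= C * (\<Sum>i<p. (cmod (L2_inner (leb_on O1) \<phi> (?q i)))\<^sup>2)"
      using c C by (auto intro!: mult_nonneg_nonneg sum_nonneg add_nonneg_nonneg)
    have le': "(\<integral>\<^sup>+z. ennreal (\<gamma> * (cmod (\<phi> z))\<^sup>2) \<partial>S) <= ennreal ?E"
      using le[OF \<phi>] ennreal_plus[OF E] unfolding s nn_integral_test_energy[OF \<phi> c] by simp
    have E': "0 <= ?E" using E by simp
    show "\<phi> \<in> L2 S \<and> \<gamma> * (L2_norm S \<phi>)\<^sup>2 <= ?E"
      using L2_from_energy[OF test_fun_measurable_S[OF \<phi>] \<gamma> E' le'] by blast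
  qed (use C q0 in auto)
qed

lemma trace_control:
  assumes \<gamma>: "\<gamma> > 0"
  obtains C where "C \<ge> 0"
    "\<And>\<phi>. test_fun \<phi> ==> \<phi> \<in> L2 S \<and> \<gamma> * (L2_norm S \<phi>)\<^sup>2 <= 1 * grad_norm_sq O1 \<phi> + C * (norm_on O1 \<phi>)\<^sup>2"
    "\<And>\<phi>. test_fun \<phi> ==> \<phi> \<in> L2 S \<and> \<gamma> * (L2_norm S \<phi>)\<^sup>2 <= 1 * grad_norm_sq O2 \<phi> + C * (norm_on O2 \<phi>)\<^sup>2"
proof -
  interpret admissible O1 by (rule admissible_Omega[OF th])
  obtain p q C where q: "\<And>i. i < (p::nat) ==> q i \<in> L2 lborel" and C: "C \<ge> 0"
    and le: "\<And>\<phi>. test_fun \<phi> ==> \<phi> \<in> L2 S \<and> \<gamma> * (L2_norm S \<phi>)\<^sup>2 <= 1 * grad_norm_sq O1 \<phi> + (\<gamma>\<^sup>2 + 1) * (norm_on O1 \<phi>)\<^sup>2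
       + C * (\<Sum>i<p. (cmod (L2_inner (leb_on O1) \<phi> (q i)))\<^sup>2)"
    using Robin1[OF \<gamma> zero_less_one] by metis
  define C1 where "C1 = \<gamma>\<^sup>2 + 1 + C * (\<Sum>i<p. (norm_on O1 (q i))\<^sup>2)"
  define C' where "C' = C1 + (\<gamma>\<^sup>2 + \<gamma> / 1)"
  have C1: "C1 \<ge> 0" unfolding C1_def using C by (intro add_nonneg_nonneg mult_nonneg_nonneg sum_nonneg) auto
  show thesis
  proof (rule that[of C'])
    show "C' \<ge> 0" using C1 \<gamma> by (simp add: C'_def)
    fix \<phi> :: "real \<times> real => complex" assume \<phi>: "test_fun \<phi>"
    have L: "\<phi> \<in> L2 (leb_on O1)" by (intro L2_restrict(1) op test_fun_L2 \<phi>)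
    have "C * (\<Sum>i<p. (cmod (L2_inner (leb_on O1) \<phi> (q i)))\<^sup>2) <= C * (\<Sum>i<p. (norm_on O1 \<phi>)\<^sup>2 * (norm_on O1 (q i))\<^sup>2)"
      using L2.Cauchy_Schwarz_sq[OF L L2_restrict(1)[OF op q]] C by (intro mult_left_mono sum_mono) (auto simp: L2_inner_self)
    then have "\<gamma> * (L2_norm S \<phi>)\<^sup>2 <= grad_norm_sq O1 \<phi> + C1 * (norm_on O1 \<phi>)\<^sup>2"
      using le[OF \<phi>] by (simp add: C1_def sum_distrib_left[symmetric] algebra_simps)
    moreover have "C1 * (norm_on O1 \<phi>)\<^sup>2 <= C' * (norm_on O1 \<phi>)\<^sup>2" using \<gamma> by (intro mult_right_mono) (auto simp: C'_def)
    ultimately show "\<phi> \<in> L2 S \<and> \<gamma> * (L2_norm S \<phi>)\<^sup>2 <= 1 * grad_norm_sq O1 \<phi> + C' * (norm_on O1 \<phi>)\<^sup>2"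
      using le[OF \<phi>] by simp
    have "(\<gamma>\<^sup>2 + \<gamma> / 1) * (norm_on O2 \<phi>)\<^sup>2 <= C' * (norm_on O2 \<phi>)\<^sup>2" using C1 by (intro mult_right_mono) (auto simp: C'_def)
    then show "\<phi> \<in> L2 S \<and> \<gamma> * (L2_norm S \<phi>)\<^sup>2 <= 1 * grad_norm_sq O2 \<phi> + C' * (norm_on O2 \<phi>)\<^sup>2"
      using Robin2[OF \<phi> \<gamma> zero_less_one] by simp
  qed
qed

lemma trace_domain_exists: "\<exists>K. trace_domain O1 S K \<and> trace_domain O2 S K \<and> trace_domain UNIV S K"
proof -
  interpret A1: admissible O1 by (rule admissible_Omega[OF th])
  interpret A2: admissible O2 by (rule admissible_Omega[OF th])
  interpret A: admissible "UNIV :: (real \<times> real) set" by (rule admissible_UNIV)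
  obtain C where C: "C \<ge> 0"
    and le1: "\<And>\<phi>. test_fun \<phi> ==> \<phi> \<in> L2 S \<and> 1 * (L2_norm S \<phi>)\<^sup>2 <= 1 * grad_norm_sq O1 \<phi> + C * (norm_on O1 \<phi>)\<^sup>2"
    and le2: "\<And>\<phi>. test_fun \<phi> ==> \<phi> \<in> L2 S \<and> 1 * (L2_norm S \<phi>)\<^sup>2 <= 1 * grad_norm_sq O2 \<phi> + C * (norm_on O2 \<phi>)\<^sup>2"
    using trace_control[OF zero_less_one] by metis
  have weaken: "t <= (1 + C) * (G + n\<^sup>2)" if "t <= G + C * n\<^sup>2" "G \<ge> 0" for t G n :: real
  proof -
    have "(1 + C) * (G + n\<^sup>2) = G + C * n\<^sup>2 + (C * G + n\<^sup>2)" by (simp add: algebra_simps)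
    moreover have "0 <= C * G" using C that by simp
    ultimately show ?thesis using that zero_le_power2[of n] by linarith
  qed
  have t1: "\<phi> \<in> L2 S \<and> (L2_norm S \<phi>)\<^sup>2 <= (1 + C) * (grad_norm_sq O1 \<phi> + (norm_on O1 \<phi>)\<^sup>2)" if "test_fun \<phi>" for \<phi>
    using le1[OF that] weaken[of "(L2_norm S \<phi>)\<^sup>2" "grad_norm_sq O1 \<phi>"] by simp
  have t2: "\<phi> \<in> L2 S \<and> (L2_norm S \<phi>)\<^sup>2 <= (1 + C) * (grad_norm_sq O2 \<phi> + (norm_on O2 \<phi>)\<^sup>2)" if "test_fun \<phi>" for \<phi>
    using le2[OF that] weaken[of "(L2_norm S \<phi>)\<^sup>2" "grad_norm_sq O2 \<phi>"] by simp
  have U: "leb_on (UNIV :: (real \<times> real) set) = lborel" by (rule leb_on_UNIV)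
  have t0: "\<phi> \<in> L2 S \<and> (L2_norm S \<phi>)\<^sup>2 <= (1 + C) * (grad_norm_sq UNIV \<phi> + (norm_on UNIV \<phi>)\<^sup>2)" if \<phi>: "test_fun \<phi>" for \<phi>
  proof -
    have "grad_norm_sq O2 \<phi> <= grad_norm_sq UNIV \<phi>"
      unfolding A2.grad_norm_sq_test[OF \<phi>] A.grad_norm_sq_test[OF \<phi>] U
      by (intro sum_mono power_mono L2_restrict(2) A2.op test_fun_L2 test_fun_pderiv \<phi>) auto
    moreover have "(norm_on O2 \<phi>)\<^sup>2 <= (norm_on UNIV \<phi>)\<^sup>2"
      unfolding U by (intro power_mono L2_restrict(2) A2.op test_fun_L2 \<phi>) auto
    ultimately have "(1 + C) * (grad_norm_sq O2 \<phi> + (norm_on O2 \<phi>)\<^sup>2) <= (1 + C) * (grad_norm_sq UNIV \<phi> + (norm_on UNIV \<phi>)\<^sup>2)"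
      using C by (intro mult_left_mono add_mono) auto
    then show ?thesis using t2[OF \<phi>] by linarith
  qed
  have "trace_domain O1 S (1 + C)" using t1 C by unfold_locales auto
  moreover have "trace_domain O2 S (1 + C)" using t2 C by unfold_locales auto
  moreover have "trace_domain UNIV S (1 + C)" using t0 C by unfold_locales auto
  ultimately show ?thesis by blast
qed

definition K where "K = (SOME K. trace_domain O1 S K \<and> trace_domain O2 S K \<and> trace_domain UNIV S K)"

lemma trace_domain_K: "trace_domain O1 S K" "trace_domain O2 S K" "trace_domain UNIV S K"
  using someI_ex[OF trace_domain_exists] by (simp_all add: K_def)

sublocale D1: trace_domain O1 S K by (rule trace_domain_K)
sublocale D2: trace_domain O2 S K by (rule trace_domain_K)
sublocale D0: trace_domain UNIV S K by (rule trace_domain_K)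

end

section \<open>The form with jump conditions is closed\<close>

context broken_line_geometry begin

abbreviation "T0 \<equiv> sobolev_trace S UNIV"
abbreviation "T1 \<equiv> sobolev_trace S O1"
abbreviation "T2 \<equiv> sobolev_trace S O2"
abbreviation "G1 \<equiv> grad_norm_sq O1"
abbreviation "G2 \<equiv> grad_norm_sq O2"
abbreviation "B \<equiv> H1_broken \<theta>"

lemma H1_brokenD:
  assumes "u \<in> B" shows "u \<in> L2 lborel" "u \<in> H1 O1" "u \<in> H1 O2"
  using assms by (simp_all add: H1_broken_def)

lemma subspace_H1_broken: "fun_space.subspace B"
proof -
  have "B = L2 lborel \<inter> (H1 O1 \<inter> H1 O2)" by (auto simp: H1_broken_def)
  then show ?thesis by (simp add: fun_space.subspace_inter subspace_L2 D1.subspace_H1 D2.subspace_H1)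
qed

lemma trace_jump_eq: "trace_jump \<theta> u = T1 u - T2 u"
  by (simp add: trace_jump_def fun_eq_iff)

lemma AE_linear_jump: "AE_linear B S (trace_jump \<theta>)"
proof -
  have "AE_linear B S (%u. T1 u - T2 u)"
    by (intro AE_linear_diff D1.AE_linear_trace D2.AE_linear_trace) (auto simp: H1_brokenD)
  then show ?thesis by (simp add: trace_jump_eq[abs_def])
qed

lemma jump_L2: "u \<in> B ==> trace_jump \<theta> u \<in> L2 S"
  using AE_linear_jump by (simp add: AE_linear_def)

lemma delta'_form_eq:
  assumes "u \<in> B" "v \<in> B"
  shows "delta'_form \<theta> \<beta> u v = grad_inner O1 u v + grad_inner O2 u v - of_real (1 / \<beta>) * L2_inner S (trace_jump \<theta> u) (trace_jump \<theta> v)"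
proof -
  have "L2_inner S (%x. of_real (1 / \<beta>) * trace_jump \<theta> u x) (trace_jump \<theta> v) = of_real (1 / \<beta>) * L2_inner S (trace_jump \<theta> u) (trace_jump \<theta> v)"
    using L2.q_scale_left[OF jump_L2[OF assms(1)] jump_L2[OF assms(2)], of "of_real (1 / \<beta>)"] by (simp only: fscale_def)
  then show ?thesis by (simp only: delta'_form_def)
qed

lemma delta_form_eq:
  assumes "u \<in> H1 UNIV" "v \<in> H1 UNIV"
  shows "delta_form \<theta> \<alpha> u v = grad_inner UNIV u v - of_real \<alpha> * L2_inner S (T0 u) (T0 v)"
proof -
  have "L2_inner S (%x. of_real \<alpha> * T0 u x) (T0 v) = of_real \<alpha> * L2_inner S (T0 u) (T0 v)"
    using L2.q_scale_left[OF D0.trace_L2[OF assms(1)] D0.trace_L2[OF assms(2)], of "of_real \<alpha>"] by (simp only: fscale_def)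
  then show ?thesis by (simp only: delta_form_def Let_def)
qed

lemma hermitian_delta': "hermitian_form fscale B (delta'_form \<theta> \<beta>)"
proof -
  let ?q = "%i. [grad_inner O1, grad_inner O2, %u v. L2_inner S (trace_jump \<theta> u) (trace_jump \<theta> v)] ! i"
  have h: "hermitian_form fscale B (grad_inner O1)" "hermitian_form fscale B (grad_inner O2)"
    "hermitian_form fscale B (%u v. L2_inner S (trace_jump \<theta> u) (trace_jump \<theta> v))"
    by (rule D1.hermitian_grad_inner D2.hermitian_grad_inner hermitian_form_pullback subspace_H1_broken AE_linear_jump | auto simp: H1_brokenD)+
  have "hermitian_form fscale B (%u v. \<Sum>i\<in>{..<3::nat}. of_real ([1, 1, - (1 / \<beta>)] ! i) * ?q i u v)"
  proof (rule hermitian_form_sum[OF subspace_H1_broken])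
    fix i :: nat assume "i \<in> {..<3}"
    then have "i = 0 \<or> i = 1 \<or> i = 2" by auto
    then show "hermitian_form fscale B (?q i)" using h by (elim disjE) simp_all
  qed
  then show ?thesis by (rule hermitian_form_cong) (simp add: delta'_form_eq numeral_3_eq_3)
qed

lemma hermitian_delta: "hermitian_form fscale (H1 UNIV) (delta_form \<theta> \<alpha>)"
proof -
  let ?q = "%i. [grad_inner UNIV, %u v. L2_inner S (T0 u) (T0 v)] ! i"
  note h = D0.hermitian_grad_inner[OF D0.subspace_H1 order_refl] hermitian_form_pullback[OF D0.subspace_H1 D0.AE_linear_trace[OF order_refl]]
  have "hermitian_form fscale (H1 UNIV) (%u v. \<Sum>i\<in>{..<2::nat}. of_real ([1, - \<alpha>] ! i) * ?q i u v)"
  proof (rule hermitian_form_sum[OF D0.subspace_H1])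
    fix i :: nat assume "i \<in> {..<2}"
    then have "i = 0 \<or> i = 1" by auto
    then show "hermitian_form fscale (H1 UNIV) (?q i)" using h by (elim disjE) simp_all
  qed
  then show ?thesis by (rule hermitian_form_cong) (simp add: delta_form_eq numeral_2_eq_2)
qed

lemma delta'_self: "u \<in> B ==> delta'_form \<theta> \<beta> u u = of_real (G1 u + G2 u - (1 / \<beta>) * (L2_norm S (trace_jump \<theta> u))\<^sup>2)"
  by (simp add: delta'_form_eq grad_inner_self L2_inner_self)

lemma delta_self: "u \<in> H1 UNIV ==> delta_form \<theta> \<alpha> u u = of_real (grad_norm_sq UNIV u - \<alpha> * (L2_norm S (T0 u))\<^sup>2)"
  by (simp add: delta_form_eq grad_inner_self L2_inner_self)

lemma jump_bound:
  assumes "u \<in> B"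
  shows "(L2_norm S (trace_jump \<theta> u))\<^sup>2 <= 2 * (L2_norm S (T1 u))\<^sup>2 + 2 * (L2_norm S (T2 u))\<^sup>2"
proof -
  have L: "T1 u \<in> L2 S" "T2 u \<in> L2 S" using D1.trace_L2 D2.trace_L2 H1_brokenD[OF assms] by auto
  have "L2_norm S (- T2 u) = L2_norm S (T2 u)" by (simp add: L2_norm_def)
  moreover have "- T2 u \<in> L2 S" using L2_fscale[OF L(2), of "-1"] by (simp add: fscale_def fun_Compl_def)
  ultimately have "L2_norm S (trace_jump \<theta> u) <= L2_norm S (T1 u) + L2_norm S (T2 u)"
    using L2_norm_triangle[OF L(1), of "- T2 u"] by (simp add: trace_jump_eq)
  then have "(L2_norm S (trace_jump \<theta> u))\<^sup>2 <= (L2_norm S (T1 u) + L2_norm S (T2 u))\<^sup>2" by (intro power_mono) auto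
  also have "\<dots> <= 2 * (L2_norm S (T1 u))\<^sup>2 + 2 * (L2_norm S (T2 u))\<^sup>2"
    using zero_le_power2[of "L2_norm S (T1 u) - L2_norm S (T2 u)"] by (simp add: power2_sum power2_diff)
  finally show ?thesis .
qed

lemma Robin2_H1:
  assumes u: "u \<in> H1 O2" and \<gamma>: "\<gamma> > 0" and L: "L > 0"
  shows "\<gamma> * (L2_norm S (T2 u))\<^sup>2 <= G2 u + (\<gamma>\<^sup>2 + \<gamma> / L) * (norm_on O2 u)\<^sup>2"
  using D2.energy_inequality_extends[where c' = 1 and C = 0 and p = 0 and q = "%_. 0" and c = "\<gamma>\<^sup>2 + \<gamma> / L", OF _ _ u D2.trace_exists[OF u]]
    Robin2(2)[OF _ \<gamma> L] by simp

lemma trace_control_H1: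
  assumes \<gamma>: "\<gamma> > 0"
  obtains C where "C \<ge> 0" "\<And>u. u \<in> H1 O1 ==> \<gamma> * (L2_norm S (T1 u))\<^sup>2 <= G1 u + C * (norm_on O1 u)\<^sup>2"
    "\<And>u. u \<in> H1 O2 ==> \<gamma> * (L2_norm S (T2 u))\<^sup>2 <= G2 u + C * (norm_on O2 u)\<^sup>2"
proof -
  obtain C where C: "C \<ge> 0"
    and le1: "\<And>\<phi>. test_fun \<phi> ==> \<phi> \<in> L2 S \<and> \<gamma> * (L2_norm S \<phi>)\<^sup>2 <= 1 * grad_norm_sq O1 \<phi> + C * (norm_on O1 \<phi>)\<^sup>2"
    and le2: "\<And>\<phi>. test_fun \<phi> ==> \<phi> \<in> L2 S \<and> \<gamma> * (L2_norm S \<phi>)\<^sup>2 <= 1 * grad_norm_sq O2 \<phi> + C * (norm_on O2 \<phi>)\<^sup>2"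
    using trace_control[OF \<gamma>] by metis
  show thesis
  proof (rule that[OF C])
    show "\<gamma> * (L2_norm S (T1 u))\<^sup>2 <= G1 u + C * (norm_on O1 u)\<^sup>2" if u: "u \<in> H1 O1" for u
      using D1.energy_inequality_extends[where c' = 1 and C = 0 and p = 0 and q = "%_. 0" and c = C, OF _ _ u D1.trace_exists[OF u]] conjunct2[OF le1] by simp
    show "\<gamma> * (L2_norm S (T2 u))\<^sup>2 <= G2 u + C * (norm_on O2 u)\<^sup>2" if u: "u \<in> H1 O2" for u
      using D2.energy_inequality_extends[where c' = 1 and C = 0 and p = 0 and q = "%_. 0" and c = C, OF _ _ u D2.trace_exists[OF u]] conjunct2[OF le2] by simp
  qed
qed

lemma delta'_finite_codim_bound:
  assumes \<gamma>: "\<gamma> > 0" and e: "e > 0"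
  shows "\<exists>(p::nat) g C. (\<forall>i<p. g i \<in> L2 lborel) \<and> C \<ge> 0 \<and>
     (\<forall>u\<in>B. (- \<gamma>\<^sup>2 - e) * Re (L2_inner lborel u u) <= Re (delta'_form \<theta> (2 / \<gamma>) u u) + C * (\<Sum>i<p. (cmod (L2_inner lborel u (g i)))\<^sup>2))"
proof (rule Robin1[OF \<gamma> e])
  fix p :: nat and q C
  assume q: "\<And>i. i < p ==> q i \<in> L2 lborel" and q0: "\<And>i z. i < p ==> z \<notin> O1 ==> q i z = 0" and C: "C \<ge> 0"
    and le: "\<And>\<phi>. test_fun \<phi> ==> \<phi> \<in> L2 S \<and> \<gamma> * (L2_norm S \<phi>)\<^sup>2 <= 1 * grad_norm_sq O1 \<phi> + (\<gamma>\<^sup>2 + e) * (norm_on O1 \<phi>)\<^sup>2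
       + C * (\<Sum>i<p. (cmod (L2_inner (leb_on O1) \<phi> (q i)))\<^sup>2)"
  have "(- \<gamma>\<^sup>2 - e) * Re (L2_inner lborel u u) <= Re (delta'_form \<theta> (2 / \<gamma>) u u) + C * (\<Sum>i<p. (cmod (L2_inner lborel u (q i)))\<^sup>2)" if u: "u \<in> B" for u
  proof -
    note uH = H1_brokenD[OF u]
    have "\<gamma> * (L2_norm S (T1 u))\<^sup>2 <= 1 * G1 u + (\<gamma>\<^sup>2 + e) * (norm_on O1 u)\<^sup>2 + C * (\<Sum>i<p. (cmod (L2_inner (leb_on O1) u (q i)))\<^sup>2)"
      by (rule D1.energy_inequality_extends[OF conjunct2[OF le] L2_restrict(1)[OF D1.op q] uH(2) D1.trace_exists[OF uH(2)]])
    also have "(\<Sum>i<p. (cmod (L2_inner (leb_on O1) u (q i)))\<^sup>2) = (\<Sum>i<p. (cmod (L2_inner lborel u (q i)))\<^sup>2)"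
      using q0 by (intro sum.cong refl) (simp add: L2_inner_leb_on[OF D1.op])
    finally have 1: "\<gamma> * (L2_norm S (T1 u))\<^sup>2 <= G1 u + (\<gamma>\<^sup>2 + e) * (norm_on O1 u)\<^sup>2 + C * (\<Sum>i<p. (cmod (L2_inner lborel u (q i)))\<^sup>2)" by simp
    have "\<gamma> / (\<gamma> / e) = e" "\<gamma> / e > 0" using \<gamma> e by auto
    then have 2: "\<gamma> * (L2_norm S (T2 u))\<^sup>2 <= G2 u + (\<gamma>\<^sup>2 + e) * (norm_on O2 u)\<^sup>2"
      using Robin2_H1[OF uH(3) \<gamma>, of "\<gamma> / e"] by simp
    have "(\<gamma> / 2) * (L2_norm S (trace_jump \<theta> u))\<^sup>2 <= (\<gamma> / 2) * (2 * (L2_norm S (T1 u))\<^sup>2 + 2 * (L2_norm S (T2 u))\<^sup>2)"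
      using jump_bound[OF u] \<gamma> by (intro mult_left_mono) auto
    then have 3: "(\<gamma> / 2) * (L2_norm S (trace_jump \<theta> u))\<^sup>2 <= \<gamma> * (L2_norm S (T1 u))\<^sup>2 + \<gamma> * (L2_norm S (T2 u))\<^sup>2"
      by (simp add: algebra_simps)
    have "(\<gamma>\<^sup>2 + e) * (L2_norm lborel u)\<^sup>2 = (\<gamma>\<^sup>2 + e) * (norm_on O1 u)\<^sup>2 + (\<gamma>\<^sup>2 + e) * (norm_on O2 u)\<^sup>2"
      by (simp add: L2_norm_split[OF uH(1)] distrib_left)
    moreover have "Re (delta'_form \<theta> (2 / \<gamma>) u u) = G1 u + G2 u - (\<gamma> / 2) * (L2_norm S (trace_jump \<theta> u))\<^sup>2"
      by (simp add: delta'_self[OF u])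
    moreover have "(- \<gamma>\<^sup>2 - e) * Re (L2_inner lborel u u) = - ((\<gamma>\<^sup>2 + e) * (L2_norm lborel u)\<^sup>2)" by (simp add: L2_inner_self algebra_simps)
    ultimately show ?thesis using 1 2 3 by linarith
  qed
  then show ?thesis using q C by blast
qed

text \<open>
  The trace estimate with twice the required constant leaves half of the gradient term, so \<open>a'\<close> and
  the \<open>H\<^sup>1\<close>-norm are equivalent modulo the \<open>L\<^sup>2\<close>-norm. This is what closedness needs.
\<close>

lemma delta'_gradient_control:
  assumes \<gamma>: "\<gamma> > 0"
  obtains C where "C \<ge> 0"
    "\<And>u. u \<in> B ==> G1 u + G2 u <= 2 * Re (delta'_form \<theta> (2 / \<gamma>) u u) + C * (L2_norm lborel u)\<^sup>2"
    "\<And>u. u \<in> B ==> \<bar>Re (delta'_form \<theta> (2 / \<gamma>) u u)\<bar> <= 2 * (G1 u + G2 u) + C * (L2_norm lborel u)\<^sup>2"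
proof -
  have g2: "2 * \<gamma> > 0" using \<gamma> by simp
  obtain C where C: "C \<ge> 0" and c1: "\<And>u. u \<in> H1 O1 ==> 2 * \<gamma> * (L2_norm S (T1 u))\<^sup>2 <= G1 u + C * (norm_on O1 u)\<^sup>2"
    and c2: "\<And>u. u \<in> H1 O2 ==> 2 * \<gamma> * (L2_norm S (T2 u))\<^sup>2 <= G2 u + C * (norm_on O2 u)\<^sup>2"
    using trace_control_H1[OF g2] by metis
  have key: "2 * ((\<gamma> / 2) * (L2_norm S (trace_jump \<theta> u))\<^sup>2) <= G1 u + G2 u + C * (L2_norm lborel u)\<^sup>2"
    "Re (delta'_form \<theta> (2 / \<gamma>) u u) = G1 u + G2 u - (\<gamma> / 2) * (L2_norm S (trace_jump \<theta> u))\<^sup>2" if u: "u \<in> B" for u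
  proof -
    note uH = H1_brokenD[OF u]
    have "\<gamma> * (L2_norm S (trace_jump \<theta> u))\<^sup>2 <= \<gamma> * (2 * (L2_norm S (T1 u))\<^sup>2 + 2 * (L2_norm S (T2 u))\<^sup>2)"
      using jump_bound[OF u] \<gamma> by (intro mult_left_mono) auto
    also have "\<dots> = 2 * \<gamma> * (L2_norm S (T1 u))\<^sup>2 + 2 * \<gamma> * (L2_norm S (T2 u))\<^sup>2" by (simp add: algebra_simps)
    also have "\<dots> <= (G1 u + C * (norm_on O1 u)\<^sup>2) + (G2 u + C * (norm_on O2 u)\<^sup>2)"
      by (intro add_mono c1 c2 uH)
    also have "\<dots> = G1 u + G2 u + C * (L2_norm lborel u)\<^sup>2" by (simp add: L2_norm_split[OF uH(1)] distrib_left)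
    finally show "2 * ((\<gamma> / 2) * (L2_norm S (trace_jump \<theta> u))\<^sup>2) <= G1 u + G2 u + C * (L2_norm lborel u)\<^sup>2" by simp
    show "Re (delta'_form \<theta> (2 / \<gamma>) u u) = G1 u + G2 u - (\<gamma> / 2) * (L2_norm S (trace_jump \<theta> u))\<^sup>2" by (simp add: delta'_self[OF u])
  qed
  have abs: "\<bar>t\<bar> <= 2 * G + c" if "t = G - J" "2 * J <= G + c" "0 <= c" "0 <= G" "0 <= J" for t G J c :: real
    using that by linarith
  show thesis
  proof (rule that[OF C])
    fix u assume u: "u \<in> B"
    have nn: "0 <= C * (L2_norm lborel u)\<^sup>2" "0 <= G1 u" "0 <= G2 u" "0 <= (\<gamma> / 2) * (L2_norm S (trace_jump \<theta> u))\<^sup>2" using C \<gamma> by auto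
    show "G1 u + G2 u <= 2 * Re (delta'_form \<theta> (2 / \<gamma>) u u) + C * (L2_norm lborel u)\<^sup>2"
      using key[OF u] by linarith
    show "\<bar>Re (delta'_form \<theta> (2 / \<gamma>) u u)\<bar> <= 2 * (G1 u + G2 u) + C * (L2_norm lborel u)\<^sup>2"
      by (rule abs[OF key(2)[OF u] key(1)[OF u]]) (use nn in auto)
  qed
qed

theorem delta'_closed_form:
  assumes \<gamma>: "\<gamma> > 0"
  shows "closed_form fscale (L2 lborel) (L2_inner lborel) B (delta'_form \<theta> (2 / \<gamma>)) (- \<gamma>\<^sup>2)"
proof -
  let ?a = "delta'_form \<theta> (2 / \<gamma>)"
  interpret a: hermitian_form fscale B ?a by (rule hermitian_delta')
  have BL: "B \<subseteq> L2 lborel" using H1_brokenD(1) by blast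
  obtain C where C: "C \<ge> 0" and up: "\<And>u. u \<in> B ==> G1 u + G2 u <= 2 * Re (?a u u) + C * (L2_norm lborel u)\<^sup>2"
    and dn: "\<And>u. u \<in> B ==> \<bar>Re (?a u u)\<bar> <= 2 * (G1 u + G2 u) + C * (L2_norm lborel u)\<^sup>2"
    using delta'_gradient_control[OF \<gamma>] by metis
  have sq: "Re (L2_inner lborel u u) = (L2_norm lborel u)\<^sup>2" for u :: "real \<times> real => complex" by (simp add: L2_inner_self)
  have closed: "\<exists>x\<in>B. (%k. Re (L2_inner lborel (w k - x) (w k - x))) \<longlonglongrightarrow> 0 \<and> (%k. Re (?a (w k - x) (w k - x))) \<longlonglongrightarrow> 0"
    if w: "\<And>k::nat. w k \<in> B" and cauchy: "\<And>e. e > 0 ==> \<exists>K. \<forall>j\<ge>K. \<forall>k\<ge>K. Re (L2_inner lborel (w j - w k) (w j - w k)) < e \<and> \<bar>Re (?a (w j - w k) (w j - w k))\<bar> < e" for w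
  proof -
    have wd: "w j - w k \<in> B" for j k by (intro a.V_closed(3) w)
    have "\<exists>N. \<forall>j\<ge>N. \<forall>k\<ge>N. L2_norm lborel (w j - w k) < r" if r: "r > 0" for r
    proof -
      obtain N where "\<forall>j\<ge>N. \<forall>k\<ge>N. Re (L2_inner lborel (w j - w k) (w j - w k)) < r\<^sup>2" using cauchy[OF zero_less_power[OF r, of 2]] by blast
      then have "\<forall>j\<ge>N. \<forall>k\<ge>N. L2_norm lborel (w j - w k) < r" unfolding sq using r by (metis less_imp_le power_less_imp_less_base)
      then show ?thesis by blast
    qed
    from L2_complete[OF H1_brokenD(1)[OF w] this] obtain x where x: "x \<in> L2 lborel" and lim: "(%k. L2_norm lborel (w k - x)) \<longlonglongrightarrow> 0" by blast
    have grad: "\<exists>N. \<forall>j\<ge>N. \<forall>k\<ge>N. G1 (w j - w k) < r \<and> G2 (w j - w k) < r" if r: "r > 0" for r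
    proof -
      define e where "e = r / (2 + C)"
      have e: "e > 0" "(2 + C) * e = r" using r C by (auto simp: e_def)
      obtain N where N: "\<And>j k. j \<ge> N ==> k \<ge> N ==> (L2_norm lborel (w j - w k))\<^sup>2 < e \<and> \<bar>Re (?a (w j - w k) (w j - w k))\<bar> < e"
        using cauchy[OF e(1)] unfolding sq by blast
      have "G1 (w j - w k) < r \<and> G2 (w j - w k) < r" if "j \<ge> N" "k \<ge> N" for j k
      proof -
        have "C * (L2_norm lborel (w j - w k))\<^sup>2 <= C * e" using N[OF that] C by (intro mult_left_mono) auto
        moreover have re: "Re (?a (w j - w k) (w j - w k)) < e" using N[OF that] by (simp add: abs_less_iff)
        ultimately have "G1 (w j - w k) + G2 (w j - w k) < (2 + C) * e" using up[OF wd[of j k]] re by (simp add: distrib_right)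
        moreover have "0 <= G1 (w j - w k)" "0 <= G2 (w j - w k)" by simp_all
        ultimately show ?thesis unfolding e(2) by linarith
      qed
      then show ?thesis by blast
    qed
    have lim_on: "(%k. norm_on W (w k - x)) \<longlonglongrightarrow> 0" if "open W" for W :: "(real \<times> real) set"
      by (rule tendsto_sandwich[OF _ _ tendsto_const lim])
        (use L2_restrict(2)[OF that L2.V_closed(3)[OF H1_brokenD(1)[OF w] x]] in auto)
    have x1: "x \<in> H1 O1" "(%k. G1 (w k - x)) \<longlonglongrightarrow> 0"
      using D1.H1_complete[OF H1_brokenD(2)[OF w] L2_restrict(1)[OF D1.op x] lim_on[OF D1.op]] grad by blast+
    have x2: "x \<in> H1 O2" "(%k. G2 (w k - x)) \<longlonglongrightarrow> 0"
      using D2.H1_complete[OF H1_brokenD(3)[OF w] L2_restrict(1)[OF D2.op x] lim_on[OF D2.op]] grad by blast+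
    have xB: "x \<in> B" using x x1 x2 by (simp add: H1_broken_def)
    have "(%k. 2 * (G1 (w k - x) + G2 (w k - x)) + C * (L2_norm lborel (w k - x))\<^sup>2) \<longlonglongrightarrow> 2 * (0 + 0) + C * 0\<^sup>2"
      by (intro tendsto_intros x1 x2 lim)
    then have "(%k. Re (?a (w k - x) (w k - x))) \<longlonglongrightarrow> 0"
      by (intro Lim_null_comparison[of "%k. Re (?a (w k - x) (w k - x))"]) (use dn[OF a.V_closed(3)[OF w xB]] in auto)
    moreover have "(%k. Re (L2_inner lborel (w k - x) (w k - x))) \<longlonglongrightarrow> 0"
      unfolding sq using tendsto_power[OF lim, of 2] by simp
    ultimately show ?thesis using xB by blast
  qed
  show ?thesis
  proof unfold_locales
    show "B \<subseteq> L2 lborel" by (rule BL)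
  qed (use closed delta'_finite_codim_bound[OF \<gamma>] in blast)+
qed

end

section \<open>The sign flip across the broken line\<close>

lemma L2_leb_on_cong:
  assumes "\<And>x. x \<in> W ==> u x = v x"
  shows "u \<in> L2 (leb_on W) \<longleftrightarrow> v \<in> L2 (leb_on W)" "norm_on W u = norm_on W v"
proof -
  have sp: "x \<in> space (leb_on W) ==> u x = v x" for x using assms by (simp add: space_restrict_space)
  show "u \<in> L2 (leb_on W) \<longleftrightarrow> v \<in> L2 (leb_on W)"
    using measurable_cong[of "leb_on W" u v borel, OF sp]
      Bochner_Integration.integrable_cong[of "leb_on W" "leb_on W" "%x. (cmod (u x))\<^sup>2" "%x. (cmod (v x))\<^sup>2"] sp
    by (simp add: L2_def)
  show "norm_on W u = norm_on W v"
    unfolding L2_norm_def using sp by (intro arg_cong[where f = sqrt] Bochner_Integration.integral_cong) auto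
qed

lemma has_weak_deriv_cong:
  assumes "\<And>x. x \<in> W ==> u x = v x"
  shows "has_weak_deriv W e u = has_weak_deriv W e v"
proof -
  have "(\<integral>x. u x * f x \<partial>leb_on W) = (\<integral>x. v x * f x \<partial>leb_on W)" for f
    using assms by (intro Bochner_Integration.integral_cong) (auto simp: space_restrict_space)
  then show ?thesis by (simp add: has_weak_deriv_def fun_eq_iff)
qed

lemma weak_deriv_cong: "(\<And>x. x \<in> W ==> u x = v x) ==> weak_deriv W e u = weak_deriv W e v"
  unfolding weak_deriv_def by (subst has_weak_deriv_cong) auto

lemma H1_cong: "(\<And>x. x \<in> W ==> u x = v x) ==> u \<in> H1 W \<longleftrightarrow> v \<in> H1 W"
  using L2_leb_on_cong(1)[of W u v] has_weak_deriv_cong[of W u v] by (simp add: H1_def)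

lemma sobolev_trace_cong:
  assumes "\<And>x. x \<in> W ==> u x = v x"
  shows "sobolev_trace S W u = sobolev_trace S W v"
proof -
  have eq: "f x - u x = f x - v x" if "x \<in> W" for f :: "_ => complex" and x using assms that by simp
  have "H1_norm W (%x. f x - u x) = H1_norm W (%x. f x - v x)" for f
  proof -
    have "norm_on W (%x. f x - u x) = norm_on W (%x. f x - v x)" by (rule L2_leb_on_cong(2)) (rule eq)
    moreover have "weak_deriv W e (%x. f x - u x) = weak_deriv W e (%x. f x - v x)" for e by (rule weak_deriv_cong) (rule eq)
    ultimately show ?thesis by (simp add: H1_norm_def)
  qed
  then show ?thesis by (simp add: sobolev_trace_def is_trace_def)
qed

lemma H1_UNIV_L2: "u \<in> H1 UNIV ==> u \<in> L2 lborel"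
  by (simp add: H1_def leb_on_UNIV)

lemma (in admissible) H1_restrict:
  assumes u: "u \<in> H1 UNIV"
  shows "u \<in> H1 W" "e \<in> Basis ==> AE x in leb_on W. weak_deriv W e u x = weak_deriv UNIV e u x"
proof -
  interpret A: admissible "UNIV :: 'a set" by (rule admissible_UNIV)
  note w = has_weak_deriv_restrict[OF op A.weak_deriv_works[OF u]]
  show "u \<in> H1 W" using L2_restrict(1)[OF op H1_UNIV_L2[OF u]] w by (rule H1_I)
  show "e \<in> Basis ==> AE x in leb_on W. weak_deriv W e u x = weak_deriv UNIV e u x" by (rule weak_deriv_eq[OF w])
qed

lemma (in trace_domain) trace_restrict:
  assumes U: "trace_domain UNIV S K'" and u: "u \<in> H1 UNIV"
  shows "AE x in S. sobolev_trace S W u x = sobolev_trace S UNIV u x"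
proof -
  interpret U: trace_domain UNIV S K' by (rule U)
  have uH: "u \<in> H1 W" by (rule H1_restrict(1)[OF u])
  obtain \<phi> where ap: "U.approximates \<phi> u" and l: "(%k. L2_norm S (\<phi> k - sobolev_trace S UNIV u)) \<longlonglongrightarrow> 0"
    using U.trace_exists[OF u] U.is_trace_iff[OF u] by blast
  have t: "test_fun (\<phi> k)" for k using ap by (simp add: U.approximates_def)
  have squeeze: "(%k. norm_on W (f k)) \<longlonglongrightarrow> 0" if "\<And>k. f k \<in> L2 lborel" "(%k. L2_norm lborel (f k)) \<longlonglongrightarrow> 0" for f :: "nat => 'a => complex"
    by (rule tendsto_sandwich[OF _ _ tendsto_const that(2)]) (use L2_restrict(2)[OF op that(1)] in auto)
  have "approximates \<phi> u"
    unfolding approximates_def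
  proof (intro conjI allI ballI t)
    show "(%k. norm_on W (\<phi> k - u)) \<longlonglongrightarrow> 0"
      using ap by (intro squeeze L2.V_closed(3) test_fun_L2 t H1_UNIV_L2 u) (simp add: U.approximates_def leb_on_UNIV)
    fix e :: 'a assume e: "e \<in> Basis"
    have wL: "weak_deriv UNIV e u \<in> L2 lborel" using U.weak_deriv_L2[OF u e] by (simp add: leb_on_UNIV)
    have "(%k. norm_on W (pderiv_dir e (\<phi> k) - weak_deriv UNIV e u)) \<longlonglongrightarrow> 0"
      using ap e by (intro squeeze L2.V_closed(3) test_fun_L2 test_fun_pderiv t wL) (simp_all add: U.approximates_def leb_on_UNIV)
    moreover have "norm_on W (pderiv_dir e (\<phi> k) - weak_deriv W e u) = norm_on W (pderiv_dir e (\<phi> k) - weak_deriv UNIV e u)" for k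
    proof (rule L2_norm_cong_AE)
      show "AE x in leb_on W. (pderiv_dir e (\<phi> k) - weak_deriv W e u) x = (pderiv_dir e (\<phi> k) - weak_deriv UNIV e u) x"
        using H1_restrict(2)[OF u e] by eventually_elim simp
    qed (rule L2_measurable[OF L2.V_closed(3)[OF test_L2(2)[OF t e] weak_deriv_L2[OF uH e]]]
        L2_measurable[OF L2.V_closed(3)[OF test_L2(2)[OF t e] L2_restrict(1)[OF op wL]]])+
    ultimately show "(%k. norm_on W (pderiv_dir e (\<phi> k) - weak_deriv W e u)) \<longlonglongrightarrow> 0" by simp
  qed
  then have "is_trace S W u (sobolev_trace S UNIV u)" using is_trace_iff[OF uH] U.trace_L2[OF u] l by blast
  then show ?thesis by (rule trace_unique[OF uH trace_exists[OF uH]])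
qed

context broken_line_geometry begin

definition reflect :: "(real \<times> real => complex) => real \<times> real => complex" where
  "reflect u z = (if z \<in> O2 then - u z else u z)"

lemma reflect_add: "reflect (u + v) = reflect u + reflect v"
  and reflect_scale: "reflect (fscale c u) = fscale c (reflect u)"
  and reflect_zero: "reflect 0 = 0"
  by (simp_all add: reflect_def fun_eq_iff)

lemma reflect_combination: "reflect (\<Sum>i\<in>I. fscale (k i) (u i)) = (\<Sum>i\<in>I. fscale (k i) (reflect (u i)))"
  by (induction I rule: infinite_finite_induct) (simp_all only: sum.infinite sum.empty sum.insert reflect_add reflect_scale reflect_zero not_False_eq_True)

lemma reflect_on: "z \<in> O1 ==> reflect u z = u z" "z \<in> O2 ==> reflect u z = fscale (-1) u z"
  using Omega_disjoint by (auto simp: reflect_def)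

lemma reflect_L2_inner: "L2_inner lborel (reflect u) (reflect u) = L2_inner lborel u u"
  unfolding L2_inner_def by (rule Bochner_Integration.integral_cong) (auto simp: reflect_def)

lemma reflect_H1_broken:
  assumes u: "u \<in> H1 UNIV" shows "reflect u \<in> B"
proof -
  have e2: "extend0 O2 u \<in> L2 lborel" using L2_restrict(1)[OF D2.op H1_UNIV_L2[OF u]] L2_leb_on[OF D2.op] by blast
  have "reflect u = u - fscale 2 (extend0 O2 u)" by (auto simp: reflect_def extend0_def fun_eq_iff)
  then have "reflect u \<in> L2 lborel" using L2.V_closed(3)[OF H1_UNIV_L2[OF u] L2_fscale[OF e2]] by simp
  moreover have "reflect u \<in> H1 O1" using D1.H1_restrict(1)[OF u] H1_cong[of O1 "reflect u" u] reflect_on(1) by blast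
  moreover have "reflect u \<in> H1 O2"
    using D2.H1_closed(2)[OF D2.H1_restrict(1)[OF u], of "-1"] H1_cong[of O2 "reflect u" "fscale (-1) u"] reflect_on(2) by blast
  ultimately show ?thesis by (simp add: H1_broken_def)
qed

lemma reflect_traces:
  assumes u: "u \<in> H1 UNIV"
  shows "AE x in S. T1 (reflect u) x = T0 u x" "AE x in S. T2 (reflect u) x = - T0 u x"
proof -
  have "T1 (reflect u) = T1 u" using reflect_on(1) by (rule sobolev_trace_cong)
  then show "AE x in S. T1 (reflect u) x = T0 u x" using D1.trace_restrict[OF D0.trace_domain_axioms u] by simp
  have 2: "T2 (reflect u) = T2 (fscale (-1) u)" using reflect_on(2) by (rule sobolev_trace_cong)
  show "AE x in S. T2 (reflect u) x = - T0 u x"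
    unfolding 2 using D2.trace_restrict[OF D0.trace_domain_axioms u] D2.trace_scale[OF D2.H1_restrict(1)[OF u], of "-1"]
    by eventually_elim simp
qed

lemma grad_norm_sq_split:
  assumes u: "u \<in> H1 UNIV" shows "grad_norm_sq UNIV u = G1 u + G2 u"
proof -
  have "(norm_on UNIV (weak_deriv UNIV e u))\<^sup>2 = (norm_on O1 (weak_deriv O1 e u))\<^sup>2 + (norm_on O2 (weak_deriv O2 e u))\<^sup>2"
    if e: "e \<in> Basis" for e
  proof -
    have wL: "weak_deriv UNIV e u \<in> L2 lborel" using D0.weak_deriv_L2[OF u e] by (simp add: leb_on_UNIV)
    have "norm_on O1 (weak_deriv O1 e u) = norm_on O1 (weak_deriv UNIV e u)"
      by (rule L2_norm_cong_AE[OF L2_measurable[OF D1.weak_deriv_L2[OF D1.H1_restrict(1)[OF u] e]] L2_measurable[OF L2_restrict(1)[OF D1.op wL]] D1.H1_restrict(2)[OF u e]])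
    moreover have "norm_on O2 (weak_deriv O2 e u) = norm_on O2 (weak_deriv UNIV e u)"
      by (rule L2_norm_cong_AE[OF L2_measurable[OF D2.weak_deriv_L2[OF D2.H1_restrict(1)[OF u] e]] L2_measurable[OF L2_restrict(1)[OF D2.op wL]] D2.H1_restrict(2)[OF u e]])
    ultimately show ?thesis using L2_norm_split[OF wL] by (simp add: leb_on_UNIV)
  qed
  then show ?thesis by (simp add: grad_norm_sq_def sum.distrib)
qed

lemma grad_norm_sq_reflect:
  assumes u: "u \<in> H1 UNIV" shows "G1 (reflect u) + G2 (reflect u) = grad_norm_sq UNIV u"
proof -
  have c1: "weak_deriv O1 e (reflect u) = weak_deriv O1 e u" for e using reflect_on(1) by (rule weak_deriv_cong)
  have c2: "weak_deriv O2 e (reflect u) = weak_deriv O2 e (fscale (-1) u)" for e using reflect_on(2) by (rule weak_deriv_cong)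
  interpret q: hermitian_form fscale "H1 O2" "grad_inner O2" by (rule D2.hermitian_grad_inner[OF D2.subspace_H1 order_refl])
  have uH: "u \<in> H1 O2" by (rule D2.H1_restrict(1)[OF u])
  have "grad_inner O2 (fscale (-1) u) (fscale (-1) u) = grad_inner O2 u u"
    by (simp only: q.q_scale_left[OF uH D2.H1_closed(2)[OF uH]] q.q_scale_right[OF uH uH]) simp
  then have "G2 (fscale (-1) u) = G2 u" by (simp add: grad_inner_self)
  moreover have "G1 (reflect u) = G1 u" "G2 (reflect u) = G2 (fscale (-1) u)" by (simp_all add: grad_norm_sq_def c1 c2)
  ultimately show ?thesis by (simp add: grad_norm_sq_split[OF u])
qed

lemma delta'_form_reflect:
  assumes u: "u \<in> H1 UNIV"
  shows "delta'_form \<theta> (2 / \<gamma>) (reflect u) (reflect u) = delta_form \<theta> (2 * \<gamma>) u u"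
proof -
  have "L2_norm S (trace_jump \<theta> (reflect u)) = L2_norm S (fscale 2 (T0 u))"
  proof (rule L2_norm_cong_AE[OF L2_measurable[OF jump_L2[OF reflect_H1_broken[OF u]]] L2_measurable[OF L2_fscale[OF D0.trace_L2[OF u]]]])
    show "AE x in S. trace_jump \<theta> (reflect u) x = fscale 2 (T0 u) x"
      using reflect_traces[OF u] by eventually_elim (simp add: trace_jump_def)
  qed
  then have "(L2_norm S (trace_jump \<theta> (reflect u)))\<^sup>2 = 4 * (L2_norm S (T0 u))\<^sup>2" by (simp add: L2_norm_fscale power_mult_distrib)
  then show ?thesis
    by (simp add: delta'_self[OF reflect_H1_broken[OF u]] delta_self[OF u] grad_norm_sq_reflect[OF u])
qed

text \<open>
  Once \<open>x = reflect u\<close> is known to vanish on \<open>\<Omega>\<^sub>2\<close>, its trace vanishes too: the energy identity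
  says \<open>\<parallel>\<nabla>x\<parallel>\<^sup>2 = \<gamma> \<parallel>x\<parallel>\<^sub>\<Sigma>\<^sup>2\<close> on \<open>\<Omega>\<^sub>2\<close>, and a trace estimate with the constant \<open>2 \<gamma>\<close> in place of
  \<open>\<gamma>\<close> is compatible with that only if both sides are zero.
\<close>

lemma reflect_not_eigenvector:
  assumes u: "u \<in> H1 UNIV" and \<gamma>: "\<gamma> > 0" and l: "l < - \<gamma>\<^sup>2" and pos: "Re (L2_inner lborel u u) > 0"
    and ev: "\<And>v. v \<in> B ==> delta'_form \<theta> (2 / \<gamma>) (reflect u) v = of_real l * L2_inner lborel (reflect u) v"
  shows False
proof -
  let ?x = "reflect u"
  let ?v = "extend0 O2 ?x"
  have xB: "?x \<in> B" by (rule reflect_H1_broken[OF u])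
  note x = H1_brokenD[OF xB]
  have v0: "z \<in> O1 ==> ?v z = 0 z" and vx: "z \<in> O2 ==> ?v z = ?x z" for z using Omega_disjoint by (auto simp: extend0_def)
  have z1: "0 \<in> H1 O1" using D1.subspace_H1 by (rule fun_space.subspace_0)
  have vB: "?v \<in> B"
    unfolding H1_broken_def using L2_restrict(1)[OF D2.op x(1)] L2_leb_on[OF D2.op] H1_cong[of O1 ?v 0, OF v0] z1 H1_cong[of O2 ?v ?x, OF vx] x(3) by blast
  have "grad_inner O1 ?x ?v = grad_inner O1 ?x 0"
    using weak_deriv_cong[of O1 ?v 0, OF v0] by (simp add: grad_inner_def)
  also have "\<dots> = 0"
    by (rule hermitian_form.q_zero_right[OF D1.hermitian_grad_inner[OF D1.subspace_H1 order_refl] x(2)])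
  finally have g1: "grad_inner O1 ?x ?v = 0" .
  have g2: "grad_inner O2 ?x ?v = of_real (G2 ?x)"
    using weak_deriv_cong[of O2 ?v ?x, OF vx] by (simp add: grad_inner_def grad_inner_self[symmetric])
  have T2L: "T2 ?x \<in> L2 S" by (rule D2.trace_L2[OF x(3)])
  have "L2_inner S (trace_jump \<theta> ?x) (trace_jump \<theta> ?v) = L2_inner S (fscale (-2) (T2 ?x)) (fscale (-1) (T2 ?x))"
  proof (rule L2_inner_cong_AE)
    show "AE z in S. trace_jump \<theta> ?x z = fscale (-2) (T2 ?x) z"
      using reflect_traces[OF u] by eventually_elim (simp add: trace_jump_def)
    have "T1 ?v = T1 0" "T2 ?v = T2 ?x" using v0 vx by (auto intro!: sobolev_trace_cong)
    moreover have "fscale 0 (0::real \<times> real => complex) = 0" by (simp add: fun_eq_iff)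
    then have "AE z in S. T1 0 z = 0" using D1.trace_scale[OF z1, of 0] by simp
    ultimately show "AE z in S. trace_jump \<theta> ?v z = fscale (-1) (T2 ?x) z" by (auto simp: trace_jump_def)
  qed (rule L2_measurable jump_L2 xB vB L2_fscale T2L)+
  also have "\<dots> = of_real (2 * (L2_norm S (T2 ?x))\<^sup>2)"
    using L2.q_scale_left[OF T2L L2_fscale[OF T2L], of "-2" "-1"] L2.q_scale_right[OF T2L T2L, of "-1"] by (simp add: L2_inner_self)
  finally have "delta'_form \<theta> (2 / \<gamma>) ?x ?v = of_real (G2 ?x - \<gamma> * (L2_norm S (T2 ?x))\<^sup>2)"
    by (simp add: delta'_form_eq[OF xB vB] g1 g2)
  moreover have "L2_inner lborel ?x ?v = of_real ((norm_on O2 ?x)\<^sup>2)"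
  proof -
    have "L2_inner lborel ?x ?v = L2_inner (leb_on O2) ?x ?v"
      by (rule L2_inner_leb_on[OF D2.op, symmetric]) (simp add: extend0_def)
    also have "\<dots> = L2_inner (leb_on O2) ?x ?x"
      unfolding L2_inner_def by (rule Bochner_Integration.integral_cong) (auto simp: vx space_restrict_space)
    finally show ?thesis by (simp add: L2_inner_self)
  qed
  ultimately have "complex_of_real (G2 ?x - \<gamma> * (L2_norm S (T2 ?x))\<^sup>2) = of_real (l * (norm_on O2 ?x)\<^sup>2)"
    using ev[OF vB] by simp
  then have eq: "G2 ?x - \<gamma> * (L2_norm S (T2 ?x))\<^sup>2 = l * (norm_on O2 ?x)\<^sup>2" by (simp only: of_real_eq_iff)
  \<comment> \<open>strips of length \<open>\<gamma> / \<epsilon>\<close> cost less than the distance from \<open>l\<close> to \<open>- \<gamma>\<^sup>2\<close>\<close>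
  define \<epsilon> where "\<epsilon> = - (l + \<gamma>\<^sup>2) / 2"
  have eps: "\<epsilon> > 0" using l by (simp add: \<epsilon>_def)
  have "\<gamma> / (\<gamma> / \<epsilon>) = \<epsilon>" "\<gamma> / \<epsilon> > 0" using \<gamma> eps by auto
  then have "\<gamma> * (L2_norm S (T2 ?x))\<^sup>2 <= G2 ?x + (\<gamma>\<^sup>2 + \<epsilon>) * (norm_on O2 ?x)\<^sup>2"
    using Robin2_H1[OF x(3) \<gamma>, of "\<gamma> / \<epsilon>"] by simp
  then have "0 <= l * (norm_on O2 ?x)\<^sup>2 + (\<gamma>\<^sup>2 + \<epsilon>) * (norm_on O2 ?x)\<^sup>2" using eq by linarith
  also have "\<dots> = - \<epsilon> * (norm_on O2 ?x)\<^sup>2"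
  proof -
    have "l + (\<gamma>\<^sup>2 + \<epsilon>) = - \<epsilon>" by (simp add: \<epsilon>_def field_simps)
    then show ?thesis by (simp only: distrib_right[symmetric])
  qed
  finally have n0: "(norm_on O2 ?x)\<^sup>2 = 0" using eps by (simp add: mult_le_0_iff)
  obtain C where "\<And>w. w \<in> H1 O2 ==> 2 * \<gamma> * (L2_norm S (T2 w))\<^sup>2 <= G2 w + C * (norm_on O2 w)\<^sup>2"
    using trace_control_H1[of "2 * \<gamma>"] \<gamma> by (metis mult_pos_pos zero_less_numeral)
  from this[OF x(3)] have "2 * \<gamma> * (L2_norm S (T2 ?x))\<^sup>2 <= G2 ?x" by (simp add: n0)
  moreover have "G2 ?x = \<gamma> * (L2_norm S (T2 ?x))\<^sup>2" using eq n0 by simp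
  ultimately have t0: "(L2_norm S (T2 ?x))\<^sup>2 = 0" using \<gamma> by simp
  have "L2_norm S (T0 u) = L2_norm S (fscale (-1) (T2 ?x))"
  proof (rule L2_norm_cong_AE[OF L2_measurable[OF D0.trace_L2[OF u]] L2_measurable[OF L2_fscale[OF T2L]]])
    show "AE x in S. T0 u x = fscale (-1) (T2 ?x) x" using reflect_traces(2)[OF u] by eventually_elim simp
  qed
  then have "L2_norm S (T0 u) = 0" unfolding L2_norm_fscale using t0 by simp
  then have "Re (delta_form \<theta> (2 * \<gamma>) u u) \<ge> 0" by (simp add: delta_self[OF u])
  moreover have "delta_form \<theta> (2 * \<gamma>) u u = of_real l * L2_inner lborel u u"
    using ev[OF xB] by (simp add: delta'_form_reflect[OF u] reflect_L2_inner)
  ultimately have "0 <= l * Re (L2_inner lborel u u)" by simp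
  moreover have "l < 0" using l zero_le_power2[of \<gamma>] by linarith
  ultimately show False using pos by (simp add: zero_le_mult_iff)
qed

end

section \<open>Comparison of the eigenvalues\<close>

lemma sum_fun_eval: "(\<Sum>i\<in>I. f i) x = (\<Sum>i\<in>I. f i x)" for f :: "'i => 'a => 'b::comm_monoid_add"
  by (induction I rule: infinite_finite_induct) simp_all

lemma enat_le_sum_SUP:
  assumes "finite E" "\<And>m. m \<in> E ==> X m \<noteq> {}" "enat n <= (\<Sum>m\<in>E. SUP k\<in>X m. enat k)"
  shows "\<exists>k. (\<forall>m\<in>E. k m \<in> X m) \<and> n <= (\<Sum>m\<in>E. k m)"
  using assms
proof (induction E arbitrary: n rule: finite_induct)
  case empty then show ?case by (simp add: zero_enat_def)
next
  case (insert a E)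
  let ?a = "SUP k\<in>X a. enat k" and ?b = "\<Sum>m\<in>E. SUP k\<in>X m. enat k"
  have le: "enat n <= ?a + ?b" using insert by simp
  have "\<exists>n1 n2. n = n1 + n2 \<and> enat n1 <= ?a \<and> enat n2 <= ?b"
  proof (cases "enat n <= ?a")
    case True then show ?thesis by (intro exI[of _ n] exI[of _ 0]) (simp add: zero_enat_def[symmetric])
  next
    case False
    then obtain a' where a': "?a = enat a'" "a' < n" by (cases ?a) auto
    have "enat (n - a') <= ?b" using le unfolding a'(1) by (cases ?b) auto
    then show ?thesis using a' by (intro exI[of _ a'] exI[of _ "n - a'"]) auto
  qed
  then obtain n1 n2 where n: "n = n1 + n2" "enat n1 <= ?a" "enat n2 <= ?b" by blast
  obtain k1 where k1: "k1 \<in> X a" "n1 <= k1" using SUP_enat_attained[OF n(2)] insert.prems(1) by auto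
  obtain k where k: "\<forall>m\<in>E. k m \<in> X m" "n2 <= (\<Sum>m\<in>E. k m)" using insert.IH[OF _ n(3)] insert.prems(1) by auto
  have "(\<Sum>m\<in>E. (k(a := k1)) m) = (\<Sum>m\<in>E. k m)" using insert.hyps by (intro sum.cong) auto
  then show ?case using k k1 n(1) insert.hyps by (intro exI[of _ "k(a := k1)"]) auto
qed

text \<open>
  Eigenfunctions for different eigenvalues are orthogonal for both the inner product and the form, so
  on their span the Rayleigh quotient is an average of eigenvalues that are at most \<open>l\<close>.
\<close>

lemma nth_eigenvalue_trial_space:
  assumes a: "hermitian_form fscale D a" and D: "D \<subseteq> L2 M" and ev: "nth_eigenvalue M (form_operator M D a) n l"
  obtains I :: "(real \<times> nat) set" and u where "finite I" "n <= card I" "\<And>i. i \<in> I ==> u i \<in> D"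
    "\<And>k x. x = (\<Sum>i\<in>I. fscale (k i) (u i)) ==> \<exists>i\<in>I. k i \<noteq> 0 ==>
       x \<in> D \<and> Re (L2_inner M x x) > 0 \<and> Re (a x x) <= l * Re (L2_inner M x x)"
proof -
  interpret a: hermitian_form fscale D a by (rule a)
  let ?A = "form_operator M D a"
  define E where "E = {m::real. op_eigenvalue M ?A (of_real m) \<and> m <= l}"
  define X where "X m = {k. \<exists>u. (\<forall>i<k. u i \<in> eigenspace ?A (of_real m)) \<and> AE_independent M k u}" for m :: real
  have E: "finite E" and le: "enat n <= (\<Sum>m\<in>E. SUP k\<in>X m. enat k)"
    using ev by (simp_all add: nth_eigenvalue_def E_def X_def op_multiplicity_def)
  have "X m \<noteq> {}" for m by (auto simp: X_def AE_independent_def intro!: exI[of _ 0])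
  then obtain k where k: "\<And>m. m \<in> E ==> k m \<in> X m" and n: "n <= (\<Sum>m\<in>E. k m)"
    using enat_le_sum_SUP[OF E _ le] by blast
  have "\<forall>m\<in>E. \<exists>u. (\<forall>i<k m. u i \<in> eigenspace ?A (of_real m)) \<and> AE_independent M (k m) u" using k by (simp add: X_def)
  then obtain u where u: "\<And>m i. m \<in> E ==> i < k m ==> u m i \<in> eigenspace ?A (of_real m)"
    and ind: "\<And>m. m \<in> E ==> AE_independent M (k m) (u m)" by metis
  have uD: "u m i \<in> D" if "m \<in> E" "i < k m" for m i using u[OF that] by (simp add: eigenspace_def form_operator_def)
  have ua: "a (u m i) v = of_real m * L2_inner M (u m i) v" if "m \<in> E" "i < k m" "v \<in> D" for m i v
  proof -
    have "a (u m i) v = L2_inner M (fscale (of_real m) (u m i)) v" using u[OF that(1,2)] that(3) by (simp add: eigenspace_def form_operator_def fscale_def)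
    also have "\<dots> = of_real m * L2_inner M (u m i) v" using uD[OF that(1,2)] that(3) D by (intro L2.q_scale_left) auto
    finally show ?thesis .
  qed
  let ?I = "Sigma E (%m. {..<k m})"
  show thesis
  proof (rule that[of ?I "%(m, i). u m i"])
    show "finite ?I" using E by auto
    show "n <= card ?I" using n E by (simp add: card_SigmaI)
    show "(case p of (m, i) => u m i) \<in> D" if "p \<in> ?I" for p using that uD by auto
    fix c x assume x: "x = (\<Sum>p\<in>?I. fscale (c p) (case p of (m, i) => u m i))" and nz: "\<exists>p\<in>?I. c p \<noteq> 0"
    define y where "y m = (\<Sum>i<k m. fscale (c (m, i)) (u m i))" for m
    have x_y: "x = (\<Sum>m\<in>E. y m)" unfolding x y_def using E by (subst sum.Sigma) (auto intro!: sum.cong)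
    have yD: "y m \<in> D" if "m \<in> E" for m unfolding y_def using that by (intro a.V_closed(5) a.V_closed(4) uD) auto
    have yL: "y m \<in> L2 M" if "m \<in> E" for m using yD[OF that] D by blast
    have ya: "a (y m) v = of_real m * L2_inner M (y m) v" if m: "m \<in> E" and v: "v \<in> D" for m v
    proof -
      have "a (y m) v = (\<Sum>i<k m. a (fscale (c (m, i)) (u m i)) v)"
        unfolding y_def using m v uD by (intro a.q_sum_left a.V_closed(4)) auto
      also have "\<dots> = (\<Sum>i<k m. of_real m * L2_inner M (fscale (c (m, i)) (u m i)) v)"
      proof (intro sum.cong refl)
        fix i assume "i \<in> {..<k m}"
        then have i: "i < k m" by simp
        have "u m i \<in> L2 M" "v \<in> L2 M" using uD[OF m i] v D by auto
        then show "a (fscale (c (m, i)) (u m i)) v = of_real m * L2_inner M (fscale (c (m, i)) (u m i)) v"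
          by (simp only: a.q_scale_left[OF uD[OF m i] v] ua[OF m i v] L2.q_scale_left mult.left_commute)
      qed
      also have "\<dots> = of_real m * L2_inner M (y m) v"
        unfolding y_def sum_distrib_left[symmetric] using m v uD D by (intro arg_cong[where f = "(*) (of_real m)"] L2.q_sum_left[symmetric] L2_fscale) auto
      finally show ?thesis .
    qed
    have orth: "L2_inner M (y m) (y m') = (if m = m' then of_real ((L2_norm M (y m))\<^sup>2) else 0)" if m: "m \<in> E" "m' \<in> E" for m m'
    proof (cases "m = m'")
      case True then show ?thesis by (simp add: L2_inner_self)
    next
      case False
      have "a (y m) (y m') = cnj (a (y m') (y m))" by (rule a.q_cnj[OF yD[OF m(2)] yD[OF m(1)], symmetric])
      then have "of_real m * L2_inner M (y m) (y m') = of_real m' * cnj (L2_inner M (y m') (y m))"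
        using ya[OF m(1) yD[OF m(2)]] ya[OF m(2) yD[OF m(1)]] by simp
      also have "cnj (L2_inner M (y m') (y m)) = L2_inner M (y m) (y m')" by (rule L2.q_cnj[OF yL[OF m(2)] yL[OF m(1)]])
      finally show ?thesis using False by simp
    qed
    have one: "(\<Sum>m\<in>E. fscale 1 (y m)) = x" unfolding x_y by (intro sum.cong refl) (simp add: fun_eq_iff)
    have "L2_inner M x x = (\<Sum>m\<in>E. of_real ((cmod 1)\<^sup>2) * of_real ((L2_norm M (y m))\<^sup>2))"
      using L2.q_orthogonal_combination[where e = y and c = "%_. 1" and d = "%m. of_real ((L2_norm M (y m))\<^sup>2)", OF E yL orth] by (simp only: one)
    then have ip: "Re (L2_inner M x x) = (\<Sum>m\<in>E. (L2_norm M (y m))\<^sup>2)" by simp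
    have "a (y m) (y m') = (if m = m' then of_real (m * (L2_norm M (y m))\<^sup>2) else 0)" if "m \<in> E" "m' \<in> E" for m m'
      using ya[OF that(1) yD[OF that(2)]] orth[OF that] by simp
    then have "a x x = (\<Sum>m\<in>E. of_real ((cmod 1)\<^sup>2) * of_real (m * (L2_norm M (y m))\<^sup>2))"
      using a.q_orthogonal_combination[where e = y and c = "%_. 1" and d = "%m. of_real (m * (L2_norm M (y m))\<^sup>2)", OF E yD] by (simp only: one)
    then have "Re (a x x) = (\<Sum>m\<in>E. m * (L2_norm M (y m))\<^sup>2)" by simp
    also have "\<dots> <= (\<Sum>m\<in>E. l * (L2_norm M (y m))\<^sup>2)" by (intro sum_mono mult_right_mono) (auto simp: E_def)
    finally have ax: "Re (a x x) <= l * Re (L2_inner M x x)" by (simp add: ip sum_distrib_left)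
    obtain m i where mi: "m \<in> E" "i < k m" "c (m, i) \<noteq> 0" using nz by auto
    have "\<not> (AE z in M. y m z = 0)"
    proof
      assume "AE z in M. y m z = 0"
      then have "AE z in M. (\<Sum>i<k m. c (m, i) * u m i z) = 0" by (simp add: y_def sum_fun_eval)
      then have "\<forall>i<k m. c (m, i) = 0"
        using ind[OF mi(1)] unfolding AE_independent_def by (elim allE[of _ "%i. c (m, i)"]) simp
      then show False using mi by blast
    qed
    then have "(L2_norm M (y m))\<^sup>2 > 0" using L2_norm_zero_iff[OF yL[OF mi(1)]] by simp
    then have "Re (L2_inner M x x) > 0" unfolding ip using mi(1) E by (intro sum_pos2) auto
    moreover have "x \<in> D" unfolding x_y using yD by (rule a.V_closed(5))
    ultimately show "x \<in> D \<and> Re (L2_inner M x x) > 0 \<and> Re (a x x) <= l * Re (L2_inner M x x)" using ax by blast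
  qed
qed

theorem mainTheorem3:
  fixes \<theta> \<alpha> \<beta> :: real
  assumes "0 < \<theta>" and "\<theta> < pi / 2"
    and "\<alpha> > 0" and "\<beta> = 4 / \<alpha>"
  shows "\<forall>n\<ge>1. \<forall>l.
           nth_eigenvalue lborel (delta_operator \<theta> \<alpha>) n l \<and> l < - (\<alpha>\<^sup>2 / 4) \<longrightarrow>
           (\<exists>l'. nth_eigenvalue lborel (delta'_operator \<theta> \<beta>) n l' \<and> l' < l)"
proof (intro allI impI, elim conjE)
  fix n l assume n: "n \<ge> 1" and ev: "nth_eigenvalue lborel (delta_operator \<theta> \<alpha>) n l" and l: "l < - (\<alpha>\<^sup>2 / 4)"
  interpret broken_line_geometry \<theta> using assms(1,2) by unfold_locales
  define \<gamma> where "\<gamma> = \<alpha> / 2"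
  have \<gamma>: "\<gamma> > 0" "\<alpha> = 2 * \<gamma>" "\<beta> = 2 / \<gamma>" "\<alpha>\<^sup>2 / 4 = \<gamma>\<^sup>2" using assms(3,4) by (auto simp: \<gamma>_def power_divide)
  interpret A': L2_closed_form lborel B "delta'_form \<theta> (2 / \<gamma>)" "- \<gamma>\<^sup>2"
    unfolding L2_closed_form_def by (rule delta'_closed_form[OF \<gamma>(1)])
  have l': "l < - \<gamma>\<^sup>2" using l \<gamma>(4) by simp
  have HL: "H1 UNIV \<subseteq> (L2 lborel :: (real \<times> real => complex) set)" using H1_UNIV_L2 by blast
  show "\<exists>l'. nth_eigenvalue lborel (delta'_operator \<theta> \<beta>) n l' \<and> l' < l"
  proof (rule nth_eigenvalue_trial_space[OF hermitian_delta HL ev[unfolded delta_operator_def]])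
    fix I :: "(real \<times> nat) set" and u
    assume I: "finite I" "n <= card I" and u: "\<And>i. i \<in> I ==> u i \<in> H1 UNIV"
      and trial: "\<And>k y. y = (\<Sum>i\<in>I. fscale (k i) (u i)) ==> \<exists>i\<in>I. k i \<noteq> 0 ==>
        y \<in> H1 UNIV \<and> Re (L2_inner lborel y y) > 0 \<and> Re (delta_form \<theta> \<alpha> y y) <= l * Re (L2_inner lborel y y)"
    show ?thesis
    proof (rule A'.min_max_strict[OF l' I(1), where u = "%i. reflect (u i)"])
      show "reflect (u i) \<in> B" if "i \<in> I" for i by (rule reflect_H1_broken[OF u[OF that]])
    next
      fix k x assume x: "x = (\<Sum>i\<in>I. fscale (k i) (reflect (u i)))" and k: "\<exists>i\<in>I. k i \<noteq> 0"
      define y where "y = (\<Sum>i\<in>I. fscale (k i) (u i))"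
      have y: "y \<in> H1 UNIV" "Re (L2_inner lborel y y) > 0" "Re (delta_form \<theta> \<alpha> y y) <= l * Re (L2_inner lborel y y)"
        using trial[OF y_def k] by auto
      have xy: "x = reflect y" unfolding x y_def by (rule reflect_combination[symmetric])
      have "\<not> A'.eigenvector (of_real l) x"
        using reflect_not_eigenvector[OF y(1) \<gamma>(1) l' y(2)] unfolding xy A'.eigenvector_def by blast
      then show "Re (L2_inner lborel x x) > 0 \<and> Re (delta'_form \<theta> (2 / \<gamma>) x x) <= l * Re (L2_inner lborel x x) \<and> \<not> A'.eigenvector (of_real l) x"
        using y(2,3) by (simp add: xy reflect_L2_inner delta'_form_reflect[OF y(1)] \<gamma>(2))
    next
      fix N e m assume es: "A'.eigensystem {..<N::nat} e m" and m: "\<And>i. i < N ==> m i < l" and N: "card I <= N"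
      show ?thesis
        using A'.nth_eigenvalue_below[OF l' n es m order_trans[OF I(2) N]] by (simp add: delta'_operator_def \<gamma>(3))
    qed
  qed
qed

end
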